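(* Let $c_0>0$. There is a positive constant $D=D(c_0)$ such that for every $L>2$ and every sequence $(\beta_n)_{n\ge1}$ of positive numbers with $\beta_n\ge c_0\log n$ for all large $n$, almost surely the following assertions hold simultaneously: (i) (Bulk) For every $x\in(-2,2)$ and every sequence $y_n\to x$, $$\limsup_{n\to\infty}\Big|\#_n[B(y_n,L/n)]-2\sigma(x)L\Big|\le D\log^2L.$$ (ii) (Boundary) For $x=\pm2$, $$\limsup_{n\to\infty}\Big|\#_n[B(x,(L/n)^{2/3})]-\tfrac2{3\pi}L\Big|\le D\,L^{4/5}\log^{1/5}L.$$
   Context: For $\beta>0$ and $n\ge1$, $\mathbf P_n^\beta$ is the probability measure on $\mathbb R^n$ with density $$p_n^\beta(x_1,\dots,x_n)=\frac1{Z_{\beta,n}}\prod_{k<j}|x_k-x_j|^\beta\, e^{-n\frac\beta2\sum_{j=1}^n\frac12x_j^2},$$ where $Z_{\beta,n}$ is the normalizing constant. Families $(x^{(n)})_{n\ge1}$ of configurations $x^{(n)}=(x_1^{(n)},\dots,x_n^{(n)})\in\mathbb R^n$ are drawn from the product measure $\mathbf P=\prod_{n=1}^\infty\mathbf P_n^{\beta_n}$, and "almost surely" refers to $\mathbf P$. For $I\subseteq\mathbb R$, $\#_n[I]$ is the number of points of $\{x_j^{(n)}\}_{j=1}^n$ in $I$. $B(x,r)=(x-r,x+r)$. $\sigma(x)=\frac1{2\pi}\sqrt{(4-x^2)_+}$. $\log^aL=(\log L)^a$. *)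

theory Defs
  imports "HOL-Probability.Probability"
begin

text \<open>
  Euclidean space of dimension \<open>n\<close> is \<open>PiM {1..n} (\<lambda>_. lborel)\<close>: a configuration is a function
  on \<open>{1..n}\<close>, extended by \<open>undefined\<close>, and the reference measure is Lebesgue measure.
\<close>

definition weight :: "real \<Rightarrow> nat \<Rightarrow> (nat \<Rightarrow> real) \<Rightarrow> real" where
  "weight \<beta> n x =
     (\<Prod>(k, j)\<in>{(k, j). 1 \<le> k \<and> k < j \<and> j \<le> n}. \<bar>x k - x j\<bar> powr \<beta>)
       * exp (- (real n * (\<beta> / 2) * (\<Sum>j=1..n. (1 / 2) * (x j)\<^sup>2)))"

definition partition_const :: "real \<Rightarrow> nat \<Rightarrow> real" where
  "partition_const \<beta> n = (LINT x|PiM {1..n} (\<lambda>_. lborel). weight \<beta> n x)"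

definition beta_ensemble :: "real \<Rightarrow> nat \<Rightarrow> (nat \<Rightarrow> real) measure" where
  "beta_ensemble \<beta> n =
     density (PiM {1..n} (\<lambda>_. lborel))
       (\<lambda>x. ennreal (1 / partition_const \<beta> n * weight \<beta> n x))"

definition joint_law :: "(nat \<Rightarrow> real) \<Rightarrow> (nat \<Rightarrow> nat \<Rightarrow> real) measure" where
  "joint_law \<beta> = PiM {1..} (\<lambda>n. beta_ensemble (\<beta> n) n)"

text \<open>Points are counted with multiplicity; under \<open>joint_law\<close> they are almost surely distinct.\<close>

definition num_points :: "(nat \<Rightarrow> nat \<Rightarrow> real) \<Rightarrow> nat \<Rightarrow> real set \<Rightarrow> nat" where
  "num_points \<omega> n I = card {j \<in> {1..n}. \<omega> n j \<in> I}"

definition semicircle :: "real \<Rightarrow> real" where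
  "semicircle x = 1 / (2 * pi) * sqrt (max 0 (4 - x\<^sup>2))"

end

theory Submission
  imports Defs "HOL-Complex_Analysis.Complex_Analysis"
begin

text \<open>
  Let \<open>w j t\<close> be the product of \<open>\<bar>t - x i\<bar>\<close> over \<open>i \<noteq> j\<close> times \<open>exp (- n t\<^sup>2 / 4)\<close>; up to a factor that
  does not involve \<open>x j\<close>, the density is \<open>w j (x j)\<close> to the power \<open>\<beta>\<close>. Resampling the single point \<open>x j\<close>
  and Markov's inequality show that outside an event of probability \<open>pi / n\<^sup>2\<close> the integral of \<open>(w j) powr \<beta>\<close>
  is at most \<open>n ^ 3 * (1 + (x j)\<^sup>2) * w j (x j) powr \<beta>\<close> for every \<open>j\<close>. A Bernstein inequality replaces the
  integral by the supremum at the price of a power of \<open>n\<close>, and \<open>\<beta> \<ge> c0 * ln n\<close> turns that power, after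
  taking the root of order \<open>\<beta>\<close>, into a constant: \<open>w j \<le> C * w j (x j)\<close> on \<open>[- 4, 4]\<close>. By Borel--Cantelli
  this holds almost surely for all large \<open>n\<close>, and the rest is deterministic.

  Under \<open>x = z + 1 / z\<close> the function \<open>w j\<close> becomes the boundary modulus of a function \<open>L j\<close> that is
  holomorphic in the disc, has no zero there, and is dominated by \<open>C\<close> times its value at the
  point of the circle over \<open>x j\<close>. The Lagrange bounds also give a lower bound for \<open>L j\<close>, so near the circle
  \<open>ln \<bar>L j\<bar>\<close> is known up to the logarithm of the distance to \<open>x j\<close> in units of the local spacing. The
  Schwarz lemma for a half-plane bounds the derivative of \<open>ln (L j)\<close>, and integrating it
  costs another logarithm for the imaginary part. The latter compares the number of points above \<open>2 * cos t\<close> with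
  \<open>n * (t - sin (2 * t) / 2) / pi\<close>, which is the semicircle law.
\<close>

section \<open>Weighted polynomials in the disc\<close>

text \<open>The final errors may depend on \<open>L\<close> only, so no power of log n may survive.
  Hence distances are measured in \<open>eta k\<close>, the spacing at a base point
  \<open>k\<close>, and only logarithms of such ratios are lost. This helps only if \<open>k\<close>
  is close to the angle observed. In the bulk a bootstrap shows that a nearest point is boundedly
  many spacings away: on an empty arc the count is constant while \<open>Phi\<close> grows linearly,
  and the count estimate leaves room for a squared logarithm only. Putting the extreme points
  exactly at -2 and 2 places every x in [-2, 2] between two consecutive points. There the weight
  without these two points is log-concave, so lower bounds at points carry over to the gaps; this is
  the source of the lower bound for L j. The price is an unknown centre m and scale a, entering as
  \<open>p = a^2\<close> and \<open>q = a * m\<close>. They are pinned to order n^(-2/3) by running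
  the whole estimate with the defect itself as \<open>nu\<close>. At the edge no second angle is
  compared; the reflection of z in the real axis takes its place. The resulting error, L^(1/3) plus
  a squared logarithm, is below the required one.\<close>

definition quad :: "real \<Rightarrow> complex \<Rightarrow> complex" where
  "quad c z = z^2 - of_real c * z + 1"

definition jouk :: "complex \<Rightarrow> complex" where
  "jouk z = z + 1 / z"

definition circ_root :: "real \<Rightarrow> complex" where
  "circ_root c = Complex (c / 2) (sqrt (1 - (c / 2)\<^sup>2))"

text \<open>The exponent is chosen holomorphic at 0: for \<open>norm z = 1\<close> and
  \<open>x = 2 * Re z\<close> the real part of \<open>p * z^2 / 2 + q * z\<close> is
  \<open>p * x^2 / 4 + q * x / 2 - p / 2\<close>, so the real weight reappears on the circle up to a
  constant. The same expression in \<open>jouk z\<close> would have a pole at the centre.\<close>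

definition wpoly :: "(nat \<Rightarrow> real) \<Rightarrow> nat \<Rightarrow> real \<Rightarrow> real \<Rightarrow> nat set \<Rightarrow> complex \<Rightarrow> complex" where
  "wpoly c n p q J z =
     (\<Prod>i\<in>J. quad (c i) z) * exp (- of_nat n * (of_real p * z^2 / 2 + of_real q * z))"

definition rweight :: "(nat \<Rightarrow> real) \<Rightarrow> nat \<Rightarrow> real \<Rightarrow> real \<Rightarrow> nat set \<Rightarrow> real \<Rightarrow> real" where
  "rweight c n p q J x = (\<Prod>i\<in>J. \<bar>x - c i\<bar>) * exp (- real n * (p * x\<^sup>2 / 4 + q * x / 2))"

section \<open>The substitution x = z + 1 / z\<close>

lemma norm_circ_root: "\<bar>c\<bar> \<le> 2 \<Longrightarrow> norm (circ_root c) = 1"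
proof -
  assume "\<bar>c\<bar> \<le> 2"
  then have "(c / 2)\<^sup>2 \<le> 1" by (simp add: abs_square_le_1)
  then show ?thesis by (simp add: circ_root_def cmod_def)
qed

lemma Re_circ_root [simp]: "Re (circ_root c) = c / 2"
  by (simp add: circ_root_def)

lemma Im_circ_root_nonneg: "\<bar>c\<bar> \<le> 2 \<Longrightarrow> 0 \<le> Im (circ_root c)"
proof -
  assume "\<bar>c\<bar> \<le> 2"
  then have "(c / 2)\<^sup>2 \<le> 1" by (simp add: abs_square_le_1)
  then show ?thesis by (simp add: circ_root_def)
qed

lemma quad_factor:
  assumes "\<bar>c\<bar> \<le> 2"
  shows "quad c z = (z - circ_root c) * (z - cnj (circ_root c))"
proof -
  have 1: "circ_root c * cnj (circ_root c) = 1"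
    using norm_circ_root[OF assms] complex_norm_square[of "circ_root c"] by simp
  have 2: "circ_root c + cnj (circ_root c) = of_real c"
    by (simp add: complex_eq_iff)
  have "(z - circ_root c) * (z - cnj (circ_root c))
      = z^2 - (circ_root c + cnj (circ_root c)) * z + circ_root c * cnj (circ_root c)"
    by (simp add: algebra_simps power2_eq_square)
  then show ?thesis using 1 2 by (simp add: quad_def)
qed

lemma quad_jouk: "z \<noteq> 0 \<Longrightarrow> quad c z = z * (jouk z - of_real c)"
  by (simp add: quad_def jouk_def field_simps power2_eq_square)

lemma jouk_inverse: "jouk (1 / z) = jouk z"
  by (simp add: jouk_def)

lemma quad_inverse: "z \<noteq> 0 \<Longrightarrow> quad c z = z^2 * quad c (1 / z)"
  by (simp add: quad_jouk jouk_inverse power2_eq_square)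

lemma Re_jouk: "z \<noteq> 0 \<Longrightarrow> Re (jouk z) = Re z * (1 + 1 / (norm z)\<^sup>2)"
  by (simp add: jouk_def Re_divide cmod_power2 algebra_simps)

lemma Im_jouk: "z \<noteq> 0 \<Longrightarrow> Im (jouk z) = Im z * (1 - 1 / (norm z)\<^sup>2)"
  by (simp add: jouk_def Im_divide cmod_power2 algebra_simps)

lemma jouk_unit: "norm z = 1 \<Longrightarrow> jouk z = of_real (2 * Re z)"
  by (cases "z = 0") (auto simp: complex_eq_iff Re_jouk Im_jouk)

lemma wpoly_holomorphic: "wpoly c n p q J holomorphic_on S"
  unfolding wpoly_def quad_def by (intro holomorphic_intros) auto

lemma wpoly_insert:
  "finite J \<Longrightarrow> i \<notin> J \<Longrightarrow> wpoly c n p q (insert i J) z = quad (c i) z * wpoly c n p q J z"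
  by (simp add: wpoly_def)

section \<open>Weighted polynomials on, outside and inside the unit circle\<close>

lemma norm_wpoly:
  "norm (wpoly c n p q J z)
     = (\<Prod>i\<in>J. norm (quad (c i) z)) * exp (- real n * (p * Re (z^2) / 2 + q * Re z))"
  by (simp add: wpoly_def norm_mult prod_norm[symmetric])

lemma Re_power2_norm: "Re (z^2) = (norm z)\<^sup>2 - 2 * (Im z)\<^sup>2"
  by (simp add: cmod_power2 Re_power2)

lemma norm_wpoly_unit:
  assumes "norm z = 1"
  shows "norm (wpoly c n p q J z) = rweight c n p q J (2 * Re z) * exp (real n * p / 2)"
proof -
  have z: "z \<noteq> 0" using assms by auto
  have "norm (quad (c i) z) = \<bar>2 * Re z - c i\<bar>" for i
  proof -
    have "quad (c i) z = z * of_real (2 * Re z - c i)"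
      by (simp add: quad_jouk[OF z] jouk_unit[OF assms])
    then show ?thesis using assms by (simp only: norm_mult norm_of_real) simp
  qed
  moreover have "Re (z^2) = 2 * (Re z)\<^sup>2 - 1"
    using assms cmod_power2[of z] by (simp add: Re_power2)
  then have "- real n * (p * Re (z^2) / 2 + q * Re z)
      = - real n * (p * (2 * Re z)\<^sup>2 / 4 + q * (2 * Re z) / 2) + real n * p / 2"
    by (simp add: power_mult_distrib ring_distribs add_divide_distrib diff_divide_distrib)
  then have "exp (- real n * (p * Re (z^2) / 2 + q * Re z))
      = exp (- real n * (p * (2 * Re z)\<^sup>2 / 4 + q * (2 * Re z) / 2)) * exp (real n * p / 2)"
    by (simp only: exp_add)
  ultimately show ?thesis by (simp add: norm_wpoly rweight_def)
qed

text \<open>For \<open>r = exp s\<close> this is \<open>s <= sinh s\<close>. It expresses the growth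
  of the polynomial part in the quantity \<open>r - 1 / r\<close> in which the exponential part is
  computed.\<close>

lemma sinh_ln_ge:
  fixes r :: real
  assumes "1 \<le> r"
  shows "ln r \<le> (r - 1 / r) / 2"
proof -
  define g where "g = (\<lambda>r::real. (r - 1 / r) / 2 - ln r)"
  have "g 1 \<le> g r"
  proof (rule DERIV_nonneg_imp_nondecreasing[OF assms])
    fix x :: real assume x: "1 \<le> x" "x \<le> r"
    have "(g has_real_derivative ((1 + 1 / x\<^sup>2) / 2 - 1 / x)) (at x)"
      unfolding g_def using x
      by (auto intro!: derivative_eq_intros simp: field_simps power2_eq_square)
    moreover have "(1 + 1 / x\<^sup>2) / 2 - 1 / x = (1 - 1 / x)\<^sup>2 / 2"
      using x by (simp add: power2_eq_square field_simps)
    ultimately show "\<exists>y. (g has_real_derivative y) (at x) \<and> 0 \<le> y" by force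
  qed
  then show ?thesis by (simp add: g_def)
qed

lemma wpoly_max_disc:
  assumes "\<And>w. norm w = 1 \<Longrightarrow> norm (wpoly c n p q J w) \<le> m" and "norm z \<le> 1"
  shows "norm (wpoly c n p q J z) \<le> m"
proof (rule maximum_modulus_frontier[where f = "wpoly c n p q J" and S = "cball 0 1"])
  show "wpoly c n p q J holomorphic_on interior (cball 0 1)" by (rule wpoly_holomorphic)
  show "continuous_on (closure (cball 0 1)) (wpoly c n p q J)"
    by (intro holomorphic_on_imp_continuous_on wpoly_holomorphic)
qed (use assms in auto)

text \<open>
  Outside the disc the reflection \<open>z \<mapsto> 1 / z\<close> fixes the polynomial part, so the growth is that of
  the exponential factor alone.
\<close>

lemma wpoly_growth:
  assumes J: "finite J" "card J \<le> n"
    and m: "\<And>w. norm w = 1 \<Longrightarrow> norm (wpoly c n p q J w) \<le> m"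
    and p: "0 \<le> p" "p \<le> 4" and \<nu>: "0 \<le> \<nu>" "1 - p + \<bar>q\<bar> \<le> \<nu>"
    and z: "1 \<le> norm z" "norm z \<le> 2"
  shows "norm (wpoly c n p q J z) \<le> m * exp (16 * real n * (norm z - 1) * (\<nu> + (Im z)\<^sup>2))"
proof -
  define r where "r = norm z"
  have r: "1 \<le> r" "r \<le> 2" and z0: "z \<noteq> 0" using z by (auto simp: r_def)
  define w where "w = 1 / z"
  have nw: "norm w = 1 / r" by (simp add: w_def r_def norm_divide)
  have m0: "0 \<le> m" using m[of 1] norm_ge_zero[of "wpoly c n p q J 1"] by (simp del: norm_ge_zero)
  have wle: "norm (wpoly c n p q J w) \<le> m"
    by (rule wpoly_max_disc[OF m]) (use r in \<open>auto simp: nw\<close>)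
  have Rew: "Re w = Re z / r\<^sup>2" and Imw: "Im w = - Im z / r\<^sup>2"
    by (simp_all add: w_def r_def Re_divide Im_divide cmod_power2)
  have Rew2: "Re (w^2) = Re (z^2) / r^4"
  proof -
    have "Re (w^2) = (Re z / r\<^sup>2)\<^sup>2 - (Im z / r\<^sup>2)\<^sup>2" by (simp add: Re_power2 Rew Imw)
    also have "\<dots> = Re (z^2) / r^4" using r by (simp add: Re_power2 power_divide diff_divide_distrib flip: power_mult)
    finally show ?thesis .
  qed
  have prodeq: "(\<Prod>i\<in>J. norm (quad (c i) z)) = r ^ (2 * card J) * (\<Prod>i\<in>J. norm (quad (c i) w))"
  proof -
    have "norm (quad (c i) z) = r^2 * norm (quad (c i) w)" for i
      by (subst quad_inverse[OF z0]) (simp add: norm_mult norm_power r_def w_def)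
    then show ?thesis by (simp add: prod.distrib power_mult)
  qed
  define E where "E = (\<lambda>u. - real n * (p * Re (u^2) / 2 + q * Re u))"
  have nE: "norm (wpoly c n p q J u) = (\<Prod>i\<in>J. norm (quad (c i) u)) * exp (E u)" for u
    by (simp only: norm_wpoly E_def)
  have key: "2 * real (card J) * ln r + E z - E w \<le> 16 * real n * (r - 1) * (\<nu> + (Im z)\<^sup>2)"
  proof -
    define R where "R = r\<^sup>2"
    have R: "1 \<le> R" using r by (simp add: R_def)
    \<comment> \<open>Per unit of \<open>n * s\<close> the polynomial contributes at most 1, the
      quadratic exponent at most \<open>- p\<close> and the linear one at most the modulus of
      \<open>q\<close>. So \<open>p = 1\<close>, \<open>q = 0\<close> is balanced, and
      \<open>nu\<close> bounds what is left.\<close>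
    define s where "s = r - 1 / r"
    have s: "0 \<le> s" "s \<le> 2 * (r - 1)"
    proof -
      have eq: "s = (r - 1) * (1 + 1 / r)" using r by (simp add: s_def field_simps)
      show "0 \<le> s" using r by (simp add: eq)
      have "(r - 1) * (1 + 1 / r) \<le> (r - 1) * 2" using r by (intro mult_left_mono) auto
      then show "s \<le> 2 * (r - 1)" by (simp add: eq)
    qed
    have lnr: "2 * real (card J) * ln r \<le> real n * s"
    proof -
      have "2 * real (card J) * ln r \<le> 2 * real n * ln r"
        using J r by (intro mult_right_mono) auto
      also have "\<dots> \<le> 2 * real n * ((r - 1 / r) / 2)"
        using sinh_ln_ge[OF r(1)] by (intro mult_left_mono) auto
      finally show ?thesis by (simp add: s_def)
    qed
    have Rez2: "Re (z^2) = R - 2 * (Im z)\<^sup>2" by (simp add: Re_power2_norm R_def r_def)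
    have "E z - E w = - real n * (p * (Re (z^2) * (1 - 1 / R\<^sup>2)) / 2 + q * (Re z * (1 - 1 / R)))"
    proof -
      have "r^4 = R\<^sup>2" by (simp add: R_def)
      then show ?thesis unfolding E_def Rew2 Rew R_def[symmetric]
        by (simp add: algebra_simps diff_divide_distrib add_divide_distrib)
    qed
    also have "\<dots> = real n * (- (p * (R - 1 / R) / 2) - q * (Re z * (1 - 1 / R)) + p * (Im z)\<^sup>2 * (1 - 1 / R\<^sup>2))"
      unfolding Rez2 using R by (simp add: field_simps power2_eq_square)
    also have "\<dots> \<le> real n * (- p * s + \<bar>q\<bar> * s + 16 * (r - 1) * (Im z)\<^sup>2)"
    proof (intro mult_left_mono add_mono)
      have "(R - 1 / R) / 2 = s * ((r + 1 / r) / 2)"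
        using r by (simp add: R_def s_def power2_eq_square field_simps)
      moreover have "1 \<le> (r + 1 / r) / 2"
      proof -
        have "0 \<le> (r - 1)\<^sup>2" by simp
        then show ?thesis using r by (simp add: field_simps power2_eq_square)
      qed
      ultimately have "s \<le> (R - 1 / R) / 2" using s(1) mult_left_mono[of 1 "(r + 1 / r) / 2" s] by linarith
      then have "p * s \<le> p * ((R - 1 / R) / 2)" using p by (intro mult_left_mono)
      moreover have "\<bar>Re z * (1 - 1 / R)\<bar> \<le> s"
      proof -
        have "\<bar>Re z * (1 - 1 / R)\<bar> \<le> r * (1 - 1 / R)"
          using R abs_Re_le_cmod[of z] by (simp add: abs_mult r_def mult_right_mono)
        also have "\<dots> = s" using r by (simp add: R_def s_def power2_eq_square field_simps)
        finally show ?thesis .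
      qed
      then have "\<bar>q * (Re z * (1 - 1 / R))\<bar> \<le> \<bar>q\<bar> * s"
        by (simp add: abs_mult mult_left_mono)
      moreover have "- b - d \<le> - a + e" if "a \<le> b" "\<bar>d\<bar> \<le> e" for a b d e :: real
        using that by linarith
      ultimately show "- (p * (R - 1 / R) / 2) - q * (Re z * (1 - 1 / R)) \<le> - p * s + \<bar>q\<bar> * s"
        unfolding mult_minus_left times_divide_eq_right[symmetric] by blast
      have "1 - 1 / R\<^sup>2 \<le> 4 * (r - 1)"
      proof -
        have "r * 1 \<le> r * r" using r by (intro mult_left_mono) auto
        then have "r + 1 \<le> 2 * R" using r unfolding R_def power2_eq_square by linarith
        then have "(r + 1) / R \<le> 2" using R by (simp add: field_simps)
        then have "(r - 1) * ((r + 1) / R) \<le> (r - 1) * 2" using r by (intro mult_left_mono) auto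
        moreover have "1 - 1 / R = (r - 1) * ((r + 1) / R)"
          using r by (simp add: R_def field_simps power2_eq_square)
        moreover have "1 - 1 / R\<^sup>2 = (1 - 1 / R) * (1 + 1 / R)"
          using R by (simp add: field_simps power2_eq_square)
        moreover have "(1 - 1 / R) * (1 + 1 / R) \<le> (1 - 1 / R) * 2"
          using R by (intro mult_left_mono) auto
        moreover have "a \<le> 4 * (r - 1)" if "b \<le> (r - 1) * 2" "d = b" "a = e" "e \<le> d * 2" for a b d e :: real
          using that by linarith
        ultimately show ?thesis by blast
      qed
      moreover have "p * (1 - 1 / R\<^sup>2) \<le> 4 * (1 - 1 / R\<^sup>2)" using p R by (intro mult_right_mono) auto
      moreover have "a \<le> 16 * b" if "d \<le> 4 * b" "a \<le> 4 * d" for a b d :: real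
        using that by linarith
      ultimately have "p * (1 - 1 / R\<^sup>2) \<le> 16 * (r - 1)" by blast
      then have "p * (1 - 1 / R\<^sup>2) * (Im z)\<^sup>2 \<le> 16 * (r - 1) * (Im z)\<^sup>2" by (intro mult_right_mono) auto
      then show "p * (Im z)\<^sup>2 * (1 - 1 / R\<^sup>2) \<le> 16 * (r - 1) * (Im z)\<^sup>2" by (simp add: ac_simps)
    qed simp
    finally have "2 * real (card J) * ln r + E z - E w
       \<le> real n * ((1 - p + \<bar>q\<bar>) * s + 16 * (r - 1) * (Im z)\<^sup>2)"
      using lnr by (simp add: algebra_simps)
    also have "\<dots> \<le> real n * (\<nu> * (2 * (r - 1)) + 16 * (r - 1) * (Im z)\<^sup>2)"
    proof (intro mult_left_mono add_right_mono)
      have "(1 - p + \<bar>q\<bar>) * s \<le> \<nu> * s" using \<nu> s by (intro mult_right_mono)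
      also have "\<dots> \<le> \<nu> * (2 * (r - 1))" using \<nu> s by (intro mult_left_mono)
      finally show "(1 - p + \<bar>q\<bar>) * s \<le> \<nu> * (2 * (r - 1))" .
    qed simp
    also have "\<dots> \<le> 16 * real n * (r - 1) * (\<nu> + (Im z)\<^sup>2)"
    proof -
      have "0 \<le> \<nu> * (r - 1)" using \<nu> r by simp
      then have "\<nu> * (2 * (r - 1)) + 16 * (r - 1) * (Im z)\<^sup>2 \<le> 16 * (r - 1) * (\<nu> + (Im z)\<^sup>2)"
        by (simp add: algebra_simps)
      then have "real n * (\<nu> * (2 * (r - 1)) + 16 * (r - 1) * (Im z)\<^sup>2)
          \<le> real n * (16 * (r - 1) * (\<nu> + (Im z)\<^sup>2))"
        by (rule mult_left_mono) simp
      then show ?thesis by (simp only: ac_simps)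
    qed
    finally show ?thesis .
  qed
  have rp: "r ^ (2 * card J) = exp (2 * real (card J) * ln r)"
    using exp_of_nat_mult[of "2 * card J" "ln r"] r by simp
  have "norm (wpoly c n p q J z) = r ^ (2 * card J) * (\<Prod>i\<in>J. norm (quad (c i) w)) * exp (E z)"
    by (simp only: nE prodeq)
  also have "\<dots> = exp (2 * real (card J) * ln r + E z - E w) * norm (wpoly c n p q J w)"
    by (simp add: nE rp exp_add exp_diff)
  also have "\<dots> \<le> exp (16 * real n * (r - 1) * (\<nu> + (Im z)\<^sup>2)) * m"
    using key wle m0 by (intro mult_mono) auto
  finally show ?thesis by (simp add: r_def mult.commute)
qed

text \<open>Cauchy's inequality on discs of radius \<open>R / 2\<close> centred in the disc of half
  the radius bounds the derivative there by \<open>2 * B / R\<close>.\<close>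

lemma holomorphic_near:
  assumes hol: "f holomorphic_on cball z0 R" and "0 < R"
    and B: "\<And>z. z \<in> cball z0 R \<Longrightarrow> norm (f z) \<le> B"
    and z: "norm (z - z0) \<le> R / 2"
  shows "norm (f z - f z0) \<le> 2 * B / R * norm (z - z0)"
proof -
  have "norm (f z - f z0) \<le> (B / (R / 2)) * norm (z - z0)"
  proof (rule field_differentiable_bound[where S = "cball z0 (R / 2)" and f' = "deriv f"])
    fix w assume w: "w \<in> cball z0 (R / 2)"
    have sub: "cball w (R / 2) \<subseteq> cball z0 R"
    proof
      fix x assume "x \<in> cball w (R / 2)"
      then show "x \<in> cball z0 R" using w dist_triangle[of z0 x w] by auto
    qed
    have wb: "w \<in> ball z0 R" using w \<open>0 < R\<close> by auto
    show "(f has_field_derivative deriv f w) (at w within cball z0 (R / 2))"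
      by (rule has_field_derivative_at_within, rule holomorphic_derivI[OF holomorphic_on_subset[OF hol ball_subset_cball] _ wb]) simp
    have "norm ((deriv ^^ 1) f w) \<le> fact 1 * B / (R / 2) ^ 1"
    proof (rule Cauchy_inequality)
      show "f holomorphic_on ball w (R / 2)"
        using hol sub ball_subset_cball by (blast intro: holomorphic_on_subset)
      show "continuous_on (cball w (R / 2)) f"
        using hol sub by (blast intro: holomorphic_on_imp_continuous_on holomorphic_on_subset)
      show "0 < R / 2" using \<open>0 < R\<close> by simp
      fix x assume "norm (w - x) = R / 2"
      then have "x \<in> cball w (R / 2)" by (simp add: dist_norm)
      then show "norm (f x) \<le> B" using B sub by blast
    qed
    then show "norm (deriv f w) \<le> B / (R / 2)" by simp
  qed (use z \<open>0 < R\<close> in \<open>auto simp: dist_norm norm_minus_commute\<close>)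
  then show ?thesis by (simp add: field_simps)
qed

text \<open>
  Moving inside the disc, each factor is compared with its value at the real point
  \<open>Re (jouk z)\<close>, not at the radial projection of \<open>z\<close>: the radial comparison loses a term of order
  \<open>n (1 - |z|)\<^sup>2\<close>, which is too much near the edges.
\<close>

lemma wpoly_inside_ge:
  assumes J: "finite J" "card J \<le> n" and p: "0 \<le> p" "p \<le> 4"
    and \<nu>: "1 - p + \<bar>q\<bar> \<le> \<nu>" "0 \<le> \<nu>" and z: "1 / 2 \<le> norm z" "norm z \<le> 1"
  shows "norm (wpoly c n p q J z) \<ge> rweight c n p q J (Re (jouk z)) * exp (real n * p / 2)
           * exp (- real n * (1 - norm z) * (2 * \<nu> + 128 * (Im z)\<^sup>2))"
proof -
  define r x y X where "r = norm z" and "x = Re z" and "y = Im z" and "X = Re (jouk z)"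
  have r: "1/2 \<le> r" "r \<le> 1" and z0: "z \<noteq> 0" using z by (auto simp: r_def)
  define R where "R = r\<^sup>2"
  have R: "1/4 \<le> R" "R \<le> 1"
    using power_mono[OF r(1), of 2] power_le_one[of r 2] r by (auto simp: R_def power2_eq_square)
  have xy: "x\<^sup>2 = R - y\<^sup>2" by (simp add: R_def r_def x_def y_def cmod_power2)
  have X: "X = x * (1 + 1 / R)" using Re_jouk[OF z0] by (simp add: X_def x_def R_def r_def)
  have key: "ln r - (p * (R - 2 * y\<^sup>2) / 2 + q * x) + (p * X\<^sup>2 / 4 + q * X / 2) - p / 2
          \<ge> - (1 - r) * (2 * \<nu> + 128 * y\<^sup>2)"
  proof -
    have X2: "X\<^sup>2 = (R - y\<^sup>2) * (1 + 1 / R)\<^sup>2" by (simp add: X power_mult_distrib xy)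
    have eq: "- (p * (R - 2 * y\<^sup>2) / 2 + q * x) + (p * X\<^sup>2 / 4 + q * X / 2) - p / 2
       = p * ((1 - R\<^sup>2) / (4 * R)) - p * y\<^sup>2 * ((1 - R) * (1 + 3 * R) / (4 * R\<^sup>2)) + q * x * (1 - R) / (2 * R)"
      unfolding X2 unfolding X using R by (simp add: field_simps power2_eq_square)
    \<comment> \<open>This is \<open>sinh (- ln r)\<close>. As outside the disc, the first-order
      terms combine to the balance \<open>1 - p\<close> plus the modulus of \<open>q\<close>, times
      \<open>t\<close>.\<close>
    define t where "t = (1 - R) / (2 * r)"
    have t0: "0 \<le> t" using r R by (simp add: t_def)
    have At: "t \<le> (1 - R\<^sup>2) / (4 * R)"
    proof -
      have "0 \<le> (1 - r)\<^sup>2" by simp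
      then have "2 * r \<le> 1 + R" by (simp add: R_def power2_eq_square algebra_simps)
      then have "t * (2 * r) \<le> t * (1 + R)" using t0 by (intro mult_left_mono)
      moreover have "(1 - R\<^sup>2) / (4 * R) * (2 * r) = t * (1 + R)"
        using r by (simp add: t_def R_def field_simps power2_eq_square)
      ultimately have "t * (2 * r) \<le> (1 - R\<^sup>2) / (4 * R) * (2 * r)" by linarith
      then show ?thesis by (rule mult_right_le_imp_le) (use r in simp)
    qed
    have qt: "- (\<bar>q\<bar> * t) \<le> q * x * (1 - R) / (2 * R)"
    proof -
      have "\<bar>x\<bar> \<le> r" using abs_Re_le_cmod[of z] by (simp add: x_def r_def)
      then have "\<bar>x\<bar> * ((1 - R) / (2 * R)) \<le> r * ((1 - R) / (2 * R))" using R by (intro mult_right_mono) auto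
      also have "\<dots> = t" using r by (simp add: t_def R_def power2_eq_square)
      finally have "\<bar>q\<bar> * (\<bar>x\<bar> * ((1 - R) / (2 * R))) \<le> \<bar>q\<bar> * t" by (intro mult_left_mono) auto
      then have "\<bar>q * x * ((1 - R) / (2 * R))\<bar> \<le> \<bar>q\<bar> * t" using R by (simp add: abs_mult)
      then have "- (\<bar>q\<bar> * t) \<le> q * x * ((1 - R) / (2 * R))" by linarith
      then show ?thesis by simp
    qed
    have lnt: "- t \<le> ln r"
      using sinh_ln_ge[of "1 / r"] r by (simp add: ln_div t_def R_def field_simps power2_eq_square)
    have pt: "p * t \<le> p * ((1 - R\<^sup>2) / (4 * R))" using At p by (intro mult_left_mono)
    have yt: "p * y\<^sup>2 * ((1 - R) * (1 + 3 * R) / (4 * R\<^sup>2)) \<le> (1 - r) * (128 * y\<^sup>2)"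
    proof -
      have R2: "1/16 \<le> R\<^sup>2" using power_mono[OF R(1), of 2] by (simp add: power2_eq_square)
      have "(1 - R) * (1 + 3 * R) / (4 * R\<^sup>2) \<le> ((1 - R) * 4) / (4 * (1/16))"
        using R R2 by (intro frac_le mult_left_mono) auto
      also have "\<dots> = 16 * ((1 - r) * (1 + r))" by (simp add: R_def power2_eq_square algebra_simps)
      also have "\<dots> \<le> 16 * ((1 - r) * 2)" using r by (intro mult_left_mono) auto
      finally have 1: "(1 - R) * (1 + 3 * R) / (4 * R\<^sup>2) \<le> 32 * (1 - r)" by simp
      have "p * y\<^sup>2 * ((1 - R) * (1 + 3 * R) / (4 * R\<^sup>2)) \<le> 4 * y\<^sup>2 * (32 * (1 - r))"
        using 1 p R by (intro mult_mono) auto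
      then show ?thesis by (simp add: algebra_simps)
    qed
    have "t \<le> 2 * (1 - r)"
    proof -
      have "t = (1 - r) * ((1 + r) / (2 * r))" using r by (simp add: t_def R_def power2_eq_square field_simps)
      also have "\<dots> \<le> (1 - r) * 2" using r by (intro mult_left_mono) (auto simp: field_simps)
      finally show ?thesis by simp
    qed
    then have "\<nu> * t \<le> \<nu> * (2 * (1 - r))" using \<nu> by (intro mult_left_mono)
    moreover have "(1 - p + \<bar>q\<bar>) * t \<le> \<nu> * t" using \<nu> t0 by (intro mult_right_mono)
    ultimately have "- (2 * \<nu> * (1 - r)) \<le> - t + p * t - \<bar>q\<bar> * t" by (simp add: algebra_simps)
    then show ?thesis using eq qt lnt pt yt by (simp add: algebra_simps)
  qed
  have fac: "norm (quad (c i) z) \<ge> r * \<bar>X - c i\<bar>" for i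
  proof -
    have "\<bar>X - c i\<bar> \<le> norm (jouk z - of_real (c i))"
      using abs_Re_le_cmod[of "jouk z - of_real (c i)"] by (simp add: X_def)
    then show ?thesis using r by (simp add: quad_jouk[OF z0] norm_mult r_def[symmetric] mult_left_mono)
  qed
  have "r ^ n * (\<Prod>i\<in>J. \<bar>X - c i\<bar>) \<le> r ^ card J * (\<Prod>i\<in>J. \<bar>X - c i\<bar>)"
    using J r by (intro mult_right_mono power_decreasing prod_nonneg) auto
  also have "\<dots> = (\<Prod>i\<in>J. r * \<bar>X - c i\<bar>)" by (simp add: prod.distrib)
  also have "\<dots> \<le> (\<Prod>i\<in>J. norm (quad (c i) z))" using fac r by (intro prod_mono) auto
  finally have P: "r ^ n * (\<Prod>i\<in>J. \<bar>X - c i\<bar>) \<le> (\<Prod>i\<in>J. norm (quad (c i) z))" .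
  have rn: "r ^ n = exp (real n * ln r)" using r by (simp add: exp_of_nat_mult)
  have "rweight c n p q J X * exp (real n * p / 2) * exp (- real n * (1 - r) * (2 * \<nu> + 128 * y\<^sup>2))
     = (\<Prod>i\<in>J. \<bar>X - c i\<bar>) * exp (- real n * (p * X\<^sup>2 / 4 + q * X / 2) + real n * p / 2
           + real n * (- (1 - r) * (2 * \<nu> + 128 * y\<^sup>2)))"
  proof -
    have "- real n * (1 - r) * (2 * \<nu> + 128 * y\<^sup>2) = real n * (- (1 - r) * (2 * \<nu> + 128 * y\<^sup>2))"
      by (simp only: mult_minus_left mult_minus_right mult.assoc)
    then show ?thesis by (simp only: rweight_def mult.assoc exp_add)
  qed
  also have "\<dots> \<le> (\<Prod>i\<in>J. \<bar>X - c i\<bar>) * exp (- real n * (p * X\<^sup>2 / 4 + q * X / 2) + real n * p / 2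
           + real n * (ln r - (p * (R - 2 * y\<^sup>2) / 2 + q * x) + (p * X\<^sup>2 / 4 + q * X / 2) - p / 2))"
    using key by (intro mult_left_mono prod_nonneg) (auto intro!: mult_left_mono)
  also have "\<dots> = (\<Prod>i\<in>J. \<bar>X - c i\<bar>) * exp (real n * ln r - real n * (p * (R - 2 * y\<^sup>2) / 2 + q * x))"
    by (intro arg_cong2[where f = "(*)"] arg_cong[where f = exp] refl) (simp add: algebra_simps)
  also have "\<dots> = r ^ n * (\<Prod>i\<in>J. \<bar>X - c i\<bar>) * exp (- real n * (p * (R - 2 * y\<^sup>2) / 2 + q * x))"
    by (simp only: rn exp_diff exp_minus mult_minus_left divide_inverse ac_simps)
  also have "\<dots> \<le> (\<Prod>i\<in>J. norm (quad (c i) z)) * exp (- real n * (p * (R - 2 * y\<^sup>2) / 2 + q * x))"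
    using P by (intro mult_right_mono) auto
  also have "\<dots> = norm (wpoly c n p q J z)"
    by (simp add: norm_wpoly Re_power2_norm R_def r_def x_def y_def)
  finally show ?thesis by (simp add: r_def X_def y_def)
qed

lemma abs_convex_combination_powr:
  fixes a b x y :: real
  assumes "0 \<le> t" "t \<le> 1" "0 \<le> a" "0 \<le> b"
  shows "a powr (1 - t) * b powr t \<le> (1 - t) * a + t * b"
proof (cases "a = 0 \<or> b = 0")
  case True then show ?thesis using assms by auto
next
  case False then show ?thesis using assms Youngs_inequality_0[of "1 - t" t a b] by simp
qed

text \<open>On an interval free of points every \<open>ln\<close> of a distance is concave, and so
  is the exponent because \<open>0 <= p\<close>. The form with powers covers weights that vanish at
  an end point.\<close>

lemma rweight_log_concave:
  assumes p: "0 \<le> p" and t: "0 \<le> t" "t \<le> 1" and ab: "a \<le> b"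
    and J: "\<And>i. i \<in> J \<Longrightarrow> c i \<le> a \<or> b \<le> c i"
  shows "rweight c n p q J a powr (1 - t) * rweight c n p q J b powr t
           \<le> rweight c n p q J ((1 - t) * a + t * b)"
proof -
  define x where "x = (1 - t) * a + t * b"
  define E where "E = (\<lambda>x. - real n * (p * x\<^sup>2 / 4 + q * x / 2))"
  have pp: "(\<Prod>i\<in>J. f i) powr s = (\<Prod>i\<in>J. f i powr s)" if "\<And>i. 0 \<le> f i" for f :: "nat \<Rightarrow> real" and s
    using that by (induction J rule: infinite_finite_induct) (auto simp: powr_mult prod_nonneg)
  have rw: "rweight c n p q J y = (\<Prod>i\<in>J. \<bar>y - c i\<bar>) * exp (E y)" for y
    by (simp only: rweight_def E_def)
  have xab: "a \<le> x" "x \<le> b"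
  proof -
    have "t * a \<le> t * b" "(1 - t) * a \<le> (1 - t) * b" using t ab by (auto intro!: mult_left_mono)
    then show "a \<le> x" "x \<le> b" by (auto simp: x_def algebra_simps)
  qed
  have "rweight c n p q J a powr (1 - t) * rweight c n p q J b powr t
     = (\<Prod>i\<in>J. \<bar>a - c i\<bar> powr (1 - t) * \<bar>b - c i\<bar> powr t) * exp ((1 - t) * E a + t * E b)"
    by (simp add: rw powr_mult prod_nonneg pp prod.distrib exp_powr_real exp_add ac_simps)
  also have "\<dots> \<le> (\<Prod>i\<in>J. \<bar>x - c i\<bar>) * exp (E x)"
  proof (intro mult_mono prod_mono conjI)
    fix i assume "i \<in> J"
    have "\<bar>a - c i\<bar> powr (1 - t) * \<bar>b - c i\<bar> powr t \<le> (1 - t) * \<bar>a - c i\<bar> + t * \<bar>b - c i\<bar>"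
      by (rule abs_convex_combination_powr) (use t in auto)
    also have "\<dots> = \<bar>x - c i\<bar>"
      using J[OF \<open>i \<in> J\<close>]
    proof
      assume "c i \<le> a"
      then show ?thesis using xab ab by (simp add: x_def algebra_simps)
    next
      assume "b \<le> c i"
      then show ?thesis using xab ab by (simp add: x_def algebra_simps)
    qed
    finally show "\<bar>a - c i\<bar> powr (1 - t) * \<bar>b - c i\<bar> powr t \<le> \<bar>x - c i\<bar>" .
  next
    have "x\<^sup>2 \<le> (1 - t) * a\<^sup>2 + t * b\<^sup>2"
    proof -
      have "(1 - t) * a\<^sup>2 + t * b\<^sup>2 - x\<^sup>2 = t * (1 - t) * (a - b)\<^sup>2"
        by (simp add: x_def power2_eq_square algebra_simps)
      moreover have "0 \<le> t * (1 - t) * (a - b)\<^sup>2" using t by simp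
      ultimately show ?thesis by linarith
    qed
    then have "p * x\<^sup>2 / 4 + q * x / 2 \<le> p * ((1 - t) * a\<^sup>2 + t * b\<^sup>2) / 4 + q * x / 2"
      using p by (simp add: mult_left_mono)
    then have "real n * (p * x\<^sup>2 / 4 + q * x / 2) \<le> real n * (p * ((1 - t) * a\<^sup>2 + t * b\<^sup>2) / 4 + q * x / 2)"
      by (intro mult_left_mono) auto
    then have "(1 - t) * E a + t * E b \<le> E x"
      by (simp add: E_def x_def algebra_simps add_divide_distrib diff_divide_distrib)
    then show "exp ((1 - t) * E a + t * E b) \<le> exp (E x)" by simp
  qed (auto intro!: prod_nonneg)
  finally show ?thesis by (simp add: rw x_def)
qed

section \<open>Configurations with bounded Lagrange weights\<close>

text \<open>
  For \<open>p = 1\<close> and \<open>q = 0\<close> the equilibrium measure of the weight is the semicircle law on \<open>[- 2, 2]\<close>; the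
  parameter \<open>\<nu>\<close> bounds the deviation, and \<open>eta j\<close> below is the local spacing at \<open>c j\<close>, measured in the angle.
\<close>

locale lagrange_config =
  fixes I :: "nat set" and c :: "nat \<Rightarrow> real" and n :: nat and p q \<nu> C :: real
  assumes fin: "finite I" and card_I: "card I = n"
    and c_bound: "\<And>i. i \<in> I \<Longrightarrow> \<bar>c i\<bar> \<le> 2"
    and hi: "\<exists>i\<in>I. c i = 2" and lo: "\<exists>i\<in>I. c i = - 2"
    and p0: "0 \<le> p" and p4: "p \<le> 4"
    and nu: "1 - p + \<bar>q\<bar> \<le> \<nu>" and nu0: "0 < \<nu>" and nu2: "2 \<le> real n * \<nu>"
    and nu3: "1 \<le> (real n)\<^sup>2 * \<nu> ^ 3"
    and C1: "1 \<le> C"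
    and lagr: "\<And>j w. j \<in> I \<Longrightarrow> norm w = 1 \<Longrightarrow>
      norm (wpoly c n p q (I - {j}) w)
        \<le> C * norm (wpoly c n p q (I - {j}) (circ_root (c j)))"
    and nz: "\<And>j. j \<in> I \<Longrightarrow> wpoly c n p q (I - {j}) (circ_root (c j)) \<noteq> 0"
begin

abbreviation "L j \<equiv> wpoly c n p q (I - {j})"
abbreviation "zr j \<equiv> circ_root (c j)"

section \<open>Values at the points and their mutual comparison\<close>

definition lam :: "nat \<Rightarrow> real" where "lam j = norm (L j (zr j))"
definition eta :: "nat \<Rightarrow> real" where "eta j = 1 / (real n * (\<nu> + (Im (zr j))\<^sup>2))"
text \<open>The step inward, in units of \<open>eta j\<close>, over which Cauchy's bound loses half
  of \<open>lam j\<close> at most: \<open>2 * (C * exp 12) / (1 / 4) * c1 = 1 / 2\<close>.\<close>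

definition c1 :: real where "c1 = 1 / (16 * C * exp 12)"
definition z0 :: "nat \<Rightarrow> complex" where "z0 j = of_real (1 - c1 * eta j) * zr j"
text \<open>Stands for the spacing at \<open>c j\<close> measured in x instead of the angle; it is
  at least a multiple of \<open>eta j * (eta j + Im (zr j))\<close>, see
  \<open>xi_ge\<close>.\<close>

definition xi :: "nat \<Rightarrow> real" where "xi j = norm (jouk (z0 j) - of_real (c j))"

lemma n0: "0 < real n"
  using nu2 nu0 by (cases n) auto

lemma c1_bounds: "0 < c1" "c1 \<le> 1 / 16"
proof -
  have "1 * 1 \<le> C * exp 12" using C1 by (intro mult_mono) auto
  then show "0 < c1" "c1 \<le> 1 / 16" by (auto simp: c1_def field_simps)
qed

lemma lam_pos: "j \<in> I \<Longrightarrow> 0 < lam j"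
  using nz by (simp add: lam_def)

lemma norm_zr: "j \<in> I \<Longrightarrow> norm (zr j) = 1"
  using norm_circ_root c_bound by blast

lemma c_distinct:
  assumes "i \<in> I" "j \<in> I" "i \<noteq> j"
  shows "c i \<noteq> c j"
proof
  assume eq: "c i = c j"
  have "quad (c i) (zr j) = 0" using quad_factor[OF c_bound[OF assms(2)]] eq by simp
  then have "L j (zr j) = 0" unfolding wpoly_def using assms fin by (auto intro!: prod_zero)
  then show False using nz assms by blast
qed

lemma quad_nonzero:
  assumes "i \<in> I" "norm z < 1"
  shows "quad (c i) z \<noteq> 0"
  using quad_factor[OF c_bound[OF assms(1)], of z] norm_zr[OF assms(1)] assms(2)
  by auto

lemma L_disc:
  assumes "j \<in> I" "norm z \<le> 1"
  shows "norm (L j z) \<le> C * lam j"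
  using wpoly_max_disc[OF lagr[OF assms(1)] assms(2)] by (simp add: lam_def)

lemma eta_pos: "0 < eta j"
  using n0 nu0 by (simp add: eta_def add_pos_nonneg)

lemma eta_half: "eta j \<le> 1 / 2"
proof -
  have "2 \<le> real n * (\<nu> + (Im (zr j))\<^sup>2)"
    using nu2 n0 by (simp add: distrib_left add_increasing2)
  then show ?thesis by (simp add: eta_def field_simps)
qed

text \<open>This is \<open>nu3\<close>: no spacing is finer than the resolution of the edge. Hence a
  move by one spacing changes \<open>nu\<close> plus the squared imaginary part by a bounded factor
  only.\<close>

lemma eta_sq: "(eta j)\<^sup>2 \<le> \<nu> + (Im (zr j))\<^sup>2"
proof -
  define T where "T = \<nu> + (Im (zr j))\<^sup>2"
  have T: "\<nu> \<le> T" "0 < T" using nu0 by (auto simp: T_def add_pos_nonneg)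
  have "1 \<le> (real n)\<^sup>2 * T ^ 3"
    using nu3 mult_left_mono[OF power_mono[OF T(1), of 3], of "(real n)\<^sup>2"] nu0 by simp
  then have "1 \<le> T * (real n * T)\<^sup>2" by (simp add: power2_eq_square power3_eq_cube algebra_simps)
  then show ?thesis using n0 T
    by (simp add: eta_def T_def[symmetric] power_divide field_simps)
qed

text \<open>Outside the disc \<open>wpoly_growth\<close> gives an exponent of at most
  \<open>16 * (1 / 4) * 3 = 12\<close>; the factor 3 bounds the growth of \<open>nu\<close> plus the
  squared imaginary part over a quarter of a spacing.\<close>

lemma L_near:
  assumes j: "j \<in> I" and z: "norm (z - zr j) \<le> eta j / 4"
  shows "norm (L j z) \<le> C * exp 12 * lam j"
proof (cases "norm z \<le> 1")
  case True
  have "C * lam j \<le> C * lam j * exp 12" using C1 lam_pos[OF j] by (intro mult_left_mono[of 1 "exp 12" "C * lam j", simplified]) simp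
  then show ?thesis using L_disc[OF j True] by (simp add: algebra_simps)
next
  case False
  have nz1: "norm z - 1 \<le> eta j / 4"
    using norm_triangle_ineq2[of z "zr j"] z norm_zr[OF j] by simp
  have "\<bar>Im z\<bar> \<le> Im (zr j) + eta j / 4"
    using abs_Im_le_cmod[of "z - zr j"] z Im_circ_root_nonneg[OF c_bound[OF j]] by simp
  then have "(Im z)\<^sup>2 \<le> (Im (zr j) + eta j / 4)\<^sup>2" by (rule abs_le_square_iff[THEN iffD1, OF order_trans]) auto
  also have "\<dots> \<le> 2 * (Im (zr j))\<^sup>2 + 2 * (eta j / 4)\<^sup>2"
    using sum_squares_bound[of "Im (zr j)" "eta j / 4"] by (simp add: power2_sum)
  also have "2 * (eta j / 4)\<^sup>2 \<le> \<nu> + (Im (zr j))\<^sup>2"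
  proof -
    have "2 * (eta j / 4)\<^sup>2 = (eta j)\<^sup>2 / 8" by (simp add: power_divide)
    then show ?thesis using eta_sq[of j] zero_le_power2[of "eta j"] by linarith
  qed
  finally have im: "\<nu> + (Im z)\<^sup>2 \<le> 3 * (\<nu> + (Im (zr j))\<^sup>2)" using nu0 by simp
  have "norm (L j z) \<le> (C * lam j) * exp (16 * real n * (norm z - 1) * (\<nu> + (Im z)\<^sup>2))"
    by (rule wpoly_growth) (use fin card_I card_mono[OF fin, of "I - {j}"] lagr j p0 p4 nu nu0 False nz1 eta_half[of j] in \<open>auto simp: lam_def\<close>)
  also have "16 * real n * (norm z - 1) * (\<nu> + (Im z)\<^sup>2)
      \<le> 16 * real n * (eta j / 4) * (3 * (\<nu> + (Im (zr j))\<^sup>2))"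
    using nz1 im nu0 False eta_pos[of j] by (intro mult_mono) auto
  also have "\<dots> = 12"
  proof -
    define T where "T = \<nu> + (Im (zr j))\<^sup>2"
    have "0 < T" using nu0 by (simp add: T_def add_pos_nonneg)
    then show ?thesis using n0 by (simp add: eta_def T_def[symmetric])
  qed
  finally show ?thesis using C1 lam_pos[OF j] by (simp add: algebra_simps)
qed

lemma norm_z0: "j \<in> I \<Longrightarrow> norm (z0 j) = 1 - c1 * eta j"
  and c1_eta: "0 < c1 * eta j" "c1 * eta j \<le> 1 / 32"
proof -
  have "c1 * eta j \<le> (1 / 16) * (1 / 2)" using c1_bounds eta_half eta_pos[of j] by (intro mult_mono) auto
  then show 1: "0 < c1 * eta j" "c1 * eta j \<le> 1 / 32" using c1_bounds eta_pos by auto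
  show "j \<in> I \<Longrightarrow> norm (z0 j) = 1 - c1 * eta j"
    using 1 by (simp add: z0_def norm_mult norm_zr del: of_real_diff)
qed

lemma dist_z0: "j \<in> I \<Longrightarrow> norm (z0 j - zr j) = c1 * eta j"
proof -
  assume j: "j \<in> I"
  have "z0 j - zr j = of_real (- (c1 * eta j)) * zr j" by (simp add: z0_def algebra_simps)
  then have "norm (z0 j - zr j) = \<bar>- (c1 * eta j)\<bar> * 1"
    using norm_zr[OF j] by (simp only: norm_mult norm_of_real)
  then show ?thesis using c1_eta[of j] by simp
qed

lemma z0_ge:
  assumes j: "j \<in> I"
  shows "lam j / 2 \<le> norm (L j (z0 j))"
proof -
  have "norm (L j (z0 j) - L j (zr j)) \<le> 2 * (C * exp 12 * lam j) / (eta j / 4) * norm (z0 j - zr j)"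
  proof (rule holomorphic_near)
    show "L j holomorphic_on cball (zr j) (eta j / 4)" by (rule wpoly_holomorphic)
    show "norm (L j z) \<le> C * exp 12 * lam j" if "z \<in> cball (zr j) (eta j / 4)" for z
      using L_near[OF j] that by (simp add: dist_norm norm_minus_commute)
    have "c1 * eta j \<le> 1 / 16 * eta j" using c1_bounds eta_pos[of j] by (intro mult_right_mono) auto
    then show "norm (z0 j - zr j) \<le> eta j / 4 / 2" using dist_z0[OF j] eta_pos[of j] by simp
  qed (use eta_pos in auto)
  also have "\<dots> = lam j / 2" using dist_z0[OF j] eta_pos[of j] C1 by (simp add: c1_def)
  finally show ?thesis using norm_triangle_ineq2[of "L j (zr j)" "L j (z0 j)"]
    by (simp add: lam_def norm_minus_commute)
qed

lemma L_split:
  assumes "j \<in> I"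
  shows "wpoly c n p q I z = quad (c j) z * L j z"
  using wpoly_insert[of "I - {j}" j c n p q z] assms fin by (simp add: insert_absorb)

lemma xi_pos:
  assumes "j \<in> I"
  shows "0 < xi j"
proof -
  have lt: "norm (z0 j) < 1" using norm_z0[OF assms] c1_eta[of j] by simp
  have "z0 j \<noteq> 0" using norm_z0[OF assms] c1_eta[of j] by auto
  then show ?thesis using quad_nonzero[OF assms lt] by (simp add: quad_jouk xi_def)
qed

text \<open>The full product over \<open>I\<close> equals both \<open>quad (c k) z * L k z\<close>
  and \<open>quad (c j) z * L j z\<close>. On the circle over a point this reads 0 = 0; evaluated
  slightly inside, at \<open>z0 k\<close>, it links the two Lagrange weights. There
  \<open>L k\<close> is still at least half of \<open>lam k\<close>, while \<open>L j\<close> is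
  bounded by the maximum principle.\<close>

lemma lam_ratio:
  assumes k: "k \<in> I" and j: "j \<in> I"
  shows "lam k / (2 * C) * (xi k / (xi k + \<bar>c j - c k\<bar>)) \<le> lam j"
proof -
  have nz0: "z0 k \<noteq> 0" and lt: "norm (z0 k) \<le> 1" using norm_z0[OF k] c1_eta[of k] by auto
  have "norm (quad (c k) (z0 k) * L k (z0 k)) = norm (quad (c j) (z0 k) * L j (z0 k))"
    using L_split[OF k] L_split[OF j] by metis
  then have eq: "xi k * norm (L k (z0 k)) = norm (jouk (z0 k) - of_real (c j)) * norm (L j (z0 k))"
    using nz0 by (simp add: quad_jouk norm_mult xi_def)
  have "xi k * (lam k / 2) \<le> xi k * norm (L k (z0 k))"
    using z0_ge[OF k] xi_pos[OF k] by (intro mult_left_mono) auto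
  also have "\<dots> \<le> (xi k + \<bar>c j - c k\<bar>) * (C * lam j)"
    unfolding eq
  proof (intro mult_mono)
    have "jouk (z0 k) - of_real (c j) = (jouk (z0 k) - of_real (c k)) - of_real (c j - c k)" by simp
    then show "norm (jouk (z0 k) - of_real (c j)) \<le> xi k + \<bar>c j - c k\<bar>"
      using norm_triangle_ineq4[of "jouk (z0 k) - of_real (c k)" "of_real (c j - c k)"]
      by (simp only: xi_def norm_of_real)
  qed (use L_disc[OF j lt] xi_pos[OF k] in auto)
  finally have le: "xi k * (lam k / 2) \<le> (xi k + \<bar>c j - c k\<bar>) * (C * lam j)" .
  define A where "A = xi k + \<bar>c j - c k\<bar>"
  have A0: "0 < A" using xi_pos[OF k] by (simp add: A_def add_pos_nonneg)
  have "lam k / (2 * C) * (xi k / A) = xi k * (lam k / 2) / (A * C)" by (simp add: ac_simps)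
  also have "\<dots> \<le> A * (C * lam j) / (A * C)"
    using le A0 C1 unfolding A_def[symmetric] by (intro divide_right_mono) auto
  also have "\<dots> = lam j" using A0 C1 by simp
  finally show ?thesis by (simp add: A_def)
qed

lemma neighbours:
  assumes X: "\<bar>X\<bar> \<le> 2"
  obtains a b where "a \<in> I" "b \<in> I" "c a \<le> X" "X \<le> c b" "c a < c b"
    "\<And>i. i \<in> I \<Longrightarrow> c i \<le> c a \<or> c b \<le> c i"
proof -
  obtain h l where h: "h \<in> I" "c h = 2" and l: "l \<in> I" "c l = - 2" using hi lo by blast
  \<comment> \<open>No point lies to the right of \<open>X = 2\<close>, so there the extreme point
    itself serves as the right neighbour.\<close>
  define B where "B = (if X < 2 then {i\<in>I. X < c i} else {h})"
  define A where "A = (if X < 2 then {i\<in>I. c i \<le> X} else {i\<in>I. c i < 2})"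
  have finAB: "finite A" "finite B" using fin by (auto simp: A_def B_def)
  have ne: "A \<noteq> {}" "B \<noteq> {}" using h l X by (auto simp: A_def B_def)
  obtain a where a: "a \<in> A" "\<And>i. i \<in> A \<Longrightarrow> c i \<le> c a"
    using Max_in[of "c ` A"] Max_ge[of "c ` A"] finAB ne by (metis (no_types, lifting) finite_imageI image_iff image_is_empty)
  obtain b where b: "b \<in> B" "\<And>i. i \<in> B \<Longrightarrow> c b \<le> c i"
    using Min_in[of "c ` B"] Min_le[of "c ` B"] finAB ne by (metis (no_types, lifting) finite_imageI image_iff image_is_empty)
  show ?thesis
  proof (rule that[of a b])
    show "a \<in> I" "b \<in> I" using a(1) b(1) h by (auto simp: A_def B_def split: if_splits)
    show "c a \<le> X" "X \<le> c b" "c a < c b" using a(1) b(1) h X by (auto simp: A_def B_def split: if_splits)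
    fix i assume i: "i \<in> I"
    show "c i \<le> c a \<or> c b \<le> c i"
      using a b i h c_bound[OF i] by (cases "X < 2") (force simp: A_def B_def)+
  qed
qed

lemma lam_rweight:
  assumes "a \<in> I" "b \<in> I" "a \<noteq> b"
  shows "lam a = \<bar>c a - c b\<bar> * rweight c n p q (I - {a, b}) (c a) * exp (real n * p / 2)"
proof -
  have "I - {a} = insert b (I - {a, b})" using assms by auto
  then have "rweight c n p q (I - {a}) (c a) = \<bar>c a - c b\<bar> * rweight c n p q (I - {a, b}) (c a)"
    using fin by (simp add: rweight_def)
  then show ?thesis by (simp add: lam_def norm_wpoly_unit norm_zr assms)
qed

lemma rweight_nonneg: "0 \<le> rweight c n p q J x"
  by (simp add: rweight_def prod_nonneg)

text \<open>Let a and b be the consecutive points around the real part of \<open>jouk z\<close>.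
  \<open>lam_ratio\<close> bounds \<open>lam a\<close> and \<open>lam b\<close> from below;
  log-concavity of the weight without these two points carries the bound to that real part, and
  \<open>wpoly_inside_ge\<close> from there to \<open>z\<close>. The condition on
  \<open>1 - norm z\<close> keeps the last loss below \<open>exp 128\<close>. Putting the two
  neighbours back costs only the ratio of the height of \<open>jouk z\<close> to its distance from
  \<open>c k\<close>.\<close>

lemma L_lower:
  assumes k: "k \<in> I" and z: "1 / 2 \<le> norm z" "norm z < 1" and X: "\<bar>Re (jouk z)\<bar> \<le> 2"
    and h: "real n * (1 - norm z) * ((Im z)\<^sup>2 + \<nu>) \<le> 1"
  defines "D \<equiv> norm (jouk z - of_real (c k))"
  shows "lam k * exp (- 128) / (8 * C) * (xi k / (xi k + D)) * (\<bar>Im (jouk z)\<bar> / D) \<le> norm (L k z)"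
proof -
  define X where "X = Re (jouk z)"
  obtain a b where ab: "a \<in> I" "b \<in> I" "c a \<le> X" "X \<le> c b" "c a < c b"
    and gap: "\<And>i. i \<in> I \<Longrightarrow> c i \<le> c a \<or> c b \<le> c i"
    using neighbours[of X] assms(4) unfolding X_def by blast
  have anb: "a \<noteq> b" using ab by auto
  define J where "J = I - {a, b}"
  define g where "g = c b - c a"
  define t where "t = (X - c a) / g"
  have g0: "0 < g" using ab by (simp add: g_def)
  have t: "0 \<le> t" "t \<le> 1" using ab g0 by (auto simp: t_def g_def field_simps)
  have Xt: "X = (1 - t) * c a + t * c b"
  proof -
    have "t * g = X - c a" using g0 by (simp add: t_def)
    then show ?thesis by (simp add: g_def algebra_simps)
  qed
  define K where "K = lam k / (2 * C)"
  have K0: "0 < K" using lam_pos[OF k] C1 by (simp add: K_def)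
  note xk = xi_pos[OF k]
  define A B where "A = xi k + \<bar>c a - c k\<bar>" and "B = xi k + \<bar>c b - c k\<bar>"
  have AB: "0 < A" "0 < B" using xk by (auto simp: A_def B_def add_pos_nonneg)
  have XAB: "A powr (1 - t) * B powr t \<le> xi k + \<bar>X - c k\<bar>"
  proof -
    have "A powr (1 - t) * B powr t \<le> (1 - t) * A + t * B"
      by (rule abs_convex_combination_powr) (use t AB in auto)
    also have "\<dots> = xi k + \<bar>X - c k\<bar>"
      using gap[OF k]
    proof
      assume "c k \<le> c a"
      then show ?thesis using ab by (simp add: A_def B_def Xt algebra_simps)
    next
      assume "c b \<le> c k"
      then show ?thesis using ab by (simp add: A_def B_def Xt algebra_simps)
    qed
    finally show ?thesis .
  qed
  have XD: "\<bar>X - c k\<bar> \<le> D"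
    using abs_Re_le_cmod[of "jouk z - of_real (c k)"] by (simp add: X_def D_def)
  have la: "K * xi k / A \<le> lam a" and lb: "K * xi k / B \<le> lam b"
    using lam_ratio[OF k ab(1)] lam_ratio[OF k ab(2)] by (simp_all add: K_def A_def B_def)
  have lamX: "K * xi k / (xi k + D) \<le> lam a powr (1 - t) * lam b powr t"
  proof -
    have "K * xi k / (xi k + D) \<le> K * xi k / (A powr (1 - t) * B powr t)"
      using K0 xk AB XAB XD by (intro divide_left_mono) (auto intro!: mult_pos_pos add_pos_nonneg simp: D_def)
    also have "\<dots> = (K * xi k / A) powr (1 - t) * (K * xi k / B) powr t"
    proof -
      have "(K * xi k) powr (1 - t) * (K * xi k) powr t = K * xi k"
        using K0 xk by (simp flip: powr_add)
      then show ?thesis using K0 xk AB by (simp add: powr_divide)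
    qed
    also have "\<dots> \<le> lam a powr (1 - t) * lam b powr t"
      using la lb t K0 xk AB by (intro mult_mono powr_mono2) auto
    finally show ?thesis .
  qed
  \<comment> \<open>Both \<open>lam a\<close> and \<open>lam b\<close> contain the gap
    \<open>g\<close>, as the distance to the other neighbour; it is kept to cancel against
    \<open>dab\<close>.\<close>
  have rw: "lam a powr (1 - t) * lam b powr t \<le> g * (rweight c n p q J X * exp (real n * p / 2))"
  proof -
    define e where "e = g * exp (real n * p / 2)"
    have e0: "0 < e" using g0 by (simp add: e_def)
    have "lam a = e * rweight c n p q J (c a)"
      using lam_rweight[OF ab(1,2) anb] ab by (simp add: e_def g_def J_def)
    moreover have "lam b = e * rweight c n p q J (c b)"
      using lam_rweight[OF ab(2,1)] anb ab by (simp add: e_def g_def J_def insert_commute)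
    ultimately have "lam a powr (1 - t) * lam b powr t
        = (e powr (1 - t) * e powr t) * (rweight c n p q J (c a) powr (1 - t) * rweight c n p q J (c b) powr t)"
      using e0 by (simp add: powr_mult rweight_nonneg)
    also have "e powr (1 - t) * e powr t = e" using e0 by (simp flip: powr_add)
    also have "e * (rweight c n p q J (c a) powr (1 - t) * rweight c n p q J (c b) powr t) \<le> e * rweight c n p q J X"
      unfolding Xt using e0 ab t p0 gap by (intro mult_left_mono rweight_log_concave) (auto simp: J_def)
    finally show ?thesis by (simp add: e_def algebra_simps)
  qed
  have inside: "rweight c n p q J X * exp (real n * p / 2) * exp (- 128) \<le> norm (wpoly c n p q J z)"
  proof -
    have "real n * (1 - norm z) * (2 * \<nu> + 128 * (Im z)\<^sup>2) \<le> 128 * (real n * (1 - norm z) * ((Im z)\<^sup>2 + \<nu>))"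
    proof -
      have "2 * \<nu> + 128 * (Im z)\<^sup>2 \<le> 128 * ((Im z)\<^sup>2 + \<nu>)" using nu0 by simp
      then have "real n * (1 - norm z) * (2 * \<nu> + 128 * (Im z)\<^sup>2) \<le> real n * (1 - norm z) * (128 * ((Im z)\<^sup>2 + \<nu>))"
        using z by (intro mult_left_mono) auto
      then show ?thesis by (simp add: algebra_simps)
    qed
    then have "exp (- 128) \<le> exp (- real n * (1 - norm z) * (2 * \<nu> + 128 * (Im z)\<^sup>2))"
      using h by simp
    then have "rweight c n p q J X * exp (real n * p / 2) * exp (- 128)
       \<le> rweight c n p q J X * exp (real n * p / 2) * exp (- real n * (1 - norm z) * (2 * \<nu> + 128 * (Im z)\<^sup>2))"
      using rweight_nonneg by (intro mult_left_mono mult_nonneg_nonneg) auto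
    also have "\<dots> \<le> norm (wpoly c n p q J z)"
      unfolding X_def
    proof (rule wpoly_inside_ge)
      show "card J \<le> n" using card_mono[OF fin, of J] card_I by (auto simp: J_def)
    qed (use p0 p4 nu nu0 z fin in \<open>auto simp: J_def\<close>)
    finally show ?thesis .
  qed
  define r Z Y where "r = norm z" and "Z = jouk z" and "Y = \<bar>Im (jouk z)\<bar>"
  have z0': "z \<noteq> 0" using z by auto
  have r: "1/2 \<le> r" "0 < r" using z by (auto simp: r_def)
  define da db where "da = norm (Z - of_real (c a))" and "db = norm (Z - of_real (c b))"
  have dY: "Y \<le> da" "Y \<le> db"
    using abs_Im_le_cmod[of "Z - of_real (c a)"] abs_Im_le_cmod[of "Z - of_real (c b)"]
    by (auto simp: da_def db_def Y_def Z_def)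
  have dg: "g \<le> da + db"
  proof -
    have "norm (of_real (c b - c a) :: complex) \<le> norm (Z - of_real (c a)) + norm (Z - of_real (c b))"
      using norm_triangle_ineq4[of "Z - of_real (c a)" "Z - of_real (c b)"] by simp
    then show ?thesis using ab by (simp add: g_def da_def db_def del: of_real_diff)
  qed
  \<comment> \<open>One of the two distances is at least half the gap, and the other is at least the
    height \<open>Y\<close>.\<close>
  have dab: "g * Y / 2 \<le> da * db"
  proof -
    have Y0: "0 \<le> Y" by (simp add: Y_def)
    consider "g / 2 \<le> da" | "g / 2 \<le> db" using dg by linarith
    then show ?thesis
    proof cases
      case 1 then show ?thesis using mult_mono[OF 1 dY(2)] Y0 g0 by (simp add: da_def)
    next
      case 2 then show ?thesis using mult_mono[OF dY(1) 2] Y0 g0 by (simp add: da_def algebra_simps)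
    qed
  qed
  have split: "wpoly c n p q I z = quad (c a) z * (quad (c b) z * wpoly c n p q J z)"
  proof -
    have "insert b J = I - {a}" using ab anb by (auto simp: J_def)
    then show ?thesis using L_split[OF ab(1), of z] wpoly_insert[of J b c n p q z] fin by (simp add: J_def)
  qed
  have D0: "0 < D" using quad_nonzero[OF k z(2)] z0' by (simp add: D_def quad_jouk)
  have "r * D * norm (L k z) = norm (wpoly c n p q I z)"
    by (simp add: L_split[OF k] norm_mult quad_jouk[OF z0'] r_def D_def)
  also have "\<dots> = r * da * (r * db * norm (wpoly c n p q J z))"
    by (simp add: split norm_mult quad_jouk[OF z0'] r_def da_def db_def Z_def)
  also have "\<dots> = r * r * (da * db) * norm (wpoly c n p q J z)" by simp
  also have "\<dots> \<ge> r * r * (g * Y / 2) * (K * xi k / (xi k + D) / g * exp (- 128))"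
  proof (intro mult_mono)
    have "K * xi k / (xi k + D) / g \<le> rweight c n p q J X * exp (real n * p / 2)"
    proof -
      have "K * xi k / (xi k + D) / g \<le> g * (rweight c n p q J X * exp (real n * p / 2)) / g"
        by (rule divide_right_mono[OF order_trans[OF lamX rw]]) (use g0 in simp)
      then show ?thesis using g0 by simp
    qed
    then have "K * xi k / (xi k + D) / g * exp (- 128) \<le> rweight c n p q J X * exp (real n * p / 2) * exp (- 128)"
      by (intro mult_right_mono) auto
    then show "K * xi k / (xi k + D) / g * exp (- 128) \<le> norm (wpoly c n p q J z)" using inside by linarith
  qed (use r dab K0 xk D0 g0 in \<open>auto simp: da_def db_def Y_def\<close>)
  finally have main: "r * r * (g * Y / 2) * (K * xi k / (xi k + D) / g * exp (- 128)) \<le> r * D * norm (L k z)" .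
  define F where "F = Y * (K * (xi k / (xi k + D)) * exp (- 128))"
  have F0: "0 \<le> F" using K0 xk D0 by (simp add: F_def Y_def)
  have Feq: "r * r * (g * Y / 2) * (K * xi k / (xi k + D) / g * exp (- 128)) = r * (r * F / 2)"
    using g0 by (simp add: F_def ac_simps)
  have "r * (r * F / 2) \<le> r * (D * norm (L k z))"
    using main unfolding Feq by (simp only: mult.assoc)
  then have "r * F / 2 \<le> D * norm (L k z)"
    by (rule mult_left_le_imp_le) (use r in simp)
  moreover have "F / 4 \<le> r * F / 2" using mult_right_mono[OF r(1) F0] by simp
  ultimately have "F / 4 \<le> D * norm (L k z)" by linarith
  then have "F / 4 / D \<le> norm (L k z)" using D0 by (simp add: pos_divide_le_eq mult.commute)
  moreover have "lam k * exp (- 128) / (8 * C) * (xi k / (xi k + D)) * (\<bar>Im (jouk z)\<bar> / D) = F / 4 / D"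
    by (simp add: F_def K_def Y_def ac_simps)
  ultimately show ?thesis by simp
qed


section \<open>The lower bound on a region touching the circle at 1 and -1\<close>

definition etaB :: real where "etaB = 1 / (real n * \<nu>)"
text \<open>A pole outside the disc: up to a constant, \<open>norm (z - zout k) / eta k\<close>
  equals \<open>1 + norm (z - zr k) / eta k\<close> in the disc, but it is the modulus of a
  holomorphic function without zeros there.\<close>

definition zout :: "nat \<Rightarrow> complex" where "zout k = of_real (1 + eta k) * zr k"
text \<open>The factor \<open>8 * C * exp 128\<close> comes from \<open>L_lower\<close>; in
  \<open>frontier_estimate\<close>, 1575 is \<open>9 * 175\<close> and 6561 is
  \<open>3 ^ 8\<close>.\<close>

definition Kc :: real where "Kc = 8 * C * exp 128 * (1575 * 6561) / c1\<^sup>2"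
text \<open>The spacing at imaginary part \<open>y\<close>; at \<open>Im (zr k)\<close> it equals
  \<open>eta k\<close>.\<close>

definition height :: "real \<Rightarrow> real" where "height y = 1 / (real n * (y\<^sup>2 + \<nu>))"
text \<open>The points deeper than one spacing, enlarged by two cones with vertices 1 and -1.
  Without the cones the frontier would cross the real axis at points where \<open>jouk z\<close>
  lies outside [-2, 2] and \<open>L_lower\<close> does not apply.\<close>

definition Gset :: "complex set" where
  "Gset = {z. norm z < 1 \<and> min (\<bar>Im z\<bar> / 2) (height (Im z)) < 1 - norm z}"

lemma etaB_pos: "0 < etaB" and etaB_half: "etaB \<le> 1 / 2" and eta_le_etaB: "eta k \<le> etaB"
  and etaB_sq: "etaB\<^sup>2 \<le> \<nu>"
proof -
  have nn: "0 < real n * \<nu>" using n0 nu0 by simp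
  then show "0 < etaB" "etaB \<le> 1 / 2" using nu2 by (auto simp: etaB_def field_simps)
  show "eta k \<le> etaB" unfolding eta_def etaB_def using n0 nu0 nn
    by (intro divide_left_mono mult_left_mono mult_pos_pos) (auto simp: add_pos_nonneg)
  have "1 \<le> \<nu> * (real n * \<nu>)\<^sup>2" using nu3 by (simp add: power2_eq_square power3_eq_cube ac_simps)
  then show "etaB\<^sup>2 \<le> \<nu>" using zero_less_power[OF nn, of 2]
    by (simp only: etaB_def power_divide pos_divide_le_eq) simp
qed

lemma height_pos: "0 < height y" and height_le: "height y \<le> etaB"
proof -
  have nn: "0 < real n * \<nu>" using n0 nu0 by simp
  show "0 < height y" using n0 nu0 by (simp add: height_def add_nonneg_pos)
  show "height y \<le> etaB" unfolding height_def etaB_def using n0 nu0 nn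
    by (intro divide_left_mono mult_left_mono mult_pos_pos) (auto simp: add_nonneg_pos)
qed

lemma dist_zout:
  assumes k: "k \<in> I"
  shows "norm (z - zout k) \<le> norm (z - zr k) + eta k"
    and "norm (z - zr k) \<le> norm (z - zout k) + eta k"
    and "norm z \<le> 1 \<Longrightarrow> eta k \<le> norm (z - zout k)"
proof -
  have "zout k - zr k = of_real (eta k) * zr k" by (simp add: zout_def algebra_simps)
  then have 1: "norm (zout k - zr k) = eta k"
    using norm_zr[OF k] eta_pos[of k] by (simp add: norm_mult)
  show "norm (z - zout k) \<le> norm (z - zr k) + eta k"
    using norm_triangle_ineq4[of "z - zr k" "zout k - zr k"] 1 by simp
  show "norm (z - zr k) \<le> norm (z - zout k) + eta k"
    using norm_triangle_ineq[of "z - zout k" "zout k - zr k"] 1 by simp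
  have "norm (zout k) = 1 + eta k"
    using norm_zr[OF k] eta_pos[of k] by (simp add: zout_def norm_mult del: of_real_add)
  then show "norm z \<le> 1 \<Longrightarrow> eta k \<le> norm (z - zout k)"
    using norm_triangle_ineq2[of "zout k" z] by (simp add: norm_minus_commute)
qed

lemma xi_ge:
  assumes k: "k \<in> I"
  shows "c1\<^sup>2 / 2 * (eta k * (eta k + Im (zr k))) \<le> xi k"
proof -
  define s where "s = Im (zr k)"
  have s0: "0 \<le> s" using Im_circ_root_nonneg[OF c_bound[OF k]] by (simp add: s_def)
  define a where "a = c1 * eta k"
  have a: "0 < a" "a \<le> 1/32" using c1_eta[of k] by (auto simp: a_def)
  have z0n: "norm (z0 k) = 1 - a" using norm_z0[OF k] by (simp add: a_def)
  have z00: "z0 k \<noteq> 0" using z0n a by auto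
  have "Im (z0 k) = (1 - a) * s" by (simp add: z0_def a_def s_def)
  then have "s \<le> Im (z0 k - cnj (zr k))" using s0 a by (simp add: s_def)
  then have 1: "s \<le> norm (z0 k - cnj (zr k))" using abs_Im_le_cmod[of "z0 k - cnj (zr k)"] by linarith
  have 2: "a \<le> norm (z0 k - cnj (zr k))"
    using norm_triangle_ineq2[of "cnj (zr k)" "z0 k"] z0n norm_zr[OF k] by (simp add: norm_minus_commute)
  have "c1\<^sup>2 / 2 * (eta k * (eta k + s)) = a * ((a + c1 * s) / 2)"
    by (simp add: a_def power2_eq_square algebra_simps)
  also have "\<dots> \<le> a * norm (z0 k - cnj (zr k))"
  proof (intro mult_left_mono)
    have "c1 * s \<le> 1 * s" using c1_bounds s0 by (intro mult_right_mono) auto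
    then show "(a + c1 * s) / 2 \<le> norm (z0 k - cnj (zr k))" using 1 2 by simp
  qed (use a in auto)
  also have "\<dots> = norm (quad (c k) (z0 k))"
    using dist_z0[OF k] by (simp add: quad_factor[OF c_bound[OF k]] norm_mult a_def)
  also have "\<dots> = norm (z0 k) * xi k" by (simp add: quad_jouk[OF z00] norm_mult xi_def)
  also have "\<dots> \<le> 1 * xi k" using z0n a xi_pos[OF k] by (intro mult_right_mono) auto
  finally show ?thesis by (simp add: s_def)
qed

lemma jouk_dist_le:
  assumes k: "k \<in> I" and z: "1 / 2 \<le> norm z"
  shows "norm (jouk z - of_real (c k)) \<le> 2 * norm (z - zr k) * (norm (z - zr k) + 2 * Im (zr k))"
proof -
  have z0: "z \<noteq> 0" using z by auto
  have s0: "0 \<le> Im (zr k)" using Im_circ_root_nonneg[OF c_bound[OF k]] .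
  have "zr k - cnj (zr k) = 2 * of_real (Im (zr k)) * \<i>" by (simp add: complex_eq_iff)
  then have "norm (zr k - cnj (zr k)) = 2 * Im (zr k)" using s0 by (simp add: norm_mult)
  then have 1: "norm (z - cnj (zr k)) \<le> norm (z - zr k) + 2 * Im (zr k)"
    using norm_triangle_ineq[of "z - zr k" "zr k - cnj (zr k)"] by simp
  have "norm z * norm (jouk z - of_real (c k)) = norm (z - zr k) * norm (z - cnj (zr k))"
    by (metis quad_jouk[OF z0] quad_factor[OF c_bound[OF k]] norm_mult)
  also have "\<dots> \<le> norm (z - zr k) * (norm (z - zr k) + 2 * Im (zr k))"
    using 1 by (intro mult_left_mono) auto
  finally have 2: "norm z * norm (jouk z - of_real (c k)) \<le> norm (z - zr k) * (norm (z - zr k) + 2 * Im (zr k))" .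
  have "1/2 * norm (jouk z - of_real (c k)) \<le> norm z * norm (jouk z - of_real (c k))"
    using z by (intro mult_right_mono) auto
  with 2 show ?thesis by simp
qed

text \<open>With \<open>e = 1 + d / eta k\<close>, the first loss factor of \<open>L_lower\<close>
  costs \<open>e ^ 2\<close> and the second \<open>e ^ 6\<close>, which explains the eighth power.
  On the cones the second factor is unbounded near the vertices; this is absorbed by comparing the
  distances to 1 and -1 with those to the shifted points \<open>1 + etaB\<close> and
  \<open>- (1 + etaB)\<close>.\<close>

lemma frontier_estimate:
  assumes k: "k \<in> I" and z: "norm z < 1" and eq: "1 - norm z = min (\<bar>Im z\<bar> / 2) (height (Im z))"
  shows "lam k * (norm (1 - z) * norm (1 + z))\<^sup>2 * eta k ^ 8
    \<le> Kc * norm (L k z) * norm (z - zout k) ^ 8 * (norm (of_real (1 + etaB) - z) * norm (of_real (1 + etaB) + z))\<^sup>2"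
proof -
  define h y s \<eta> d where "h = 1 - norm z" and "y = \<bar>Im z\<bar>" and "s = Im (zr k)" and "\<eta> = eta k"
    and "d = norm (z - zr k)"
  define e where "e = 1 + d / \<eta>"
  have \<eta>: "0 < \<eta>" "\<eta> \<le> etaB" using eta_pos eta_le_etaB by (auto simp: \<eta>_def)
  have hy: "height (Im z) = height y" by (simp add: y_def height_def)
  have h: "0 < h" "h \<le> y / 2" "h \<le> height y"
    using z eq unfolding hy unfolding h_def y_def by linarith+
  have y0: "0 < y" using h by linarith
  have s0: "0 \<le> s" using Im_circ_root_nonneg[OF c_bound[OF k]] by (simp add: s_def)
  have h12: "h \<le> 1 / 2" using h(3) height_le[of y] etaB_half by linarith
  have r: "1 / 2 \<le> norm z" using h12 by (simp add: h_def)
  have z0: "z \<noteq> 0" using r by auto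
  have d0: "0 \<le> d" by (simp add: d_def)
  have hd: "h \<le> d" using norm_triangle_ineq2[of "zr k" z] norm_zr[OF k]
    by (simp add: h_def d_def norm_minus_commute)
  have e1: "1 \<le> e" using d0 \<eta> by (simp add: e_def)
  have de: "d \<le> e * \<eta>" using \<eta> by (simp add: e_def field_simps)
  have ys: "y \<le> s + d" "s \<le> y + d"
    using abs_Im_le_cmod[of "z - zr k"] s0 by (auto simp: y_def s_def d_def)
  have nh: "real n * (1 - norm z) * ((Im z)\<^sup>2 + \<nu>) \<le> 1"
  proof -
    have pos: "0 < real n * ((Im z)\<^sup>2 + \<nu>)" using n0 nu0 by (simp add: add_nonneg_pos)
    then have "h * (real n * ((Im z)\<^sup>2 + \<nu>)) \<le> 1"
      using h(3) by (simp add: height_def y_def pos_le_divide_eq)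
    then show ?thesis by (simp add: h_def ac_simps)
  qed
  \<comment> \<open>Since \<open>(1 + R)^2 - 4 * R = (1 - R)^2\<close>, the claim amounts to
    \<open>R * (1 - R)^2 <= y^2 * (1 + R)^2\<close>, and the cone condition
    \<open>h <= y / 2\<close> gives \<open>1 - R <= y\<close>.\<close>
  have X: "\<bar>Re (jouk z)\<bar> \<le> 2"
  proof -
    define R where "R = (norm z)\<^sup>2"
    have R: "0 < R" "R \<le> 1" using z z0 by (auto simp: R_def power_le_one)
    have x2: "(Re z)\<^sup>2 = R - y\<^sup>2" by (simp add: R_def y_def cmod_power2)
    have "(1 - R)\<^sup>2 \<le> y\<^sup>2"
    proof (rule power_mono)
      have "1 - R = h * (1 + norm z)" by (simp add: R_def h_def power2_eq_square algebra_simps)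
      also have "\<dots> \<le> h * 2" using h z by (intro mult_left_mono) auto
      finally show "1 - R \<le> y" using h by simp
    qed (use R in auto)
    also have "y\<^sup>2 \<le> y\<^sup>2 * (1 + R)\<^sup>2" using R one_le_power[of "1 + R" 2] by (simp add: mult_le_cancel_left1)
    finally have "R * (1 - R)\<^sup>2 \<le> y\<^sup>2 * (1 + R)\<^sup>2"
      using R mult_right_mono[of R 1 "(1 - R)\<^sup>2"] by simp
    then have "(R - y\<^sup>2) * (1 + R)\<^sup>2 \<le> 4 * R\<^sup>2" by (simp add: power2_eq_square algebra_simps)
    then have "(R - y\<^sup>2) * (1 + R)\<^sup>2 / R\<^sup>2 \<le> 4" using R by (simp add: pos_divide_le_eq)
    moreover have "(Re (jouk z))\<^sup>2 = (R - y\<^sup>2) * (1 + R)\<^sup>2 / R\<^sup>2"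
    proof -
      have "1 + 1 / R = (1 + R) / R" using R by (simp add: field_simps)
      then show ?thesis by (simp add: Re_jouk[OF z0] R_def[symmetric] power_mult_distrib x2 power_divide)
    qed
    ultimately have "(Re (jouk z))\<^sup>2 \<le> 2\<^sup>2" by simp
    then show ?thesis using abs_le_square_iff[of "Re (jouk z)" 2] by simp
  qed
  define D Y where "D = norm (jouk z - of_real (c k))" and "Y = \<bar>Im (jouk z)\<bar>"
  have low: "lam k * exp (- 128) / (8 * C) * (xi k / (xi k + D)) * (Y / D) \<le> norm (L k z)"
    unfolding D_def Y_def by (rule L_lower[OF k r z X nh])
  have Yh: "y * h \<le> Y"
  proof -
    define R where "R = (norm z)\<^sup>2"
    have R: "0 < R" "R \<le> 1" using z z0 by (auto simp: R_def power_le_one)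
    have "Y = y * \<bar>1 - 1 / R\<bar>" by (simp add: Y_def y_def Im_jouk[OF z0] R_def abs_mult)
    moreover have "h \<le> \<bar>1 - 1 / R\<bar>"
    proof -
      have "norm z * norm z \<le> 1 * norm z" using z by (intro mult_right_mono) auto
      then have "h \<le> 1 - R" by (simp add: h_def R_def power2_eq_square)
      also have "\<dots> \<le> (1 - R) / R" using R mult_left_le[of R "1 - R"] by (simp add: pos_le_divide_eq)
      also have "\<dots> = \<bar>1 - 1 / R\<bar>" using R by (simp add: field_simps abs_if)
      finally show ?thesis .
    qed
    ultimately show ?thesis using y0 by (simp add: mult_left_mono)
  qed
  have D0: "0 < D" using quad_nonzero[OF k z] z0 by (simp add: D_def quad_jouk)
  note xk = xi_pos[OF k]
  have Dle: "D \<le> 2 * d * (d + 2 * s)" using jouk_dist_le[OF k r] by (simp add: D_def d_def s_def)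
  have Dxi: "(xi k + D) / xi k \<le> 9 / c1\<^sup>2 * e\<^sup>2"
  proof -
    have "d + 2 * s \<le> 2 * e * (\<eta> + s)"
    proof -
      have "2 * s \<le> 2 * e * s" using e1 s0 mult_right_mono[of 1 e s] by simp
      moreover have "e * \<eta> \<le> 2 * e * \<eta>" using e1 \<eta> by simp
      ultimately show ?thesis using de by (simp add: algebra_simps)
    qed
    then have "2 * d * (d + 2 * s) \<le> 2 * (e * \<eta>) * (2 * e * (\<eta> + s))"
      using de d0 s0 e1 \<eta> by (intro mult_mono) auto
    moreover have "2 * (e * \<eta>) * (2 * e * (\<eta> + s)) = 8 / c1\<^sup>2 * e\<^sup>2 * (c1\<^sup>2 / 2 * (\<eta> * (\<eta> + s)))"
      using c1_bounds by (simp add: power2_eq_square)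
    ultimately have "D \<le> 8 / c1\<^sup>2 * e\<^sup>2 * (c1\<^sup>2 / 2 * (\<eta> * (\<eta> + s)))"
      using Dle by linarith
    also have "\<dots> \<le> 8 / c1\<^sup>2 * e\<^sup>2 * xi k"
      using xi_ge[OF k] by (intro mult_left_mono) (auto simp: \<eta>_def s_def)
    finally have "D / xi k \<le> 8 / c1\<^sup>2 * e\<^sup>2" using xk by (simp add: pos_divide_le_eq)
    moreover have "1 \<le> 1 / c1\<^sup>2 * e\<^sup>2"
    proof -
      have "c1\<^sup>2 \<le> 1\<^sup>2" using c1_bounds by (intro power_mono) auto
      moreover have "1\<^sup>2 \<le> e\<^sup>2" using e1 by (intro power_mono) auto
      ultimately have "c1\<^sup>2 \<le> e\<^sup>2" by simp
      then show ?thesis using c1_bounds by simp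
    qed
    ultimately show ?thesis using xk by (simp add: add_divide_distrib)
  qed
  define Bd Bn where "Bd = norm (1 - z) * norm (1 + z)"
    and "Bn = norm (of_real (1 + etaB) - z) * norm (of_real (1 + etaB) + z)"
  have Re_le: "\<bar>Re z\<bar> < 1" using abs_Re_le_cmod[of z] z by linarith
  have b1: "norm (1 - z) \<le> norm (of_real (1 + etaB) - z)" "norm (1 + z) \<le> norm (of_real (1 + etaB) + z)"
    using Re_le etaB_pos unfolding cmod_def by (auto intro!: real_sqrt_le_mono add_mono power_mono)
  have b2: "etaB \<le> norm (of_real (1 + etaB) - z)" "etaB \<le> norm (of_real (1 + etaB) + z)"
    using Re_le abs_Re_le_cmod[of "of_real (1 + etaB) - z"] abs_Re_le_cmod[of "of_real (1 + etaB) + z"] by auto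
  have Bd0: "0 < Bd"
  proof -
    have "1 - z \<noteq> 0" "1 + z \<noteq> 0" using Re_le by (auto simp: complex_eq_iff)
    then show ?thesis by (simp add: Bd_def)
  qed
  have BB: "Bd \<le> Bn" using b1 by (auto simp: Bd_def Bn_def intro!: mult_mono)
  have DY: "D / (y * h) * Bd\<^sup>2 \<le> 175 * e ^ 6 * Bn\<^sup>2"
  proof (cases "height y \<le> y / 2")
    case True
    then have hA: "h = height y" using eq unfolding hy by (simp add: h_def y_def)
    define S2 where "S2 = \<nu> + s\<^sup>2"
    have S2: "0 < S2" "\<eta>\<^sup>2 \<le> S2" using nu0 eta_sq[of k] by (auto simp: S2_def \<eta>_def s_def add_pos_nonneg)
    have \<eta>S: "real n * S2 * \<eta> = 1" using n0 S2 by (simp add: \<eta>_def eta_def S2_def s_def)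
    have "y\<^sup>2 \<le> (s + d)\<^sup>2" using ys y0 by (intro power_mono) auto
    also have "\<dots> \<le> 2 * s\<^sup>2 + 2 * d\<^sup>2" using sum_squares_bound[of s d] by (simp add: power2_sum)
    finally have "y\<^sup>2 + \<nu> \<le> 2 * S2 + 2 * d\<^sup>2" using nu0 by (simp add: S2_def)
    also have "d\<^sup>2 \<le> (d / \<eta>)\<^sup>2 * S2"
    proof -
      have "d\<^sup>2 = (d / \<eta>)\<^sup>2 * \<eta>\<^sup>2" using \<eta> by (simp add: power_divide)
      then show ?thesis using S2 by (simp add: mult_left_mono)
    qed
    then have "2 * S2 + 2 * d\<^sup>2 \<le> 2 * S2 * (1 + (d / \<eta>)\<^sup>2)" by (simp add: algebra_simps)
    also have "\<dots> \<le> 2 * S2 * e\<^sup>2"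
    proof (intro mult_left_mono)
      have "e\<^sup>2 = 1 + (d / \<eta>)\<^sup>2 + 2 * (d / \<eta>)" unfolding e_def by (simp add: power2_sum)
      then show "1 + (d / \<eta>)\<^sup>2 \<le> e\<^sup>2" using d0 \<eta> by simp
    qed (use S2 in auto)
    finally have "real n * (y\<^sup>2 + \<nu>) * \<eta> \<le> real n * (2 * S2 * e\<^sup>2) * \<eta>"
      using n0 \<eta> by (intro mult_left_mono mult_right_mono) auto
    also have "\<dots> = 2 * e\<^sup>2" 
    proof -
      have "real n * (2 * S2 * e\<^sup>2) * \<eta> = 2 * e\<^sup>2 * (real n * S2 * \<eta>)" by (simp add: ac_simps)
      then show ?thesis using \<eta>S by simp
    qed
    finally have hinv: "1 / h \<le> 2 * e\<^sup>2 / \<eta>"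
      using \<eta> by (simp add: hA height_def pos_le_divide_eq)
    have dh: "d / h \<le> 2 * e ^ 3"
    proof -
      have "d / h = d * (1 / h)" by simp
      also have "\<dots> \<le> (e * \<eta>) * (2 * e\<^sup>2 / \<eta>)" using de hinv d0 h e1 \<eta> by (intro mult_mono) auto
      also have "\<dots> = 2 * e ^ 3" using \<eta> by (simp add: power2_eq_square power3_eq_cube)
      finally show ?thesis .
    qed
    have dy: "d / y \<le> e ^ 3"
    proof -
      have "d / y \<le> d / (2 * h)" using h y0 d0 by (intro divide_left_mono) auto
      then show ?thesis using dh by simp
    qed
    have "D / (y * h) \<le> 2 * d * (3 * d + 2 * y) / (y * h)"
    proof (intro divide_right_mono)
      have "2 * d * (d + 2 * s) \<le> 2 * d * (3 * d + 2 * y)" using ys d0 by (intro mult_left_mono) auto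
      then show "D \<le> 2 * d * (3 * d + 2 * y)" using Dle by linarith
    qed (use y0 h in auto)
    also have "\<dots> = 2 * (d / h) * (3 * (d / y) + 2)" using y0 h by (simp add: field_simps)
    also have "\<dots> \<le> 2 * (2 * e ^ 3) * (3 * e ^ 3 + 2 * e ^ 3)"
      using dh dy d0 y0 h e1 one_le_power[OF e1, of 3] by (intro mult_mono add_mono) auto
    also have "\<dots> = 20 * e ^ 6" by (simp add: power3_eq_cube power_def numeral_eq_Suc)
    finally have "D / (y * h) \<le> 20 * e ^ 6" .
    then have "D / (y * h) * Bd\<^sup>2 \<le> (20 * e ^ 6) * Bn\<^sup>2"
      using BB Bd0 D0 y0 h e1 by (intro mult_mono power_mono) auto
    also have "\<dots> \<le> 175 * e ^ 6 * Bn\<^sup>2" using e1 by (intro mult_right_mono) auto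
    finally show ?thesis .
  next
    case False
    then have hB: "h = y / 2" and yB: "y / 2 < height y" using eq unfolding hy by (auto simp: h_def y_def)
    have yd: "y \<le> 2 * d" using hd hB by simp
    have D14: "D \<le> 14 * d\<^sup>2"
    proof -
      have "2 * d * (d + 2 * s) \<le> 2 * d * (7 * d)" using ys yd d0 by (intro mult_left_mono) auto
      then show ?thesis using Dle by (simp add: power2_eq_square)
    qed
    have "D / (y * h) \<le> 28 * (e * etaB)\<^sup>2 / y\<^sup>2"
    proof -
      have "d\<^sup>2 \<le> (e * etaB)\<^sup>2"
      proof (rule power_mono)
        have "e * \<eta> \<le> e * etaB" using \<eta> e1 by (intro mult_left_mono) auto
        then show "d \<le> e * etaB" using de by linarith
      qed (use d0 in auto)
      then have "D \<le> 14 * (e * etaB)\<^sup>2" using D14 by linarith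
      have "y * h = y\<^sup>2 / 2" by (simp add: hB power2_eq_square)
      then have "D / (y * h) = 2 * D / y\<^sup>2" by (simp only: \<open>y * h = y\<^sup>2 / 2\<close>) simp
      moreover have "2 * D / y\<^sup>2 \<le> 2 * (14 * (e * etaB)\<^sup>2) / y\<^sup>2"
        using \<open>D \<le> 14 * (e * etaB)\<^sup>2\<close> by (intro divide_right_mono) auto
      ultimately show ?thesis by simp
    qed
    \<comment> \<open>On the cone the nearer vertex is within \<open>5 / 2 * y\<close> of
      \<open>z\<close>, and its shifted copy is at least \<open>etaB\<close> away. Trading one
      distance for the other compensates the factor \<open>etaB / y\<close>.\<close>
    moreover have "etaB * Bd \<le> 5 / 2 * y * Bn"
    proof -
      have one: "1 - \<bar>Re z\<bar> \<le> 3 / 2 * y"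
      proof -
        have "norm z \<le> \<bar>Re z\<bar> + \<bar>Im z\<bar>" by (rule cmod_le)
        then show ?thesis using hB by (simp add: h_def y_def)
      qed
      show ?thesis
      proof (cases "0 \<le> Re z")
        case True
        have "norm (1 - z) \<le> \<bar>Re (1 - z)\<bar> + \<bar>Im (1 - z)\<bar>" by (rule cmod_le)
        also have "\<dots> \<le> 5 / 2 * y" using one True Re_le by (simp add: y_def)
        finally have "etaB * Bd \<le> norm (of_real (1 + etaB) - z) * ((5 / 2 * y) * norm (of_real (1 + etaB) + z))"
          unfolding Bd_def using b1 b2 etaB_pos y0 by (intro mult_mono) auto
        then show ?thesis by (simp add: Bn_def ac_simps)
      next
        case False
        have "norm (1 + z) \<le> \<bar>Re (1 + z)\<bar> + \<bar>Im (1 + z)\<bar>" by (rule cmod_le)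
        also have "\<dots> \<le> 5 / 2 * y" using one False Re_le by (simp add: y_def)
        finally have "etaB * Bd \<le> norm (of_real (1 + etaB) + z) * (norm (of_real (1 + etaB) - z) * (5 / 2 * y))"
          unfolding Bd_def using b1 b2 etaB_pos y0 by (intro mult_mono) auto
        then show ?thesis by (simp add: Bn_def ac_simps)
      qed
    qed
    then have "(etaB * Bd)\<^sup>2 \<le> (5 / 2 * y * Bn)\<^sup>2" using etaB_pos Bd0 by (intro power_mono) auto
    then have "etaB\<^sup>2 * Bd\<^sup>2 / y\<^sup>2 \<le> 25 / 4 * Bn\<^sup>2" using y0 by (simp add: power_mult_distrib field_simps)
    then have "28 * e\<^sup>2 * (etaB\<^sup>2 * Bd\<^sup>2 / y\<^sup>2) \<le> 28 * e\<^sup>2 * (25 / 4 * Bn\<^sup>2)" by (intro mult_left_mono) auto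
    moreover have "D / (y * h) * Bd\<^sup>2 \<le> 28 * (e * etaB)\<^sup>2 / y\<^sup>2 * Bd\<^sup>2"
      using calculation(1) by (intro mult_right_mono) auto
    moreover have "28 * (e * etaB)\<^sup>2 / y\<^sup>2 * Bd\<^sup>2 = 28 * e\<^sup>2 * (etaB\<^sup>2 * Bd\<^sup>2 / y\<^sup>2)"
      by (simp add: power_mult_distrib)
    moreover have "28 * e\<^sup>2 * (25 / 4 * Bn\<^sup>2) \<le> 175 * e ^ 6 * Bn\<^sup>2"
    proof -
      have "175 * Bn\<^sup>2 * e\<^sup>2 \<le> 175 * Bn\<^sup>2 * e ^ 6"
        using e1 by (intro mult_left_mono power_increasing) auto
      then show ?thesis by (simp add: ac_simps)
    qed
    ultimately show ?thesis by linarith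
  qed
  define w where "w = norm (z - zout k) / \<eta>"
  have ew: "e \<le> 3 * w"
  proof -
    have "1 \<le> w" using dist_zout(3)[OF k, of z] z \<eta> by (simp add: w_def \<eta>_def)
    moreover have "d / \<eta> \<le> w + 1"
      using dist_zout(2)[OF k, of z] \<eta> by (simp add: w_def d_def \<eta>_def divide_simps)
    ultimately show ?thesis by (simp add: e_def)
  qed
  have "D * (xi k + D) / (xi k * (y * h)) * Bd\<^sup>2 = (xi k + D) / xi k * (D / (y * h) * Bd\<^sup>2)" by simp
  also have "\<dots> \<le> (9 / c1\<^sup>2 * e\<^sup>2) * (175 * e ^ 6 * Bn\<^sup>2)"
    by (rule mult_mono[OF Dxi DY]) (use xk D0 y0 h in auto)
  also have "\<dots> = 1575 / c1\<^sup>2 * Bn\<^sup>2 * e ^ 8" by (simp add: numeral_eq_Suc)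
  also have "\<dots> \<le> 1575 / c1\<^sup>2 * Bn\<^sup>2 * (3 * w) ^ 8" using ew e1 by (intro mult_left_mono power_mono) auto
  finally have big: "D * (xi k + D) / (xi k * (y * h)) * Bd\<^sup>2 \<le> 1575 * 6561 / c1\<^sup>2 * Bn\<^sup>2 * w ^ 8"
    by (simp add: power_mult_distrib)
  define M where "M = xi k / (xi k + D) * (Y / D)"
  have "Bd\<^sup>2 \<le> M * (1575 * 6561 / c1\<^sup>2 * Bn\<^sup>2 * w ^ 8)"
  proof -
    have "1 * Bd\<^sup>2 \<le> (Y / (y * h)) * Bd\<^sup>2"
      using Yh y0 h by (intro mult_right_mono) auto
    also have "\<dots> = M * (D * (xi k + D) / (xi k * (y * h)) * Bd\<^sup>2)"
      using D0 xk y0 h by (simp add: M_def)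
    also have "\<dots> \<le> M * (1575 * 6561 / c1\<^sup>2 * Bn\<^sup>2 * w ^ 8)"
      using big D0 xk by (intro mult_left_mono) (auto simp: M_def Y_def)
    finally show ?thesis by simp
  qed
  then have "lam k * Bd\<^sup>2 \<le> lam k * (M * (1575 * 6561 / c1\<^sup>2 * Bn\<^sup>2 * w ^ 8))"
    using lam_pos[OF k] by (intro mult_left_mono) auto
  also have "\<dots> = Kc * (lam k * exp (- 128) / (8 * C) * M) * w ^ 8 * Bn\<^sup>2"
    using C1 by (simp add: Kc_def exp_minus field_simps)
  also have "\<dots> \<le> Kc * norm (L k z) * w ^ 8 * Bn\<^sup>2"
    using low C1 by (intro mult_right_mono mult_left_mono) (auto simp: M_def Kc_def mult.assoc w_def \<eta>_def eta_pos less_imp_le)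
  finally have fin': "lam k * Bd\<^sup>2 \<le> Kc * norm (L k z) * w ^ 8 * Bn\<^sup>2" .
  have "lam k * Bd\<^sup>2 * \<eta> ^ 8 \<le> Kc * norm (L k z) * w ^ 8 * Bn\<^sup>2 * \<eta> ^ 8"
    using fin' \<eta> by (intro mult_right_mono) auto
  also have "\<dots> = Kc * norm (L k z) * norm (z - zout k) ^ 8 * Bn\<^sup>2"
    using \<eta> by (simp add: w_def power_divide)
  finally show ?thesis by (simp add: Bd_def Bn_def \<eta>_def)
qed

text \<open>A closed condition that contains \<open>closure Gset\<close> and meets the circle only
  at 1 and -1.\<close>

definition in_closure :: "complex set" where
  "in_closure = {z. norm z \<le> 1 \<and> min (\<bar>Im z\<bar> / 2) (height (Im z)) \<le> 1 - norm z}"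

lemma continuous_height: "continuous_on S (\<lambda>z. height (Im z))"
  unfolding height_def using n0 nu0 by (intro continuous_intros) (auto simp: add_nonneg_pos less_imp_neq[symmetric] add_nonneg_eq_0_iff)

lemma open_Gset: "open Gset"
  unfolding Gset_def by (intro open_Collect_conj open_Collect_less continuous_intros continuous_height) auto

lemma closure_Gset: "closure Gset \<subseteq> in_closure"
proof (rule closure_minimal)
  show "Gset \<subseteq> in_closure" by (auto simp: Gset_def in_closure_def)
  show "closed in_closure"
    unfolding in_closure_def by (intro closed_Collect_conj closed_Collect_le continuous_intros continuous_height) auto
qed

lemma in_closure_cases:
  assumes "z \<in> in_closure"
  shows "norm z < 1 \<or> z = 1 \<or> z = - 1"
proof (cases "norm z < 1")
  case False
  then have n1: "norm z = 1" and le: "min (\<bar>Im z\<bar> / 2) (height (Im z)) \<le> 0"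
    using assms by (auto simp: in_closure_def)
  then have im: "Im z = 0" using height_pos[of "Im z"] by (auto simp: min_def split: if_splits)
  then have "\<bar>Re z\<bar> = 1" using n1 by (simp add: cmod_eq_Re)
  then show ?thesis using im by (auto simp: complex_eq_iff abs_if split: if_splits)
qed simp

text \<open>An estimate known on the frontier inside the open disc reaches the two vertices by
  continuity along an explicit arc of that frontier.\<close>

lemma corner_limit:
  assumes P: "\<And>z. norm z < 1 \<Longrightarrow> 1 - norm z = min (\<bar>Im z\<bar> / 2) (height (Im z)) \<Longrightarrow> f z \<le> g z"
    and cont: "continuous_on UNIV f" "continuous_on UNIV g" and \<sigma>: "\<sigma> = 1 \<or> \<sigma> = - 1"
  shows "f (of_real \<sigma>) \<le> (g (of_real \<sigma>) :: real)"
proof -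
  \<comment> \<open>The arc with \<open>Im z = t\<close> and \<open>norm z = 1 - t / 2\<close>. For
    \<open>t\<close> below \<open>sqrt nu\<close> and \<open>etaB\<close> the minimum is attained by
    the cone term, so the arc lies on the frontier.\<close>
  define z where "z = (\<lambda>t. Complex (\<sigma> * sqrt ((1 - t / 2)\<^sup>2 - t\<^sup>2)) t)"
  have lim: "(z \<longlongrightarrow> of_real \<sigma>) (at_right 0)"
  proof -
    have "((\<lambda>t. Complex (\<sigma> * sqrt ((1 - t / 2)\<^sup>2 - t\<^sup>2)) t) \<longlongrightarrow> Complex (\<sigma> * sqrt ((1 - 0 / 2)\<^sup>2 - 0\<^sup>2)) 0) (at_right 0)"
      by (intro tendsto_intros) auto
    then show ?thesis by (simp add: z_def complex_of_real_def)
  qed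
  define \<delta> where "\<delta> = min (1 / 2) (min (sqrt \<nu>) etaB)"
  have \<delta>0: "0 < \<delta>" using nu0 etaB_pos by (simp add: \<delta>_def)
  have ev: "\<forall>\<^sub>F t in at_right 0. f (z t) \<le> g (z t)"
  proof (rule eventually_at_rightI[OF _ \<delta>0])
    fix t assume "t \<in> {0<..<\<delta>}"
    then have t: "0 < t" "t < 1 / 2" "t < sqrt \<nu>" "t < etaB" by (auto simp: \<delta>_def)
    have "t\<^sup>2 \<le> (1 - t / 2)\<^sup>2" using t by (intro power_mono) auto
    then have "(norm (z t))\<^sup>2 = (1 - t / 2)\<^sup>2"
      using \<sigma> by (auto simp: z_def cmod_power2 power_mult_distrib)
    then have nz: "norm (z t) = 1 - t / 2" using t by (simp add: power2_eq_iff_nonneg)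
    have t2: "t\<^sup>2 \<le> \<nu>" using t real_less_rsqrt real_sqrt_le_iff by (metis abs_of_pos less_imp_le real_sqrt_abs)
    have "t / 2 \<le> 1 / (real n * (\<nu> + \<nu>))"
      using t n0 nu0 by (simp add: etaB_def field_simps)
    also have "\<dots> \<le> height t" unfolding height_def
      using t2 n0 nu0 by (intro divide_left_mono mult_left_mono mult_pos_pos) (auto simp: add_nonneg_pos)
    finally have "min (\<bar>Im (z t)\<bar> / 2) (height (Im (z t))) = t / 2" using t by (simp add: z_def)
    then show "f (z t) \<le> g (z t)" using nz t by (intro P) auto
  qed
  have "((\<lambda>t. f (z t)) \<longlongrightarrow> f (of_real \<sigma>)) (at_right 0)" "((\<lambda>t. g (z t)) \<longlongrightarrow> g (of_real \<sigma>)) (at_right 0)"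
    using lim cont by (auto intro!: isCont_tendsto_compose[OF _ lim] simp: continuous_on_eq_continuous_at)
  then show ?thesis using ev by (intro tendsto_le[of "at_right 0"]) auto
qed

text \<open>
  The lower bound on the frontier is carried into \<open>Gset\<close> by the minimum modulus principle. The region
  touches the circle at \<open>z = 1\<close> and \<open>z = - 1\<close>, where \<open>L k\<close> may vanish; the corresponding quadratic
  factors are cancelled against \<open>(1 - z)\<^sup>2 * (1 + z)\<^sup>2\<close>.
\<close>

lemma Gset_estimate:
  assumes k: "k \<in> I" and z: "z \<in> Gset"
  shows "lam k * (norm (1 - z) * norm (1 + z))\<^sup>2 * eta k ^ 8
    \<le> Kc * norm (L k z) * norm (z - zout k) ^ 8 * (norm (of_real (1 + etaB) - z) * norm (of_real (1 + etaB) + z))\<^sup>2"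
proof -
  obtain a b where a: "a \<in> I" "c a = - 2" and b: "b \<in> I" "c b = 2" using hi lo by blast
  have ab: "a \<noteq> b" using a b by auto
  \<comment> \<open>\<open>rest\<close> is nontrivial only if \<open>k\<close> is itself an extreme
    point; its quadratic factor is then missing from \<open>L k\<close> and nothing cancels
    it.\<close>
  define num rest where "num z = (\<Prod>i\<in>{a, b} - {k}. quad (c i) z)"
    and "rest z = (\<Prod>i\<in>{a, b} \<inter> {k}. quad (c i) z)" for z
  define wp where "wp = wpoly c n p q (I - {a, b, k})"
  have L_eq: "L k z = num z * wp z" for z
  proof -
    have "I - {k} = ({a, b} - {k}) \<union> (I - {a, b, k})" using a b by auto
    moreover have "(\<Prod>i\<in>({a, b} - {k}) \<union> (I - {a, b, k}). quad (c i) z)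
        = num z * (\<Prod>i\<in>I - {a, b, k}. quad (c i) z)"
      unfolding num_def using fin by (intro prod.union_disjoint) auto
    ultimately have "(\<Prod>i\<in>I - {k}. quad (c i) z) = num z * (\<Prod>i\<in>I - {a, b, k}. quad (c i) z)"
      by (simp only:)
    then show ?thesis by (simp add: wpoly_def wp_def)
  qed
  have nr: "num z * rest z = ((1 - z) * (1 + z))\<^sup>2" for z
  proof -
    have "num z * rest z = (\<Prod>i\<in>{a, b}. quad (c i) z)"
      unfolding num_def rest_def by (subst prod.union_disjoint[symmetric]) (auto intro!: arg_cong2[where f = prod])
    also have "\<dots> = quad (- 2) z * quad 2 z" using ab a b by simp
    also have "\<dots> = ((1 - z) * (1 + z))\<^sup>2" by (simp add: quad_def power2_eq_square algebra_simps)
    finally show ?thesis .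
  qed
  have num0: "num z \<noteq> 0" if "norm z < 1" for z
    using quad_nonzero that a b by (auto simp: num_def)
  define Bn where "Bn = (\<lambda>z::complex. norm (of_real (1 + etaB) - z) * norm (of_real (1 + etaB) + z))"
  have cancel: "lam k * norm (rest z) * eta k ^ 8 \<le> Kc * norm (wp z) * norm (z - zout k) ^ 8 * (Bn z)\<^sup>2"
    if z: "norm z < 1" "1 - norm z = min (\<bar>Im z\<bar> / 2) (height (Im z))" for z
  proof -
    have "norm (num z) * (lam k * norm (rest z) * eta k ^ 8)
        = lam k * (norm (1 - z) * norm (1 + z))\<^sup>2 * eta k ^ 8"
      using arg_cong[OF nr[of z], of norm] by (simp add: norm_mult norm_power)
    also have "\<dots> \<le> norm (num z) * (Kc * norm (wp z) * norm (z - zout k) ^ 8 * (Bn z)\<^sup>2)"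
      using frontier_estimate[OF k z] by (simp add: L_eq norm_mult Bn_def ac_simps)
    finally show ?thesis by (rule mult_left_le_imp_le) (use num0[OF z(1)] in simp)
  qed
  have cont: "continuous_on UNIV (\<lambda>z. lam k * norm (rest z) * eta k ^ 8)"
    "continuous_on UNIV (\<lambda>z. Kc * norm (wp z) * norm (z - zout k) ^ 8 * (Bn z)\<^sup>2)"
    unfolding rest_def wp_def wpoly_def quad_def Bn_def by (intro continuous_intros; simp)+
  have corner: "lam k * norm (rest z) * eta k ^ 8 \<le> Kc * norm (wp z) * norm (z - zout k) ^ 8 * (Bn z)\<^sup>2"
    if "z = 1 \<or> z = - 1" for z
    using that corner_limit[OF cancel cont, of 1] corner_limit[OF cancel cont, of "- 1"] by auto
  have wp0: "wp z \<noteq> 0" if "z \<in> in_closure" for z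
    using in_closure_cases[OF that]
  proof (elim disjE)
    assume "norm z < 1"
    then show ?thesis using quad_nonzero fin by (auto simp: wp_def wpoly_def)
  next
    assume z1: "z = 1"
    have "quad (c i) z \<noteq> 0" if i: "i \<in> I - {a, b, k}" for i
    proof -
      have "c i \<noteq> 2" using c_distinct[of i b] i b by auto
      then have "complex_of_real (c i) \<noteq> 2" by (metis of_real_eq_iff of_real_numeral)
      then show ?thesis by (simp add: quad_def z1)
    qed
    then show ?thesis using fin by (auto simp: wp_def wpoly_def)
  next
    assume z1: "z = - 1"
    have "quad (c i) z \<noteq> 0" if i: "i \<in> I - {a, b, k}" for i
    proof -
      have "c i \<noteq> - 2" using c_distinct[of i a] i a by auto
      then have "c i + 2 \<noteq> 0" by simp
      then have "complex_of_real (c i + 2) \<noteq> 0" by (simp only: of_real_eq_0_iff not_False_eq_True)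
      then show ?thesis by (simp add: quad_def z1 add.commute)
    qed
    then show ?thesis using fin by (auto simp: wp_def wpoly_def)
  qed
  have out0: "z - zout k \<noteq> 0" if "z \<in> in_closure" for z
    using dist_zout(3)[OF k, of z] eta_pos[of k] that by (auto simp: in_closure_def)
  have B0: "of_real (1 + etaB) - z \<noteq> 0" "of_real (1 + etaB) + z \<noteq> 0" if "z \<in> in_closure" for z :: complex
  proof -
    have "\<bar>Re z\<bar> \<le> 1" using abs_Re_le_cmod[of z] that by (simp add: in_closure_def)
    then show "of_real (1 + etaB) - z \<noteq> 0" "of_real (1 + etaB) + z \<noteq> 0"
      using etaB_pos by (auto simp: complex_eq_iff)
  qed
  \<comment> \<open>The cancelled estimate reads \<open>norm (f z) <= Kc\<close>. As a quotient
    holomorphic up to the vertices, \<open>f\<close> obeys the maximum principle on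
    \<open>Gset\<close>.\<close>
  define f where "f = (\<lambda>z. rest z * of_real (lam k * eta k ^ 8)
      / (wp z * (z - zout k) ^ 8 * ((of_real (1 + etaB) - z) * (of_real (1 + etaB) + z))\<^sup>2))"
  have den0: "wp z * (z - zout k) ^ 8 * ((of_real (1 + etaB) - z) * (of_real (1 + etaB) + z))\<^sup>2 \<noteq> 0"
    if "z \<in> in_closure" for z
    using wp0[OF that] out0[OF that] B0[OF that] by simp
  have holf: "f holomorphic_on in_closure"
    unfolding f_def
  proof (rule holomorphic_on_divide)
    show "(\<lambda>z. rest z * of_real (lam k * eta k ^ 8)) holomorphic_on in_closure"
      unfolding rest_def quad_def by (intro holomorphic_intros)
    show "(\<lambda>z. wp z * (z - zout k) ^ 8 * ((of_real (1 + etaB) - z) * (of_real (1 + etaB) + z))\<^sup>2) holomorphic_on in_closure"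
      unfolding wp_def by (intro holomorphic_intros wpoly_holomorphic)
  qed (use den0 in auto)
  have nf: "norm (f z) \<le> Kc"
    if z: "z \<in> in_closure" and le: "lam k * norm (rest z) * eta k ^ 8 \<le> Kc * norm (wp z) * norm (z - zout k) ^ 8 * (Bn z)\<^sup>2" for z
  proof -
    define d where "d = norm (wp z * (z - zout k) ^ 8 * ((of_real (1 + etaB) - z) * (of_real (1 + etaB) + z))\<^sup>2)"
    have d0: "0 < d" using den0[OF z] by (simp only: d_def zero_less_norm_iff not_False_eq_True)
    have "norm (f z) = (lam k * norm (rest z) * eta k ^ 8) / d"
      using lam_pos[OF k] eta_pos[of k] by (simp add: f_def d_def norm_divide norm_mult norm_power)
    also have "\<dots> \<le> (Kc * d) / d"
    proof (rule divide_right_mono)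
      show "lam k * norm (rest z) * eta k ^ 8 \<le> Kc * d"
        using le by (simp add: d_def norm_mult norm_power Bn_def ac_simps)
    qed (use d0 in simp)
    finally show ?thesis using d0 by simp
  qed
  have "norm (f z) \<le> Kc"
  proof (rule maximum_modulus_frontier[where f = f and S = Gset and \<xi> = z])
    show "f holomorphic_on interior Gset"
      using holf closure_Gset closure_subset interior_subset by (blast intro: holomorphic_on_subset)
    show "continuous_on (closure Gset) f"
      using holf closure_Gset by (blast intro: holomorphic_on_imp_continuous_on continuous_on_subset)
    show "bounded Gset" by (rule bounded_subset[of "ball 0 1"]) (auto simp: Gset_def)
    show "z \<in> Gset" by (rule z)
    fix w assume "w \<in> frontier Gset"
    then have w: "w \<in> in_closure" "w \<notin> Gset"
      using closure_Gset open_Gset by (auto simp: frontier_def interior_open)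
    show "norm (f w) \<le> Kc"
      using in_closure_cases[OF w(1)]
    proof (elim disjE)
      assume "norm w < 1"
      then have "1 - norm w = min (\<bar>Im w\<bar> / 2) (height (Im w))"
        using w by (auto simp: in_closure_def Gset_def)
      then show ?thesis using cancel \<open>norm w < 1\<close> by (intro nf[OF w(1)]) auto
    next
      assume "w = 1" then show ?thesis using nf[OF w(1) corner] by simp
    next
      assume "w = - 1" then show ?thesis using nf[OF w(1) corner] by simp
    qed
  qed
  have zc: "z \<in> in_closure" "norm z < 1" using z by (auto simp: Gset_def in_closure_def)
  define d where "d = norm (wp z * (z - zout k) ^ 8 * ((of_real (1 + etaB) - z) * (of_real (1 + etaB) + z))\<^sup>2)"
  have d0: "0 < d" using den0[OF zc(1)] by (simp only: d_def zero_less_norm_iff not_False_eq_True)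
  have "norm (f z) = (lam k * norm (rest z) * eta k ^ 8) / d"
    using lam_pos[OF k] eta_pos[of k] by (simp add: f_def d_def norm_divide norm_mult norm_power)
  then have "lam k * norm (rest z) * eta k ^ 8 \<le> Kc * d"
    using \<open>norm (f z) \<le> Kc\<close> d0 by (simp add: pos_divide_le_eq)
  then have "norm (num z) * (lam k * norm (rest z) * eta k ^ 8) \<le> norm (num z) * (Kc * d)"
    by (rule mult_left_mono) simp
  moreover have "norm (num z) * (lam k * norm (rest z) * eta k ^ 8)
        = lam k * (norm (1 - z) * norm (1 + z))\<^sup>2 * eta k ^ 8"
    using arg_cong[OF nr[of z], of norm] by (simp add: norm_mult norm_power)
  moreover have "norm (num z) * (Kc * d) = Kc * norm (L k z) * norm (z - zout k) ^ 8 * (norm (of_real (1 + etaB) - z) * norm (of_real (1 + etaB) + z))\<^sup>2"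
    by (simp add: L_eq d_def norm_mult norm_power ac_simps)
  ultimately show ?thesis by simp
qed

section \<open>The lower bound beyond one spacing of depth\<close>

definition K2 :: real where "K2 = 81 * Kc"

lemma K2_pos: "0 < K2"
  using C1 c1_bounds by (simp add: K2_def Kc_def)

text \<open>At this depth \<open>z\<close> is at least \<open>etaB / 2\<close> away from 1 and -1.
  The shifted distances are then at most three times the true ones, and the correction at the
  vertices costs the factor \<open>81 = (3 * 3)^2\<close>.\<close>

lemma L_interior_ge:
  assumes k: "k \<in> I" and z: "norm z < 1" and h: "1 < real n * (1 - norm z) * ((Im z)\<^sup>2 + \<nu>)"
  shows "lam k \<le> K2 * norm (L k z) * (1 + norm (z - zr k) / eta k) ^ 8"
proof -
  have pos: "0 < real n * ((Im z)\<^sup>2 + \<nu>)" using n0 nu0 by (simp add: add_nonneg_pos)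
  have "height (Im z) < 1 - norm z"
    unfolding height_def using h pos by (simp add: pos_divide_less_eq ac_simps)
  then have zG: "z \<in> Gset" using z by (auto simp: Gset_def)
  have big: "etaB / 2 \<le> 1 - norm z \<or> etaB / 2 \<le> \<bar>Im z\<bar>"
  proof (cases "(Im z)\<^sup>2 \<le> \<nu>")
    case True
    have "1 / (real n * (\<nu> + \<nu>)) \<le> height (Im z)" unfolding height_def
      using True n0 nu0 by (intro divide_left_mono mult_left_mono mult_pos_pos) (auto simp: add_nonneg_pos)
    moreover have "1 / (real n * (\<nu> + \<nu>)) = etaB / 2" by (simp add: etaB_def)
    ultimately show ?thesis using \<open>height (Im z) < 1 - norm z\<close> by linarith
  next
    case False
    then have "etaB\<^sup>2 \<le> \<bar>Im z\<bar>\<^sup>2" using etaB_sq by simp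
    then have "etaB \<le> \<bar>Im z\<bar>" by (rule power2_le_imp_le) simp
    then show ?thesis using etaB_pos by simp
  qed
  have d1: "etaB / 2 \<le> norm (1 - z)" "etaB / 2 \<le> norm (1 + z)"
    using big norm_triangle_ineq2[of 1 z] norm_triangle_ineq2[of 1 "- z"]
      abs_Im_le_cmod[of "1 - z"] abs_Im_le_cmod[of "1 + z"] by auto
  have "norm (of_real (1 + etaB) - z) \<le> norm (1 - z) + etaB"
    using norm_triangle_ineq[of "1 - z" "of_real etaB"] etaB_pos by (simp add: algebra_simps)
  moreover have "norm (of_real (1 + etaB) + z) \<le> norm (1 + z) + etaB"
    using norm_triangle_ineq[of "1 + z" "of_real etaB"] etaB_pos by (simp add: algebra_simps)
  ultimately have "norm (of_real (1 + etaB) - z) * norm (of_real (1 + etaB) + z) \<le> (3 * norm (1 - z)) * (3 * norm (1 + z))"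
    using d1 by (intro mult_mono) auto
  then have B: "(norm (of_real (1 + etaB) - z) * norm (of_real (1 + etaB) + z))\<^sup>2 \<le> ((3 * norm (1 - z)) * (3 * norm (1 + z)))\<^sup>2"
    by (intro power_mono) auto
  have eta: "0 < eta k" by (rule eta_pos)
  define P where "P = (norm (1 - z) * norm (1 + z))\<^sup>2"
  have P0: "0 < P" using d1 etaB_pos by (auto simp: P_def)
  have zo: "norm (z - zout k) ^ 8 \<le> ((1 + norm (z - zr k) / eta k) * eta k) ^ 8"
    using dist_zout(1)[OF k, of z] eta by (intro power_mono) (auto simp: algebra_simps)
  have "lam k * P * eta k ^ 8 \<le> Kc * norm (L k z) * ((1 + norm (z - zr k) / eta k) * eta k) ^ 8 * (81 * P)"
  proof -
    have "Kc * norm (L k z) * norm (z - zout k) ^ 8 * (norm (of_real (1 + etaB) - z) * norm (of_real (1 + etaB) + z))\<^sup>2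
      \<le> Kc * norm (L k z) * ((1 + norm (z - zr k) / eta k) * eta k) ^ 8 * (81 * P)"
      using zo B C1 by (intro mult_mono mult_left_mono) (auto simp: P_def Kc_def power_mult_distrib eta less_imp_le)
    then show ?thesis using Gset_estimate[OF k zG] unfolding P_def by linarith
  qed
  then have "P * eta k ^ 8 * lam k \<le> P * eta k ^ 8 * (K2 * norm (L k z) * (1 + norm (z - zr k) / eta k) ^ 8)"
    by (simp add: K2_def power_mult_distrib ac_simps)
  then show ?thesis by (rule mult_left_le_imp_le) (use P0 eta in simp)
qed

end

section \<open>Bounds for the logarithm of a Lagrange weight\<close>

text \<open>Map the half-plane to the unit disc so that \<open>f z\<close> goes to 0, and apply the
  Schwarz lemma at the centre. Enlarging \<open>M\<close> slightly turns the weak bound into a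
  strict one, and an arbitrary \<open>e\<close> pays for it.\<close>

lemma half_plane_deriv_bound:
  assumes hol: "f holomorphic_on ball z r" and r: "0 < r"
    and M: "\<And>w. w \<in> ball z r \<Longrightarrow> Re (f w) \<le> M"
  shows "norm (deriv f z) \<le> 2 * (M - Re (f z)) / r"
proof (rule field_le_epsilon)
  fix e :: real assume e: "0 < e"
  define \<epsilon> where "\<epsilon> = e * r / 2"
  have \<epsilon>: "0 < \<epsilon>" using e r by (simp add: \<epsilon>_def)
  define g where "g = (\<lambda>w. of_real (M + \<epsilon>) - f (z + of_real r * w))"
  have inb: "z + of_real r * w \<in> ball z r" if "norm w < 1" for w
    using that r by (simp add: dist_norm norm_mult)
  have Reg: "0 < Re (g w)" if "norm w < 1" for w
    using M[OF inb[OF that]] \<epsilon> by (simp add: g_def)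
  have holg: "g holomorphic_on ball 0 1"
  proof -
    have "(\<lambda>w. f (z + of_real r * w)) holomorphic_on ball 0 1"
      by (rule holomorphic_on_compose_gen[OF _ hol, unfolded o_def]) (use inb in \<open>auto intro!: holomorphic_intros\<close>)
    then show ?thesis unfolding g_def by (intro holomorphic_intros)
  qed
  define a where "a = g 0"
  have a0: "0 < Re a" using Reg[of 0] by (simp add: a_def)
  \<comment> \<open>The Cayley transform of the right half-plane that sends \<open>a\<close> to
    0.\<close>
  define h where "h = (\<lambda>w. (g w - a) / (g w + cnj a))"
  have den: "g w + cnj a \<noteq> 0" if "norm w < 1" for w
  proof -
    have "0 < Re (g w + cnj a)" using Reg[OF that] a0 by simp
    then show ?thesis by (metis less_irrefl zero_complex.sel(1))
  qed
  have holh: "h holomorphic_on ball 0 1"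
    unfolding h_def using den by (intro holomorphic_intros holg) auto
  have "norm (deriv h 0) \<le> 1"
  proof (rule Schwarz_Lemma(2)[OF holh, where \<xi> = 0])
    show "h 0 = 0" by (simp add: h_def a_def)
    show "norm (h w) < 1" if w: "norm w < 1" for w
    proof -
      have "(norm (g w - a))\<^sup>2 < (norm (g w + cnj a))\<^sup>2"
      proof -
        have "(norm (g w + cnj a))\<^sup>2 - (norm (g w - a))\<^sup>2 = 4 * (Re (g w) * Re a)"
          unfolding cmod_power2 by (simp add: power2_eq_square algebra_simps)
        moreover have "0 < Re (g w) * Re a" using Reg[OF w] a0 by simp
        ultimately show ?thesis by linarith
      qed
      then have "norm (g w - a) < norm (g w + cnj a)" by (rule power2_less_imp_less) simp
      then show ?thesis using den[OF w] by (simp add: h_def norm_divide)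
    qed
  qed auto
  moreover have "deriv h 0 = - (of_real r * deriv f z) / of_real (2 * Re a)"
  proof (rule DERIV_imp_deriv)
    have df: "(f has_field_derivative deriv f z) (at z)"
      using hol r by (intro holomorphic_derivI[of f "ball z r"]) auto
    have d1: "((\<lambda>w. f (z + of_real r * w)) has_field_derivative deriv f z * of_real r) (at 0)"
      by (rule DERIV_chain'[where g = f and f = "\<lambda>w. z + of_real r * w", unfolded o_def])
         (use df in \<open>auto intro!: derivative_eq_intros\<close>)
    have dg: "(g has_field_derivative - (deriv f z * of_real r)) (at 0)"
      unfolding g_def by (rule derivative_eq_intros d1 refl | simp)+
    have aa: "a + cnj a = of_real (2 * Re a)" by (simp add: complex_eq_iff)
    have "(h has_field_derivative
        ((- (deriv f z * of_real r)) * (g 0 + cnj a) - (g 0 - a) * (- (deriv f z * of_real r))) / ((g 0 + cnj a) * (g 0 + cnj a))) (at 0)"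
      unfolding h_def
      by (rule DERIV_divide) (use den[of 0] in \<open>auto intro!: derivative_eq_intros dg\<close>)
    moreover have "((- (deriv f z * of_real r)) * (g 0 + cnj a) - (g 0 - a) * (- (deriv f z * of_real r))) / ((g 0 + cnj a) * (g 0 + cnj a))
        = - (of_real r * deriv f z) / of_real (2 * Re a)"
      using a0 unfolding a_def[symmetric] aa by simp
    ultimately show "(h has_field_derivative - (of_real r * deriv f z) / of_real (2 * Re a)) (at 0)" by simp
  qed
  ultimately have "norm (of_real r * deriv f z / of_real (2 * Re a)) \<le> 1" by (simp add: norm_divide)
  then have "r * norm (deriv f z) / (2 * Re a) \<le> 1" using r a0 by (simp add: norm_divide norm_mult)
  then have "norm (deriv f z) \<le> 2 * Re a / r" using r a0 by (simp add: field_simps)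
  also have "2 * Re a / r = 2 * (M - Re (f z)) / r + e"
    using r by (simp add: a_def g_def \<epsilon>_def field_simps)
  finally show "norm (deriv f z) \<le> 2 * (M - Re (f z)) / r + e" .
qed

section \<open>A holomorphic logarithm of \<open>L k\<close> and its oscillation\<close>

context lagrange_config
begin

text \<open>Each factor \<open>1 - z * zr i\<close> and its conjugate partner has positive real part
  in the disc, so principal logarithms add up to a global logarithm of \<open>L k\<close> whose
  imaginary part can be computed point by point.\<close>

definition lf :: "nat \<Rightarrow> complex \<Rightarrow> complex" where
  "lf k z = (\<Sum>i\<in>I - {k}. Ln (1 - z * zr i) + Ln (1 - z * cnj (zr i)))
      - of_nat n * (of_real p * z^2 / 2 + of_real q * z)"

text \<open>How far \<open>ln (norm (L k z))\<close> stays below its bound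
  \<open>ln (C * lam k)\<close>. It is nonnegative in the disc and is the quantity to which the
  half-plane Schwarz lemma is sensitive.\<close>

definition uu :: "nat \<Rightarrow> complex \<Rightarrow> real" where
  "uu k z = ln (C * lam k) - Re (lf k z)"

definition KU :: real where "KU = ln (C * K2)"

text \<open>Deeper than one spacing, where \<open>L_interior_ge\<close> bounds \<open>uu\<close> by
  a logarithm.\<close>

definition admissible :: "complex \<Rightarrow> bool" where
  "admissible z \<longleftrightarrow> norm z < 1 \<and> 1 < real n * (1 - norm z) * ((Im z)\<^sup>2 + \<nu>)"

lemma Re_one_minus_pos: "norm z < 1 \<Longrightarrow> norm w = 1 \<Longrightarrow> 0 < Re (1 - z * w)"
  using abs_Re_le_cmod[of "z * w"] by (simp add: norm_mult)

lemma one_minus_nonzero: "norm z < 1 \<Longrightarrow> norm w = 1 \<Longrightarrow> 1 - z * w \<noteq> 0" for z w :: complex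
  using Re_one_minus_pos[of z w] by (metis less_irrefl zero_complex.sel(1))

lemma quad_product:
  assumes "i \<in> I"
  shows "quad (c i) z = (1 - z * zr i) * (1 - z * cnj (zr i))"
proof -
  have 1: "zr i * cnj (zr i) = 1" using norm_zr[OF assms] complex_norm_square[of "zr i"] by simp
  have "(1 - z * zr i) * (1 - z * cnj (zr i)) = 1 - z * (zr i + cnj (zr i)) + z^2 * (zr i * cnj (zr i))"
    by (simp add: algebra_simps power2_eq_square)
  moreover have "(z - zr i) * (z - cnj (zr i)) = zr i * cnj (zr i) - z * (zr i + cnj (zr i)) + z^2"
    by (simp add: algebra_simps power2_eq_square)
  ultimately show ?thesis using quad_factor[OF c_bound[OF assms], of z] unfolding 1 by simp
qed

lemma exp_lf:
  assumes z: "norm z < 1"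
  shows "exp (lf k z) = L k z"
proof -
  have pair: "exp (Ln (1 - z * zr i) + Ln (1 - z * cnj (zr i))) = quad (c i) z" if "i \<in> I - {k}" for i
  proof -
    have i: "i \<in> I" using that by simp
    have "1 - z * zr i \<noteq> 0" "1 - z * cnj (zr i) \<noteq> 0"
      using one_minus_nonzero[OF z] norm_zr[OF i] by simp_all
    then show ?thesis by (simp add: exp_add quad_product[OF i])
  qed
  have fk: "finite (I - {k})" using fin by simp
  have "exp (\<Sum>i\<in>I - {k}. Ln (1 - z * zr i) + Ln (1 - z * cnj (zr i)))
      = (\<Prod>i\<in>I - {k}. exp (Ln (1 - z * zr i) + Ln (1 - z * cnj (zr i))))"
    by (rule exp_sum[OF fk])
  also have "\<dots> = (\<Prod>i\<in>I - {k}. quad (c i) z)"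
    by (rule prod.cong[OF refl pair])
  finally have *: "exp (\<Sum>i\<in>I - {k}. Ln (1 - z * zr i) + Ln (1 - z * cnj (zr i))) = (\<Prod>i\<in>I - {k}. quad (c i) z)" .
  show ?thesis unfolding lf_def exp_diff * wpoly_def minus_mult_left[symmetric] exp_minus divide_inverse ..
qed

lemma lf_holomorphic: "lf k holomorphic_on ball 0 1"
  unfolding lf_def
proof (intro holomorphic_intros)
  fix i z assume i: "i \<in> I - {k}" and z: "z \<in> ball (0::complex) 1"
  have "0 < Re (1 - z * zr i)" "0 < Re (1 - z * cnj (zr i))"
    by (rule Re_one_minus_pos; use norm_zr[of i] i z in simp)+
  then show "1 - z * zr i \<notin> \<real>\<^sub>\<le>\<^sub>0" "1 - z * cnj (zr i) \<notin> \<real>\<^sub>\<le>\<^sub>0"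
    using complex_nonpos_Reals_iff by (metis not_less)+
qed auto

lemma norm_L_uu: "norm z < 1 \<Longrightarrow> k \<in> I \<Longrightarrow> norm (L k z) = C * lam k * exp (- uu k z)"
  using exp_lf[of z k] lam_pos[of k] C1 norm_exp_eq_Re[of "lf k z"]
  by (simp add: uu_def exp_diff)

lemma uu_nonneg:
  assumes k: "k \<in> I" and z: "norm z < 1"
  shows "0 \<le> uu k z"
proof -
  have "C * lam k * exp (- uu k z) \<le> C * lam k * 1"
    using L_disc[OF k, of z] norm_L_uu[OF z k] z by simp
  then have "exp (- uu k z) \<le> 1" using C1 lam_pos[OF k] by (simp only: mult_le_cancel_left_pos[of "C * lam k"] mult_pos_pos)
  then show ?thesis by simp
qed

lemma uu_le:
  assumes k: "k \<in> I" and z: "admissible z"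
  shows "uu k z \<le> KU + 8 * ln (1 + norm (z - zr k) / eta k)"
proof -
  define w where "w = 1 + norm (z - zr k) / eta k"
  have w0: "0 < w" using eta_pos[of k] by (simp add: w_def add_pos_nonneg)
  have zl: "norm z < 1" using z by (simp add: admissible_def)
  have "lam k \<le> K2 * norm (L k z) * w ^ 8"
    using L_interior_ge[OF k] z by (simp add: admissible_def w_def)
  also have "\<dots> = K2 * C * lam k * exp (- uu k z) * w ^ 8" by (simp add: norm_L_uu[OF zl k] ac_simps)
  finally have "lam k * exp (uu k z) \<le> K2 * C * lam k * exp (- uu k z) * w ^ 8 * exp (uu k z)"
    by (intro mult_right_mono) auto
  also have "\<dots> = lam k * (K2 * C * w ^ 8)" by (simp add: exp_minus)
  finally have "exp (uu k z) \<le> K2 * C * w ^ 8" using lam_pos[OF k] by simp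
  then have "uu k z \<le> ln (K2 * C * w ^ 8)" using K2_pos C1 w0 by (subst ln_ge_iff) auto
  also have "\<dots> = KU + 8 * ln w" using K2_pos C1 w0 by (simp add: KU_def ln_mult ln_realpow)
  finally show ?thesis by (simp add: w_def)
qed

lemma KU_nonneg: "0 \<le> KU"
proof -
  have "1 \<le> Kc"
  proof -
    have "c1\<^sup>2 \<le> 1" using c1_bounds by (simp add: power_le_one)
    then have "1 * 1 * 1 \<le> (8 * C) * exp 128 * ((1575 * 6561) / c1\<^sup>2)"
      using C1 c1_bounds by (intro mult_mono) (auto simp: pos_le_divide_eq)
    then show ?thesis by (simp add: Kc_def)
  qed
  then have "1 * 1 \<le> C * K2" using C1 by (intro mult_mono) (auto simp: K2_def)
  then show ?thesis by (simp add: KU_def)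
qed

lemma lf_deriv_bound:
  assumes k: "k \<in> I" and z: "norm z < 1"
  shows "norm (deriv (lf k) z) \<le> 2 * uu k z / (1 - norm z)"
  unfolding uu_def
proof (rule half_plane_deriv_bound)
  have sub: "ball z (1 - norm z) \<subseteq> ball 0 1"
  proof
    fix w assume "w \<in> ball z (1 - norm z)"
    then show "w \<in> ball 0 1" using norm_triangle_ineq[of z "w - z"] by (simp add: dist_norm norm_minus_commute)
  qed
  then show "lf k holomorphic_on ball z (1 - norm z)" using lf_holomorphic holomorphic_on_subset by blast
  fix w assume "w \<in> ball z (1 - norm z)"
  then have "norm w < 1" using sub by auto
  then show "Re (lf k w) \<le> ln (C * lam k)" using uu_nonneg[OF k] by (simp add: uu_def)
qed (use z in auto)

lemma lf_diff_convex:
  assumes k: "k \<in> I" and S: "convex S" and ab: "a \<in> S" "b \<in> S" and h: "0 < h"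
    and SU: "\<And>w. w \<in> S \<Longrightarrow> h \<le> 1 - norm w \<and> uu k w \<le> U"
  shows "norm (lf k a - lf k b) \<le> 2 * U / h * norm (a - b)"
proof (rule field_differentiable_bound[OF S, where f' = "deriv (lf k)"])
  fix w assume w: "w \<in> S"
  have wn: "norm w < 1" using SU[OF w] h by linarith
  show "(lf k has_field_derivative deriv (lf k) w) (at w within S)"
    by (rule has_field_derivative_at_within, rule holomorphic_derivI[OF lf_holomorphic]) (use wn in auto)
  have "norm (deriv (lf k) w) \<le> 2 * uu k w / (1 - norm w)" by (rule lf_deriv_bound[OF k wn])
  also have "\<dots> \<le> 2 * U / h" using SU[OF w] uu_nonneg[OF k wn] h by (intro frac_le) auto
  finally show "norm (deriv (lf k) w) \<le> 2 * U / h" .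
qed (use ab in auto)

text \<open>In the coordinate \<open>s = ln (1 - norm z)\<close> the factor
  \<open>1 / (1 - norm z)\<close> of the derivative bound cancels and the speed is at most
  \<open>2 * U\<close>. A radial path therefore costs only the logarithm of the ratio of
  depths.\<close>

lemma lf_diff_radial:
  assumes k: "k \<in> I" and e: "norm e = 1" and h: "0 < h" "h \<le> H" "H < 1"
    and U: "\<And>t. h \<le> t \<Longrightarrow> t \<le> H \<Longrightarrow> uu k (of_real (1 - t) * e) \<le> U"
  shows "norm (lf k (of_real (1 - h) * e) - lf k (of_real (1 - H) * e)) \<le> 2 * U * ln (H / h)"
proof -
  define g where "g = (\<lambda>s. lf k (of_real (1 - exp s) * e))"
  define S where "S = {ln h..ln H}"
  have H0: "0 < H" using h by simp
  have lt: "norm (of_real (1 - exp s) * e) = 1 - exp s" "exp s \<le> H" "h \<le> exp s" if "s \<in> S" for s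
  proof -
    have "exp s \<le> exp (ln H)" "exp (ln h) \<le> exp s" using that by (simp_all add: S_def)
    then show 1: "exp s \<le> H" "h \<le> exp s" using h H0 by simp_all
    then have "\<bar>1 - exp s\<bar> = 1 - exp s" using h by simp
    then show "norm (of_real (1 - exp s) * e) = 1 - exp s" by (simp only: norm_mult norm_of_real e mult_1_right)
  qed
  have "norm (g (ln h) - g (ln H)) \<le> (2 * U) * norm (ln h - ln H)"
  proof (rule differentiable_bound[where S = S and f' = "\<lambda>s x. x *\<^sub>R (deriv (lf k) (of_real (1 - exp s) * e) * (- of_real (exp s) * e))"])
    show "convex S" by (simp add: S_def)
    show "ln h \<in> S" "ln H \<in> S" using h by (auto simp: S_def)
    fix s assume s: "s \<in> S"
    define w where "w = of_real (1 - exp s) * e"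
    have wn: "norm w = 1 - exp s" using lt(1)[OF s] by (simp only: w_def)
    have w1: "norm w < 1" by (simp add: wn)
    have dlf: "(lf k has_field_derivative deriv (lf k) w) (at w)"
      by (rule holomorphic_derivI[OF lf_holomorphic]) (use w1 in auto)
    have vd: "((\<lambda>s. of_real (1 - exp s) * e) has_vector_derivative (- of_real (exp s) * e)) (at s within S)"
      by (auto intro!: derivative_eq_intros)
    have "(g has_vector_derivative (- of_real (exp s) * e) * deriv (lf k) w) (at s within S)"
      unfolding g_def w_def
      by (rule field_vector_diff_chain_within[OF vd has_field_derivative_at_within[OF dlf[unfolded w_def]], unfolded o_def])
    then show "(g has_derivative (\<lambda>x. x *\<^sub>R (deriv (lf k) (of_real (1 - exp s) * e) * (- of_real (exp s) * e)))) (at s within S)"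
      by (simp add: has_vector_derivative_def w_def mult.commute)
    have "norm (deriv (lf k) w * (- of_real (exp s) * e)) = norm (deriv (lf k) w) * exp s"
      by (simp add: norm_mult e)
    also have "\<dots> \<le> (2 * uu k w / exp s) * exp s"
      using lf_deriv_bound[OF k w1] by (intro mult_right_mono) (auto simp: wn)
    also have "\<dots> = 2 * uu k w" by simp
    also have "\<dots> \<le> 2 * U" using U[of "exp s"] lt[OF s] by (simp add: w_def)
    finally have "norm (deriv (lf k) w * (- of_real (exp s) * e)) \<le> 2 * U" .
    then show "onorm (\<lambda>x. x *\<^sub>R (deriv (lf k) (of_real (1 - exp s) * e) * (- of_real (exp s) * e))) \<le> 2 * U"
      unfolding w_def by (intro onorm_le) (simp add: mult.commute mult_left_mono)
  qed
  then show ?thesis using h H0 by (simp add: g_def ln_div abs_if split: if_splits)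
qed

text \<open>Moving inward increases the depth but shrinks the imaginary part. The product
  \<open>t * (1 - t)^2\<close> still grows up to its critical point 1/3.\<close>

lemma admissible_radial:
  assumes e: "norm e = 1" and h: "0 < h" "h \<le> t" "t \<le> 1 / 3"
    and a: "admissible (of_real (1 - h) * e)"
  shows "admissible (of_real (1 - t) * e)"
proof -
  have nrm: "norm (of_real (1 - s) * e) = 1 - s" if "s \<le> 1/3" for s
    using that by (simp add: norm_mult e del: of_real_diff)
  have nrmh: "norm (of_real (1 - h) * e) = 1 - h" and nrmt: "norm (of_real (1 - t) * e) = 1 - t"
    using h by (auto intro!: nrm simp del: of_real_diff)
  have im: "(Im (of_real (1 - s) * e))\<^sup>2 = (1 - s)\<^sup>2 * (Im e)\<^sup>2" for s
    by (simp add: power_mult_distrib)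
  have "h * (1 - h)\<^sup>2 \<le> t * (1 - t)\<^sup>2"
  proof -
    have "t * (1 - t)\<^sup>2 - h * (1 - h)\<^sup>2 = (t - h) * (1 - 2 * (t + h) + t\<^sup>2 + t * h + h\<^sup>2)"
      by (simp add: power2_eq_square algebra_simps)
    moreover have "0 \<le> 1 - 2 * (t + h) + t\<^sup>2 + t * h + h\<^sup>2"
    proof -
      have "0 \<le> (1 - t - h)\<^sup>2 - t * h"
      proof -
        have "(1/3)\<^sup>2 \<le> (1 - t - h)\<^sup>2" using h by (intro power_mono) auto
        moreover have "t * h \<le> (1/3) * (1/3)" using h by (intro mult_mono) auto
        ultimately show ?thesis by (simp add: power2_eq_square)
      qed
      then show ?thesis by (simp add: power2_eq_square algebra_simps)
    qed
    ultimately show ?thesis using h by (smt (verit) mult_nonneg_nonneg)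
  qed
  then have "h * (1 - h)\<^sup>2 * (Im e)\<^sup>2 + h * \<nu> \<le> t * (1 - t)\<^sup>2 * (Im e)\<^sup>2 + t * \<nu>"
    using h nu0 by (intro add_mono mult_right_mono) auto
  then have "real n * (h * (1 - h)\<^sup>2 * (Im e)\<^sup>2 + h * \<nu>) \<le> real n * (t * (1 - t)\<^sup>2 * (Im e)\<^sup>2 + t * \<nu>)"
    by (intro mult_left_mono) auto
  moreover have "1 < real n * (h * (1 - h)\<^sup>2 * (Im e)\<^sup>2 + h * \<nu>)"
    using a unfolding admissible_def im nrmh by (simp add: algebra_simps)
  ultimately have "1 < real n * (t * (1 - t)\<^sup>2 * (Im e)\<^sup>2 + t * \<nu>)" by linarith
  then show ?thesis
    using h unfolding admissible_def im nrmt by (simp add: algebra_simps)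
qed

text \<open>Go radially inward to depth \<open>H\<close>, along the chord, and outward again. Since
  the directions are at most \<open>H\<close> apart, the chord costs a bounded multiple of the bound
  for \<open>uu\<close>; only the radial pieces cost another logarithm.\<close>

lemma lf_diff:
  assumes k: "k \<in> I" and e: "norm e1 = 1" "norm e2 = 1" and h: "0 < h1" "h1 \<le> H" "0 < h2" "h2 \<le> H" "H \<le> 1 / 3"
    and d: "norm (e1 - e2) \<le> H"
    and a: "admissible (of_real (1 - h1) * e1)" "admissible (of_real (1 - h2) * e2)"
    and seg: "\<And>w. w \<in> closed_segment (of_real (1 - H) * e1) (of_real (1 - H) * e2) \<Longrightarrow> admissible w"
    and D: "norm (e1 - zr k) + 2 * H \<le> D"
  shows "norm (lf k (of_real (1 - h1) * e1) - lf k (of_real (1 - h2) * e2))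
     \<le> 2 * (KU + 8 * ln (1 + D / eta k)) * (1 + ln (H / h1) + ln (H / h2))"
proof -
  define U where "U = KU + 8 * ln (1 + D / eta k)"
  have H0: "0 < H" using h by linarith
  have UU: "uu k w \<le> U" if "admissible w" "norm (w - zr k) \<le> D" for w
  proof -
    have "1 + norm (w - zr k) / eta k \<le> 1 + D / eta k"
      using that eta_pos[of k] by (simp add: divide_right_mono less_imp_le)
    then have "ln (1 + norm (w - zr k) / eta k) \<le> ln (1 + D / eta k)"
      using eta_pos[of k] by (intro ln_mono) (auto simp: add_pos_nonneg)
    then show ?thesis using uu_le[OF k that(1)] by (simp add: U_def)
  qed
  have dw: "norm (of_real (1 - t) * e - zr k) \<le> D"
    if "t \<le> H" "0 \<le> t" "e = e1 \<or> e = e2" for t e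
  proof -
    have e': "norm e = 1" "norm (e - zr k) \<le> norm (e1 - zr k) + H"
      using that(3) e d norm_triangle_ineq4[of "e1 - zr k" "e1 - e2"] H0 by auto
    have eq: "of_real (1 - t) * e - zr k = (e - zr k) - of_real t * e" by (simp add: algebra_simps)
    have "norm (of_real (1 - t) * e - zr k) \<le> norm (e - zr k) + t"
      unfolding eq using norm_triangle_ineq4[of "e - zr k" "of_real t * e"] e' that by (simp add: norm_mult)
    then show ?thesis using e' that D by linarith
  qed
  have r1: "norm (lf k (of_real (1 - h1) * e1) - lf k (of_real (1 - H) * e1)) \<le> 2 * U * ln (H / h1)"
    by (rule lf_diff_radial[OF k e(1)]) (use h a dw in \<open>auto intro!: UU admissible_radial[OF e(1), of h1] simp del: of_real_diff\<close>)
  have r2: "norm (lf k (of_real (1 - h2) * e2) - lf k (of_real (1 - H) * e2)) \<le> 2 * U * ln (H / h2)"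
    by (rule lf_diff_radial[OF k e(2)]) (use h a dw in \<open>auto intro!: UU admissible_radial[OF e(2), of h2] simp del: of_real_diff\<close>)
  define S where "S = closed_segment (of_real (1 - H) * e1) (of_real (1 - H) * e2)"
  have nH: "norm (of_real (1 - H) * e1) = 1 - H" "norm (of_real (1 - H) * e2) = 1 - H"
    using h e by (simp_all add: norm_mult del: of_real_diff)
  have "norm (lf k (of_real (1 - H) * e1) - lf k (of_real (1 - H) * e2))
      \<le> 2 * U / H * norm (of_real (1 - H) * e1 - of_real (1 - H) * e2)"
  proof (rule lf_diff_convex[OF k, where S = S])
    fix w assume w: "w \<in> S"
    have "S \<subseteq> cball 0 (1 - H)" unfolding S_def using nH
      by (intro closed_segment_subset) (auto simp del: of_real_diff)
    then have "norm w \<le> 1 - H" using w by auto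
    have "S \<subseteq> cball (zr k) D" unfolding S_def
      using dw[of H e1] dw[of H e2] H0 by (intro closed_segment_subset) (auto simp: dist_norm norm_minus_commute simp del: of_real_diff)
    then have "norm (w - zr k) \<le> D" using w by (auto simp: dist_norm norm_minus_commute)
    then show "H \<le> 1 - norm w \<and> uu k w \<le> U" using \<open>norm w \<le> 1 - H\<close> UU seg w by (auto simp: S_def)
  qed (use H0 in \<open>auto simp: S_def\<close>)
  also have "\<dots> \<le> 2 * U / H * H"
  proof (intro mult_left_mono)
    have "of_real (1 - H) * e1 - of_real (1 - H) * e2 = of_real (1 - H) * (e1 - e2)" by (simp add: algebra_simps)
    then have "norm (of_real (1 - H) * e1 - of_real (1 - H) * e2) = (1 - H) * norm (e1 - e2)"
      using h by (simp add: norm_mult del: of_real_diff)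
    also have "\<dots> \<le> 1 * H" using d h H0 by (intro mult_mono) auto
    finally show "norm (of_real (1 - H) * e1 - of_real (1 - H) * e2) \<le> H" by simp
    have "0 \<le> D" using D H0 norm_ge_zero[of "e1 - zr k"] by linarith
    then have "0 \<le> U" using KU_nonneg eta_pos[of k] by (simp add: U_def)
    then show "0 \<le> 2 * U / H" using H0 by simp
  qed
  finally have m: "norm (lf k (of_real (1 - H) * e1) - lf k (of_real (1 - H) * e2)) \<le> 2 * U" using H0 by simp
  have "norm (lf k (of_real (1 - h1) * e1) - lf k (of_real (1 - h2) * e2))
     \<le> norm (lf k (of_real (1 - h1) * e1) - lf k (of_real (1 - H) * e1))
      + norm (lf k (of_real (1 - H) * e1) - lf k (of_real (1 - H) * e2))
      + norm (lf k (of_real (1 - h2) * e2) - lf k (of_real (1 - H) * e2))"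
  proof -
    have tri: "norm (a - d) \<le> norm (a - b) + norm (b - c') + norm (d - c')" for a b c' d :: complex
    proof -
      have "a - d = (a - b) + (b - c') - (d - c')" by simp
      then show ?thesis
        using norm_triangle_ineq4[of "(a - b) + (b - c')" "d - c'"] norm_triangle_ineq[of "a - b" "b - c'"] by simp
    qed
    show ?thesis by (rule tri)
  qed
  also have "\<dots> \<le> 2 * U * ln (H / h1) + 2 * U + 2 * U * ln (H / h2)"
    using r1 r2 m by linarith
  also have "\<dots> = 2 * U * (1 + ln (H / h1) + ln (H / h2))" by (simp add: algebra_simps)
  finally show ?thesis by (simp add: U_def)
qed

section \<open>The argument of \<open>L k\<close> as a smoothed count\<close>

definition kap :: "real \<Rightarrow> real \<Rightarrow> real" where "kap t Y = pi / 2 - arctan (t / Y)"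

text \<open>\<open>kap t Y / pi\<close> is the Poisson smoothing, at scale \<open>Y\<close>, of the
  indicator of \<open>t < 0\<close>; so \<open>TT k X Y / pi\<close> is a smoothed number of points
  above \<open>X\<close>.\<close>

definition TT :: "nat \<Rightarrow> real \<Rightarrow> real \<Rightarrow> real" where
  "TT k X Y = (\<Sum>i\<in>I - {k}. kap (X - c i) Y)"

lemma kap_bounds: "0 < kap t Y" "kap t Y < pi"
  using arctan_bounded[of "t / Y"] by (auto simp: kap_def)

lemma kap_polar:
  assumes "0 < Y"
  shows "Complex t (- Y) = of_real (sqrt (t\<^sup>2 + Y\<^sup>2)) * cis (- kap t Y)"
proof -
  have s: "sqrt (t\<^sup>2 + Y\<^sup>2) = Y * sqrt (1 + (t / Y)\<^sup>2)"
  proof -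
    have "t\<^sup>2 + Y\<^sup>2 = Y\<^sup>2 * (1 + (t / Y)\<^sup>2)" using assms by (simp add: power_divide field_simps)
    then show ?thesis using assms by (simp add: real_sqrt_mult)
  qed
  have pos: "0 < sqrt (1 + (t / Y)\<^sup>2)" by (simp add: add_pos_nonneg)
  have "cos (kap t Y) = (t / Y) / sqrt (1 + (t / Y)\<^sup>2)"
    unfolding kap_def cos_diff by (simp add: sin_arctan)
  moreover have "sin (kap t Y) = 1 / sqrt (1 + (t / Y)\<^sup>2)"
    unfolding kap_def sin_diff by (simp add: cos_arctan)
  ultimately show ?thesis using assms pos unfolding s by (simp add: complex_eq_iff)
qed

text \<open>Both sides are arguments of \<open>quad (c i) z\<close>, the right one through its form
  \<open>z * (jouk z - c i)\<close>. They agree modulo \<open>2 * pi\<close>, and each lies strictly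
  between \<open>- pi\<close> and \<open>pi\<close>.\<close>

lemma Im_Ln_pair:
  assumes i: "i \<in> I" and z: "norm z < 1" "0 < Im z"
  shows "Im (Ln (1 - z * zr i) + Ln (1 - z * cnj (zr i)))
      = Arg z - kap (Re (jouk z) - c i) (- Im (jouk z))"
proof -
  define a b Y t where "a = Im (Ln (1 - z * zr i) + Ln (1 - z * cnj (zr i)))"
    and "b = Arg z - kap (Re (jouk z) - c i) (- Im (jouk z))"
    and "Y = - Im (jouk z)" and "t = Re (jouk z) - c i"
  have z0: "z \<noteq> 0" using z by auto
  have Y0: "0 < Y"
  proof -
    have "(norm z)\<^sup>2 < 1" using z by (simp add: power_less_one_iff abs_square_less_1)
    then have "1 < 1 / (norm z)\<^sup>2" using z0 by (simp add: field_simps)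
    then show ?thesis using z by (simp add: Y_def Im_jouk[OF z0] mult_less_0_iff)
  qed
  have n1: "norm (zr i) = 1" "norm (cnj (zr i)) = 1" using norm_zr[OF i] by auto
  have R: "0 < Re (1 - z * zr i)" "0 < Re (1 - z * cnj (zr i))"
    using Re_one_minus_pos[OF z(1) n1(1)] Re_one_minus_pos[OF z(1) n1(2)] by blast+
  have nz: "1 - z * zr i \<noteq> 0" "1 - z * cnj (zr i) \<noteq> 0"
    using one_minus_nonzero[OF z(1)] n1 by blast+
  have ab: "\<bar>a\<bar> < pi"
  proof -
    have "\<bar>Im (Ln (1 - z * zr i))\<bar> < pi / 2" "\<bar>Im (Ln (1 - z * cnj (zr i)))\<bar> < pi / 2"
      using R nz Re_Ln_pos_lt by blast+
    then show ?thesis by (simp add: a_def)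
  qed
  have bb: "\<bar>b\<bar> < pi"
  proof -
    have "0 < Arg z" "Arg z < pi" using z Arg_lt_pi[of z] by auto
    then show ?thesis using kap_bounds[of "Re (jouk z) - c i" "- Im (jouk z)"] by (auto simp: b_def)
  qed
  have "exp (Ln (1 - z * zr i) + Ln (1 - z * cnj (zr i))) = quad (c i) z"
    using nz by (simp add: exp_add quad_product[OF i])
  then have 1: "quad (c i) z = of_real (exp (Re (Ln (1 - z * zr i) + Ln (1 - z * cnj (zr i))))) * cis a"
    unfolding a_def by (metis exp_eq_polar)
  have "quad (c i) z = z * Complex t (- Y)"
    by (simp add: quad_jouk[OF z0] t_def Y_def complex_eq_iff)
  also have "\<dots> = (of_real (norm z) * cis (Arg z)) * (of_real (sqrt (t\<^sup>2 + Y\<^sup>2)) * cis (- kap t Y))"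
    using kap_polar[OF Y0] rcis_cmod_Arg[of z] by (simp add: rcis_def)
  also have "\<dots> = of_real (norm z * sqrt (t\<^sup>2 + Y\<^sup>2)) * cis b"
  proof -
    have "cis b = cis (Arg z) * cis (- kap t Y)" by (simp add: b_def t_def Y_def cis_mult)
    then show ?thesis by simp
  qed
  finally have 2: "quad (c i) z = of_real (norm z * sqrt (t\<^sup>2 + Y\<^sup>2)) * cis b" .
  have "cis a = cis b"
  proof -
    define A B where "A = exp (Re (Ln (1 - z * zr i) + Ln (1 - z * cnj (zr i))))" and "B = norm z * sqrt (t\<^sup>2 + Y\<^sup>2)"
    have A0: "0 < A" by (simp add: A_def)
    have B0: "0 \<le> B" by (simp add: B_def)
    have eq: "of_real A * cis a = of_real B * cis b" using 1 2 by (simp add: A_def B_def)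
    then have "norm (of_real A * cis a) = norm (of_real B * cis b)" by simp
    then have "A = B" using A0 B0 by (simp add: norm_mult)
    then show ?thesis using eq A0 by simp
  qed
  then have "cos a = cos b" "sin a = sin b" by (auto simp: complex_eq_iff)
  then have "cos (a - b) = 1" using sin_cos_squared_add[of b] by (simp add: cos_diff power2_eq_square)
  then obtain m :: int where m: "a - b = of_int m * 2 * pi" using cos_one_2pi_int by blast
  have "\<bar>a - b\<bar> < 2 * pi" using ab bb by linarith
  then have "\<bar>real_of_int m\<bar> * (2 * pi) < 1 * (2 * pi)" using m by (simp add: abs_mult)
  then have "\<bar>real_of_int m\<bar> < 1" using mult_less_cancel_right_pos[of "2 * pi" "\<bar>real_of_int m\<bar>" 1] pi_gt_zero by simp
  then have "m = 0" by linarith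
  then show ?thesis using m by (simp add: a_def b_def)
qed

lemma Im_lf:
  assumes k: "k \<in> I" and z: "norm z < 1" "0 < Im z"
  shows "Im (lf k z) = (real n - 1) * Arg z - TT k (Re (jouk z)) (- Im (jouk z))
     - real n * Im (of_real p * z^2 / 2 + of_real q * z)"
proof -
  have card: "real (card (I - {k})) = real n - 1"
    using card_I fin k card_gt_0_iff[of I] by (auto simp: of_nat_diff Suc_leI)
  have "Im (\<Sum>i\<in>I - {k}. Ln (1 - z * zr i) + Ln (1 - z * cnj (zr i)))
      = (\<Sum>i\<in>I - {k}. Arg z - kap (Re (jouk z) - c i) (- Im (jouk z)))"
    unfolding Im_sum using Im_Ln_pair[OF _ z] by (intro sum.cong) auto
  also have "\<dots> = (real n - 1) * Arg z - TT k (Re (jouk z)) (- Im (jouk z))"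
    by (simp add: sum_subtractf TT_def card)
  finally show ?thesis by (simp add: lf_def)
qed

end

section \<open>The argument and the counting function\<close>

text \<open>The linear terms at 0 cancel. The shape of the bound is chosen so that
  \<open>v = 1 / s\<close> turns it into \<open>12 / (1 + s^2)\<close>.\<close>

lemma two_arctan_diff: 
  fixes v :: real
  assumes "0 \<le> v"
  shows "\<bar>2 * arctan v - arctan (2 * v)\<bar> \<le> 12 * v\<^sup>2 / (1 + v\<^sup>2)"
proof (cases "v \<le> 1")
  case True
  define g where "g = (\<lambda>x::real. 2 * arctan x - arctan (2 * x))"
  have "norm (g v - g 0) \<le> (6 * v) * norm (v - 0)"
  proof (rule differentiable_bound[where S = "{0..v}" and f' = "\<lambda>x y. (2 / (1 + x\<^sup>2) - 2 / (1 + (2 * x)\<^sup>2)) * y"])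
    fix x assume x: "x \<in> {0..v}"
    have pos: "0 < 1 + x\<^sup>2" "0 < 1 + (2 * x)\<^sup>2" by (simp_all add: add_pos_nonneg)
    show "(g has_derivative (\<lambda>y. (2 / (1 + x\<^sup>2) - 2 / (1 + (2 * x)\<^sup>2)) * y)) (at x within {0..v})"
      unfolding g_def has_field_derivative_def[symmetric]
      by (rule has_field_derivative_at_within) (auto intro!: derivative_eq_intros simp: field_simps)
    have eq: "2 / (1 + x\<^sup>2) - 2 / (1 + (2 * x)\<^sup>2) = 6 * x\<^sup>2 / ((1 + x\<^sup>2) * (1 + (2 * x)\<^sup>2))"
    proof -
      have gen: "2 / P - 2 / Q = 2 * (Q - P) / (P * Q)" if "0 < P" "0 < Q" for P Q :: real
        using that by (simp add: field_simps)
      have "2 * ((1 + (2 * x)\<^sup>2) - (1 + x\<^sup>2)) = 6 * x\<^sup>2" by (simp add: power_mult_distrib)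
      then show ?thesis unfolding gen[OF pos] by (simp only:)
    qed
    have "6 * x\<^sup>2 / ((1 + x\<^sup>2) * (1 + (2 * x)\<^sup>2)) \<le> 6 * x\<^sup>2 / 1"
    proof (intro divide_left_mono)
      have "1 * 1 \<le> (1 + x\<^sup>2) * (1 + (2 * x)\<^sup>2)" by (intro mult_mono) auto
      then show "1 \<le> (1 + x\<^sup>2) * (1 + (2 * x)\<^sup>2)" by simp
    qed (use pos in auto)
    also have "6 * x\<^sup>2 / 1 \<le> 6 * v"
    proof -
      have "x * x \<le> v * 1" using x True by (intro mult_mono) auto
      then show ?thesis by (simp add: power2_eq_square)
    qed
    finally have "\<bar>2 / (1 + x\<^sup>2) - 2 / (1 + (2 * x)\<^sup>2)\<bar> \<le> 6 * v"
      unfolding eq using pos by (subst abs_of_nonneg) auto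
    then show "onorm (\<lambda>y. (2 / (1 + x\<^sup>2) - 2 / (1 + (2 * x)\<^sup>2)) * y) \<le> 6 * v"
      by (intro onorm_le) (simp add: abs_mult mult_right_mono)
  qed (use assms in auto)
  then have "\<bar>2 * arctan v - arctan (2 * v)\<bar> \<le> 6 * v\<^sup>2" using assms by (simp add: g_def power2_eq_square)
  also have "\<dots> \<le> 12 * v\<^sup>2 / (1 + v\<^sup>2)"
  proof -
    have "v\<^sup>2 \<le> 1" using True assms by (simp add: power_le_one)
    then have "6 * v\<^sup>2 * (1 + v\<^sup>2) \<le> 6 * v\<^sup>2 * 2" by (intro mult_left_mono) auto
    then show ?thesis by (simp add: pos_le_divide_eq add_pos_nonneg)
  qed
  finally show ?thesis .
next
  case False
  have "0 \<le> arctan v" "0 \<le> arctan (2 * v)" using assms by auto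
  then have "\<bar>2 * arctan v - arctan (2 * v)\<bar> \<le> pi"
    using arctan_ubound[of v] arctan_ubound[of "2 * v"] by linarith
  also have "\<dots> \<le> 6" using pi_less_4 by simp
  also have "6 \<le> 12 * v\<^sup>2 / (1 + v\<^sup>2)"
  proof -
    have "1 \<le> v\<^sup>2" using False by simp
    then show ?thesis by (simp add: pos_le_divide_eq add_pos_nonneg)
  qed
  finally show ?thesis .
qed

text \<open>The two preimages are reciprocal. The one in the disc lies above the real axis because
  \<open>jouk\<close> reverses the sign of the imaginary part there.\<close>

lemma exists_jouk_preimage:
  assumes "Im Z < 0"
  obtains z where "norm z < 1" "0 < Im z" "jouk z = Z"
proof -
  define w where "w = csqrt (Z^2 - 4)"
  have w2: "w^2 = Z^2 - 4" by (simp add: w_def)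
  define a b where "a = (Z + w) / 2" and "b = (Z - w) / 2"
  have prod: "a * b = 1" using w2 by (simp add: a_def b_def field_simps power2_eq_square)
  have sum: "a + b = Z" by (simp add: a_def b_def field_simps)
  note out = that
  have key: thesis if z: "norm z \<le> 1" "z * y = 1" "z + y = Z" for z y
  proof -
    have z0: "z \<noteq> 0" using z(2) by auto
    have y: "y = 1 / z" using z(2) z0 by (simp add: field_simps)
    have j: "jouk z = Z" using z(3) y by (simp add: jouk_def)
    have "norm z \<noteq> 1" using jouk_unit[of z] j assms by auto
    then have n1: "norm z < 1" using z(1) by simp
    have "(norm z)\<^sup>2 < 1" using n1 by (simp add: power_less_one_iff abs_square_less_1)
    then have "1 - 1 / (norm z)\<^sup>2 < 0" using z0 by (simp add: field_simps)
    moreover have "Im z * (1 - 1 / (norm z)\<^sup>2) < 0" using assms j Im_jouk[OF z0] by simp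
    ultimately have "0 < Im z" by (simp add: mult_less_0_iff)
    then show thesis using out n1 j by blast
  qed
  have "norm a * norm b = 1" using prod by (metis norm_mult norm_one)
  have "norm a \<le> 1 \<or> norm b \<le> 1"
  proof (rule ccontr)
    assume "\<not> (norm a \<le> 1 \<or> norm b \<le> 1)"
    then have "1 * 1 < norm a * norm b" by (intro mult_strict_mono) auto
    then show False using \<open>norm a * norm b = 1\<close> by simp
  qed
  then show thesis using key[of a b] key[of b a] prod sum by (auto simp: ac_simps)
qed

context lagrange_config
begin

text \<open>\<open>kap t Y\<close> reaches its limits only like \<open>Y / t\<close>, and the sum of
  such tails over all points is not locally controlled. Combining the scales \<open>Y\<close> and
  \<open>2 * Y\<close> cancels this term; what is left decays like the square, as a Poisson kernel
  does.\<close>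

lemma kap_richardson:
  assumes Y: "0 < Y"
  shows "\<bar>2 * kap t Y - kap t (2 * Y) - (if t < 0 then pi else 0)\<bar> \<le> 12 / (1 + (t / Y)\<^sup>2)"
proof -
  define s where "s = t / Y"
  have eq: "2 * kap t Y - kap t (2 * Y) = pi / 2 - 2 * arctan s + arctan (s / 2)"
    using Y by (simp add: kap_def s_def mult.commute)
  have sgn: "t < 0 \<longleftrightarrow> s < 0" using Y by (simp add: s_def divide_less_0_iff)
  have pos: "\<bar>pi / 2 - 2 * arctan s + arctan (s / 2)\<bar> \<le> 12 / (1 + s\<^sup>2)" if "0 < s" for s
  proof -
    have "arctan (1 / s) = pi / 2 - arctan s" "arctan (1 / (s / 2)) = pi / 2 - arctan (s / 2)"
      using that arctan_inverse[of s] arctan_inverse[of "s / 2"] by (auto simp: inverse_eq_divide)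
    then have "pi / 2 - 2 * arctan s + arctan (s / 2) = 2 * arctan (1 / s) - arctan (2 * (1 / s))"
      by simp
    moreover have "12 * (1 / s)\<^sup>2 / (1 + (1 / s)\<^sup>2) = 12 / (1 + s\<^sup>2)"
      using that by (simp add: power_divide field_simps)
    ultimately show ?thesis using two_arctan_diff[of "1 / s"] that by simp
  qed
  have "\<bar>2 * kap t Y - kap t (2 * Y) - (if t < 0 then pi else 0)\<bar> \<le> 12 / (1 + s\<^sup>2)"
  proof -
    consider "0 < s" | "s = 0" | "s < 0" by linarith
    then show ?thesis
    proof cases
      case 1 then show ?thesis using pos[of s] by (simp add: eq sgn)
    next
      case 2
      have "pi / 2 \<le> 12" using pi_less_4 by simp
      then show ?thesis using 2 by (simp add: eq sgn)
    next
      case 3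
      have "arctan (- s / 2) = - arctan (s / 2)" using arctan_minus[of "s / 2"] by simp
      then show ?thesis using pos[of "- s"] 3 by (simp add: eq sgn arctan_minus abs_if split: if_splits)
    qed
  qed
  then show ?thesis by (simp add: s_def)
qed

text \<open>Bounds the Poisson-type error of \<open>kap_richardson\<close> by a difference of
  smoothed counts at \<open>X - Y\<close> and \<open>X + Y\<close>, which the formula for the
  argument evaluates again.\<close>

lemma kap_diff_ge:
  assumes Y: "0 < Y"
  shows "(2 / 3) / (1 + (t / Y)\<^sup>2) \<le> kap (t - Y) Y - kap (t + Y) Y"
proof -
  define s where "s = t / Y"
  have "(t - Y) / Y = s - 1" "(t + Y) / Y = s + 1" using Y by (simp_all add: s_def field_simps)
  then have eq: "kap (t - Y) Y - kap (t + Y) Y = arctan (s + 1) - arctan (s - 1)" by (simp add: kap_def)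
  have "\<exists>x. s - 1 < x \<and> x < s + 1 \<and> arctan (s + 1) - arctan (s - 1) = ((s + 1) - (s - 1)) * (1 / (1 + x\<^sup>2))"
    by (rule MVT2) (auto intro!: derivative_eq_intros simp: inverse_eq_divide)
  then obtain x where x: "s - 1 < x" "x < s + 1" and xe: "arctan (s + 1) - arctan (s - 1) = 2 * (1 / (1 + x\<^sup>2))"
    by auto
  have "\<bar>x\<bar> \<le> \<bar>s\<bar> + 1" using x by linarith
  then have "x\<^sup>2 \<le> (\<bar>s\<bar> + 1)\<^sup>2" by (metis abs_ge_zero power2_abs power_mono)
  also have "\<dots> \<le> 2 * s\<^sup>2 + 2" using sum_squares_bound[of "\<bar>s\<bar>" 1] by (simp add: power2_sum)
  finally have "1 + x\<^sup>2 \<le> 3 + 3 * s\<^sup>2" using zero_le_power2[of s] by linarith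
  then have "1 + x\<^sup>2 \<le> 3 * (1 + s\<^sup>2)" by simp
  then have "2 / (3 * (1 + s\<^sup>2)) \<le> 2 / (1 + x\<^sup>2)" by (intro divide_left_mono mult_pos_pos) (auto simp: add_pos_nonneg)
  then show ?thesis unfolding eq xe by (simp add: s_def[symmetric])
qed

definition NN :: "nat \<Rightarrow> real \<Rightarrow> nat" where "NN k X = card {i \<in> I - {k}. X < c i}"

lemma TT_count:
  assumes Y: "0 < Y"
  shows "\<bar>2 * TT k X Y - TT k X (2 * Y) - pi * real (NN k X)\<bar> \<le> 18 * (TT k (X - Y) Y - TT k (X + Y) Y)"
proof -
  have fk: "finite (I - {k})" using fin by simp
  have "pi * real (NN k X) = (\<Sum>i\<in>I - {k}. if X - c i < 0 then pi else 0)"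
    unfolding NN_def using fk by (simp add: sum.If_cases Int_def conj_commute mult.commute)
  then have eq: "2 * TT k X Y - TT k X (2 * Y) - pi * real (NN k X)
     = (\<Sum>i\<in>I - {k}. 2 * kap (X - c i) Y - kap (X - c i) (2 * Y) - (if X - c i < 0 then pi else 0))"
    by (simp add: TT_def sum_subtractf sum_distrib_left)
  have "\<bar>2 * TT k X Y - TT k X (2 * Y) - pi * real (NN k X)\<bar> \<le> (\<Sum>i\<in>I - {k}. 18 * (kap (X - Y - c i) Y - kap (X + Y - c i) Y))"
    unfolding eq
  proof (rule order_trans[OF sum_abs], rule sum_mono)
    fix i
    have "18 * ((2 / 3) / (1 + ((X - c i) / Y)\<^sup>2)) \<le> 18 * (kap ((X - c i) - Y) Y - kap ((X - c i) + Y) Y)"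
      using kap_diff_ge[OF Y, of "X - c i"] by (intro mult_left_mono) auto
    moreover have "X - c i - Y = X - Y - c i" "X - c i + Y = X + Y - c i" by simp_all
    moreover have "18 * ((2 / 3) / w) = 12 / w" for w :: real by simp
    ultimately have "12 / (1 + ((X - c i) / Y)\<^sup>2) \<le> 18 * (kap (X - Y - c i) Y - kap (X + Y - c i) Y)"
      by (simp only:)
    then show "\<bar>2 * kap (X - c i) Y - kap (X - c i) (2 * Y) - (if X - c i < 0 then pi else 0)\<bar>
        \<le> 18 * (kap (X - Y - c i) Y - kap (X + Y - c i) Y)"
      by (rule order_trans[OF kap_richardson[OF Y]])
  qed
  also have "\<dots> = 18 * (TT k (X - Y) Y - TT k (X + Y) Y)"
    unfolding TT_def sum_subtractf[symmetric] sum_distrib_left ..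
  finally show ?thesis .
qed

text \<open>The main term of the smoothed count, extended off the circle:
  \<open>MM (cis t) = Phi t\<close> by \<open>MM_cis\<close>.\<close>

definition MM :: "complex \<Rightarrow> real" where
  "MM z = real n * (Arg z - Im (of_real p * (z^2 - 1 / z^2) / 4 + of_real q * (z - 1 / z) / 2))"

text \<open>Split the exponent into its parts odd and even under the exchange of \<open>z\<close>
  and \<open>1 / z\<close>. The odd part enters \<open>MM\<close>; the even part is a polynomial in
  \<open>jouk z\<close> and yields the explicit term proportional to \<open>Y\<close>.\<close>

lemma TT_MM:
  assumes k: "k \<in> I" and z: "norm z < 1" "0 < Im z" and Z: "jouk z = Complex X (- Y)"
  shows "TT k X Y = MM z - Arg z + real n * Y * (p * X + q) / 2 - Im (lf k z)"
proof -
  have z0: "z \<noteq> 0" using z by auto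
  have 1: "of_real p * z^2 / 2 + of_real q * z
     = (of_real p * (z^2 - 1 / z^2) / 4 + of_real q * (z - 1 / z) / 2)
       + (of_real p * ((jouk z)^2 - 2) / 4 + of_real q * jouk z / 2)"
    using z0 by (simp add: jouk_def field_simps power2_eq_square)
  have 2: "Im (of_real p * ((jouk z)^2 - 2) / 4 + of_real q * jouk z / 2) = - Y * (p * X + q) / 2"
    unfolding Z by (simp add: power2_eq_square algebra_simps)
  have "Im (of_real p * z^2 / 2 + of_real q * z)
     = Im (of_real p * (z^2 - 1 / z^2) / 4 + of_real q * (z - 1 / z) / 2) + - Y * (p * X + q) / 2"
    unfolding 1 plus_complex.sel(2)[of "of_real p * (z^2 - 1 / z^2) / 4 + of_real q * (z - 1 / z) / 2"] 2 ..
  moreover have "T = N * (a - G) - a + N * Y * w / 2 - L"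
    if "L = (N - 1) * a - T - N * E" "E = G + - Y * w / 2" for L N a T G E w :: real
    using that by (simp add: algebra_simps)
  ultimately show ?thesis using Im_lf[OF k z] unfolding Z MM_def by simp
qed

text \<open>The explicit term linear in \<open>Y\<close> cancels in
  \<open>2 * TT k X Y - TT k X (2 * Y)\<close>. In the difference between \<open>X - Y\<close> and
  \<open>X + Y\<close> it leaves \<open>- n * p * Y^2\<close>, whose sign is favourable because
  \<open>0 <= p\<close>.\<close>

lemma count_identity:
  assumes k: "k \<in> I" and Y: "0 < Y"
    and z1: "norm z1 < 1" "0 < Im z1" "jouk z1 = Complex X (- Y)"
    and z2: "norm z2 < 1" "0 < Im z2" "jouk z2 = Complex X (- (2 * Y))"
    and z3: "norm z3 < 1" "0 < Im z3" "jouk z3 = Complex (X - Y) (- Y)"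
    and z4: "norm z4 < 1" "0 < Im z4" "jouk z4 = Complex (X + Y) (- Y)"
    and M: "\<bar>MM z1 - MM z2\<bar> \<le> a" "\<bar>MM z3 - MM z4\<bar> \<le> a"
    and F: "norm (lf k z1 - lf k z2) \<le> b" "norm (lf k z3 - lf k z4) \<le> b"
  shows "\<bar>pi * real (NN k X) - MM z1 + Im (lf k z1)\<bar> \<le> 19 * a + 19 * b + 24 * pi"
proof -
  note T1 = TT_MM[OF k z1] and T2 = TT_MM[OF k z2] and T3 = TT_MM[OF k z3] and T4 = TT_MM[OF k z4]
  have A: "\<bar>Arg z\<bar> < pi" "0 < Arg z" if "norm z < 1" "0 < Im z" for z
    using that Arg_lt_pi[of z] by auto
  have F': "\<bar>Im (lf k z1) - Im (lf k z2)\<bar> \<le> b" "\<bar>Im (lf k z3) - Im (lf k z4)\<bar> \<le> b"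
    using F abs_Im_le_cmod[of "lf k z1 - lf k z2"] abs_Im_le_cmod[of "lf k z3 - lf k z4"] by auto
  have "0 \<le> real n * Y * (p * (2 * Y))" using Y p0 by simp
  then have lin34: "real n * Y * (p * (X - Y) + q) / 2 - real n * Y * (p * (X + Y) + q) / 2 \<le> 0"
    by (simp add: algebra_simps)
  define l34 m3 m4 where "l34 = real n * Y * (p * (X - Y) + q) / 2 - real n * Y * (p * (X + Y) + q) / 2"
    and "m3 = Im (lf k z3)" and "m4 = Im (lf k z4)"
  have "TT k (X - Y) Y - TT k (X + Y) Y = (MM z3 - MM z4) - (Arg z3 - Arg z4) + l34 - (m3 - m4)"
    unfolding T3 T4 l34_def m3_def m4_def by simp
  moreover have "x - (y1 - y2) + l - w \<le> a + \<pi> + b"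
    if "\<bar>x\<bar> \<le> a" "\<bar>y1\<bar> < \<pi>" "0 < y1" "\<bar>y2\<bar> < \<pi>" "0 < y2" "l \<le> 0" "\<bar>w\<bar> \<le> b" for x y1 y2 l w \<pi> :: real
    using that by linarith
  ultimately have d34: "TT k (X - Y) Y - TT k (X + Y) Y \<le> a + pi + b"
    using lin34 M(2) F'(2) A[OF z3(1,2)] A[OF z4(1,2)] unfolding l34_def[symmetric] m3_def[symmetric] m4_def[symmetric]
    by simp
  define l1 t1 t2 m1 m2 where "l1 = real n * Y * (p * X + q) / 2"
    and "t1 = TT k X Y" and "t2 = TT k X (2 * Y)" and "m1 = Im (lf k z1)" and "m2 = Im (lf k z2)"
  have t1: "t1 = MM z1 - Arg z1 + l1 - m1" unfolding t1_def T1 l1_def m1_def ..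
  have t2: "t2 = MM z2 - Arg z2 + 2 * l1 - m2" unfolding t2_def T2 l1_def m2_def by simp
  have 1: "\<bar>(2 * t1 - t2) - (MM z1 - m1)\<bar> \<le> a + b + 3 * pi"
  proof -
    have "(2 * t1 - t2) - (MM z1 - m1) = MM z1 - MM z2 - 2 * Arg z1 + Arg z2 - m1 + m2"
      unfolding t1 t2 by simp
    then show ?thesis
      using M(1) F'(1) A[OF z1(1,2)] A[OF z2(1,2)] unfolding m1_def[symmetric] m2_def[symmetric]
      by linarith
  qed
  define N where "N = pi * real (NN k X)"
  have 2: "\<bar>2 * t1 - t2 - N\<bar> \<le> 18 * a + 18 * pi + 18 * b"
    unfolding t1_def t2_def N_def by (rule order_trans[OF TT_count[OF Y]]) (use d34 in simp)
  have "\<bar>N - MM z1 + m1\<bar> \<le> 19 * a + 19 * b + 24 * pi" using 1 2 pi_gt_zero by linarith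
  then show ?thesis by (simp add: N_def m1_def)
qed

end

section \<open>The count at one angle, up to the imaginary part of \<open>lf\<close>\<close>

lemma circ_root_cos:
  assumes "0 \<le> t" "t \<le> pi"
  shows "circ_root (2 * cos t) = cis t"
proof -
  have "sqrt (1 - (cos t)\<^sup>2) = \<bar>sin t\<bar>" by (simp add: sin_squared_eq[symmetric])
  then show ?thesis using sin_ge_zero[OF assms] by (simp add: circ_root_def complex_eq_iff)
qed

lemma norm_one_minus_sq:
  fixes r :: real
  assumes "0 \<le> r" "r \<le> 1"
  shows "(1 - r\<^sup>2) / 2 \<le> 1 - r"
proof -
  have "(1 - r) * (1 + r) \<le> (1 - r) * 2" using assms by (intro mult_left_mono) auto
  then have "1 - r\<^sup>2 \<le> 2 * (1 - r)" by (simp add: power2_eq_square algebra_simps)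
  then show ?thesis by simp
qed

context lagrange_config
begin

definition Phi :: "real \<Rightarrow> real" where
  "Phi t = real n * (t - p * sin (2 * t) / 2 - q * sin t)"

lemma MM_cis:
  assumes "0 < t" "t < pi"
  shows "MM (cis t) = Phi t"
proof -
  have 1: "Arg (cis t) = t" using assms by (intro Arg_cis) auto
  have 2: "1 / cis t = cis (- t)" by (simp add: cis_inverse[symmetric] inverse_eq_divide del: cis_inverse)
  have 4: "(cis t)^2 = cis (2 * t)" by (simp add: power2_eq_square cis_mult)
  have 3: "1 / (cis t)^2 = cis (- (2 * t))"
    unfolding 4 by (simp add: cis_inverse[symmetric] inverse_eq_divide del: cis_inverse)
  show ?thesis unfolding MM_def 1 2 3 unfolding 4 Phi_def by simp
qed

text \<open>Here \<open>h\<close> is the spacing at the angle \<open>t\<close>, and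
  \<open>sin t * h\<close> is its size in x up to a constant. The condition on
  \<open>n * sin t ^ 3\<close> says \<open>h <= sin t / 1000\<close>, that is, many spacings away
  from both edges; then \<open>jouk\<close> is nearly linear at scale \<open>h\<close> around
  \<open>cis t\<close>.\<close>

lemma local_point:
  assumes t: "0 < t" "t < pi" and big: "1000 \<le> real n * sin t ^ 3"
  defines "h \<equiv> 1 / (real n * (sin t)\<^sup>2)"
  assumes Y: "8 * sin t * h \<le> Y" "\<bar>X - 2 * cos t\<bar> + Y \<le> 16 * sin t * h"
    and z: "norm z < 1" "0 < Im z" "jouk z = Complex X (- Y)"
  shows "norm (z - cis t) \<le> 16 * h" "3 * h \<le> 1 - norm z" "(49 / 50) * sin t \<le> Im z"
proof -
  define s where "s = sin t"
  have s: "0 < s" "s \<le> 1" using sin_gt_zero[OF t] by (auto simp: s_def)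
  have h0: "0 < h" using s n0 by (simp add: h_def s_def)
  have hs: "1000 * h \<le> s"
  proof -
    have "1000 * h = 1000 / (real n * s\<^sup>2)" by (simp add: h_def s_def)
    also have "\<dots> \<le> s" using big s n0
      by (simp add: pos_divide_le_eq s_def power2_eq_square power3_eq_cube ac_simps)
    finally show ?thesis .
  qed
  have z0: "z \<noteq> 0" using z by auto
  have "quad (2 * cos t) z = (z - cis t) * (z - cnj (cis t))"
    using quad_factor[of "2 * cos t" z] circ_root_cos[of t] t abs_cos_le_one[of t] by (simp add: abs_mult)
  moreover have "quad (2 * cos t) z = z * (jouk z - of_real (2 * cos t))" by (rule quad_jouk[OF z0])
  ultimately have eq: "norm (z - cis t) * norm (z - cnj (cis t)) = norm z * norm (jouk z - of_real (2 * cos t))"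
    by (metis norm_mult)
  have "norm (jouk z - of_real (2 * cos t)) \<le> \<bar>Re (jouk z - of_real (2 * cos t))\<bar> + \<bar>Im (jouk z - of_real (2 * cos t))\<bar>"
    by (rule cmod_le)
  also have "\<dots> \<le> 16 * s * h"
  proof -
    have "0 < 8 * sin t * h" using s h0 by (simp add: s_def)
    then have "0 < Y" using Y(1) by linarith
    then show ?thesis using Y(2) unfolding z(3) by (simp add: s_def)
  qed
  finally have up: "norm (jouk z - of_real (2 * cos t)) \<le> 16 * s * h" .
  have "s \<le> Im (z - cnj (cis t))" using z by (simp add: s_def)
  then have lo: "s \<le> norm (z - cnj (cis t))" using abs_Im_le_cmod[of "z - cnj (cis t)"] by linarith
  have "s * norm (z - cis t) \<le> norm (z - cnj (cis t)) * norm (z - cis t)"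
    using lo by (intro mult_right_mono) auto
  also have "\<dots> = norm z * norm (jouk z - of_real (2 * cos t))" using eq by (simp add: mult.commute)
  also have "\<dots> \<le> 1 * (16 * s * h)" using up z by (intro mult_mono) auto
  finally have "s * norm (z - cis t) \<le> s * (16 * h)" by (simp add: ac_simps)
  then show A: "norm (z - cis t) \<le> 16 * h" using s by simp
  have im: "\<bar>Im z - s\<bar> \<le> 16 * h" using abs_Im_le_cmod[of "z - cis t"] A by (simp add: s_def)
  then show "(49 / 50) * sin t \<le> Im z" using hs unfolding s_def[symmetric] by linarith
  have iz: "Im z \<le> (51 / 50) * s" using im hs by linarith
  define R where "R = (norm z)\<^sup>2"
  have R: "0 < R" "R < 1" using z z0 by (auto simp: R_def power_less_one_iff abs_square_less_1)
  have nz: "(49 / 50) \<le> norm z" using norm_triangle_ineq2[of "cis t" z] A hs s by (simp add: norm_minus_commute)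
  have R9: "(9 / 10) \<le> R" using power_mono[OF nz, of 2] by (simp add: R_def power2_eq_square)
  have "Y = Im z * (1 / R - 1)"
    using Im_jouk[OF z0] unfolding z(3) by (simp add: R_def algebra_simps)
  then have "R * Y = Im z * (1 - R)" using R by (simp add: field_simps)
  moreover have "(9 / 10) * (8 * s * h) \<le> R * Y" using R9 Y(1) s h0 R by (intro mult_mono) (auto simp: s_def)
  moreover have "Im z * (1 - R) \<le> (51 / 50) * s * (1 - R)" using iz R by (intro mult_right_mono) auto
  ultimately have "s * ((36 / 5) * h) \<le> s * ((51 / 50) * (1 - R))" by (simp add: algebra_simps)
  then have "(36 / 5) * h \<le> (51 / 50) * (1 - R)" using s by (simp only: mult_le_cancel_left_pos)
  then have "(36 / 5) * h \<le> 51 / 50 - 51 / 50 * R" by (simp add: algebra_simps)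
  then have "6 * h \<le> 1 - R" using h0 by linarith
  then show "3 * h \<le> 1 - norm z" using norm_one_minus_sq[of "norm z"] z by (simp add: R_def)
qed

text \<open>\<open>MM\<close> is the imaginary part of a holomorphic \<open>F\<close> whose
  derivative near \<open>cis t\<close> has size \<open>n * sin t ^ 2 = 1 / h\<close>. The two points
  are at most \<open>32 * h\<close> apart.\<close>

lemma MM_lipschitz:
  assumes t: "0 < t" "t < pi" and big: "1000 \<le> real n * sin t ^ 3"
  defines "h \<equiv> 1 / (real n * (sin t)\<^sup>2)"
  assumes A: "0 \<le> A" "\<bar>1 - p\<bar> + 2 * \<bar>q\<bar> \<le> A * (sin t)\<^sup>2"
    and zw: "norm (z - cis t) \<le> 16 * h" "norm (w - cis t) \<le> 16 * h"
  shows "\<bar>MM z - MM w\<bar> \<le> 64 * (A + 9)"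
proof -
  define s where "s = sin t"
  have s: "0 < s" "s \<le> 1" using sin_gt_zero[OF t] by (auto simp: s_def)
  have h0: "0 < h" using s n0 by (simp add: h_def s_def)
  have hs: "1000 * h \<le> s"
  proof -
    have "1000 * h = 1000 / (real n * s\<^sup>2)" by (simp add: h_def s_def)
    also have "\<dots> \<le> s" using big s n0
      by (simp add: pos_divide_le_eq s_def power2_eq_square power3_eq_cube ac_simps)
    finally show ?thesis .
  qed
  define S where "S = cball (cis t) (16 * h)"
  define F where "F = (\<lambda>z::complex. of_nat n * (Ln z - (of_real p * (z^2 - 1 / z^2) / 4 + of_real q * (z - 1 / z) / 2)))"
  define F' where "F' = (\<lambda>z::complex. of_nat n / z * (1 - of_real p * (z^2 + 1 / z^2) / 2 - of_real q * (z + 1 / z) / 2))"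
  have geo: "0 < Im u" "(9 / 10) \<le> norm u" "norm u \<le> (51 / 50)" if "u \<in> S" for u
  proof -
    have d: "norm (u - cis t) \<le> 16 * h" using that by (simp add: S_def dist_norm norm_minus_commute)
    show "0 < Im u" using abs_Im_le_cmod[of "u - cis t"] d hs h0 by (simp add: s_def)
    show "(9 / 10) \<le> norm u" using norm_triangle_ineq2[of "cis t" u] d hs s by (simp add: norm_minus_commute)
    show "norm u \<le> (51 / 50)" using norm_triangle_ineq2[of u "cis t"] d hs s by simp
  qed
  have "norm (F z - F w) \<le> (2 * (A + 9) / h) * norm (z - w)"
  proof (rule field_differentiable_bound[where S = S and f' = F'])
    show "convex S" by (simp add: S_def)
    show "z \<in> S" "w \<in> S" using zw by (simp_all add: S_def dist_norm norm_minus_commute)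
    fix u assume u: "u \<in> S"
    have u0: "u \<noteq> 0" using geo(1)[OF u] by auto
    have unp: "u \<notin> \<real>\<^sub>\<le>\<^sub>0" using geo(1)[OF u] by (auto simp: complex_nonpos_Reals_iff)
    have i1: "((\<lambda>z. 1 / z) has_field_derivative (- (1 / u^2))) (at u)"
      using u0 by (auto intro!: derivative_eq_intros simp: power2_eq_square)
    have i2: "((\<lambda>z. 1 / z^2) has_field_derivative (- (2 / u^3))) (at u)"
      using u0 by (auto intro!: derivative_eq_intros simp: power2_eq_square power3_eq_cube)
    have i3: "((\<lambda>z. z^2) has_field_derivative (2 * u)) (at u)"
      by (auto intro!: derivative_eq_intros)
    have "(F has_field_derivative of_nat n * (1 / u - (of_real p * (2 * u - - (2 / u^3)) / 4 + of_real q * (1 - - (1 / u^2)) / 2))) (at u)"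
      unfolding F_def
      by (intro DERIV_cmult DERIV_diff DERIV_add DERIV_cdivide i1 i2 i3 DERIV_ident)
         (use has_field_derivative_Ln[OF unp] in \<open>simp add: inverse_eq_divide\<close>)
    then have "(F has_field_derivative of_nat n * (1 / u - (of_real p * (2 * u + 2 / u^3) / 4 + of_real q * (1 + 1 / u^2) / 2))) (at u)"
      by simp
    moreover have "of_nat n * (1 / u - (of_real p * (2 * u + 2 / u^3) / 4 + of_real q * (1 + 1 / u^2) / 2)) = F' u"
      using u0 by (simp add: F'_def field_simps power2_eq_square power3_eq_cube)
    ultimately show "(F has_field_derivative F' u) (at u within S)" by (auto intro: has_field_derivative_at_within)
    have u1: "norm (1 / u) \<le> (6 / 5)"
    proof -
      have "norm (1 / u) = 1 / norm u" by (simp add: norm_divide)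
      also have "\<dots> \<le> 1 / (9 / 10)" using geo(2)[OF u] by (intro divide_left_mono) auto
      finally show ?thesis by simp
    qed
    have dm: "norm (u - 1 / u) \<le> (21 / 10) * s"
    proof -
      have d: "norm (u - cis t) \<le> 16 * h" using u by (simp add: S_def dist_norm norm_minus_commute)
      have e: "cis t - 1 / cis t = of_real (2 * s) * \<i>"
        by (simp add: complex_eq_iff s_def divide_inverse)
      have "1 / cis t - 1 / u = (u - cis t) * (1 / u) * (1 / cis t)" using u0 by (simp add: field_simps)
      then have "norm (1 / cis t - 1 / u) = norm (u - cis t) * norm (1 / u)" by (simp only: norm_mult) (simp add: norm_divide)
      also have "\<dots> \<le> 16 * h * (6 / 5)" using d u1 h0 by (intro mult_mono) auto
      finally have e2: "norm (1 / cis t - 1 / u) \<le> 16 * h * (6 / 5)" .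
      have "u - 1 / u = (u - cis t) + (cis t - 1 / cis t) + (1 / cis t - 1 / u)" by simp
      then have "norm (u - 1 / u) \<le> norm (u - cis t) + norm (cis t - 1 / cis t) + norm (1 / cis t - 1 / u)"
        by (metis norm_triangle_ineq norm_triangle_mono order_refl)
      also have "\<dots> \<le> 16 * h + 2 * s + 16 * h * (6 / 5)"
        using d e2 s unfolding e by (simp add: norm_mult)
      also have "\<dots> \<le> (21 / 10) * s" using hs h0 by simp
      finally show ?thesis .
    qed
    have dp: "norm (u + 1 / u) \<le> (12 / 5)" using norm_triangle_ineq[of u "1 / u"] u1 geo(3)[OF u] by simp
    \<comment> \<open>Since \<open>u^2 + 1 / u^2 = (u - 1 / u)^2 + 2\<close>, only
      \<open>1 - p\<close>, a multiple of \<open>q\<close> and a square of size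
      \<open>sin t ^ 2\<close> remain.\<close>
    have eq: "1 - of_real p * (u^2 + 1 / u^2) / 2 - of_real q * (u + 1 / u) / 2
      = of_real (1 - p) - of_real (p / 2) * (u - 1 / u)^2 - of_real (q / 2) * (u + 1 / u)"
      using u0 by (simp add: field_simps power2_eq_square)
    have "norm (of_real (1 - p) - of_real (p / 2) * (u - 1 / u)^2 - of_real (q / 2) * (u + 1 / u))
       \<le> \<bar>1 - p\<bar> + p / 2 * (norm (u - 1 / u))\<^sup>2 + \<bar>q\<bar> / 2 * norm (u + 1 / u)"
    proof -
      have "norm (of_real (1 - p) - of_real (p / 2) * (u - 1 / u)^2 - of_real (q / 2) * (u + 1 / u))
        \<le> norm (of_real (1 - p) :: complex) + norm (of_real (p / 2) * (u - 1 / u)^2) + norm (of_real (q / 2) * (u + 1 / u))"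
      proof -
        have "norm (a - b - d) \<le> norm a + norm b + norm d" for a b d :: complex
          using norm_triangle_ineq4[of "a - b" d] norm_triangle_ineq4[of a b] by linarith
        then show ?thesis .
      qed
      also have "\<dots> = \<bar>1 - p\<bar> + p / 2 * (norm (u - 1 / u))\<^sup>2 + \<bar>q\<bar> / 2 * norm (u + 1 / u)"
      proof -
        have n1: "norm (of_real r * v) = \<bar>r\<bar> * norm v" for r :: real and v :: complex
          by (simp add: norm_mult)
        show ?thesis unfolding n1 norm_power norm_of_real using p0 by simp
      qed
      finally show ?thesis .
    qed
    also have "\<dots> \<le> \<bar>1 - p\<bar> + 4 / 2 * ((21 / 10) * s)\<^sup>2 + \<bar>q\<bar> / 2 * (12 / 5)"
      using p0 p4 dm dp by (intro add_mono mult_mono power_mono) auto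
    also have "\<dots> \<le> (\<bar>1 - p\<bar> + 2 * \<bar>q\<bar>) + 9 * s\<^sup>2"
    proof -
      have "4 / 2 * ((21 / 10) * s)\<^sup>2 = 441 / 50 * s\<^sup>2" by (simp add: power2_eq_square)
      moreover have "441 / 50 * s\<^sup>2 \<le> 9 * s\<^sup>2" by (intro mult_right_mono) auto
      moreover have "\<bar>q\<bar> / 2 * (12 / 5) \<le> 2 * \<bar>q\<bar>" by simp
      ultimately show ?thesis by linarith
    qed
    also have "\<dots> \<le> (A + 9) * s\<^sup>2" using A(2) by (simp add: s_def algebra_simps)
    finally have G0: "norm (of_real (1 - p) - of_real (p / 2) * (u - 1 / u)^2 - of_real (q / 2) * (u + 1 / u)) \<le> (A + 9) * s\<^sup>2" .
    have "norm (F' u) \<le> real n * (6 / 5) * ((A + 9) * s\<^sup>2)"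
    proof -
      note G = G0
      have "F' u = of_nat n * (1 / u) * (of_real (1 - p) - of_real (p / 2) * (u - 1 / u)^2 - of_real (q / 2) * (u + 1 / u))"
        unfolding F'_def eq by simp
      then have "norm (F' u) = real n * norm (1 / u) * norm (of_real (1 - p) - of_real (p / 2) * (u - 1 / u)^2 - of_real (q / 2) * (u + 1 / u))"
        by (simp only: norm_mult norm_of_nat)
      also have "\<dots> \<le> real n * (6 / 5) * ((A + 9) * s\<^sup>2)"
        using u1 G by (intro mult_mono mult_left_mono) auto
      finally show ?thesis .
    qed
    also have "\<dots> = (6 / 5) * (A + 9) / h" using s n0 by (simp add: h_def s_def)
    also have "\<dots> \<le> 2 * (A + 9) / h" using A h0 by (intro divide_right_mono mult_right_mono) auto
    finally show "norm (F' u) \<le> 2 * (A + 9) / h" .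
  qed
  also have "\<dots> \<le> (2 * (A + 9) / h) * (32 * h)"
  proof (intro mult_left_mono)
    show "norm (z - w) \<le> 32 * h"
      using norm_triangle_ineq4[of "z - cis t" "w - cis t"] zw by simp
  qed (use A h0 in auto)
  also have "\<dots> = 64 * (A + 9)" using h0 by simp
  finally have 1: "norm (F z - F w) \<le> 64 * (A + 9)" .
  have "Im (F u) = MM u" if "u \<in> S" for u
  proof -
    have "u \<noteq> 0" using geo(1)[OF that] by auto
    then show ?thesis by (simp add: F_def MM_def Arg_eq_Im_Ln)
  qed
  then have "MM z - MM w = Im (F z - F w)" using zw by (simp add: S_def dist_norm norm_minus_commute)
  then show ?thesis using abs_Im_le_cmod[of "F z - F w"] 1 by simp
qed

text \<open>The spacing at \<open>t\<close> exceeds that at the base point by at most a polynomial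
  in their distance, measured in spacings of the base point. Inside a logarithm such a change of
  unit is harmless; \<open>scale_compare2\<close> is the converse direction.\<close>

lemma scale_compare:
  assumes k: "k \<in> I" and t: "0 < t" "t < pi" and big: "1000 \<le> real n * sin t ^ 3"
  defines "h \<equiv> 1 / (real n * (sin t)\<^sup>2)"
  assumes A: "0 \<le> A" "\<nu> \<le> A * (sin t)\<^sup>2"
  shows "h / eta k \<le> (A + 4) * (1 + norm (cis t - zr k) / eta k)\<^sup>2"
    and "10 * eta k \<le> sin t"
proof -
  define s s' d \<eta> where "s = sin t" and "s' = Im (zr k)" and "d = norm (cis t - zr k)" and "\<eta> = eta k"
  have s: "0 < s" using sin_gt_zero[OF t] by (auto simp: s_def)
  have \<eta>0: "0 < \<eta>" by (simp add: \<eta>_def eta_pos)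
  define S2 where "S2 = \<nu> + s'\<^sup>2"
  have S2: "0 < S2" "\<eta>\<^sup>2 \<le> S2" using nu0 eta_sq[of k] by (auto simp: S2_def s'_def \<eta>_def add_pos_nonneg)
  have \<eta>S: "\<eta> * (real n * S2) = 1" using n0 S2 by (simp add: \<eta>_def eta_def S2_def s'_def)
  have cube: "real n * \<eta> ^ 3 \<le> 1"
  proof -
    have "real n * \<eta> ^ 3 = \<eta> * real n * \<eta>\<^sup>2" by (simp add: power2_eq_square power3_eq_cube)
    also have "\<dots> \<le> \<eta> * real n * S2" using S2 \<eta>0 by (intro mult_left_mono) auto
    finally show ?thesis using \<eta>S by (simp add: mult.assoc)
  qed
  show small: "10 * eta k \<le> sin t"
  proof (rule ccontr)
    assume "\<not> 10 * eta k \<le> sin t"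
    then have "s ^ 3 < (10 * \<eta>) ^ 3" using s by (intro power_strict_mono) (auto simp: s_def \<eta>_def)
    then have "real n * s ^ 3 < real n * (10 * \<eta>) ^ 3" using n0 by (intro mult_strict_left_mono) auto
    also have "\<dots> = 1000 * (real n * \<eta> ^ 3)" by (simp add: power_mult_distrib)
    finally show False using big cube by (simp add: s_def)
  qed
  have d0: "0 \<le> d" by (simp add: d_def)
  have s'0: "0 \<le> s'" using Im_circ_root_nonneg[OF c_bound[OF k]] by (simp add: s'_def)
  have "s' \<le> s + d" using abs_Im_le_cmod[of "cis t - zr k"] by (simp add: s_def s'_def d_def)
  then have "s'\<^sup>2 \<le> (s + d)\<^sup>2" using s'0 by (intro power_mono) auto
  also have "\<dots> \<le> 2 * s\<^sup>2 + 2 * d\<^sup>2" using sum_squares_bound[of s d] by (simp add: power2_sum)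
  finally have S2le: "S2 \<le> (A + 2) * s\<^sup>2 + 2 * d\<^sup>2" using A(2) by (simp add: S2_def s_def algebra_simps)
  have "h / \<eta> = S2 / s\<^sup>2"
    using \<eta>S s n0 \<eta>0 by (simp add: h_def s_def[symmetric] field_simps)
  also have "\<dots> \<le> ((A + 2) * s\<^sup>2 + 2 * d\<^sup>2) / s\<^sup>2" using S2le by (intro divide_right_mono) auto
  also have "\<dots> = (A + 2) + 2 * (d / s)\<^sup>2" using s by (simp add: add_divide_distrib power_divide)
  also have "\<dots> \<le> (A + 2) * (1 + d / \<eta>)\<^sup>2 + 2 * (1 + d / \<eta>)\<^sup>2"
  proof (intro add_mono)
    have "1\<^sup>2 \<le> (1 + d / \<eta>)\<^sup>2" using d0 \<eta>0 by (intro power_mono) auto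
    then show "A + 2 \<le> (A + 2) * (1 + d / \<eta>)\<^sup>2" using A by (simp add: mult_le_cancel_left1)
    have "d / s \<le> d / \<eta>" using small d0 \<eta>0 s by (intro divide_left_mono) (auto simp: s_def \<eta>_def)
    then have "(d / s)\<^sup>2 \<le> (1 + d / \<eta>)\<^sup>2" using d0 s by (intro power_mono) auto
    then show "2 * (d / s)\<^sup>2 \<le> 2 * (1 + d / \<eta>)\<^sup>2" by simp
  qed
  finally show "h / eta k \<le> (A + 4) * (1 + norm (cis t - zr k) / eta k)\<^sup>2"
    by (simp add: \<eta>_def d_def algebra_simps)
qed

end

lemma cis_dist: "norm (cis a - cis b) \<le> \<bar>a - b\<bar>"
proof -
  have "norm (cis a - cis b) \<le> 1 * norm (a - b)"
  proof (rule differentiable_bound[where S = UNIV and f' = "\<lambda>x y. y *\<^sub>R (\<i> * cis x)"])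
    fix x :: real
    have "(cis has_vector_derivative \<i> * cis x) (at x)"
      unfolding cis_conv_exp by (auto intro!: derivative_eq_intros simp: algebra_simps)
    then show "(cis has_derivative (\<lambda>y. y *\<^sub>R (\<i> * cis x))) (at x)"
      by (simp add: has_vector_derivative_def)
    show "onorm (\<lambda>y. y *\<^sub>R (\<i> * cis x)) \<le> 1"
      by (intro onorm_le) (simp add: norm_mult)
  qed auto
  then show ?thesis by simp
qed

context lagrange_config
begin

definition KC :: "real \<Rightarrow> real" where
  "KC A = 20 * (64 * (A + 9)) + 19 * (22 * (KU + 8 * ln (16 * (A + 5)) + 16)) + 24 * pi"

text \<open>\<open>count_identity\<close> at height \<open>8 * sin t * h\<close>. Its four preimages
  share a convex set of diameter at most \<open>32 * h\<close> and depth at least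
  \<open>3 * h\<close>, so \<open>lf\<close> varies there by a multiple of the bound for
  \<open>uu\<close>: a single logarithm. The imaginary part of \<open>lf\<close> itself remains, for
  \<open>bulk_pair\<close> and \<open>edge_count\<close> to treat.\<close>

lemma count_at:
  assumes k: "k \<in> I" and t: "0 < t" "t < pi" and big: "1000 \<le> real n * sin t ^ 3"
    and A: "0 \<le> A" "\<bar>1 - p\<bar> + 2 * \<bar>q\<bar> \<le> A * (sin t)\<^sup>2" "\<nu> \<le> A * (sin t)\<^sup>2"
  defines "h \<equiv> 1 / (real n * (sin t)\<^sup>2)"
  obtains z where "norm z < 1" "norm (z - cis t) \<le> 16 * h" "3 * h \<le> 1 - norm z" "49 / 50 * sin t \<le> Im z"
    "\<bar>pi * real (NN k (2 * cos t)) - Phi t + Im (lf k z)\<bar>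
       \<le> KC A * (1 + ln (1 + norm (cis t - zr k) / eta k))"
proof -
  define s where "s = sin t"
  have s: "0 < s" "s \<le> 1" using sin_gt_zero[OF t] by (auto simp: s_def)
  have h0: "0 < h" using s n0 by (simp add: h_def s_def)
  have ns2: "real n * s\<^sup>2 * h = 1" using s n0 by (simp add: h_def s_def)
  define Y where "Y = 8 * s * h"
  have Y0: "0 < Y" using s h0 by (simp add: Y_def)
  define X where "X = 2 * cos t"
  obtain z1 where z1: "norm z1 < 1" "0 < Im z1" "jouk z1 = Complex X (- Y)"
    using exists_jouk_preimage[of "Complex X (- Y)"] Y0 by auto
  obtain z2 where z2: "norm z2 < 1" "0 < Im z2" "jouk z2 = Complex X (- (2 * Y))"
    using exists_jouk_preimage[of "Complex X (- (2 * Y))"] Y0 by auto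
  obtain z3 where z3: "norm z3 < 1" "0 < Im z3" "jouk z3 = Complex (X - Y) (- Y)"
    using exists_jouk_preimage[of "Complex (X - Y) (- Y)"] Y0 by auto
  obtain z4 where z4: "norm z4 < 1" "0 < Im z4" "jouk z4 = Complex (X + Y) (- Y)"
    using exists_jouk_preimage[of "Complex (X + Y) (- Y)"] Y0 by auto
  have c1: "8 * sin t * (1 / (real n * (sin t)\<^sup>2)) \<le> Y" "8 * sin t * (1 / (real n * (sin t)\<^sup>2)) \<le> 2 * Y"
    using Y0 by (simp_all add: Y_def s_def h_def[symmetric])
  have c2: "\<bar>X - 2 * cos t\<bar> + Y \<le> 16 * sin t * (1 / (real n * (sin t)\<^sup>2))"
    "\<bar>X - 2 * cos t\<bar> + 2 * Y \<le> 16 * sin t * (1 / (real n * (sin t)\<^sup>2))"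
    "\<bar>X - Y - 2 * cos t\<bar> + Y \<le> 16 * sin t * (1 / (real n * (sin t)\<^sup>2))"
    "\<bar>X + Y - 2 * cos t\<bar> + Y \<le> 16 * sin t * (1 / (real n * (sin t)\<^sup>2))"
    using Y0 by (simp_all add: Y_def s_def h_def[symmetric] X_def)
  note L1 = local_point[OF t big c1(1) c2(1) z1, folded h_def s_def]
  note L2 = local_point[OF t big c1(2) c2(2) z2, folded h_def s_def]
  note L3 = local_point[OF t big c1(1) c2(3) z3, folded h_def s_def]
  note L4 = local_point[OF t big c1(1) c2(4) z4, folded h_def s_def]
  define d \<eta> where "d = norm (cis t - zr k)" and "\<eta> = eta k"
  have \<eta>0: "0 < \<eta>" by (simp add: \<eta>_def eta_pos)
  have d0: "0 \<le> d" by (simp add: d_def)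
  define l where "l = ln (1 + d / \<eta>)"
  have l0: "0 \<le> l" using d0 \<eta>0 by (simp add: l_def)
  define U where "U = KU + 8 * ln (16 * (A + 5)) + 16 * l"
  define S where "S = cball 0 (1 - 3 * h) \<inter> {w. 49 / 50 * s \<le> Im w} \<inter> cball (cis t) (16 * h)"
  have convS: "convex S" unfolding S_def
    by (intro convex_Int convex_cball convex_halfspace_Im_ge)
  have SU: "3 * h \<le> 1 - norm w \<and> uu k w \<le> U" if "w \<in> S" for w
  proof -
    have w: "norm w \<le> 1 - 3 * h" "49 / 50 * s \<le> Im w" "norm (w - cis t) \<le> 16 * h"
      using that by (auto simp: S_def dist_norm norm_minus_commute)
    have adm: "admissible w"
    proof -
      have "(49 / 50 * s)\<^sup>2 \<le> (Im w)\<^sup>2" using w s by (intro power_mono) auto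
      moreover have "(49 / 50 * s)\<^sup>2 = 2401 / 2500 * s\<^sup>2" by (simp add: power2_eq_square)
      moreover have "9 / 10 * s\<^sup>2 \<le> 2401 / 2500 * s\<^sup>2" by (intro mult_right_mono) auto
      ultimately have "9 / 10 * s\<^sup>2 \<le> (Im w)\<^sup>2 + \<nu>" using nu0 by linarith
      then have "(3 * h) * (9 / 10 * s\<^sup>2) \<le> (1 - norm w) * ((Im w)\<^sup>2 + \<nu>)"
        using w h0 by (intro mult_mono) auto
      then have "real n * ((3 * h) * (9 / 10 * s\<^sup>2)) \<le> real n * ((1 - norm w) * ((Im w)\<^sup>2 + \<nu>))"
        by (intro mult_left_mono) auto
      moreover have "real n * ((3 * h) * (9 / 10 * s\<^sup>2)) = 27 / 10 * (real n * s\<^sup>2 * h)" by simp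
      ultimately have "1 < real n * ((1 - norm w) * ((Im w)\<^sup>2 + \<nu>))" unfolding ns2 by linarith
      then show ?thesis using w h0 by (simp add: admissible_def mult.assoc)
    qed
    have "norm (w - zr k) \<le> d + 16 * h"
      using norm_triangle_ineq[of "w - cis t" "cis t - zr k"] w(3) by (simp add: d_def)
    then have "1 + norm (w - zr k) / \<eta> \<le> 1 + (d + 16 * h) / \<eta>"
      using \<eta>0 by (simp add: divide_right_mono)
    also have "\<dots> = (1 + d / \<eta>) + 16 * (h / \<eta>)" by (simp add: add_divide_distrib)
    also have "\<dots> \<le> (1 + d / \<eta>)\<^sup>2 + 16 * ((A + 4) * (1 + d / \<eta>)\<^sup>2)"
    proof (intro add_mono mult_left_mono)
      show "1 + d / \<eta> \<le> (1 + d / \<eta>)\<^sup>2" using d0 \<eta>0 self_le_power[of "1 + d / \<eta>" 2] by simp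
      show "h / \<eta> \<le> (A + 4) * (1 + d / \<eta>)\<^sup>2"
        using scale_compare(1)[OF k t big A(1) A(3)] by (simp add: h_def \<eta>_def d_def)
    qed auto
    also have "\<dots> \<le> 16 * (A + 5) * (1 + d / \<eta>)\<^sup>2" by (simp add: algebra_simps)
    finally have "ln (1 + norm (w - zr k) / \<eta>) \<le> ln (16 * (A + 5) * (1 + d / \<eta>)\<^sup>2)"
      using \<eta>0 by (intro ln_mono) (auto simp: add_pos_nonneg)
    also have "\<dots> = ln (16 * (A + 5)) + 2 * l"
    proof -
      have "0 < 1 + d / \<eta>" using d0 \<eta>0 by (simp add: add_pos_nonneg)
      then show ?thesis using A(1) by (simp add: ln_mult_pos ln_realpow l_def)
    qed
    finally have "8 * ln (1 + norm (w - zr k) / \<eta>) \<le> 8 * ln (16 * (A + 5)) + 16 * l" by simp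
    then have "uu k w \<le> U" using uu_le[OF k adm] by (simp add: U_def \<eta>_def)
    then show ?thesis using w by simp
  qed
  have inS: "z1 \<in> S" "z2 \<in> S" "z3 \<in> S" "z4 \<in> S"
    using L1 L2 L3 L4 by (auto simp: S_def dist_norm norm_minus_commute)
  have U0: "0 \<le> U" using SU[OF inS(1)] uu_nonneg[OF k z1(1)] by linarith
  have F: "norm (lf k a - lf k b) \<le> 22 * U" if "a \<in> S" "b \<in> S" for a b
  proof -
    have "norm (lf k a - lf k b) \<le> 2 * U / (3 * h) * norm (a - b)"
      by (rule lf_diff_convex[OF k convS that _ SU]) (use h0 in auto)
    also have "\<dots> \<le> 2 * U / (3 * h) * (32 * h)"
    proof (intro mult_left_mono)
      show "norm (a - b) \<le> 32 * h"
        using that norm_triangle_ineq4[of "a - cis t" "b - cis t"]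
        by (auto simp: S_def dist_norm norm_minus_commute)
    qed (use U0 h0 in auto)
    also have "\<dots> = 64 / 3 * U" using h0 by simp
    also have "\<dots> \<le> 22 * U" using U0 by simp
    finally show ?thesis .
  qed
  have Mlip: "\<bar>MM a - MM b\<bar> \<le> 64 * (A + 9)" if "norm (a - cis t) \<le> 16 * h" "norm (b - cis t) \<le> 16 * h" for a b
    using MM_lipschitz[OF t big A(1,2)] that by (simp add: h_def)
  have "\<bar>pi * real (NN k X) - MM z1 + Im (lf k z1)\<bar> \<le> 19 * (64 * (A + 9)) + 19 * (22 * U) + 24 * pi"
    by (rule count_identity[OF k Y0 z1 z2 z3 z4]) (use Mlip F L1 L2 L3 L4 inS in auto)
  moreover have "\<bar>MM z1 - Phi t\<bar> \<le> 64 * (A + 9)"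
    using Mlip[of z1 "cis t"] L1 h0 MM_cis[OF t] by simp
  ultimately have fin1: "\<bar>pi * real (NN k X) - Phi t + Im (lf k z1)\<bar> \<le> 20 * (64 * (A + 9)) + 19 * (22 * U) + 24 * pi"
    by linarith
  show thesis
  proof (rule that[of z1])
    have bnd: "20 * (64 * (A + 9)) + 19 * (22 * U) + 24 * pi \<le> KC2 * (1 + l)"
      if "KC2 = 20 * (64 * (A + 9)) + 19 * (22 * (KU + 8 * ln (16 * (A + 5)) + 16)) + 24 * pi" for KC2
    proof -
      have lnA: "0 \<le> ln (16 * (A + 5))" using A(1) by (intro ln_ge_zero) auto
      have a: "0 \<le> (20 * (64 * (A + 9)) + 24 * pi) * l" using A(1) l0 pi_gt_zero by (intro mult_nonneg_nonneg) auto
      have b: "0 \<le> (KU + 8 * ln (16 * (A + 5))) * l" using KU_nonneg lnA l0 by (intro mult_nonneg_nonneg) auto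
      have "KC2 * (1 + l) = 20 * (64 * (A + 9)) + 24 * pi + 418 * (KU + 8 * ln (16 * (A + 5)) + 16)
         + (20 * (64 * (A + 9)) + 24 * pi) * l + 418 * ((KU + 8 * ln (16 * (A + 5))) * l) + 418 * (16 * l)"
        unfolding that by (simp add: algebra_simps)
      moreover have "19 * (22 * U) = 418 * (KU + 8 * ln (16 * (A + 5)) + 16) - 418 * 16 + 418 * (16 * l)"
        by (simp add: U_def algebra_simps)
      ultimately show ?thesis using a b by linarith
    qed
    show "\<bar>pi * real (NN k (2 * cos t)) - Phi t + Im (lf k z1)\<bar>
       \<le> KC A * (1 + ln (1 + norm (cis t - zr k) / eta k))"
      using order_trans[OF fin1 bnd[OF KC_def]] by (simp add: X_def l_def d_def \<eta>_def)
  qed (use z1 L1 in \<open>auto simp: s_def\<close>)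
qed

section \<open>Two angles in the bulk, and one angle at the edge\<close>

definition KD :: "real \<Rightarrow> real" where
  "KD A = 12 * (KU + 8) * (3 + ln (360 * (A + 5)))\<^sup>2"

lemma near_admissible:
  assumes t: "0 < t" "t < pi" and z: "norm z < 1"
    "3 * (1 / (real n * (sin t)\<^sup>2)) \<le> 1 - norm z" "49 / 50 * sin t \<le> \<bar>Im z\<bar>"
  shows "admissible z"
proof -
  define s h where "s = sin t" and "h = 1 / (real n * (sin t)\<^sup>2)"
  have s: "0 < s" using sin_gt_zero[OF t] by (simp add: s_def)
  have ns2: "real n * s\<^sup>2 * h = 1" using s n0 by (simp add: h_def s_def)
  have "(49 / 50 * s)\<^sup>2 \<le> \<bar>Im z\<bar>\<^sup>2" using z s unfolding s_def by (intro power_mono) auto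
  moreover have "(49 / 50 * s)\<^sup>2 = 2401 / 2500 * s\<^sup>2" by (simp add: power2_eq_square)
  moreover have "9 / 10 * s\<^sup>2 \<le> 2401 / 2500 * s\<^sup>2" by (intro mult_right_mono) auto
  moreover have "\<bar>Im z\<bar>\<^sup>2 = (Im z)\<^sup>2" by simp
  ultimately have im: "9 / 10 * s\<^sup>2 \<le> (Im z)\<^sup>2 + \<nu>" using nu0 by linarith
  have "(3 * h) * (9 / 10 * s\<^sup>2) \<le> (1 - norm z) * ((Im z)\<^sup>2 + \<nu>)"
  proof (rule mult_mono)
    show "3 * h \<le> 1 - norm z" using z(2) by (simp add: h_def)
    show "0 \<le> 1 - norm z" using z(1) by simp
  qed (use im in auto)
  then have "real n * ((3 * h) * (9 / 10 * s\<^sup>2)) \<le> real n * ((1 - norm z) * ((Im z)\<^sup>2 + \<nu>))"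
    by (intro mult_left_mono) auto
  moreover have "real n * ((3 * h) * (9 / 10 * s\<^sup>2)) = 27 / 10 * (real n * s\<^sup>2 * h)" by simp
  ultimately have "1 < real n * ((1 - norm z) * ((Im z)\<^sup>2 + \<nu>))" unfolding ns2 by linarith
  then show ?thesis using z by (simp add: admissible_def mult.assoc)
qed

lemma radial_direction:
  assumes z: "z \<noteq> 0" "norm z \<le> 1" and d: "norm (z - w) \<le> r" and w: "norm w = 1"
  shows "norm (z / of_real (norm z)) = 1" "of_real (1 - (1 - norm z)) * (z / of_real (norm z)) = z"
    "1 - norm z \<le> r" "norm (z / of_real (norm z) - w) \<le> 2 * r"
    "\<bar>Im z\<bar> \<le> \<bar>Im (z / of_real (norm z))\<bar>"
proof -
  have nz: "norm z > 0" using z by simp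
  show "norm (z / of_real (norm z)) = 1" using z by (simp add: norm_divide)
  show "of_real (1 - (1 - norm z)) * (z / of_real (norm z)) = z" using z by simp
  show 1: "1 - norm z \<le> r" using norm_triangle_ineq2[of w z] d w by (simp add: norm_minus_commute)
  have "z / of_real (norm z) - z = of_real (1 - norm z) * (z / of_real (norm z))"
    using z by (simp add: field_simps)
  then have "norm (z / of_real (norm z) - z) = \<bar>1 - norm z\<bar> * norm (z / of_real (norm z))"
    by (simp only: norm_mult norm_of_real)
  also have "\<dots> = 1 - norm z" using z by (simp add: norm_divide)
  finally show "norm (z / of_real (norm z) - w) \<le> 2 * r"
    using norm_triangle_ineq[of "z / of_real (norm z) - z" "z - w"] d 1 by simp
  have "\<bar>Im z\<bar> * norm z \<le> \<bar>Im z\<bar> * 1" using z by (intro mult_left_mono) auto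
  then show "\<bar>Im z\<bar> \<le> \<bar>Im (z / of_real (norm z))\<bar>" using nz by (simp add: pos_le_divide_eq)
qed

lemma scale_compare2:
  assumes k: "k \<in> I" and t: "0 < t" "t < pi"
  shows "eta k * (real n * (sin t)\<^sup>2) \<le> 2 * (1 + norm (cis t - zr k) / eta k)\<^sup>2"
proof -
  define s s' d \<eta> where "s = sin t" and "s' = Im (zr k)" and "d = norm (cis t - zr k)" and "\<eta> = eta k"
  have s: "0 < s" using sin_gt_zero[OF t] by (auto simp: s_def)
  have \<eta>0: "0 < \<eta>" by (simp add: \<eta>_def eta_pos)
  define S2 where "S2 = \<nu> + s'\<^sup>2"
  have S2: "0 < S2" "\<eta>\<^sup>2 \<le> S2" using nu0 eta_sq[of k] by (auto simp: S2_def s'_def \<eta>_def add_pos_nonneg)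
  have \<eta>S: "\<eta> * (real n * S2) = 1" using n0 S2 by (simp add: \<eta>_def eta_def S2_def s'_def)
  have d0: "0 \<le> d" by (simp add: d_def)
  have "s \<le> s' + d" using abs_Im_le_cmod[of "cis t - zr k"] by (simp add: s_def s'_def d_def)
  then have "s\<^sup>2 \<le> (s' + d)\<^sup>2" using s by (intro power_mono) auto
  also have "\<dots> \<le> 2 * s'\<^sup>2 + 2 * d\<^sup>2" using sum_squares_bound[of s' d] by (simp add: power2_sum)
  also have "\<dots> \<le> 2 * S2 * (1 + d / \<eta>)\<^sup>2"
  proof -
    have "d\<^sup>2 = (d / \<eta>)\<^sup>2 * \<eta>\<^sup>2" using \<eta>0 by (simp add: power_divide)
    also have "\<dots> \<le> (d / \<eta>)\<^sup>2 * S2" using S2 by (intro mult_left_mono) auto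
    finally have 1: "d\<^sup>2 \<le> (d / \<eta>)\<^sup>2 * S2" .
    have "s'\<^sup>2 \<le> S2" using nu0 by (simp add: S2_def)
    then have "2 * s'\<^sup>2 + 2 * d\<^sup>2 \<le> 2 * S2 * (1 + (d / \<eta>)\<^sup>2)" using 1 by (simp add: algebra_simps)
    also have "\<dots> \<le> 2 * S2 * (1 + d / \<eta>)\<^sup>2"
    proof (intro mult_left_mono)
      have "0 \<le> 2 * (d / \<eta>)" using d0 \<eta>0 by simp
      then show "1 + (d / \<eta>)\<^sup>2 \<le> (1 + d / \<eta>)\<^sup>2" by (simp add: power2_sum)
    qed (use S2 in auto)
    finally show ?thesis .
  qed
  finally have "\<eta> * (real n * s\<^sup>2) \<le> \<eta> * (real n * (2 * S2 * (1 + d / \<eta>)\<^sup>2))"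
    using \<eta>0 by (intro mult_left_mono) auto
  also have "\<dots> = 2 * (1 + d / \<eta>)\<^sup>2 * (\<eta> * (real n * S2))" by simp
  finally show ?thesis unfolding \<eta>S by (simp add: s_def d_def \<eta>_def)
qed

text \<open>Subtracting \<open>count_at\<close> at the two angles leaves the oscillation of
  \<open>lf\<close> between the associated points. \<open>lf_diff\<close> bounds it by a logarithm
  for \<open>uu\<close> times a logarithm for the ratio of depths, whence the square.\<close>

lemma bulk_pair:
  assumes k: "k \<in> I" and t: "0 < t" "t < pi" and big: "1000 \<le> real n * sin t ^ 3"
    and t': "0 < t'" "t' < pi" and big': "1000 \<le> real n * sin t' ^ 3"
    and A: "0 \<le> A" "\<bar>1 - p\<bar> + 2 * \<bar>q\<bar> \<le> A * (sin t)\<^sup>2" "\<nu> \<le> A * (sin t)\<^sup>2"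
    and A': "\<bar>1 - p\<bar> + 2 * \<bar>q\<bar> \<le> A * (sin t')\<^sup>2" "\<nu> \<le> A * (sin t')\<^sup>2"
    and close: "\<bar>t - t'\<bar> \<le> sin t / 10"
  shows "\<bar>pi * (real (NN k (2 * cos t)) - real (NN k (2 * cos t'))) - (Phi t - Phi t')\<bar>
    \<le> (2 * KC A + KD A) * (1 + ln (1 + (norm (cis t - zr k) + \<bar>t - t'\<bar>) / eta k))\<^sup>2"
proof -
  define s h s' h' where "s = sin t" and "h = 1 / (real n * (sin t)\<^sup>2)"
    and "s' = sin t'" and "h' = 1 / (real n * (sin t')\<^sup>2)"
  obtain z where z: "norm z < 1" "norm (z - cis t) \<le> 16 * h" "3 * h \<le> 1 - norm z" "49 / 50 * s \<le> Im z"
    and zc: "\<bar>pi * real (NN k (2 * cos t)) - Phi t + Im (lf k z)\<bar> \<le> KC A * (1 + ln (1 + norm (cis t - zr k) / eta k))"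
    using count_at[OF k t big A] unfolding h_def s_def by blast
  obtain z' where z': "norm z' < 1" "norm (z' - cis t') \<le> 16 * h'" "3 * h' \<le> 1 - norm z'" "49 / 50 * s' \<le> Im z'"
    and zc': "\<bar>pi * real (NN k (2 * cos t')) - Phi t' + Im (lf k z')\<bar> \<le> KC A * (1 + ln (1 + norm (cis t' - zr k) / eta k))"
    using count_at[OF k t' big' A(1) A'] unfolding h'_def s'_def by blast
  have s: "0 < s" "s \<le> 1" "0 < s'" using sin_gt_zero[OF t] sin_gt_zero[OF t'] by (auto simp: s_def s'_def)
  have h0: "0 < h" "0 < h'" using s n0 by (simp_all add: h_def s_def h'_def s'_def)
  have hs: "1000 * h \<le> s"
  proof -
    have "1000 * h = 1000 / (real n * s\<^sup>2)" by (simp add: h_def s_def)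
    also have "\<dots> \<le> s" using big s n0
      by (simp add: pos_divide_le_eq s_def power2_eq_square power3_eq_cube ac_simps)
    finally show ?thesis .
  qed
  have ss: "\<bar>s - s'\<bar> \<le> s / 10"
    using abs_Im_le_cmod[of "cis t - cis t'"] cis_dist[of t t'] close by (simp add: s_def s'_def)
  have s1: "9 / 10 * s \<le> s'" "s' \<le> 11 / 10 * s" using ss by linarith+
  have hh: "h' \<le> 13 / 10 * h" "h \<le> 13 / 10 * h'"
  proof -
    have "(9 / 10 * s)\<^sup>2 \<le> s'\<^sup>2" "s'\<^sup>2 \<le> (11 / 10 * s)\<^sup>2" using s1 s by (auto intro!: power_mono)
    then have a: "81 / 100 * s\<^sup>2 \<le> s'\<^sup>2" "s'\<^sup>2 \<le> 121 / 100 * s\<^sup>2" by (simp_all add: power2_eq_square)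
    have "s\<^sup>2 \<le> 13 / 10 * s'\<^sup>2" "s'\<^sup>2 \<le> 13 / 10 * s\<^sup>2" using a zero_le_power2[of s] by linarith+
    then show "h' \<le> 13 / 10 * h" "h \<le> 13 / 10 * h'"
      using s n0 by (simp_all add: h_def h'_def s_def[symmetric] s'_def[symmetric] divide_simps)
  qed
  \<comment> \<open>Deep enough to exceed the distance of the two directions, at most
    \<open>74 * h\<close> plus that of the angles, yet small against \<open>sin t\<close>, so that
    the chord keeps a large imaginary part and stays admissible.\<close>
  define H where "H = \<bar>t - t'\<bar> + 120 * h"
  have H: "H \<le> 22 / 100 * s" "H \<le> 1 / 3" "0 < H" "120 * h \<le> H"
    using close hs s h0 by (auto simp: H_def s_def[symmetric])
  define \<eta> d where "\<eta> = eta k" and "d = norm (cis t - zr k)"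
  have \<eta>0: "0 < \<eta>" by (simp add: \<eta>_def eta_pos)
  have d0: "0 \<le> d" by (simp add: d_def)
  have zn: "z \<noteq> 0" "z' \<noteq> 0" using z(4) z'(4) s by auto
  define e e' where "e = z / of_real (norm z)" and "e' = z' / of_real (norm z')"
  note R = radial_direction[OF zn(1) less_imp_le[OF z(1)] z(2) norm_cis, folded e_def]
  note R' = radial_direction[OF zn(2) less_imp_le[OF z'(1)] z'(2) norm_cis, folded e'_def]
  have adm: "admissible z" "admissible z'"
    using near_admissible[OF t z(1)] near_admissible[OF t' z'(1)] z z' s by (auto simp: h_def h'_def s_def s'_def)
  have ee: "norm (e - e') \<le> H"
  proof -
    have "norm (e - e') \<le> norm (e - cis t) + norm (cis t - cis t') + norm (e' - cis t')"
    proof -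
      have "e - e' = (e - cis t) + (cis t - cis t') - (e' - cis t')" by simp
      then show ?thesis
        using norm_triangle_ineq4[of "(e - cis t) + (cis t - cis t')" "e' - cis t'"]
          norm_triangle_ineq[of "e - cis t" "cis t - cis t'"] by simp
    qed
    also have "\<dots> \<le> 32 * h + \<bar>t - t'\<bar> + 32 * (13 / 10 * h)" using R(4) R'(4) cis_dist[of t t'] hh by linarith
    also have "\<dots> \<le> H" using h0 by (simp add: H_def)
    finally show ?thesis .
  qed
  define D where "D = d + 3 * H"
  have key: "norm (lf k z - lf k z') \<le> 2 * (KU + 8 * ln (1 + D / eta k)) * (1 + ln (H / (1 - norm z)) + ln (H / (1 - norm z')))"
  proof -
    have "norm (lf k (of_real (1 - (1 - norm z)) * e) - lf k (of_real (1 - (1 - norm z')) * e'))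
       \<le> 2 * (KU + 8 * ln (1 + D / eta k)) * (1 + ln (H / (1 - norm z)) + ln (H / (1 - norm z')))"
    proof (rule lf_diff[OF k R(1) R'(1) _ _ _ _ H(2) ee])
      show "0 < 1 - norm z" "0 < 1 - norm z'" using z z' by auto
      show "1 - norm z \<le> H" using R(3) H(4) h0 by linarith
      show "1 - norm z' \<le> H" using R'(3) H(4) h0 hh by linarith
      show "admissible (of_real (1 - (1 - norm z)) * e)" unfolding R(2) by (rule adm)
      show "admissible (of_real (1 - (1 - norm z')) * e')" unfolding R'(2) by (rule adm)
      have "norm (e - zr k) \<le> 32 * h + d"
        using norm_triangle_ineq[of "e - cis t" "cis t - zr k"] R(4) by (simp add: d_def)
      then show "norm (e - zr k) + 2 * H \<le> D" using H(4) h0 by (simp add: D_def)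
      fix w assume w: "w \<in> closed_segment (of_real (1 - H) * e) (of_real (1 - H) * e')"
      have nH: "norm (of_real (1 - H) * e) = 1 - H" "norm (of_real (1 - H) * e') = 1 - H"
        using H R(1) R'(1) by (simp_all add: norm_mult del: of_real_diff)
      have ime: "88 / 100 * s \<le> Im e" "88 / 100 * s \<le> Im e'"
      proof -
        have "0 \<le> Im e" "0 \<le> Im e'" using z(4) z'(4) s by (simp_all add: e_def e'_def)
        then show "88 / 100 * s \<le> Im e" "88 / 100 * s \<le> Im e'" using R(5) R'(5) z(4) z'(4) s s1 by auto
      qed
      have imw: "68 / 100 * s \<le> Im (of_real (1 - H) * e)" "68 / 100 * s \<le> Im (of_real (1 - H) * e')"
      proof -
        have "78 / 100 \<le> 1 - H" using H s by linarith
        then have "(78 / 100) * (88 / 100 * s) \<le> (1 - H) * u" if "88 / 100 * s \<le> u" for u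
          using that s by (rule_tac mult_mono) linarith+
        from this[OF ime(1)] this[OF ime(2)] show "68 / 100 * s \<le> Im (of_real (1 - H) * e)" "68 / 100 * s \<le> Im (of_real (1 - H) * e')"
          using s by (simp_all del: of_real_diff)
      qed
      have "closed_segment (of_real (1 - H) * e) (of_real (1 - H) * e') \<subseteq> cball 0 (1 - H) \<inter> {w. 68 / 100 * s \<le> Im w}"
        by (intro closed_segment_subset convex_Int convex_cball convex_halfspace_Im_ge)
           (use nH imw in \<open>auto simp del: of_real_diff\<close>)
      then have wn: "H \<le> 1 - norm w" "68 / 100 * s \<le> Im w" using w by auto
      have "(68 / 100 * s)\<^sup>2 \<le> (Im w)\<^sup>2" using wn s by (intro power_mono) auto
      moreover have "(68 / 100 * s)\<^sup>2 = 4624 / 10000 * s\<^sup>2" by (simp add: power2_eq_square)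
      moreover have "46 / 100 * s\<^sup>2 \<le> 4624 / 10000 * s\<^sup>2" by (intro mult_right_mono) auto
      ultimately have "46 / 100 * s\<^sup>2 \<le> (Im w)\<^sup>2" by linarith
      then have "(120 * h) * (46 / 100 * s\<^sup>2) \<le> (1 - norm w) * ((Im w)\<^sup>2 + \<nu>)"
        using wn H(4) h0 nu0 by (intro mult_mono) auto
      then have "real n * ((120 * h) * (46 / 100 * s\<^sup>2)) \<le> real n * ((1 - norm w) * ((Im w)\<^sup>2 + \<nu>))"
        by (intro mult_left_mono) auto
      moreover have "real n * ((120 * h) * (46 / 100 * s\<^sup>2)) = 5520 / 100"
        using s n0 by (simp add: h_def s_def[symmetric])
      ultimately have "1 < real n * ((1 - norm w) * ((Im w)\<^sup>2 + \<nu>))" by linarith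
      then show "admissible w" using wn H(3) by (simp add: admissible_def mult.assoc)
    qed
    then show ?thesis unfolding R(2) R'(2) .
  qed
  define l where "l = ln (1 + D / \<eta>)"
  have D0: "0 \<le> D" using d0 H by (simp add: D_def)
  have De: "1 \<le> 1 + D / \<eta>" using D0 \<eta>0 by simp
  have l0: "0 \<le> l" using De by (simp add: l_def)
  \<comment> \<open>The ratio of depths is at most the cube of \<open>1 + D / eta k\<close>: one
    factor for \<open>H\<close> over the spacing of the base point, two for that spacing over
    \<open>h\<close>.\<close>
  have Hh: "ln (H / (1 - norm u)) \<le> 3 * l" if "3 * (10 / 13 * h) \<le> 1 - norm u" "norm u < 1" for u :: complex
  proof -
    have "H / (1 - norm u) \<le> H / (2 * h)" using that h0 H by (intro divide_left_mono mult_pos_pos) auto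
    also have "\<dots> = (H / \<eta>) * (\<eta> * (real n * (sin t)\<^sup>2)) / 2" using \<eta>0 by (simp add: h_def)
    also have "\<dots> \<le> (1 + D / \<eta>) * (2 * (1 + D / \<eta>)\<^sup>2) / 2"
    proof -
      have "H \<le> D" using d0 H by (simp add: D_def)
      then have "H / \<eta> \<le> D / \<eta>" using \<eta>0 by (intro divide_right_mono) auto
      then have a: "H / \<eta> \<le> 1 + D / \<eta>" by simp
      have "(1 + d / \<eta>)\<^sup>2 \<le> (1 + D / \<eta>)\<^sup>2"
        using d0 H \<eta>0 by (intro power_mono add_left_mono divide_right_mono) (auto simp: D_def)
      then have b: "\<eta> * (real n * (sin t)\<^sup>2) \<le> 2 * (1 + D / \<eta>)\<^sup>2"
        using scale_compare2[OF k t] by (simp add: \<eta>_def d_def)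
      have "(H / \<eta>) * (\<eta> * (real n * (sin t)\<^sup>2)) \<le> (1 + D / \<eta>) * (2 * (1 + D / \<eta>)\<^sup>2)"
        by (rule mult_mono[OF a b]) (use De \<eta>0 in auto)
      then show ?thesis by (rule divide_right_mono) simp
    qed
    also have "\<dots> = (1 + D / \<eta>) ^ 3" by (simp add: power2_eq_square power3_eq_cube)
    finally have "ln (H / (1 - norm u)) \<le> ln ((1 + D / \<eta>) ^ 3)" using H that by (intro ln_mono) auto
    also have "\<dots> = 3 * l" using De by (simp add: l_def ln_realpow)
    finally show ?thesis .
  qed
  have lf_le: "norm (lf k z - lf k z') \<le> 12 * (KU + 8) * (1 + l)\<^sup>2"
  proof -
    have "ln (H / (1 - norm z)) \<le> 3 * l" "ln (H / (1 - norm z')) \<le> 3 * l"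
      using z z' hh h0 by (auto intro!: Hh)
    moreover have "0 \<le> ln (H / (1 - norm z))" "0 \<le> ln (H / (1 - norm z'))"
      using R(3) R'(3) H(4) h0 hh z z' by (auto intro!: ln_ge_zero simp: pos_le_divide_eq)
    ultimately have "2 * (KU + 8 * l) * (1 + ln (H / (1 - norm z)) + ln (H / (1 - norm z'))) \<le> 2 * ((KU + 8) * (1 + l)) * (6 * (1 + l))"
      using KU_nonneg l0 mult_nonneg_nonneg[OF KU_nonneg l0] by (intro mult_mono) (auto simp: algebra_simps)
    also have "\<dots> = 12 * (KU + 8) * (1 + l)\<^sup>2" by (simp add: power2_eq_square algebra_simps)
    finally show ?thesis using key by (simp add: l_def \<eta>_def)
  qed
  define m where "m = ln (1 + (d + \<bar>t - t'\<bar>) / \<eta>)"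
  have m0: "0 \<le> m" using d0 \<eta>0 by (simp add: m_def)
  have lm: "1 + l \<le> (3 + ln (360 * (A + 5))) * (1 + m)"
  proof -
    define E where "E = 1 + (d + \<bar>t - t'\<bar>) / \<eta>"
    have E1: "1 \<le> E" using d0 \<eta>0 by (simp add: E_def)
    have "1 + D / \<eta> = 1 + (d + 3 * \<bar>t - t'\<bar>) / \<eta> + 360 * (h / \<eta>)"
      by (simp add: D_def H_def add_divide_distrib)
    also have "\<dots> \<le> 3 * E + 360 * ((A + 4) * E\<^sup>2)"
    proof (intro add_mono mult_left_mono)
      have "(d + 3 * \<bar>t - t'\<bar>) / \<eta> \<le> (3 * (d + \<bar>t - t'\<bar>)) / \<eta>" using d0 \<eta>0 by (intro divide_right_mono) auto
      then show "1 + (d + 3 * \<bar>t - t'\<bar>) / \<eta> \<le> 3 * E" by (simp add: E_def)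
      have "h / \<eta> \<le> (A + 4) * (1 + d / \<eta>)\<^sup>2"
        using scale_compare(1)[OF k t big A(1) A(3)] by (simp add: h_def \<eta>_def d_def)
      also have "\<dots> \<le> (A + 4) * E\<^sup>2"
        using d0 \<eta>0 A(1) by (intro mult_left_mono power_mono) (auto simp: E_def divide_right_mono)
      finally show "h / \<eta> \<le> (A + 4) * E\<^sup>2" .
    qed auto
    also have "\<dots> \<le> 3 * E\<^sup>2 + 360 * ((A + 4) * E\<^sup>2)"
      using self_le_power[OF E1, of 2] by simp
    also have "\<dots> \<le> 360 * (A + 5) * E\<^sup>2" by (simp add: algebra_simps)
    finally have "l \<le> ln (360 * (A + 5) * E\<^sup>2)" unfolding l_def using De by (intro ln_mono) auto
    also have "\<dots> = ln (360 * (A + 5)) + 2 * m"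
      using A(1) E1 by (simp add: ln_mult_pos ln_realpow m_def E_def[symmetric])
    finally have "1 + l \<le> (1 + ln (360 * (A + 5))) + 2 * m" by simp
    moreover have "0 \<le> ln (360 * (A + 5))" using A(1) by (intro ln_ge_zero) auto
    then have "0 \<le> ln (360 * (A + 5)) * m" using m0 by simp
    ultimately show ?thesis using m0 by (simp add: algebra_simps)
  qed
  have lf_le2: "norm (lf k z - lf k z') \<le> KD A * (1 + m)\<^sup>2"
  proof -
    have "(1 + l)\<^sup>2 \<le> ((3 + ln (360 * (A + 5))) * (1 + m))\<^sup>2" using lm l0 by (intro power_mono) auto
    then have "12 * (KU + 8) * (1 + l)\<^sup>2 \<le> 12 * (KU + 8) * ((3 + ln (360 * (A + 5))) * (1 + m))\<^sup>2"
      using KU_nonneg by (intro mult_left_mono) auto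
    then show ?thesis using lf_le by (simp add: KD_def power_mult_distrib)
  qed
  have KC0: "0 \<le> KC A"
  proof -
    have "0 \<le> ln (16 * (A + 5))" using A(1) by (intro ln_ge_zero) auto
    then show ?thesis using A(1) KU_nonneg by (simp add: KC_def)
  qed
  have m1: "1 + m \<le> (1 + m)\<^sup>2" using self_le_power[of "1 + m" 2] m0 by simp
  have c1: "KC A * (1 + ln (1 + norm (cis u - zr k) / eta k)) \<le> KC A * (1 + m)\<^sup>2" if "u = t \<or> u = t'" for u
  proof (intro mult_left_mono KC0 order_trans[OF _ m1] add_left_mono)
    have "norm (cis u - zr k) \<le> d + \<bar>t - t'\<bar>"
      using that norm_triangle_ineq[of "cis t' - cis t" "cis t - zr k"] cis_dist[of t' t] by (auto simp: d_def abs_minus_commute)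
    then show "ln (1 + norm (cis u - zr k) / eta k) \<le> m"
      unfolding m_def \<eta>_def using eta_pos[of k] d0
      by (intro ln_mono add_left_mono divide_right_mono) (auto simp: add_pos_nonneg)
  qed
  have "\<bar>Im (lf k z) - Im (lf k z')\<bar> \<le> KD A * (1 + m)\<^sup>2"
    using abs_Im_le_cmod[of "lf k z - lf k z'"] lf_le2 by simp
  then have "\<bar>pi * real (NN k (2 * cos t)) - pi * real (NN k (2 * cos t')) - (Phi t - Phi t')\<bar>
      \<le> KC A * (1 + m)\<^sup>2 + KC A * (1 + m)\<^sup>2 + KD A * (1 + m)\<^sup>2"
    using zc zc' c1[of t] c1[of t'] by linarith
  then show ?thesis by (simp add: m_def d_def \<eta>_def algebra_simps)
qed

lemma lf_cnj:
  assumes z: "norm z < 1"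
  shows "lf k (cnj z) = cnj (lf k z)"
proof -
  have "Ln (1 - cnj z * zr i) + Ln (1 - cnj z * cnj (zr i)) = cnj (Ln (1 - z * zr i) + Ln (1 - z * cnj (zr i)))"
    if i: "i \<in> I - {k}" for i
  proof -
    have n1: "norm (zr i) = 1" "norm (cnj (zr i)) = 1" using norm_zr[of i] i by auto
    have "cnj (Ln (1 - z * zr i)) = Ln (cnj (1 - z * zr i))"
      using Re_one_minus_pos[OF z n1(1)] by (intro cnj_Ln) (auto simp: complex_nonpos_Reals_iff)
    moreover have "cnj (Ln (1 - z * cnj (zr i))) = Ln (cnj (1 - z * cnj (zr i)))"
      using Re_one_minus_pos[OF z n1(2)] by (intro cnj_Ln) (auto simp: complex_nonpos_Reals_iff)
    ultimately show ?thesis by (simp add: add.commute)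
  qed
  then show ?thesis by (simp add: lf_def cnj_sum)
qed

text \<open>Near the edge the imaginary part of \<open>lf\<close> can be bounded outright:
  \<open>lf\<close> commutes with conjugation, so twice this part is the oscillation between
  \<open>z\<close> and \<open>cnj z\<close>. The path crosses the real axis at a depth of order
  \<open>sin t\<close>, which is admissible because
  \<open>1000 <= (n * sin t ^ 3) * (n ^ 2 * nu ^ 3)\<close> gives
  \<open>10 <= n * sin t * nu\<close>.\<close>

lemma edge_count:
  assumes k: "k \<in> I" and t: "0 < t" "t < pi" and big: "1000 \<le> real n * sin t ^ 3" and small: "sin t \<le> 3 / 20"
    and A: "0 \<le> A" "\<bar>1 - p\<bar> + 2 * \<bar>q\<bar> \<le> A * (sin t)\<^sup>2" "\<nu> \<le> A * (sin t)\<^sup>2"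
  shows "\<bar>pi * real (NN k (2 * cos t)) - Phi t\<bar>
    \<le> KC A * (1 + ln (1 + norm (cis t - zr k) / eta k))
      + (KU + 8 * ln (1 + (norm (cis t - zr k) + 6 * sin t) / eta k)) * (1 + 2 * ln (real n * sin t ^ 3))"
proof -
  define s h where "s = sin t" and "h = 1 / (real n * (sin t)\<^sup>2)"
  obtain z where z: "norm z < 1" "norm (z - cis t) \<le> 16 * h" "3 * h \<le> 1 - norm z" "49 / 50 * s \<le> Im z"
    and zc: "\<bar>pi * real (NN k (2 * cos t)) - Phi t + Im (lf k z)\<bar> \<le> KC A * (1 + ln (1 + norm (cis t - zr k) / eta k))"
    using count_at[OF k t big A] unfolding h_def s_def by blast
  have s: "0 < s" "s \<le> 3 / 20" using sin_gt_zero[OF t] small by (auto simp: s_def)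
  have h0: "0 < h" using s n0 by (simp add: h_def s_def)
  have hs: "1000 * h \<le> s"
  proof -
    have "1000 * h = 1000 / (real n * s\<^sup>2)" by (simp add: h_def s_def)
    also have "\<dots> \<le> s" using big s n0
      by (simp add: pos_divide_le_eq s_def power2_eq_square power3_eq_cube ac_simps)
    finally show ?thesis .
  qed
  define H where "H = 22 / 10 * s"
  have H: "H \<le> 1 / 3" "0 < H" "16 * h \<le> H" using s hs h0 by (auto simp: H_def)
  have zn: "z \<noteq> 0" using z(4) s by auto
  define e where "e = z / of_real (norm z)"
  note R = radial_direction[OF zn less_imp_le[OF z(1)] z(2) norm_cis, folded e_def]
  have adm: "admissible z" "admissible (cnj z)"
    using near_admissible[OF t z(1)] near_admissible[OF t, of "cnj z"] z s by (auto simp: h_def s_def)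
  have ime: "\<bar>Im e\<bar> \<le> s + 32 * h" using abs_Im_le_cmod[of "e - cis t"] R(4) s by (simp add: s_def)
  have ee: "norm (e - cnj e) \<le> H"
  proof -
    have "e - cnj e = of_real (2 * Im e) * \<i>" by (simp add: complex_eq_iff)
    then have "norm (e - cnj e) = 2 * \<bar>Im e\<bar>" by (simp add: norm_mult)
    then show ?thesis using ime hs by (simp add: H_def)
  qed
  define D where "D = norm (cis t - zr k) + 6 * s"
  have cz: "of_real (1 - (1 - norm z)) * cnj e = cnj z" using arg_cong[OF R(2), of cnj] by simp
  have "norm (lf k (of_real (1 - (1 - norm z)) * e) - lf k (of_real (1 - (1 - norm z)) * cnj e))
       \<le> 2 * (KU + 8 * ln (1 + D / eta k)) * (1 + ln (H / (1 - norm z)) + ln (H / (1 - norm z)))"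
  proof (rule lf_diff[OF k R(1) _ _ _ _ _ H(1) ee])
    show "norm (cnj e) = 1" using R(1) by simp
    show "0 < 1 - norm z" "0 < 1 - norm z" using z by auto
    show "1 - norm z \<le> H" "1 - norm z \<le> H" using R(3) H by auto
    show "admissible (of_real (1 - (1 - norm z)) * e)" unfolding R(2) by (rule adm)
    show "admissible (of_real (1 - (1 - norm z)) * cnj e)" unfolding cz by (rule adm)
    have "norm (e - zr k) \<le> 32 * h + norm (cis t - zr k)"
      using norm_triangle_ineq[of "e - cis t" "cis t - zr k"] R(4) by simp
    then show "norm (e - zr k) + 2 * H \<le> D" using hs s by (simp add: D_def H_def)
    fix w assume w: "w \<in> closed_segment (of_real (1 - H) * e) (of_real (1 - H) * cnj e)"
    have nH: "norm (of_real (1 - H) * e) = 1 - H" "norm (of_real (1 - H) * cnj e) = 1 - H"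
      using H R(1) by (simp_all add: norm_mult del: of_real_diff)
    have "closed_segment (of_real (1 - H) * e) (of_real (1 - H) * cnj e) \<subseteq> cball 0 (1 - H)"
      by (intro closed_segment_subset) (use nH in \<open>auto simp del: of_real_diff\<close>)
    then have wn: "H \<le> 1 - norm w" using w by auto
    have "1000 * 1 \<le> (real n * s ^ 3) * ((real n)\<^sup>2 * \<nu> ^ 3)"
      using big nu3 by (intro mult_mono) (auto simp: s_def)
    also have "\<dots> = (real n * s * \<nu>) ^ 3" by (simp add: power2_eq_square power3_eq_cube)
    finally have "10 ^ 3 \<le> (real n * s * \<nu>) ^ 3" by simp
    then have "10 \<le> real n * s * \<nu>" using n0 s nu0 by (subst (asm) power_mono_iff) auto
    moreover have "real n * (H * \<nu>) = 22 / 10 * (real n * s * \<nu>)" by (simp add: H_def)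
    moreover have "H * \<nu> \<le> (1 - norm w) * ((Im w)\<^sup>2 + \<nu>)" using wn H nu0 by (intro mult_mono) auto
    then have "real n * (H * \<nu>) \<le> real n * ((1 - norm w) * ((Im w)\<^sup>2 + \<nu>))" by (intro mult_left_mono) auto
    ultimately have "1 < real n * ((1 - norm w) * ((Im w)\<^sup>2 + \<nu>))" by linarith
    then show "admissible w" using wn H by (simp add: admissible_def mult.assoc)
  qed
  then have key: "norm (lf k z - lf k (cnj z))
      \<le> 2 * (KU + 8 * ln (1 + D / eta k)) * (1 + ln (H / (1 - norm z)) + ln (H / (1 - norm z)))"
    unfolding R(2) cz .
  have "lf k z - lf k (cnj z) = of_real (2 * Im (lf k z)) * \<i>"
    by (simp add: lf_cnj[OF z(1)] complex_eq_iff)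
  then have "norm (lf k z - lf k (cnj z)) = 2 * \<bar>Im (lf k z)\<bar>" by (simp add: norm_mult)
  then have im: "\<bar>Im (lf k z)\<bar> \<le> (KU + 8 * ln (1 + D / eta k)) * (1 + 2 * ln (H / (1 - norm z)))"
  proof -
    have "i \<le> a * (1 + 2 * b)" if "u \<le> 2 * a * (1 + b + b)" "u = 2 * i" for u i a b :: real
      using that by (simp add: algebra_simps)
    then show ?thesis using key \<open>norm (lf k z - lf k (cnj z)) = 2 * \<bar>Im (lf k z)\<bar>\<close> by blast
  qed
  have "H / (1 - norm z) \<le> H / (3 * h)" using z h0 H by (intro divide_left_mono mult_pos_pos) auto
  also have "\<dots> \<le> s / h" using h0 s by (simp add: H_def divide_simps)
  also have "\<dots> = real n * s ^ 3" by (simp add: h_def s_def[symmetric] power2_eq_square power3_eq_cube)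
  finally have "ln (H / (1 - norm z)) \<le> ln (real n * s ^ 3)" using H z by (intro ln_mono) auto
  moreover have "0 \<le> D" using s by (simp add: D_def)
  then have "0 \<le> KU + 8 * ln (1 + D / eta k)" using KU_nonneg eta_pos[of k] by simp
  ultimately have "(KU + 8 * ln (1 + D / eta k)) * (1 + 2 * ln (H / (1 - norm z)))
      \<le> (KU + 8 * ln (1 + D / eta k)) * (1 + 2 * ln (real n * s ^ 3))"
    by (intro mult_left_mono) auto
  then have "\<bar>Im (lf k z)\<bar> \<le> (KU + 8 * ln (1 + D / eta k)) * (1 + 2 * ln (real n * s ^ 3))" using im by linarith
  then show ?thesis using zc unfolding D_def s_def by linarith
qed

text \<open>
  If the support were shorter than that of the semicircle law, the polynomial part would grow
  exponentially beyond the largest point, against the Lagrange bound there.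
\<close>

lemma edge_growth:
  assumes b: "b \<in> I" "c b = 2" and r: "0 < r" "r \<le> 1 / 2"
    and adm: "1 < real n * (1 - exp (- r)) * \<nu>"
    and out: "norm (L b (of_real (exp (- r)))) * exp (real n * (r - p * sinh (2 * r) / 2 - q * sinh r) - r) \<le> C * lam b"
  shows "real n * (r - p * sinh (2 * r) / 2 - q * sinh r) - r \<le> KU + 8 * ln (1 + real n * \<nu> * r)"
proof -
  define x where "x = exp (- r)"
  have x: "0 < x" "x < 1" using r by (auto simp: x_def)
  have zb: "zr b = 1" using b by (simp add: circ_root_def complex_eq_iff)
  have eta: "eta b = 1 / (real n * \<nu>)" by (simp add: eta_def zb)
  have ad: "admissible (of_real x)" using adm x by (simp add: admissible_def x_def)
  have "C * lam b * exp (- uu b (of_real x)) * exp (real n * (r - p * sinh (2 * r) / 2 - q * sinh r) - r) \<le> C * lam b"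
    using out norm_L_uu[of "of_real x" b] x b by (simp add: x_def)
  then have "exp (real n * (r - p * sinh (2 * r) / 2 - q * sinh r) - r - uu b (of_real x)) \<le> 1"
    using C1 lam_pos[OF b(1)] by (simp add: exp_diff exp_minus field_simps)
  then have "real n * (r - p * sinh (2 * r) / 2 - q * sinh r) - r \<le> uu b (of_real x)" by simp
  also have "\<dots> \<le> KU + 8 * ln (1 + norm (of_real x - zr b) / eta b)" by (rule uu_le[OF b(1) ad])
  also have "\<dots> \<le> KU + 8 * ln (1 + real n * \<nu> * r)"
  proof (intro add_left_mono mult_left_mono ln_mono)
    have "norm (of_real x - zr b) = \<bar>x - 1\<bar>" unfolding zb by (metis norm_of_real of_real_1 of_real_diff)
    also have "\<dots> = 1 - x" using x by simp
    also have "1 - x \<le> r" using exp_ge_add_one_self[of "- r"] by (simp add: x_def)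
    finally have "norm (of_real x - zr b) / eta b \<le> r / eta b" using eta_pos[of b] by (intro divide_right_mono) auto
    then show "norm (of_real x - zr b) / eta b \<le> real n * \<nu> * r" by (simp add: eta ac_simps)
    have "0 \<le> norm (of_real x - zr b) / eta b" using eta_pos[of b] by simp
    then show "0 < 1 + norm (of_real x - zr b) / eta b" by linarith
  qed auto
  finally show ?thesis .
qed

end

section \<open>The rescaled configuration\<close>

text \<open>\<open>edge_scale n\<close> is the natural scale at the edge, in the angle \<open>t\<close> with \<open>x = 2 cos t\<close>.\<close>

definition edge_scale :: "nat \<Rightarrow> real" where "edge_scale n = real n powr (- 1 / 3)"

lemma edge_scale: "1 \<le> n \<Longrightarrow> 0 < edge_scale n" "1 \<le> n \<Longrightarrow> real n * edge_scale n ^ 3 = 1"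
proof -
  assume n: "1 \<le> n"
  then show "0 < edge_scale n" by (simp add: edge_scale_def)
  have "edge_scale n ^ 3 = real n powr (- 1)"
    using n by (simp add: edge_scale_def powr_power)
  then show "real n * edge_scale n ^ 3 = 1" using n by (simp add: powr_minus)
qed

lemma edge_scale_half: "8 \<le> n \<Longrightarrow> edge_scale n \<le> 1 / 2"
proof (rule ccontr)
  assume n: "8 \<le> n" and "\<not> edge_scale n \<le> 1 / 2"
  then have "(1 / 2) ^ 3 < edge_scale n ^ 3" by (intro power_strict_mono) auto
  then have "8 * (1 / 2) ^ 3 < real n * edge_scale n ^ 3" using n by (intro mult_le_less_imp_less) auto
  then show False using edge_scale(2)[of n] n by (simp add: power3_eq_cube)
qed

definition lagr_weight :: "nat \<Rightarrow> (nat \<Rightarrow> real) \<Rightarrow> nat \<Rightarrow> real \<Rightarrow> real" where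
  "lagr_weight n x j t = (\<Prod>i\<in>{1..n} - {j}. \<bar>t - x i\<bar>) * exp (- real n * t\<^sup>2 / 4)"

text \<open>The deterministic input. The Lagrange bound is asked on [-4, 4] because the rescaled
  circle may cover slightly more than [-2, 2] and because \<open>pin_right\<close> evaluates the
  weight beyond the extreme points.\<close>

definition good :: "real \<Rightarrow> real \<Rightarrow> nat \<Rightarrow> (nat \<Rightarrow> real) \<Rightarrow> bool" where
  "good C K n x \<longleftrightarrow> (\<forall>j\<in>{1..n}. 0 < lagr_weight n x j (x j)
     \<and> (\<forall>t. \<bar>t\<bar> \<le> 4 \<longrightarrow> lagr_weight n x j t \<le> C * lagr_weight n x j (x j))
     \<and> \<bar>x j\<bar> \<le> 2 + K * (edge_scale n)\<^sup>2)"

lemma lagr_weight_reflect: "lagr_weight n (\<lambda>i. - x i) j t = lagr_weight n x j (- t)"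
proof -
  have "\<bar>t - - x i\<bar> = \<bar>- t - x i\<bar>" for i by (simp add: abs_minus_commute)
  then show ?thesis by (simp add: lagr_weight_def)
qed

lemma good_reflect: "good C K n x \<Longrightarrow> good C K n (\<lambda>i. - x i)"
  unfolding good_def lagr_weight_reflect by auto

lemma good_distinct:
  assumes "good C K n x" "i \<in> {1..n}" "j \<in> {1..n}" "i \<noteq> j"
  shows "x i \<noteq> x j"
proof
  assume "x i = x j"
  then have "(\<Prod>k\<in>{1..n} - {j}. \<bar>x j - x k\<bar>) = 0"
    using assms by (intro prod_zero bexI[of _ i]) auto
  moreover have "0 < lagr_weight n x j (x j)" using assms unfolding good_def by blast
  ultimately show False unfolding lagr_weight_def by (metis less_irrefl mult_zero_left)
qed

text \<open>The configuration rescaled so that its extreme points become \<open>- 2\<close> and \<open>2\<close>.\<close>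

definition cent :: "nat \<Rightarrow> (nat \<Rightarrow> real) \<Rightarrow> real" where
  "cent n x = (Max (x ` {1..n}) + Min (x ` {1..n})) / 2"

definition scal :: "nat \<Rightarrow> (nat \<Rightarrow> real) \<Rightarrow> real" where
  "scal n x = (Max (x ` {1..n}) - Min (x ` {1..n})) / 4"

definition resc :: "nat \<Rightarrow> (nat \<Rightarrow> real) \<Rightarrow> nat \<Rightarrow> real" where
  "resc n x i = (x i - cent n x) / scal n x"

lemma frame_basic:
  assumes g: "good C K n x" and n: "2 \<le> n"
  shows "0 < scal n x" and "\<And>i. i \<in> {1..n} \<Longrightarrow> \<bar>resc n x i\<bar> \<le> 2"
    and "\<exists>i\<in>{1..n}. resc n x i = 2" and "\<exists>i\<in>{1..n}. resc n x i = - 2"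
    and "scal n x \<le> 1 + K * (edge_scale n)\<^sup>2 / 2"
    and "\<bar>cent n x\<bar> + 2 * scal n x \<le> 2 + K * (edge_scale n)\<^sup>2"
    and "\<And>i. i \<in> {1..n} \<Longrightarrow> x i = cent n x + scal n x * resc n x i"
proof -
  define Mx Mn where "Mx = Max (x ` {1..n})" and "Mn = Min (x ` {1..n})"
  have fin: "finite (x ` {1..n})" and ne: "x ` {1..n} \<noteq> {}" using n by auto
  have mx: "Mx \<in> x ` {1..n}" and mn: "Mn \<in> x ` {1..n}"
    unfolding Mx_def Mn_def using Max_in[OF fin ne] Min_in[OF fin ne] by auto
  have bd: "Mn \<le> x i" "x i \<le> Mx" if "i \<in> {1..n}" for i
    unfolding Mx_def Mn_def using fin that by auto
  have lt: "Mn < Mx"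
  proof -
    have "x 1 \<noteq> x 2" using good_distinct[OF g, of 1 2] n by auto
    moreover have "Mn \<le> x 1" "x 1 \<le> Mx" "Mn \<le> x 2" "x 2 \<le> Mx" using bd n by auto
    ultimately show ?thesis by linarith
  qed
  define m a where "m = cent n x" and "a = scal n x"
  have ma: "m = (Mx + Mn) / 2" "a = (Mx - Mn) / 4"
    by (simp_all add: m_def a_def cent_def scal_def Mx_def Mn_def)
  have a0: "0 < a" using lt ma by simp
  then show "0 < scal n x" by (simp add: a_def)
  have r: "resc n x i = (x i - m) / a" for i by (simp add: resc_def m_def a_def)
  show "\<bar>resc n x i\<bar> \<le> 2" if "i \<in> {1..n}" for i
  proof -
    have "\<bar>x i - m\<bar> \<le> 2 * a" using bd[OF that] ma by (simp add: abs_le_iff field_simps)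
    then show ?thesis using a0 by (simp add: r pos_divide_le_eq)
  qed
  obtain i1 where i1: "i1 \<in> {1..n}" "x i1 = Mx" using mx by auto
  obtain i2 where i2: "i2 \<in> {1..n}" "x i2 = Mn" using mn by auto
  show "\<exists>i\<in>{1..n}. resc n x i = 2"
    using i1 a0 ma by (intro bexI[of _ i1]) (auto simp: r field_simps)
  show "\<exists>i\<in>{1..n}. resc n x i = - 2"
    using i2 a0 ma by (intro bexI[of _ i2]) (auto simp: r field_simps)
  have b: "\<bar>Mx\<bar> \<le> 2 + K * (edge_scale n)\<^sup>2" "\<bar>Mn\<bar> \<le> 2 + K * (edge_scale n)\<^sup>2"
    using g i1 i2 by (auto simp: good_def)
  then show "scal n x \<le> 1 + K * (edge_scale n)\<^sup>2 / 2" using ma by (simp add: a_def[symmetric])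
  show "\<bar>cent n x\<bar> + 2 * scal n x \<le> 2 + K * (edge_scale n)\<^sup>2"
    using b ma unfolding m_def[symmetric] a_def[symmetric] by (auto simp: abs_if split: if_splits)
  show "x i = cent n x + scal n x * resc n x i" for i
    using a0 by (simp add: r m_def[symmetric] a_def[symmetric])
qed

text \<open>Expanding \<open>(m + a * u)^2 / 4\<close> gives the origin of the parameters:
  \<open>p = a^2\<close> from the quadratic term and \<open>q = a * m\<close> from the mixed
  one.\<close>

lemma rweight_lagr_weight:
  assumes g: "good C K n x" and n: "2 \<le> n" and j: "j \<in> {1..n}"
  defines "m \<equiv> cent n x" and "a \<equiv> scal n x"
  shows "rweight (resc n x) n (a\<^sup>2) (a * m) ({1..n} - {j}) u * (a ^ (n - 1) * exp (- real n * m\<^sup>2 / 4))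
     = lagr_weight n x j (m + a * u)"
proof -
  have a0: "0 < a" using frame_basic(1)[OF g n] by (simp add: a_def)
  have "\<bar>m + a * u - x i\<bar> = a * \<bar>u - resc n x i\<bar>" if "i \<in> {1..n}" for i
  proof -
    have "m + a * u - x i = a * (u - resc n x i)"
      using frame_basic(7)[OF g n that] by (simp add: m_def a_def algebra_simps)
    then show ?thesis using a0 by (simp add: abs_mult)
  qed
  then have "(\<Prod>i\<in>{1..n} - {j}. \<bar>m + a * u - x i\<bar>) = (\<Prod>i\<in>{1..n} - {j}. a * \<bar>u - resc n x i\<bar>)"
    by (intro prod.cong) auto
  also have "\<dots> = a ^ (n - 1) * (\<Prod>i\<in>{1..n} - {j}. \<bar>u - resc n x i\<bar>)"
    using j by (simp add: prod.distrib)
  finally have P: "(\<Prod>i\<in>{1..n} - {j}. \<bar>m + a * u - x i\<bar>) = a ^ (n - 1) * (\<Prod>i\<in>{1..n} - {j}. \<bar>u - resc n x i\<bar>)" .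
  have E: "- real n * (m + a * u)\<^sup>2 / 4 = - real n * (a\<^sup>2 * u\<^sup>2 / 4 + a * m * u / 2) + - real n * m\<^sup>2 / 4"
    by (simp add: power2_eq_square field_simps)
  show ?thesis unfolding lagr_weight_def P rweight_def E exp_add by (simp only: ac_simps)
qed

lemma frame_config:
  assumes g: "good C K n x" and n: "2 \<le> n" and C: "1 \<le> C" and K: "K * (edge_scale n)\<^sup>2 \<le> 1 / 10"
  defines "m \<equiv> cent n x" and "a \<equiv> scal n x"
  assumes \<nu>: "1 - a\<^sup>2 + \<bar>a * m\<bar> \<le> \<nu>" "0 < \<nu>" "2 \<le> real n * \<nu>" "1 \<le> (real n)\<^sup>2 * \<nu> ^ 3"
  shows "lagrange_config {1..n} (resc n x) n (a\<^sup>2) (a * m) \<nu> C"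
proof
  note fb = frame_basic[OF g n, folded m_def a_def]
  show "finite {1..n}" "card {1..n} = n" by simp_all
  show "\<And>i. i \<in> {1..n} \<Longrightarrow> \<bar>resc n x i\<bar> \<le> 2" by (rule fb(2))
  show "\<exists>i\<in>{1..n}. resc n x i = 2" "\<exists>i\<in>{1..n}. resc n x i = - 2" by (rule fb(3), rule fb(4))
  show "0 \<le> a\<^sup>2" by simp
  have "a \<le> 2" using fb(5) K by simp
  then show "a\<^sup>2 \<le> 4" using power_mono[of a 2 2] fb(1) by simp
  show "1 - a\<^sup>2 + \<bar>a * m\<bar> \<le> \<nu>" "0 < \<nu>" "2 \<le> real n * \<nu>" "1 \<le> (real n)\<^sup>2 * \<nu> ^ 3" by (rule \<nu>)+
  show "1 \<le> C" by (rule C)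
  define e where "e = a ^ (n - 1) * exp (- real n * m\<^sup>2 / 4)"
  have e0: "0 < e" using fb(1) by (simp add: e_def)
  have rw: "rweight (resc n x) n (a\<^sup>2) (a * m) ({1..n} - {j}) u = lagr_weight n x j (m + a * u) / e"
    if "j \<in> {1..n}" for j u
  proof -
    have "rweight (resc n x) n (a\<^sup>2) (a * m) ({1..n} - {j}) u * e = lagr_weight n x j (m + a * u)"
      unfolding m_def a_def e_def by (rule rweight_lagr_weight[OF g n that])
    then show ?thesis using e0 by (metis less_irrefl nonzero_mult_div_cancel_right)
  qed
  have at: "norm (wpoly (resc n x) n (a\<^sup>2) (a * m) ({1..n} - {j}) (circ_root (resc n x j)))
     = lagr_weight n x j (x j) / e * exp (real n * a\<^sup>2 / 2)" if j: "j \<in> {1..n}" for j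
  proof -
    define J where "J = {1..n} - {j}"
    show ?thesis
      using norm_wpoly_unit[OF norm_circ_root[OF fb(2)[OF j]]] fb(7)[OF j] rw[OF j, folded J_def]
      unfolding J_def[symmetric] by simp
  qed
  fix j assume j: "j \<in> {1..n}"
  have pos: "0 < lagr_weight n x j (x j)" using g j by (simp add: good_def)
  then show "wpoly (resc n x) n (a\<^sup>2) (a * m) ({1..n} - {j}) (circ_root (resc n x j)) \<noteq> 0"
    using at[OF j] e0 by (metis divide_pos_pos exp_gt_zero less_irrefl mult_pos_pos norm_zero)
  fix w :: complex assume w: "norm w = 1"
  have "\<bar>m + a * (2 * Re w)\<bar> \<le> \<bar>m\<bar> + 2 * a"
  proof -
    have "\<bar>Re w\<bar> \<le> 1" using abs_Re_le_cmod[of w] w by simp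
    then have "a * (2 * \<bar>Re w\<bar>) \<le> a * 2" using fb(1) by (intro mult_left_mono) auto
    moreover have "\<bar>a * (2 * Re w)\<bar> = a * (2 * \<bar>Re w\<bar>)" using fb(1) by (simp add: abs_mult)
    ultimately show ?thesis by linarith
  qed
  also have "\<dots> \<le> 4" using fb(6) K by simp
  finally have "lagr_weight n x j (m + a * (2 * Re w)) \<le> C * lagr_weight n x j (x j)"
    using g j by (simp add: good_def)
  then have "lagr_weight n x j (m + a * (2 * Re w)) / e * exp (real n * a\<^sup>2 / 2)
      \<le> C * lagr_weight n x j (x j) / e * exp (real n * a\<^sup>2 / 2)"
    using e0 by (intro mult_right_mono divide_right_mono) auto
  then show "norm (wpoly (resc n x) n (a\<^sup>2) (a * m) ({1..n} - {j}) w)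
      \<le> C * norm (wpoly (resc n x) n (a\<^sup>2) (a * m) ({1..n} - {j}) (circ_root (resc n x j)))"
    unfolding at[OF j] norm_wpoly_unit[OF w] rw[OF j] by simp
qed

section \<open>Pinning the extreme points\<close>

lemma increasing_from_zero:
  fixes g g' :: "real \<Rightarrow> real"
  assumes "0 \<le> r" and "0 \<le> g 0" and "\<And>x. 0 \<le> x \<Longrightarrow> x \<le> r \<Longrightarrow> (g has_real_derivative g' x) (at x)"
    and "\<And>x. 0 \<le> x \<Longrightarrow> x \<le> r \<Longrightarrow> 0 \<le> g' x"
  shows "0 \<le> g r"
proof -
  have "g 0 \<le> g r" using assms by (intro DERIV_nonneg_imp_nondecreasing[OF assms(1)]) blast
  then show ?thesis using assms(2) by linarith
qed

lemma sinh_ge: "0 \<le> r \<Longrightarrow> r \<le> sinh r" for r :: real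
  using increasing_from_zero[of r "\<lambda>x. sinh x - x" "\<lambda>x. cosh x - 1"]
  by (force intro!: derivative_eq_intros simp: cosh_real_ge_1)

lemma sinh_ge_cubic: "0 \<le> r \<Longrightarrow> r + r ^ 3 / 6 \<le> sinh r" for r :: real
proof -
  have c: "0 \<le> cosh x - 1 - x\<^sup>2 / 2" if "0 \<le> x" for x :: real
    by (rule increasing_from_zero[of x "\<lambda>x. cosh x - 1 - x\<^sup>2 / 2" "\<lambda>x. sinh x - x"])
       (use that in \<open>auto intro!: derivative_eq_intros simp: sinh_ge\<close>)
  assume r: "0 \<le> r"
  have "0 \<le> sinh r - r - r ^ 3 / 6"
    by (rule increasing_from_zero[of r "\<lambda>x. sinh x - x - x ^ 3 / 6" "\<lambda>x. cosh x - 1 - x\<^sup>2 / 2"])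
       (use r c in \<open>auto intro!: derivative_eq_intros\<close>)
  then show ?thesis by simp
qed

lemma cosh_le_square: "0 \<le> x \<Longrightarrow> x \<le> 1 \<Longrightarrow> cosh x \<le> 1 + 3 * x\<^sup>2" for x :: real
proof -
  have c0: "cosh x \<le> 6" if "0 \<le> x" "x \<le> 1" for x :: real
  proof -
    have "exp x \<le> exp 1" using that by simp
    moreover have "exp (- x) \<le> 1" using that by simp
    ultimately have "exp x + exp (- x) \<le> 12" using exp_le by linarith
    then show ?thesis by (simp add: cosh_def)
  qed
  have s: "0 \<le> 6 * x - sinh x" if "0 \<le> x" "x \<le> 1" for x :: real
    by (rule increasing_from_zero[of x "\<lambda>x. 6 * x - sinh x" "\<lambda>x. 6 - cosh x"])
       (use that c0 in \<open>auto intro!: derivative_eq_intros\<close>)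
  assume x: "0 \<le> x" "x \<le> 1"
  have "0 \<le> 1 + 3 * x\<^sup>2 - cosh x"
    by (rule increasing_from_zero[of x "\<lambda>x. 1 + 3 * x\<^sup>2 - cosh x" "\<lambda>x. 6 * x - sinh x"])
       (use x s in \<open>auto intro!: derivative_eq_intros\<close>)
  then show ?thesis by simp
qed

lemma sinh_le_cubic:
  fixes r :: real
  assumes "0 \<le> r" "r \<le> 1"
  shows "sinh r \<le> r + r ^ 3"
proof -
  have c: "0 \<le> 1 + 3 * x\<^sup>2 - cosh x" if "0 \<le> x" "x \<le> 1" for x :: real
    using cosh_le_square[OF that] by simp
  have "0 \<le> r + r ^ 3 - sinh r"
    by (rule increasing_from_zero[of r "\<lambda>x. x + x ^ 3 - sinh x" "\<lambda>x. 1 + 3 * x\<^sup>2 - cosh x"])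
       (use assms c in \<open>auto intro!: derivative_eq_intros\<close>)
  then show ?thesis by simp
qed

text \<open>The constants of the locale depend on \<open>C\<close> alone and are exported with
  \<open>C\<close> as argument; the absolute value makes them nonnegative where no configuration is
  at hand. The numbers solve \<open>y / 10 <= KU + 1 + 8 * (y / 160 + 19)\<close> for
  \<open>y\<close>.\<close>

definition pinC :: "real \<Rightarrow> real" where "pinC C = 20 * \<bar>lagrange_config.KU C\<bar> + 3100"

text \<open>The locale is entered with \<open>nu\<close> equal to the defect kappa that is to be
  bounded. Evaluating slightly beyond the right extreme point, \<open>edge_growth\<close> then
  opposes \<open>y = n * kappa ^ (3 / 2)\<close> to a logarithm of \<open>y\<close>. For
  \<open>m <= 0\<close> the linear term helps at the right end; the other sign is handled by
  reflection.\<close>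

lemma pin_right:
  assumes g: "good C K n x" and n: "8 \<le> n" and C: "1 \<le> C" and K: "K * (edge_scale n)\<^sup>2 \<le> 1 / 10"
  defines "m \<equiv> cent n x" and "a \<equiv> scal n x"
  assumes q: "m \<le> 0" and big: "(edge_scale n)\<^sup>2 < 1 - a\<^sup>2 + \<bar>a * m\<bar>"
  shows "real n * sqrt (1 - a\<^sup>2 + \<bar>a * m\<bar>) ^ 3 \<le> pinC C"
proof -
  have n2: "2 \<le> n" using n by simp
  note fb = frame_basic[OF g n2, folded m_def a_def]
  define \<kappa> w where "\<kappa> = 1 - a\<^sup>2 + \<bar>a * m\<bar>" and "w = sqrt \<kappa>"
  define \<delta> where "\<delta> = edge_scale n"
  have \<delta>: "0 < \<delta>" "real n * \<delta> ^ 3 = 1" "\<delta> \<le> 1 / 2" using edge_scale[of n] edge_scale_half[OF n] n by (auto simp: \<delta>_def)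
  have \<kappa>: "\<delta>\<^sup>2 < \<kappa>" using big by (simp add: \<kappa>_def \<delta>_def)
  have \<kappa>0: "0 < \<kappa>" using \<kappa> zero_le_power2[of \<delta>] by linarith
  have w0: "0 < w" "w\<^sup>2 = \<kappa>" using \<kappa>0 by (simp_all add: w_def)
  have a: "0 < a" "a \<le> 21 / 20" using fb(1,5) K by auto
  have m: "\<bar>m\<bar> \<le> 21 / 10" using fb(6) K a by linarith
  have am: "\<bar>a * m\<bar> = - (a * m)" using q a by (simp add: mult_nonneg_nonpos)
  have \<kappa>4: "\<kappa> \<le> 4"
  proof -
    have "a * \<bar>m\<bar> \<le> 21 / 20 * (21 / 10)" using a m by (intro mult_mono) auto
    then have "\<bar>a * m\<bar> \<le> 3" using a by (simp add: abs_mult)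
    then show ?thesis using zero_le_power2[of a] unfolding \<kappa>_def by linarith
  qed
  have w2: "w \<le> 2" using w0 \<kappa>4 power_mono_iff[of w 2 2] by simp
  define y where "y = real n * w ^ 3"
  have \<delta>w: "\<delta> < w" using \<kappa> w0 \<delta> by (metis less_imp_le power2_less_imp_less)
  interpret lagrange_config "{1..n}" "resc n x" n "a\<^sup>2" "a * m" \<kappa> C
    unfolding m_def a_def
  proof (rule frame_config[OF g n2 C])
    show "K * (edge_scale n)\<^sup>2 \<le> 1 / 10" by (rule K)
    show "1 - (scal n x)\<^sup>2 + \<bar>scal n x * cent n x\<bar> \<le> \<kappa>" by (simp add: \<kappa>_def a_def m_def)
    show "0 < \<kappa>" by (rule \<kappa>0)
    show "2 \<le> real n * \<kappa>"
    proof -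
      have "2 \<le> 1 / \<delta>" using \<delta> by (simp add: field_simps)
      also have "\<dots> = real n * \<delta>\<^sup>2" using \<delta> by (simp add: field_simps power2_eq_square power3_eq_cube)
      also have "\<dots> \<le> real n * \<kappa>" using \<kappa> by (intro mult_left_mono) auto
      finally show ?thesis .
    qed
    have "(real n * \<delta> ^ 3)\<^sup>2 = (real n)\<^sup>2 * (\<delta>\<^sup>2) ^ 3" by (simp add: power_mult_distrib flip: power_mult)
    then have "1 = (real n)\<^sup>2 * (\<delta>\<^sup>2) ^ 3" using \<delta>(2) by simp
    also have "\<dots> \<le> (real n)\<^sup>2 * \<kappa> ^ 3" using \<kappa> by (intro mult_left_mono power_mono) auto
    finally show "1 \<le> (real n)\<^sup>2 * \<kappa> ^ 3" .
  qed
  have "y \<le> pinC C"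
  proof (cases "y \<le> 16")
    case True
    then show ?thesis using KU_nonneg by (simp add: pinC_def)
  next
    case False
    \<comment> \<open>A small multiple of \<open>w\<close>, so that the gain
      \<open>w ^ 3 / 8\<close> dominates the cubic error \<open>5 * r ^ 3\<close>.\<close>
    define r where "r = w / 8"
    have r: "0 < r" "r \<le> 1 / 4" using w0 w2 by (auto simp: r_def)
    have er: "r / 2 \<le> 1 - exp (- r)"
    proof -
      have "exp (- r) * (1 + r) \<le> exp (- r) * exp r" using exp_ge_add_one_self[of r] by (intro mult_left_mono) auto
      then have "exp (- r) \<le> 1 / (1 + r)" using r by (simp add: exp_minus field_simps)
      moreover have "1 / (1 + r) \<le> 1 - r / 2"
      proof -
        have "r * r \<le> r * 1" using r by (intro mult_left_mono) auto
        then have "1 \<le> (1 - r / 2) * (1 + r)" using r by (simp add: algebra_simps)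
        then show ?thesis using r by (subst pos_divide_le_eq) auto
      qed
      ultimately show ?thesis by linarith
    qed
    obtain b where b: "b \<in> {1..n}" "resc n x b = 2" using hi by blast
    have adm: "1 < real n * (1 - exp (- r)) * \<kappa>"
    proof -
      have "real n * (r / 2) * \<kappa> = y / 16"
        by (simp add: y_def r_def w0(2)[symmetric] power2_eq_square power3_eq_cube)
      moreover have "real n * (r / 2) * \<kappa> \<le> real n * (1 - exp (- r)) * \<kappa>"
        using er \<kappa>0 by (intro mult_right_mono mult_left_mono) auto
      ultimately show ?thesis using False by linarith
    qed
    define J where "J = {1..n} - {b}"
    define e where "e = a ^ (n - 1) * exp (- real n * m\<^sup>2 / 4)"
    have e0: "0 < e" using a by (simp add: e_def)
    have rw: "rweight (resc n x) n (a\<^sup>2) (a * m) J u = lagr_weight n x b (m + a * u) / e" for u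
    proof -
      have "rweight (resc n x) n (a\<^sup>2) (a * m) J u * e = lagr_weight n x b (m + a * u)"
        unfolding m_def a_def e_def J_def by (rule rweight_lagr_weight[OF g n2 b(1)])
      then show ?thesis using e0 by (metis less_irrefl nonzero_mult_div_cancel_right)
    qed
    define Z z where "Z = 2 * cosh r" and "z = exp (- r)"
    have z0: "0 < z" "z \<le> 1" using r by (auto simp: z_def)
    have Zz: "Z = z + 1 / z" by (simp add: Z_def z_def cosh_def exp_minus field_simps)
    have Z2: "2 \<le> Z" using cosh_real_ge_1[of r] by (simp add: Z_def)
    have out: "norm (wpoly (resc n x) n (a\<^sup>2) (a * m) ({1..n} - {b}) (of_real (exp (- r))))
        * exp (real n * (r - a\<^sup>2 * sinh (2 * r) / 2 - (a * m) * sinh r) - r) \<le> C * lam b"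
    proof -
      have cardJ: "card J = n - 1" using b by (simp add: J_def)
      have "norm (quad (resc n x i) (of_real z)) = z * \<bar>Z - resc n x i\<bar>" if "i \<in> {1..n}" for i
      proof -
        have "quad (resc n x i) (of_real z) = of_real (z * (Z - resc n x i))"
          using z0 unfolding Zz by (simp add: quad_def field_simps power2_eq_square)
        then have "norm (quad (resc n x i) (of_real z)) = \<bar>z * (Z - resc n x i)\<bar>" by (metis norm_of_real)
        then show ?thesis using z0 by (simp add: abs_mult)
      qed
      then have "(\<Prod>i\<in>J. norm (quad (resc n x i) (of_real z))) = (\<Prod>i\<in>J. z * \<bar>Z - resc n x i\<bar>)"
        by (intro prod.cong) (auto simp: J_def)
      also have "\<dots> = z ^ (n - 1) * (\<Prod>i\<in>J. \<bar>Z - resc n x i\<bar>)" by (simp add: prod.distrib cardJ)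
      finally have P: "(\<Prod>i\<in>J. norm (quad (resc n x i) (of_real z))) = z ^ (n - 1) * (\<Prod>i\<in>J. \<bar>Z - resc n x i\<bar>)" .
      have zn: "z ^ (n - 1) = exp (- real (n - 1) * r)" by (simp add: z_def exp_of_nat_mult[symmetric])
      have expo: "- real (n - 1) * r + - real n * (a\<^sup>2 * z\<^sup>2 / 2 + a * m * z)
          + (real n * (r - a\<^sup>2 * sinh (2 * r) / 2 - (a * m) * sinh r) - r)
          = - real n * (a\<^sup>2 * Z\<^sup>2 / 4 + a * m * Z / 2) + real n * a\<^sup>2 / 2"
      proof -
        have nm: "real (n - 1) = real n - 1" using n by (simp add: of_nat_diff)
        have z2: "sinh (2 * r) = (1 / z\<^sup>2 - z\<^sup>2) / 2"
          by (simp add: z_def sinh_def exp_minus power2_eq_square exp_add[symmetric] field_simps)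
        have z1: "sinh r = (1 / z - z) / 2" by (simp add: z_def sinh_def exp_minus field_simps)
        have Q: "Z\<^sup>2 = z\<^sup>2 + 2 + 1 / z\<^sup>2" using z0 by (simp add: Zz power2_eq_square field_simps)
        define A B where "A = 1 / z\<^sup>2" and "B = 1 / z"
        show ?thesis unfolding nm z2 z1 Q A_def[symmetric] unfolding Zz B_def[symmetric]
          by (simp add: algebra_simps add_divide_distrib diff_divide_distrib)
      qed
      have "norm (wpoly (resc n x) n (a\<^sup>2) (a * m) J (of_real z))
          = (\<Prod>i\<in>J. \<bar>Z - resc n x i\<bar>) * exp (- real (n - 1) * r + - real n * (a\<^sup>2 * z\<^sup>2 / 2 + a * m * z))"
      proof -
        have "Re ((of_real z)^2 :: complex) = z\<^sup>2" by (simp flip: of_real_power)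
        then show ?thesis unfolding norm_wpoly P zn exp_add by (simp add: ac_simps)
      qed
      then have "norm (wpoly (resc n x) n (a\<^sup>2) (a * m) J (of_real z))
          * exp (real n * (r - a\<^sup>2 * sinh (2 * r) / 2 - (a * m) * sinh r) - r)
          = (\<Prod>i\<in>J. \<bar>Z - resc n x i\<bar>) * exp (- real n * (a\<^sup>2 * Z\<^sup>2 / 4 + a * m * Z / 2) + real n * a\<^sup>2 / 2)"
        unfolding expo[symmetric] exp_add by (simp only: ac_simps)
      also have "\<dots> = rweight (resc n x) n (a\<^sup>2) (a * m) J Z * exp (real n * a\<^sup>2 / 2)"
        by (simp only: rweight_def exp_add ac_simps)
      also have "\<dots> = lagr_weight n x b (m + a * Z) / e * exp (real n * a\<^sup>2 / 2)" by (simp only: rw)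
      also have "\<dots> \<le> C * lagr_weight n x b (x b) / e * exp (real n * a\<^sup>2 / 2)"
      proof (intro mult_right_mono divide_right_mono)
        \<comment> \<open>Keeps the evaluation point \<open>m + a * Z\<close> inside [-4, 4], where
          the Lagrange bound is available.\<close>
        have "Z \<le> 5 / 2"
        proof -
          have "exp r \<le> 1 / (1 - r)" using exp_ge_add_one_self[of "- r"] r by (simp add: exp_minus field_simps)
          also have "\<dots> \<le> 4 / 3" using r by (simp add: pos_divide_le_eq)
          finally have e43: "exp r \<le> 4 / 3" .
          have "1 / z = exp r" by (simp add: z_def exp_minus divide_inverse)
          then have "1 / z \<le> 4 / 3" using e43 by linarith
          then show ?thesis using z0 by (simp add: Zz)
        qed
        then have "a * (Z - 2) \<le> 21 / 20 * (1 / 2)" using a Z2 by (intro mult_mono) auto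
        moreover have "a * Z = 2 * a + a * (Z - 2)" by (simp add: algebra_simps)
        moreover have "0 \<le> a * (Z - 2)" using a Z2 by simp
        ultimately have "\<bar>m + a * Z\<bar> \<le> 4" using fb(6) K a by (auto simp: abs_le_iff)
        then show "lagr_weight n x b (m + a * Z) \<le> C * lagr_weight n x b (x b)" using g b by (simp add: good_def)
      qed (use e0 in auto)
      also have "\<dots> = C * (rweight (resc n x) n (a\<^sup>2) (a * m) J 2 * exp (real n * a\<^sup>2 / 2))"
        using fb(7)[OF b(1)] b by (simp add: rw)
      also have "\<dots> = C * lam b"
        using norm_wpoly_unit[OF norm_zr[OF b(1)]] b unfolding lam_def J_def[symmetric] by simp
      finally show ?thesis by (simp add: J_def z_def)
    qed
    have "real n * (r - a\<^sup>2 * sinh (2 * r) / 2 - a * m * sinh r) - r \<le> KU + 8 * ln (1 + real n * \<kappa> * r)"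
      by (rule edge_growth[OF b r(1) _ adm out]) (use r in simp)
    moreover have "w ^ 3 / 10 \<le> r - a\<^sup>2 * sinh (2 * r) / 2 - a * m * sinh r"
    proof -
      have "sinh (2 * r) \<le> 2 * r + (2 * r) ^ 3" using r by (intro sinh_le_cubic) auto
      then have "sinh (2 * r) / 2 \<le> r + 4 * r ^ 3" by (simp add: power3_eq_cube)
      then have "a\<^sup>2 * (sinh (2 * r) / 2) \<le> a\<^sup>2 * (r + 4 * r ^ 3)" by (intro mult_left_mono) auto
      moreover have "a * m * sinh r \<le> a * m * r"
        using am sinh_ge[of r] r abs_ge_zero[of "a * m"] by (intro mult_left_mono_neg) linarith+
      moreover have "a\<^sup>2 * (4 * r ^ 3) \<le> 5 * r ^ 3"
      proof -
        have "a\<^sup>2 \<le> (21 / 20)\<^sup>2" using a by (intro power_mono) auto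
        then have "a\<^sup>2 * 4 \<le> 5" by (simp add: power2_eq_square)
        then have "(a\<^sup>2 * 4) * r ^ 3 \<le> 5 * r ^ 3" using r by (intro mult_right_mono) auto
        then show ?thesis by (simp add: mult.assoc)
      qed
      moreover have "\<kappa> * r = w ^ 3 / 8" "5 * r ^ 3 = 5 / 512 * w ^ 3"
        by (simp_all add: r_def w0(2)[symmetric] power2_eq_square power3_eq_cube)
      moreover have "\<kappa> * r = r - a\<^sup>2 * r - a * m * r" unfolding \<kappa>_def am by (simp add: algebra_simps)
      moreover have "0 \<le> w ^ 3" using w0 by simp
      moreover have "a\<^sup>2 * (r + 4 * r ^ 3) = a\<^sup>2 * r + a\<^sup>2 * (4 * r ^ 3)" by (simp add: distrib_left)
      moreover have "a\<^sup>2 * (sinh (2 * r) / 2) = a\<^sup>2 * sinh (2 * r) / 2" by simp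
      ultimately show ?thesis by linarith
    qed
    then have "y / 10 \<le> real n * (r - a\<^sup>2 * sinh (2 * r) / 2 - a * m * sinh r)"
      using mult_left_mono[of "w ^ 3 / 10" _ "real n"] by (simp add: y_def)
    moreover have "real n * \<kappa> * r = y / 8"
      by (simp add: y_def r_def w0(2)[symmetric] power2_eq_square power3_eq_cube)
    \<comment> \<open>The tangent of \<open>ln\<close> at 20: eight times its slope term is
      \<open>y / 20\<close>, which \<open>y / 10\<close> absorbs.\<close>
    moreover have "ln (1 + y / 8) \<le> y / 160 + 19"
    proof -
      have "0 < 1 + y / 8" using False by simp
      then have "ln (1 + y / 8) = ln ((1 + y / 8) / 20) + ln 20" by (simp add: ln_div)
      moreover have "ln ((1 + y / 8) / 20) \<le> (1 + y / 8) / 20 - 1" using \<open>0 < 1 + y / 8\<close> by (intro ln_le_minus_one) simp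
      moreover have "ln 20 \<le> (20 - 1 :: real)" by (rule ln_le_minus_one) simp
      moreover have "(1 + y / 8) / 20 = 1 / 20 + y / 160" by simp
      ultimately show ?thesis by linarith
    qed
    ultimately have "y / 10 \<le> KU + 1 + 8 * (y / 160 + 19)" using r by simp
    then show ?thesis by (simp add: pinC_def)
  qed
  then show ?thesis by (simp add: y_def w_def \<kappa>_def)
qed

lemma scal_reflect: "1 \<le> n \<Longrightarrow> scal n (\<lambda>i. - x i) = scal n x" and cent_reflect: "1 \<le> n \<Longrightarrow> cent n (\<lambda>i. - x i) = - cent n x"
proof -
  assume n: "1 \<le> n"
  have fin: "finite (x ` {1..n})" and ne: "x ` {1..n} \<noteq> {}" using n by auto
  have im: "(\<lambda>i. - x i) ` {1..n} = uminus ` (x ` {1..n})" by auto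
  have mx: "Max (uminus ` (x ` {1..n})) = - Min (x ` {1..n})"
    using fin ne by (intro Max_eqI) auto
  have mn: "Min (uminus ` (x ` {1..n})) = - Max (x ` {1..n})"
    using fin ne by (intro Min_eqI) auto
  show "scal n (\<lambda>i. - x i) = scal n x" "cent n (\<lambda>i. - x i) = - cent n x"
    unfolding scal_def cent_def im mx mn by (simp_all add: field_simps)
qed

definition frameA :: "real \<Rightarrow> real \<Rightarrow> real" where "frameA C K = 10 * (pinC C + K + 1)\<^sup>2"

text \<open>\<open>good\<close> bounds the scale from above. \<open>pin_right\<close>, applied to
  the configuration or to its mirror image according to the sign of the centre, bounds the defect.
  Together they fix centre and scale to order n^(-2/3), and the locale becomes available with
  \<open>nu\<close> of that order.\<close>

lemma frame_pinned:
  assumes g: "good C K n x" and n: "8 \<le> n" and C: "1 \<le> C" and K0: "0 \<le> K"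
    and small: "frameA C K * (edge_scale n)\<^sup>2 \<le> 1 / 10"
  defines "m \<equiv> cent n x" and "a \<equiv> scal n x"
  shows "lagrange_config {1..n} (resc n x) n (a\<^sup>2) (a * m) (frameA C K * (edge_scale n)\<^sup>2) C"
    and "\<bar>1 - a\<^sup>2\<bar> + 2 * \<bar>a * m\<bar> \<le> frameA C K * (edge_scale n)\<^sup>2"
    and "\<bar>a - 1\<bar> \<le> frameA C K * (edge_scale n)\<^sup>2" and "\<bar>m\<bar> \<le> frameA C K * (edge_scale n)\<^sup>2"
proof -
  have n2: "2 \<le> n" and n1: "1 \<le> n" using n by auto
  note fb = frame_basic[OF g n2, folded m_def a_def]
  define \<delta> where "\<delta> = edge_scale n"
  have \<delta>: "0 < \<delta>" "real n * \<delta> ^ 3 = 1" "\<delta> \<le> 1 / 2" using edge_scale[of n] edge_scale_half[OF n] n by (auto simp: \<delta>_def)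
  define A where "A = frameA C K"
  define Y where "Y = pinC C"
  have Y1: "1 \<le> Y" by (simp add: Y_def pinC_def)
  have AY: "Y + K + 1 \<le> (Y + K + 1)\<^sup>2" using self_le_power[of "Y + K + 1" 2] Y1 K0 by simp
  have A10: "10 * (Y + K + 1) \<le> A" using AY by (simp add: A_def frameA_def Y_def)
  have K: "K * \<delta>\<^sup>2 \<le> 1 / 10"
  proof -
    have "K * \<delta>\<^sup>2 \<le> A * \<delta>\<^sup>2" using A10 Y1 K0 by (intro mult_right_mono) auto
    then show ?thesis using small by (simp add: A_def \<delta>_def)
  qed
  define \<kappa> where "\<kappa> = 1 - a\<^sup>2 + \<bar>a * m\<bar>"
  have \<kappa>Y: "\<kappa> \<le> Y * \<delta>\<^sup>2"
  proof (rule ccontr)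
    assume not: "\<not> \<kappa> \<le> Y * \<delta>\<^sup>2"
    moreover have "1 * \<delta>\<^sup>2 \<le> Y * \<delta>\<^sup>2" using Y1 by (intro mult_right_mono) auto
    ultimately have gt: "\<delta>\<^sup>2 < \<kappa>" by simp
    have le: "real n * sqrt \<kappa> ^ 3 \<le> Y"
    proof (cases "m \<le> 0")
      case True
      then show ?thesis using pin_right[OF g n C] K gt by (simp add: m_def a_def \<kappa>_def \<delta>_def Y_def)
    next
      case False
      then show ?thesis using pin_right[OF good_reflect[OF g] n C] K gt
        by (simp add: m_def a_def \<kappa>_def \<delta>_def Y_def scal_reflect[OF n1] cent_reflect[OF n1])
    qed
    have k0: "0 < \<kappa>" using gt zero_le_power2[of \<delta>] by linarith
    have "\<delta> < sqrt \<kappa>" using gt \<delta> by (simp add: real_less_rsqrt)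
    then have "(Y * \<delta>\<^sup>2) * \<delta> < \<kappa> * sqrt \<kappa>" using not Y1 \<delta> k0 by (intro mult_strict_mono) auto
    also have "\<kappa> * sqrt \<kappa> = sqrt \<kappa> ^ 3"
      using k0 by (simp add: power3_eq_cube)
    finally have "real n * ((Y * \<delta>\<^sup>2) * \<delta>) < real n * sqrt \<kappa> ^ 3" using n by (intro mult_strict_left_mono) auto
    moreover have "real n * ((Y * \<delta>\<^sup>2) * \<delta>) = Y * (real n * \<delta> ^ 3)" by (simp add: power2_eq_square power3_eq_cube)
    ultimately show False using le \<delta>(2) by simp
  qed
  define \<epsilon> where "\<epsilon> = \<delta>\<^sup>2"
  have \<epsilon>: "0 < \<epsilon>" using \<delta> by (simp add: \<epsilon>_def)
  have a: "0 < a" "a \<le> 1 + K * \<epsilon> / 2" using fb(1,5) by (auto simp: \<epsilon>_def \<delta>_def)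
  have Ke: "K * \<epsilon> \<le> 1 / 10" using K by (simp add: \<epsilon>_def)
  have a2: "a\<^sup>2 \<le> 1 + 2 * (K * \<epsilon>)"
  proof -
    have "a\<^sup>2 \<le> (1 + K * \<epsilon> / 2)\<^sup>2" using a by (intro power_mono) auto
    also have "\<dots> = 1 + K * \<epsilon> + (K * \<epsilon>) * (K * \<epsilon>) / 4" by (simp add: power2_eq_square field_simps)
    finally have "a\<^sup>2 \<le> 1 + K * \<epsilon> + (K * \<epsilon>) * (K * \<epsilon>) / 4" .
    moreover have "(K * \<epsilon>) * (K * \<epsilon>) \<le> (K * \<epsilon>) * 1" using Ke K0 \<epsilon> by (intro mult_left_mono) auto
    moreover have "0 \<le> K * \<epsilon>" using K0 \<epsilon> by simp
    ultimately show ?thesis by linarith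
  qed
  have k1: "1 - a\<^sup>2 + \<bar>a * m\<bar> \<le> Y * \<epsilon>" using \<kappa>Y by (simp add: \<kappa>_def \<epsilon>_def)
  have am: "\<bar>a * m\<bar> \<le> Y * \<epsilon> + 2 * (K * \<epsilon>)" using k1 a2 by linarith
  have Ye0: "0 \<le> Y * \<epsilon>" "0 \<le> K * \<epsilon>" using Y1 K0 \<epsilon> by auto
  have a21: "\<bar>1 - a\<^sup>2\<bar> \<le> Y * \<epsilon> + 2 * (K * \<epsilon>)" using k1 a2 Ye0 abs_ge_zero[of "a * m"] by linarith
  have Ae: "10 * (Y * \<epsilon>) + 10 * (K * \<epsilon>) + 10 * \<epsilon> \<le> A * \<epsilon>"
    using mult_right_mono[OF A10, of \<epsilon>] \<epsilon> by (simp add: algebra_simps)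
  show "\<bar>1 - a\<^sup>2\<bar> + 2 * \<bar>a * m\<bar> \<le> frameA C K * (edge_scale n)\<^sup>2"
    using am a21 Ae Ye0 \<epsilon> unfolding A_def[symmetric] \<delta>_def[symmetric] \<epsilon>_def[symmetric] by linarith
  have "\<bar>a - 1\<bar> * 1 \<le> \<bar>a - 1\<bar> * (a + 1)" using a by (intro mult_left_mono) auto
  also have "\<dots> = \<bar>1 - a\<^sup>2\<bar>"
  proof -
    have "1 - a\<^sup>2 = (1 - a) * (a + 1)" by (simp add: power2_eq_square algebra_simps)
    then show ?thesis using a by (simp add: abs_mult abs_minus_commute)
  qed
  finally have a1: "\<bar>a - 1\<bar> \<le> Y * \<epsilon> + 2 * (K * \<epsilon>)" using a21 by simp
  then show "\<bar>a - 1\<bar> \<le> frameA C K * (edge_scale n)\<^sup>2"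
    using Ae Ye0 \<epsilon> unfolding A_def[symmetric] \<delta>_def[symmetric] \<epsilon>_def[symmetric] by linarith
  have Aesmall: "A * \<epsilon> \<le> 1 / 10" using small by (simp add: A_def \<epsilon>_def \<delta>_def)
  have "1 / 2 \<le> a" using a1 Ae Aesmall Ye0 \<epsilon> by linarith
  then have "1 / 2 * \<bar>m\<bar> \<le> a * \<bar>m\<bar>" by (rule mult_right_mono) simp
  then have "1 / 2 * \<bar>m\<bar> \<le> \<bar>a * m\<bar>" using a by (simp add: abs_mult)
  then show "\<bar>m\<bar> \<le> frameA C K * (edge_scale n)\<^sup>2"
    using am Ae Ye0 \<epsilon> unfolding A_def[symmetric] \<delta>_def[symmetric] \<epsilon>_def[symmetric] by linarith
  show "lagrange_config {1..n} (resc n x) n (a\<^sup>2) (a * m) (frameA C K * (edge_scale n)\<^sup>2) C"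
    unfolding m_def a_def
  proof (rule frame_config[OF g n2 C])
    show "K * (edge_scale n)\<^sup>2 \<le> 1 / 10" using K by (simp add: \<delta>_def)
    have e: "\<epsilon> \<le> A * \<epsilon>" using Ae Ye0 \<epsilon> by linarith
    show "1 - (scal n x)\<^sup>2 + \<bar>scal n x * cent n x\<bar> \<le> frameA C K * (edge_scale n)\<^sup>2"
      using k1 Ae Ye0 \<epsilon> unfolding A_def[symmetric] \<delta>_def[symmetric] \<epsilon>_def[symmetric] a_def[symmetric] m_def[symmetric] by linarith
    show "0 < frameA C K * (edge_scale n)\<^sup>2"
      using e \<epsilon> unfolding A_def[symmetric] \<delta>_def[symmetric] \<epsilon>_def[symmetric] by linarith
    have "2 \<le> 1 / \<delta>" using \<delta> by (simp add: field_simps)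
    also have "\<dots> = real n * \<epsilon>" using \<delta> by (simp add: \<epsilon>_def field_simps power2_eq_square power3_eq_cube)
    also have "\<dots> \<le> real n * (A * \<epsilon>)" using e by (intro mult_left_mono) auto
    finally show "2 \<le> real n * (frameA C K * (edge_scale n)\<^sup>2)" by (simp add: A_def \<epsilon>_def \<delta>_def)
    have "(real n * \<delta> ^ 3)\<^sup>2 = (real n)\<^sup>2 * (\<delta>\<^sup>2) ^ 3" by (simp add: power_mult_distrib flip: power_mult)
    then have "1 = (real n)\<^sup>2 * \<epsilon> ^ 3" using \<delta>(2) by (simp add: \<epsilon>_def)
    also have "\<dots> \<le> (real n)\<^sup>2 * (A * \<epsilon>) ^ 3" using e \<epsilon> by (intro mult_left_mono power_mono) auto
    finally show "1 \<le> (real n)\<^sup>2 * (frameA C K * (edge_scale n)\<^sup>2) ^ 3" by (simp add: A_def \<epsilon>_def \<delta>_def)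
  qed
qed

section \<open>Limits in the bulk\<close>

lemma sin_lipschitz: "\<bar>sin s - sin t\<bar> \<le> \<bar>s - t\<bar>" for s t :: real
  using abs_Im_le_cmod[of "cis s - cis t"] cis_dist[of s t] by simp

lemma window_angle:
  assumes t: "0 < t" "t < pi" and s: "\<bar>s - t\<bar> \<le> sin t / 20"
  shows "0 < s" "s < pi" "19 / 20 * sin t \<le> sin s" "sin s \<le> 21 / 20 * sin t"
proof -
  have "sin t \<le> t" using sin_x_le_x t by simp
  moreover have "sin t \<le> pi - t" using sin_x_le_x[of "pi - t"] t by simp
  ultimately show "0 < s" "s < pi" using s t by linarith+
  show "19 / 20 * sin t \<le> sin s" "sin s \<le> 21 / 20 * sin t" using sin_lipschitz[of s t] s by (auto simp: abs_le_iff)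
qed

lemma one_plus_ln_le:
  fixes x :: real
  assumes "1 \<le> x"
  shows "1 + ln x \<le> 4 * sqrt (sqrt x)"
proof -
  have x: "0 < sqrt (sqrt x)" using assms by simp
  have "ln x = 4 * ln (sqrt (sqrt x))" using assms by (simp add: ln_sqrt)
  then show ?thesis using ln_le_minus_one[OF x] by linarith
qed

text \<open>The squared logarithm is at most a multiple of \<open>sqrt (1 + v)\<close>, which turns
  the hypothesis into a quadratic inequality for that root.\<close>

lemma self_bounded_log_sq:
  fixes K v :: real
  assumes K: "0 \<le> K" and v: "0 \<le> v" and le: "v / 2 \<le> K * (1 + ln (1 + 4 * v))\<^sup>2"
  shows "v \<le> (1 + 64 * K)\<^sup>2"
proof -
  define s where "s = sqrt (1 + v)"
  have s: "1 \<le> s" "s\<^sup>2 = 1 + v" using v by (auto simp: s_def)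
  have "1 + ln (1 + 4 * v) \<le> 4 * sqrt (sqrt (1 + 4 * v))" using v by (intro one_plus_ln_le) simp
  then have "(1 + ln (1 + 4 * v))\<^sup>2 \<le> (4 * sqrt (sqrt (1 + 4 * v)))\<^sup>2" using v by (intro power_mono) auto
  also have "\<dots> = 16 * sqrt (1 + 4 * v)" using v by (simp add: power_mult_distrib)
  also have "sqrt (1 + 4 * v) \<le> sqrt (4 * (1 + v))" by simp
  also have "sqrt (4 * (1 + v)) = 2 * s" by (simp only: real_sqrt_mult s_def) simp
  finally have "(1 + ln (1 + 4 * v))\<^sup>2 \<le> 32 * s" by simp
  then have "K * (1 + ln (1 + 4 * v))\<^sup>2 \<le> K * (32 * s)" by (rule mult_left_mono[OF _ K])
  then have "s\<^sup>2 \<le> 1 + 64 * K * s" using le s(2) by simp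
  also have "\<dots> \<le> s + 64 * K * s" using s by simp
  finally have "s * s \<le> (1 + 64 * K) * s" by (simp add: power2_eq_square algebra_simps)
  then have "s \<le> 1 + 64 * K" using s by simp
  then have "s\<^sup>2 \<le> (1 + 64 * K)\<^sup>2" using s by (intro power_mono) auto
  then show ?thesis using s by simp
qed

section \<open>Removing the base point from the bulk estimate\<close>

context lagrange_config
begin

definition NT :: "real \<Rightarrow> nat" where "NT X = card {i \<in> I. X < c i}"

definition CB :: real where "CB = 2 * KC 1 + KD 1"

lemma NT_NN:
  assumes "k \<in> I"
  shows "real (NN k X) \<le> real (NT X)" "real (NT X) \<le> real (NN k X) + 1"
proof -
  have "NN k X \<le> NT X" unfolding NN_def NT_def by (rule card_mono) (use fin in auto)
  then show "real (NN k X) \<le> real (NT X)" by simp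
  have "NT X \<le> card (insert k {i \<in> I - {k}. X < c i})" unfolding NT_def by (rule card_mono) (use fin in auto)
  also have "\<dots> \<le> Suc (NN k X)" unfolding NN_def by (rule card_insert_le_m1) (auto)
  finally show "real (NT X) \<le> real (NN k X) + 1" by simp
qed

lemma KC_nonneg: "0 \<le> A \<Longrightarrow> 0 \<le> KC A"
  using KU_nonneg by (simp add: KC_def add_nonneg_nonneg)

lemma KD_nonneg: "0 \<le> KD A"
  using KU_nonneg by (simp add: KD_def)

lemma CB_nonneg: "0 \<le> CB" using KC_nonneg[of 1] KD_nonneg[of 1] by (simp add: CB_def)

text \<open>The derivative of \<open>Phi\<close> at u is n times
  \<open>2 * sin u ^ 2 + (1 - p) * cos (2 * u) - q * cos u\<close>, and the last two terms are small
  against \<open>sin t ^ 2\<close>.\<close>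

lemma Phi_increment:
  assumes t: "0 < t" "t < pi" and pq: "\<bar>1 - p\<bar> + 2 * \<bar>q\<bar> \<le> (sin t)\<^sup>2 / 4"
    and s: "\<bar>s - t\<bar> \<le> sin t / 20" "\<bar>s' - t\<bar> \<le> sin t / 20" "s' \<le> s"
  shows "real n * (sin t)\<^sup>2 * (s - s') \<le> Phi s - Phi s'"
proof -
  define S where "S = sin t"
  have "Phi s' - real n * S\<^sup>2 * s' \<le> Phi s - real n * S\<^sup>2 * s"
  proof (rule DERIV_nonneg_imp_nondecreasing[OF s(3)], rule exI, rule conjI)
    fix u assume u: "s' \<le> u" "u \<le> s"
    show "((\<lambda>u. Phi u - real n * S\<^sup>2 * u) has_real_derivative (real n * (1 - p * cos (2 * u) - q * cos u) - real n * S\<^sup>2)) (at u)"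
      unfolding Phi_def by (auto intro!: derivative_eq_intros simp: algebra_simps)
    have "\<bar>u - t\<bar> \<le> sin t / 20" using u s by linarith
    then have "19 / 20 * S \<le> sin u" using window_angle(3)[OF t] by (simp add: S_def)
    then have "(19 / 20 * S)\<^sup>2 \<le> (sin u)\<^sup>2" using sin_gt_zero[OF t] by (intro power_mono) (auto simp: S_def)
    then have su: "361 / 400 * S\<^sup>2 \<le> (sin u)\<^sup>2" by (simp add: power2_eq_square)
    define w1 w2 where "w1 = (1 - p) * cos (2 * u)" and "w2 = q * cos u"
    have "\<bar>w1\<bar> \<le> \<bar>1 - p\<bar> * 1" unfolding w1_def abs_mult by (intro mult_left_mono) auto
    moreover have "\<bar>w2\<bar> \<le> \<bar>q\<bar> * 1" unfolding w2_def abs_mult by (intro mult_left_mono) auto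
    moreover have "1 - p * cos (2 * u) - q * cos u = 2 * (sin u)\<^sup>2 + w1 - w2"
      by (simp add: w1_def w2_def) (simp add: cos_double_sin left_diff_distrib)
    moreover have "S\<^sup>2 \<le> 2 * b + a1 - a2"
      if "\<bar>a1\<bar> \<le> e1 * 1" "\<bar>a2\<bar> \<le> e2 * 1" "e1 + 2 * e2 \<le> S\<^sup>2 / 4" "361 / 400 * S\<^sup>2 \<le> b" for a1 a2 e1 e2 b
      using that zero_le_power2[of S] by linarith
    ultimately have "S\<^sup>2 \<le> 1 - p * cos (2 * u) - q * cos u"
      using su pq unfolding S_def by metis
    then have "real n * S\<^sup>2 \<le> real n * (1 - p * cos (2 * u) - q * cos u)" by (intro mult_left_mono) auto
    then show "0 \<le> real n * (1 - p * cos (2 * u) - q * cos u) - real n * S\<^sup>2" by simp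
  qed
  then show ?thesis by (simp add: S_def algebra_simps)
qed

lemma window_pair:
  assumes t: "0 < t" "t < pi" and big: "8000 \<le> real n * sin t ^ 3"
    and pq: "\<bar>1 - p\<bar> + 2 * \<bar>q\<bar> \<le> (sin t)\<^sup>2 / 4" and nu4: "\<nu> \<le> (sin t)\<^sup>2 / 4"
    and k: "k \<in> I" and s: "\<bar>s - t\<bar> \<le> sin t / 40" "\<bar>s' - t\<bar> \<le> sin t / 40"
    and D: "norm (cis s - zr k) + \<bar>s - s'\<bar> \<le> D"
  shows "\<bar>pi * (real (NN k (2 * cos s)) - real (NN k (2 * cos s'))) - (Phi s - Phi s')\<bar>
    \<le> CB * (1 + ln (1 + D / eta k))\<^sup>2"
proof -
  have S: "0 < sin t" using sin_gt_zero[OF t] .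
  have *: "0 < u \<and> u < pi \<and> 19 / 20 * sin t \<le> sin u \<and> 1000 \<le> real n * sin u ^ 3 \<and> \<bar>1 - p\<bar> + 2 * \<bar>q\<bar> \<le> 1 * (sin u)\<^sup>2 \<and> \<nu> \<le> 1 * (sin u)\<^sup>2"
    if "\<bar>u - t\<bar> \<le> sin t / 40" for u
  proof -
    have "\<bar>u - t\<bar> \<le> sin t / 20" using that S by linarith
    note w = window_angle[OF t this]
    have h: "sin t / 2 \<le> sin u" using w(3) S by linarith
    have "(sin t / 2)\<^sup>2 \<le> (sin u)\<^sup>2" using h S by (intro power_mono) auto
    then have 2: "(sin t)\<^sup>2 / 4 \<le> (sin u)\<^sup>2" by (simp add: power2_eq_square)
    have "(sin t / 2) ^ 3 \<le> sin u ^ 3" using h S by (intro power_mono) auto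
    then have "real n * (sin t / 2) ^ 3 \<le> real n * sin u ^ 3" by (intro mult_left_mono) auto
    then have "1000 \<le> real n * sin u ^ 3" using big by (simp add: power3_eq_cube)
    then show ?thesis using w 2 pq nu4 by linarith
  qed
  have 1: "\<bar>s - s'\<bar> \<le> sin s / 10" using *[OF s(1)] s by linarith
  have "\<bar>pi * (real (NN k (2 * cos s)) - real (NN k (2 * cos s'))) - (Phi s - Phi s')\<bar>
    \<le> CB * (1 + ln (1 + (norm (cis s - zr k) + \<bar>s - s'\<bar>) / eta k))\<^sup>2"
    unfolding CB_def using *[OF s(1)] *[OF s(2)] by (intro bulk_pair[OF k, where A = 1]) (use 1 in auto)
  also have "\<dots> \<le> CB * (1 + ln (1 + D / eta k))\<^sup>2"
  proof -
    have "(norm (cis s - zr k) + \<bar>s - s'\<bar>) / eta k \<le> D / eta k" using D eta_pos[of k] by (intro divide_right_mono) auto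
    moreover have "0 \<le> (norm (cis s - zr k) + \<bar>s - s'\<bar>) / eta k" using eta_pos[of k] by simp
    ultimately show ?thesis using CB_nonneg by (intro mult_left_mono power_mono add_mono ln_mono add_nonneg_nonneg ln_ge_zero) auto
  qed
  finally show ?thesis .
qed

text \<open>The base point is taken nearest to \<open>t\<close>, and its distance in spacings is
  bounded in two stages. A crude one, with a base point anywhere and a loss of log n squared, finds
  some point within \<open>sin t / 40\<close>. Then the nearest point is used as its own base point,
  and the bound for its distance no longer involves n.\<close>

lemma bulk_window:
  assumes t: "0 < t" "t < pi" and big: "8000 \<le> real n * sin t ^ 3"
    and pq: "\<bar>1 - p\<bar> + 2 * \<bar>q\<bar> \<le> (sin t)\<^sup>2 / 4" and nu4: "\<nu> \<le> (sin t)\<^sup>2 / 4"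
    and log: "CB * (1 + ln (1 + 6 * real n))\<^sup>2 < real n * sin t ^ 3 / 20"
    and \<rho>: "\<rho> \<le> sin t / 40" "real n * (sin t)\<^sup>2 * \<rho> \<le> M"
    and s: "\<bar>s - t\<bar> \<le> \<rho>" "\<bar>s' - t\<bar> \<le> \<rho>"
  shows "\<bar>pi * (real (NT (2 * cos s)) - real (NT (2 * cos s'))) - (Phi s - Phi s')\<bar>
    \<le> CB * (1 + ln (1 + (1 + 64 * CB)\<^sup>2 + 6 * M))\<^sup>2 + pi"
proof -
  define S where "S = sin t"
  have S: "0 < S" "S \<le> 1" using sin_gt_zero[OF t] by (auto simp: S_def)
  note wp = window_pair[OF t big pq nu4]
  define \<tau> where "\<tau> i = arccos (c i / 2)" for i
  have \<tau>: "0 \<le> \<tau> i" "\<tau> i \<le> pi" "c i = 2 * cos (\<tau> i)" "zr i = cis (\<tau> i)" if "i \<in> I" for i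
  proof -
    have b: "- 1 \<le> c i / 2" "c i / 2 \<le> 1" using c_bound[OF that] by (auto simp: abs_le_iff)
    show 0: "0 \<le> \<tau> i" "\<tau> i \<le> pi" using arccos_lbound[OF b] arccos_ubound[OF b] by (auto simp: \<tau>_def)
    show 1: "c i = 2 * cos (\<tau> i)" using cos_arccos[OF b] by (simp add: \<tau>_def)
    show "zr i = cis (\<tau> i)" unfolding 1 by (rule circ_root_cos[OF 0])
  qed
  have less: "2 * cos u < c i \<longleftrightarrow> \<tau> i < u" if "i \<in> I" "0 \<le> u" "u \<le> pi" for i u
    unfolding \<tau>(3)[OF that(1)] using cos_mono_less_eq[of u "\<tau> i"] \<tau>(1,2)[OF that(1)] that by simp
  have ang: "0 < u" "u < pi" if "\<bar>u - t\<bar> \<le> S / 40" for u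
    using window_angle(1,2)[OF t, of u] that S by (auto simp: S_def)
  obtain k0 where k0: "k0 \<in> I" using hi by blast
  have "\<exists>i\<in>I. \<bar>\<tau> i - t\<bar> \<le> S / 40"
  proof (rule ccontr)
    assume none: "\<not> ?thesis"
    \<comment> \<open>If this window were empty, the count would be the same at both ends while
      \<open>Phi\<close> grows by at least \<open>n * sin t ^ 3 / 20\<close>, against the hypothesis
      on the logarithm.\<close>
    define u u' where "u = t + S / 40" and "u' = t - S / 40"
    have uu: "\<bar>u - t\<bar> \<le> S / 40" "\<bar>u' - t\<bar> \<le> S / 40" using S by (auto simp: u_def u'_def)
    have "{i \<in> I - {k0}. 2 * cos u < c i} = {i \<in> I - {k0}. 2 * cos u' < c i}"
    proof (intro Collect_cong conj_cong refl)
      fix i assume "i \<in> I - {k0}"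
      then have i: "i \<in> I" by simp
      have "\<not> \<bar>\<tau> i - t\<bar> \<le> S / 40" using none i by blast
      then have "\<tau> i < u \<longleftrightarrow> \<tau> i < u'" using S unfolding u_def u'_def by linarith
      then show "2 * cos u < c i \<longleftrightarrow> 2 * cos u' < c i" using less[OF i] ang[OF uu(1)] ang[OF uu(2)] by simp
    qed
    then have eq: "NN k0 (2 * cos u) = NN k0 (2 * cos u')" by (simp add: NN_def)
    have "norm (cis u - zr k0) + \<bar>u - u'\<bar> \<le> 3"
      using norm_triangle_ineq4[of "cis u" "zr k0"] norm_zr[OF k0] S by (simp add: u_def u'_def)
    then have "\<bar>pi * (real (NN k0 (2 * cos u)) - real (NN k0 (2 * cos u'))) - (Phi u - Phi u')\<bar>
        \<le> CB * (1 + ln (1 + 3 / eta k0))\<^sup>2"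
      using uu by (intro wp[OF k0]) (auto simp: S_def)
    moreover have "CB * (1 + ln (1 + 3 / eta k0))\<^sup>2 \<le> CB * (1 + ln (1 + 6 * real n))\<^sup>2"
    proof -
      have "(Im (zr k0))\<^sup>2 \<le> 1" using abs_Im_le_cmod[of "zr k0"] norm_zr[OF k0] by (simp add: abs_square_le_1)
      moreover have "\<nu> \<le> 1" using nu4 power_le_one[of S 2] S by (simp add: S_def)
      ultimately have "3 * (real n * (\<nu> + (Im (zr k0))\<^sup>2)) \<le> 3 * (real n * 2)" by (intro mult_left_mono) auto
      then have "3 / eta k0 \<le> 6 * real n" by (simp add: eta_def)
      moreover define v where "v = 3 / eta k0"
      moreover have "0 \<le> v" using eta_pos[of k0] by (simp add: v_def)
      ultimately show ?thesis using CB_nonneg unfolding v_def[symmetric] by (intro mult_left_mono power_mono add_mono ln_mono add_nonneg_nonneg ln_ge_zero) auto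
    qed
    moreover have "real n * (sin t)\<^sup>2 * (u - u') \<le> Phi u - Phi u'"
      using uu S by (intro Phi_increment[OF t pq]) (auto simp: u_def u'_def S_def)
    moreover have "real n * (sin t)\<^sup>2 * (u - u') = real n * sin t ^ 3 / 20"
      by (simp add: u_def u'_def S_def power2_eq_square power3_eq_cube)
    ultimately show False using log eq by simp
  qed
  then obtain i0 where i0: "i0 \<in> I" "\<bar>\<tau> i0 - t\<bar> \<le> S / 40" by blast
  obtain k where k: "k \<in> I" and kmin: "\<And>i. i \<in> I \<Longrightarrow> \<bar>\<tau> k - t\<bar> \<le> \<bar>\<tau> i - t\<bar>"
    using ex_is_arg_min_if_finite[OF fin, of "\<lambda>i. \<bar>\<tau> i - t\<bar>"] k0 by (auto simp: is_arg_min_linorder)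
  define d where "d = \<bar>\<tau> k - t\<bar>"
  have d: "0 \<le> d" "d \<le> S / 40" using kmin[OF i0(1)] i0(2) by (auto simp: d_def)
  have eta: "1 / eta k \<le> 2 * (real n * S\<^sup>2)"
  proof -
    have "sin (\<tau> k) \<le> 21 / 20 * S" "0 \<le> sin (\<tau> k)"
      using window_angle(4)[OF t, of "\<tau> k"] d S sin_ge_zero[OF \<tau>(1,2)[OF k]] by (auto simp: S_def d_def)
    then have "(sin (\<tau> k))\<^sup>2 \<le> (21 / 20 * S)\<^sup>2" by (intro power_mono) auto
    also have "\<dots> = 441 / 400 * S\<^sup>2" by (simp add: power2_eq_square)
    finally have "(sin (\<tau> k))\<^sup>2 \<le> 441 / 400 * S\<^sup>2" .
    moreover have "(Im (zr k))\<^sup>2 = (sin (\<tau> k))\<^sup>2" using \<tau>(4)[OF k] by simp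
    ultimately have "\<nu> + (Im (zr k))\<^sup>2 \<le> 2 * S\<^sup>2"
      using nu4[folded S_def] zero_le_power2[of S] by linarith
    then have "real n * (\<nu> + (Im (zr k))\<^sup>2) \<le> real n * (2 * S\<^sup>2)" by (intro mult_left_mono) auto
    then show ?thesis by (simp add: eta_def ac_simps)
  qed
  have near: "norm (cis u - zr k) \<le> \<bar>u - t\<bar> + d" for u
    using cis_dist[of u "\<tau> k"] \<tau>(4)[OF k] by (simp add: d_def)
  have dG: "d / eta k \<le> (1 + 64 * CB)\<^sup>2"
  proof (cases "d = 0")
    case False
    then have d0: "0 < d" using d by simp
    \<comment> \<open>No point is closer to \<open>t\<close> than \<open>d\<close>, so the counts at
      the two angles agree, while \<open>Phi\<close> grows by at least half of
      \<open>d / eta k\<close>.\<close>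
    define u u' where "u = t + d / 2" and "u' = t - d / 2"
    have uu: "\<bar>u - t\<bar> \<le> S / 40" "\<bar>u' - t\<bar> \<le> S / 40" using d by (auto simp: u_def u'_def)
    have "{i \<in> I - {k}. 2 * cos u < c i} = {i \<in> I - {k}. 2 * cos u' < c i}"
    proof (intro Collect_cong conj_cong refl)
      fix i assume "i \<in> I - {k}"
      then have i: "i \<in> I" by simp
      have "\<tau> i < u \<longleftrightarrow> \<tau> i < u'" using kmin[OF i] d0 unfolding d_def[symmetric] u_def u'_def by linarith
      then show "2 * cos u < c i \<longleftrightarrow> 2 * cos u' < c i" using less[OF i] ang[OF uu(1)] ang[OF uu(2)] by simp
    qed
    then have eq: "NN k (2 * cos u) = NN k (2 * cos u')" by (simp add: NN_def)
    have "norm (cis u - zr k) + \<bar>u - u'\<bar> \<le> 4 * d" using near[of u] d0 by (simp add: u_def u'_def)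
    then have "\<bar>pi * (real (NN k (2 * cos u)) - real (NN k (2 * cos u'))) - (Phi u - Phi u')\<bar>
        \<le> CB * (1 + ln (1 + 4 * d / eta k))\<^sup>2"
      using uu by (intro wp[OF k]) (auto simp: S_def)
    moreover have "real n * (sin t)\<^sup>2 * (u - u') \<le> Phi u - Phi u'"
      using uu S d0 by (intro Phi_increment[OF t pq]) (auto simp: u_def u'_def S_def)
    moreover have "d / eta k / 2 \<le> real n * (sin t)\<^sup>2 * (u - u')"
    proof -
      have "d * (1 / eta k) \<le> d * (2 * (real n * S\<^sup>2))" by (rule mult_left_mono[OF eta d(1)])
      then show ?thesis by (simp add: u_def u'_def S_def ac_simps)
    qed
    ultimately have "d / eta k / 2 \<le> CB * (1 + ln (1 + 4 * (d / eta k)))\<^sup>2" using eq by simp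
    then show ?thesis using d eta_pos[of k] by (intro self_bounded_log_sq[OF CB_nonneg]) auto
  qed simp
  have \<rho>0: "0 \<le> \<rho>" using s by linarith
  have "norm (cis s - zr k) + \<bar>s - s'\<bar> \<le> d + 3 * \<rho>" using near[of s] s by linarith
  then have "\<bar>pi * (real (NN k (2 * cos s)) - real (NN k (2 * cos s'))) - (Phi s - Phi s')\<bar>
      \<le> CB * (1 + ln (1 + (d + 3 * \<rho>) / eta k))\<^sup>2"
    using s \<rho> by (intro wp[OF k]) auto
  also have "\<dots> \<le> CB * (1 + ln (1 + (1 + 64 * CB)\<^sup>2 + 6 * M))\<^sup>2"
  proof -
    have "(3 * \<rho>) * (1 / eta k) \<le> (3 * \<rho>) * (2 * (real n * S\<^sup>2))" using \<rho>0 by (intro mult_left_mono[OF eta]) simp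
    also have "\<dots> = 6 * (real n * (sin t)\<^sup>2 * \<rho>)" by (simp add: S_def)
    finally have "3 * \<rho> / eta k \<le> 6 * M" using \<rho>(2) by simp
    then have "(d + 3 * \<rho>) / eta k \<le> (1 + 64 * CB)\<^sup>2 + 6 * M" using dG by (simp add: add_divide_distrib)
    moreover have "0 \<le> (d + 3 * \<rho>) / eta k" using d \<rho>0 eta_pos[of k] by simp
    ultimately have "1 + (d + 3 * \<rho>) / eta k \<le> 1 + (1 + 64 * CB)\<^sup>2 + 6 * M" "1 \<le> 1 + (d + 3 * \<rho>) / eta k" by auto
    then show ?thesis using CB_nonneg by (intro mult_left_mono power_mono add_left_mono ln_mono add_nonneg_nonneg ln_ge_zero) auto
  qed
  moreover have "\<bar>pi * (real (NT (2 * cos s)) - real (NT (2 * cos s'))) - pi * (real (NN k (2 * cos s)) - real (NN k (2 * cos s')))\<bar> \<le> pi"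
  proof -
    have "\<bar>(real (NT (2 * cos s)) - real (NT (2 * cos s'))) - (real (NN k (2 * cos s)) - real (NN k (2 * cos s')))\<bar> \<le> 1"
      using NT_NN[OF k, of "2 * cos s"] NT_NN[OF k, of "2 * cos s'"] by linarith
    then have "pi * \<bar>(real (NT (2 * cos s)) - real (NT (2 * cos s'))) - (real (NN k (2 * cos s)) - real (NN k (2 * cos s')))\<bar> \<le> pi * 1"
      by (intro mult_left_mono) auto
    then show ?thesis by (simp add: abs_mult right_diff_distrib[symmetric])
  qed
  ultimately show ?thesis by linarith
qed

end

text \<open>\<open>N\<close> counts points strictly above a level, so its difference counts an
  interval closed on the right. The open ball omits that end point, where at most one point can sit
  because the points are distinct.\<close>

lemma ball_count:
  assumes g: "good C K n x" and n: "2 \<le> n" and r: "0 < r"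
  defines "m \<equiv> cent n x" and "a \<equiv> scal n x"
  defines "N \<equiv> lagrange_config.NT {1..n} (resc n x)"
  assumes cfg: "lagrange_config {1..n} (resc n x) n (a\<^sup>2) (a * m) \<nu> C"
  shows "\<bar>real (card {j \<in> {1..n}. x j \<in> ball y r}) - (real (N ((y - r - m) / a)) - real (N ((y + r - m) / a)))\<bar> \<le> 1"
proof -
  note fb = frame_basic[OF g n, folded m_def a_def]
  interpret lagrange_config "{1..n}" "resc n x" n "a\<^sup>2" "a * m" \<nu> C by (rule cfg)
  have a: "0 < a" by (rule fb(1))
  have lt: "(u - m) / a < resc n x j \<longleftrightarrow> u < x j" "(u - m) / a = resc n x j \<longleftrightarrow> u = x j" if "j \<in> {1..n}" for j u
    using a by (auto simp: resc_def m_def[symmetric] a_def[symmetric] divide_less_cancel)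
  have N: "N ((u - m) / a) = card {j \<in> {1..n}. u < x j}" for u
    unfolding N_def NT_def using lt(1) by (metis (no_types, lifting))
  define A B E where "A = {j \<in> {1..n}. y - r < x j}" and "B = {j \<in> {1..n}. y + r < x j}" and "E = {j \<in> {1..n}. x j = y + r}"
  have fin: "finite A" "finite B" "finite E" by (auto simp: A_def B_def E_def)
  have eq: "{j \<in> {1..n}. x j \<in> ball y r} = A - (B \<union> E)"
    by (auto simp: A_def B_def E_def dist_real_def abs_less_iff)
  have sub: "B \<union> E \<subseteq> A" using r by (auto simp: A_def B_def E_def)
  have disj: "card (B \<union> E) = card B + card E" using fin by (intro card_Un_disjoint) (auto simp: B_def E_def)
  have "card (A - (B \<union> E)) = card A - card (B \<union> E)" using fin sub by (intro card_Diff_subset) auto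
  moreover have "card (B \<union> E) \<le> card A" using fin sub by (intro card_mono) auto
  moreover have "card E \<le> 1"
  proof -
    have "i = j" if "i \<in> E" "j \<in> E" for i j using good_distinct[OF g, of i j] that by (auto simp: E_def)
    then show ?thesis using card_le_Suc0_iff_eq[OF fin(3)] by auto
  qed
  ultimately show ?thesis unfolding eq N A_def[symmetric] B_def[symmetric] using disj by linarith
qed

text \<open>The increments of \<open>cos\<close> over the window are known exactly, those of
  \<open>Phi\<close> are not. Cauchy's mean value theorem for the pair expresses the latter through
  an intermediate angle, which is left to converge later.\<close>

lemma bulk_at:
  assumes g: "good C K n x" and n: "2 \<le> n" and L: "0 < L"
  defines "m \<equiv> cent n x" and "a \<equiv> scal n x"
  defines "B \<equiv> lagrange_config.CB C"
  assumes cfg: "lagrange_config {1..n} (resc n x) n (a\<^sup>2) (a * m) \<nu> C" and a: "1 / 2 \<le> a"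
    and t: "0 < t" "t < pi" "y - m = 2 * a * cos t"
    and s: "y - L / real n - m = 2 * a * cos s" "\<bar>s - t\<bar> \<le> sin t / 40"
    and s': "y + L / real n - m = 2 * a * cos s'" "\<bar>s' - t\<bar> \<le> sin t / 40"
    and big: "8000 \<le> real n * sin t ^ 3"
    and pq: "\<bar>1 - a\<^sup>2\<bar> + 2 * \<bar>a * m\<bar> \<le> (sin t)\<^sup>2 / 4" and nu4: "\<nu> \<le> (sin t)\<^sup>2 / 4"
    and log: "B * (1 + ln (1 + 6 * real n))\<^sup>2 < real n * sin t ^ 3 / 20"
  shows "\<exists>\<xi>. s' \<le> \<xi> \<and> \<xi> \<le> s \<and>
     \<bar>pi * real (card {j \<in> {1..n}. x j \<in> ball y (L / real n)})
        - L / a * (1 - a\<^sup>2 * cos (2 * \<xi>) - a * m * cos \<xi>) / sin \<xi>\<bar>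
     \<le> B * (1 + ln (1 + (1 + 64 * B)\<^sup>2 + 12 * L))\<^sup>2 + 2 * pi"
proof -
  interpret lagrange_config "{1..n}" "resc n x" n "a\<^sup>2" "a * m" \<nu> C by (rule cfg)
  have n0: "0 < real n" using n by simp
  have S: "0 < sin t" by (rule sin_gt_zero[OF t(1,2)])
  have r0: "0 < L / real n" using L n0 by simp
  have w: "0 < u" "u < pi" "19 / 20 * sin t \<le> sin u" if "\<bar>u - t\<bar> \<le> sin t / 40" for u
    using window_angle[OF t(1,2), of u] that S by auto
  have lip: "sin t * \<bar>u - t\<bar> \<le> 2 * \<bar>cos u - cos t\<bar>" if u: "\<bar>u - t\<bar> \<le> sin t / 40" for u
  proof (cases "u = t")
    case False
    have "\<exists>z. min u t < z \<and> z < max u t \<and> cos (max u t) - cos (min u t) = (max u t - min u t) * (- sin z)"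
      using False by (intro MVT2) (auto intro!: derivative_eq_intros)
    then obtain z where z: "min u t < z" "z < max u t" "cos (max u t) - cos (min u t) = (max u t - min u t) * (- sin z)" by blast
    then have "\<bar>cos u - cos t\<bar> = \<bar>u - t\<bar> * \<bar>sin z\<bar>"
      by (cases "u \<le> t") (auto simp: abs_mult max_def min_def abs_minus_commute)
    moreover have "\<bar>z - t\<bar> \<le> sin t / 40" using z(1,2) u by linarith
    then have "sin t \<le> 2 * \<bar>sin z\<bar>" using w(3)[of z] S by linarith
    then have "\<bar>u - t\<bar> * sin t \<le> \<bar>u - t\<bar> * (2 * \<bar>sin z\<bar>)" by (intro mult_left_mono) auto
    ultimately show ?thesis by (simp add: ac_simps)
  qed simp
  define \<rho> where "\<rho> = max \<bar>s - t\<bar> \<bar>s' - t\<bar>"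
  have cs: "2 * \<bar>cos s - cos t\<bar> = L / (real n * a)" "2 * \<bar>cos s' - cos t\<bar> = L / (real n * a)"
  proof -
    have "a * (2 * (cos s - cos t)) = - (L / real n)" "a * (2 * (cos s' - cos t)) = L / real n"
    proof -
      have "a * (2 * (u - v)) = 2 * a * u - 2 * a * v" for u v by (simp add: algebra_simps)
      then show "a * (2 * (cos s - cos t)) = - (L / real n)" "a * (2 * (cos s' - cos t)) = L / real n"
        using s(1) s'(1) t(3) by simp_all
    qed
    then have "2 * (cos s - cos t) = - (L / (real n * a))" "2 * (cos s' - cos t) = L / (real n * a)"
      using a n0 by (auto simp: field_simps)
    moreover have "0 < L / (real n * a)" using a L n0 by simp
    moreover have "2 * \<bar>u\<bar> = \<bar>2 * u\<bar>" for u :: real by simp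
    ultimately show "2 * \<bar>cos s - cos t\<bar> = L / (real n * a)" "2 * \<bar>cos s' - cos t\<bar> = L / (real n * a)" by simp_all
  qed
  have "sin t * \<rho> \<le> L / (real n * a)"
    using lip[OF s(2)] lip[OF s'(2)] unfolding cs \<rho>_def by (auto simp: max_def)
  also have "\<dots> \<le> L / (real n * (1 / 2))" using a L n0 by (intro divide_left_mono mult_left_mono) auto
  finally have "real n * (sin t * \<rho>) \<le> real n * (L / (real n * (1 / 2)))" using n0 by (intro mult_left_mono) auto
  then have "real n * (sin t * \<rho>) \<le> 2 * L" using n0 by simp
  moreover have "sin t * (real n * (sin t * \<rho>)) \<le> 1 * (real n * (sin t * \<rho>))"
    using S n0 by (intro mult_right_mono) (auto simp: \<rho>_def)
  ultimately have M: "real n * (sin t)\<^sup>2 * \<rho> \<le> 2 * L" by (simp add: power2_eq_square ac_simps)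
  have bw: "\<bar>pi * (real (NT (2 * cos s)) - real (NT (2 * cos s'))) - (Phi s - Phi s')\<bar>
      \<le> B * (1 + ln (1 + (1 + 64 * B)\<^sup>2 + 6 * (2 * L)))\<^sup>2 + pi"
    unfolding B_def
    by (rule bulk_window[OF t(1,2) big pq nu4 log[unfolded B_def] _ M]) (use s s' in \<open>auto simp: \<rho>_def\<close>)
  have X: "(y - L / real n - m) / a = 2 * cos s" "(y + L / real n - m) / a = 2 * cos s'"
    unfolding s(1) s'(1) using a by auto
  have "\<bar>real (card {j \<in> {1..n}. x j \<in> ball y (L / real n)}) - (real (NT (2 * cos s)) - real (NT (2 * cos s')))\<bar> \<le> 1"
    using ball_count[OF g n r0 cfg[unfolded a_def m_def], of y] unfolding a_def[symmetric] m_def[symmetric] X .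
  then have "pi * \<bar>real (card {j \<in> {1..n}. x j \<in> ball y (L / real n)}) - (real (NT (2 * cos s)) - real (NT (2 * cos s')))\<bar> \<le> pi * 1"
    by (intro mult_left_mono) auto
  then have bc: "\<bar>pi * real (card {j \<in> {1..n}. x j \<in> ball y (L / real n)}) - pi * (real (NT (2 * cos s)) - real (NT (2 * cos s')))\<bar> \<le> pi"
    by (simp only: right_diff_distrib[symmetric] abs_mult) simp
  have "cos s < cos s'"
  proof -
    have "a * (2 * (cos s' - cos s)) = 2 * (L / real n)" using s(1) s'(1) by (simp add: algebra_simps)
    then have "0 < a * (2 * (cos s' - cos s))" using r0 by simp
    then show ?thesis using a by (simp add: zero_less_mult_iff)
  qed
  then have ss: "s' < s" using cos_mono_less_eq[of s s'] w(1,2)[OF s(2)] w(1,2)[OF s'(2)] by auto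
  obtain \<xi> where \<xi>: "s' < \<xi>" "\<xi> < s"
      "(Phi s - Phi s') * (- sin \<xi>) = (cos s - cos s') * (real n * (1 - a\<^sup>2 * cos (2 * \<xi>) - a * m * cos \<xi>))"
  proof -
    have d: "(Phi has_real_derivative real n * (1 - a\<^sup>2 * cos (2 * u) - a * m * cos u)) (at u)" for u
      unfolding Phi_def[abs_def] by (auto intro!: derivative_eq_intros simp: algebra_simps)
    have "\<exists>c>s'. c < s \<and> (Phi s - Phi s') * (- sin c) = (cos s - cos s') * (real n * (1 - a\<^sup>2 * cos (2 * c) - a * m * cos c))"
      by (rule GMVT'[OF ss]) (use DERIV_isCont[OF d] d in \<open>auto intro!: derivative_eq_intros\<close>)
    then show ?thesis using that by blast
  qed
  have "\<bar>\<xi> - t\<bar> \<le> sin t / 40" using \<xi>(1,2) s(2) s'(2) by linarith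
  then have sx: "0 < sin \<xi>" using w(1,2) sin_gt_zero by blast
  have "cos s - cos s' = - (L / (real n * a))"
  proof -
    have "a * (u - v) = a * u - a * v" for u v by (simp add: algebra_simps)
    then have "a * (cos s - cos s') = - (L / real n)" using s(1) s'(1) by simp
    then show ?thesis using a n0 by (simp add: field_simps)
  qed
  then have "(Phi s - Phi s') * sin \<xi> = L / (real n * a) * (real n * (1 - a\<^sup>2 * cos (2 * \<xi>) - a * m * cos \<xi>))"
    using \<xi>(3) by simp
  then have "(Phi s - Phi s') * sin \<xi> = L / a * (1 - a\<^sup>2 * cos (2 * \<xi>) - a * m * cos \<xi>)"
    using n0 a by simp
  then have "Phi s - Phi s' = L / a * (1 - a\<^sup>2 * cos (2 * \<xi>) - a * m * cos \<xi>) / sin \<xi>"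
    using sx by (metis less_irrefl nonzero_mult_div_cancel_right)
  then have "\<bar>pi * real (card {j \<in> {1..n}. x j \<in> ball y (L / real n)})
        - L / a * (1 - a\<^sup>2 * cos (2 * \<xi>) - a * m * cos \<xi>) / sin \<xi>\<bar>
     \<le> B * (1 + ln (1 + (1 + 64 * B)\<^sup>2 + 12 * L))\<^sup>2 + 2 * pi"
    using bw bc by simp
  then show ?thesis using \<xi>(1,2) by (intro exI[of _ \<xi>]) simp
qed

section \<open>Passage to the limit in the bulk\<close>

lemma edge_scale_tendsto: "edge_scale \<longlonglongrightarrow> 0"
  unfolding edge_scale_def by real_asymp

lemma frame_limits:
  assumes C: "1 \<le> C" and K: "0 \<le> K" and g: "\<forall>\<^sub>F n in sequentially. good C K n (\<omega> n)"
  shows "(\<lambda>n. frameA C K * (edge_scale n)\<^sup>2) \<longlonglongrightarrow> 0"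
    and "\<forall>\<^sub>F n in sequentially. 8 \<le> n \<and> good C K n (\<omega> n) \<and> frameA C K * (edge_scale n)\<^sup>2 \<le> 1 / 10"
    and "(\<lambda>n. scal n (\<omega> n)) \<longlonglongrightarrow> 1" and "(\<lambda>n. cent n (\<omega> n)) \<longlonglongrightarrow> 0"
proof -
  have "(\<lambda>n. frameA C K * (edge_scale n)\<^sup>2) \<longlonglongrightarrow> frameA C K * 0\<^sup>2"
    by (intro tendsto_intros edge_scale_tendsto)
  then show z: "(\<lambda>n. frameA C K * (edge_scale n)\<^sup>2) \<longlonglongrightarrow> 0" by simp
  have "\<forall>\<^sub>F n in sequentially. frameA C K * (edge_scale n)\<^sup>2 < 1 / 10" using z by (rule order_tendstoD) simp
  then show ev: "\<forall>\<^sub>F n in sequentially. 8 \<le> n \<and> good C K n (\<omega> n) \<and> frameA C K * (edge_scale n)\<^sup>2 \<le> 1 / 10"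
    using g eventually_ge_at_top[of 8] by eventually_elim auto
  have "\<forall>\<^sub>F n in sequentially. norm (scal n (\<omega> n) - 1) \<le> frameA C K * (edge_scale n)\<^sup>2"
    using ev by eventually_elim (use frame_pinned(3)[OF _ _ C K] in auto)
  then have "(\<lambda>n. scal n (\<omega> n) - 1) \<longlonglongrightarrow> 0" using z by (rule Lim_null_comparison)
  then show "(\<lambda>n. scal n (\<omega> n)) \<longlonglongrightarrow> 1" by (simp add: LIM_zero_iff)
  have "\<forall>\<^sub>F n in sequentially. norm (cent n (\<omega> n)) \<le> frameA C K * (edge_scale n)\<^sup>2"
    using ev by eventually_elim (use frame_pinned(4)[OF _ _ C K] in auto)
  then show "(\<lambda>n. cent n (\<omega> n)) \<longlonglongrightarrow> 0" using z by (rule Lim_null_comparison)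
qed

text \<open>The absolute value plays the same part as in \<open>pinC\<close>; 40 absorbs
  \<open>2 * pi + 1\<close>, since \<open>ln L\<close> is at least 1/2.\<close>

definition bulkD :: "real \<Rightarrow> real" where
  "bulkD C = (let B = \<bar>lagrange_config.CB C\<bar> in B * (3 + 2 * ln (13 + (1 + 64 * B)\<^sup>2))\<^sup>2 + 40)"

lemma bulkD_pos: "0 < bulkD C"
  unfolding bulkD_def Let_def by (simp add: add_nonneg_pos)

text \<open>The assumption \<open>2 < L\<close> enters here: additive constants can be absorbed into
  multiples of powers of \<open>ln L\<close>.\<close>

lemma ln_ge_half: "2 < L \<Longrightarrow> 1 / 2 \<le> ln L" for L :: real
  using ln_mono[of 2 L] ln2_ge_two_thirds by linarith

lemma bulkD_bound:
  assumes L: "2 < L" and B: "0 \<le> lagrange_config.CB C"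
  defines "B \<equiv> lagrange_config.CB C"
  shows "B * (1 + ln (1 + (1 + 64 * B)\<^sup>2 + 12 * L))\<^sup>2 + 2 * pi + 1 \<le> bulkD C * (ln L)\<^sup>2"
proof -
  define G where "G = 13 + (1 + 64 * B)\<^sup>2"
  have l: "1 / 2 \<le> ln L" by (rule ln_ge_half[OF L])
  have G: "13 \<le> G" by (simp add: G_def)
  have lG: "0 \<le> ln G" using G by simp
  have "(1 + (1 + 64 * B)\<^sup>2) * 1 \<le> (1 + (1 + 64 * B)\<^sup>2) * L" using L by (intro mult_left_mono) auto
  then have "1 + (1 + 64 * B)\<^sup>2 + 12 * L \<le> G * L" by (simp add: G_def algebra_simps)
  moreover have pos: "1 \<le> 1 + (1 + 64 * B)\<^sup>2 + 12 * L" using L by simp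
  ultimately have "ln (1 + (1 + 64 * B)\<^sup>2 + 12 * L) \<le> ln (G * L)" by (intro ln_mono) auto
  also have "\<dots> = ln G + ln L" using G L by (simp add: ln_mult)
  finally have "1 + ln (1 + (1 + 64 * B)\<^sup>2 + 12 * L) \<le> 1 + ln G + ln L" by simp
  also have "\<dots> \<le> (3 + 2 * ln G) * ln L"
  proof -
    have "(2 + 2 * ln G) * (1 / 2) \<le> (2 + 2 * ln G) * ln L" using l lG by (intro mult_left_mono) auto
    then show ?thesis by (simp add: algebra_simps)
  qed
  finally have "(1 + ln (1 + (1 + 64 * B)\<^sup>2 + 12 * L))\<^sup>2 \<le> ((3 + 2 * ln G) * ln L)\<^sup>2"
    using pos by (intro power_mono) (auto intro!: add_nonneg_nonneg ln_ge_zero)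
  then have "B * (1 + ln (1 + (1 + 64 * B)\<^sup>2 + 12 * L))\<^sup>2 \<le> B * ((3 + 2 * ln G) * ln L)\<^sup>2"
    using B by (intro mult_left_mono) (auto simp: B_def)
  moreover have "2 * pi + 1 \<le> 40 * (ln L)\<^sup>2"
  proof -
    have "(1 / 2)\<^sup>2 \<le> (ln L)\<^sup>2" using l by (intro power_mono) auto
    then show ?thesis using pi_less_4 by (simp add: power2_eq_square)
  qed
  moreover have "bulkD C = B * (3 + 2 * ln G)\<^sup>2 + 40" using B by (simp add: bulkD_def Let_def B_def G_def)
  moreover have "bulkD C * (ln L)\<^sup>2 = B * ((3 + 2 * ln G) * ln L)\<^sup>2 + 40 * (ln L)\<^sup>2"
    if "bulkD C = B * (3 + 2 * ln G)\<^sup>2 + 40"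
    unfolding that power_mult_distrib by (simp add: algebra_simps)
  ultimately show ?thesis by linarith
qed

text \<open>The angles of the centre and of both ends of the window converge to the same limit, so
  for large n all conditions of \<open>bulk_at\<close> hold. Its intermediate angle is squeezed to
  that limit, where the main term is \<open>2 * L * sin\<close> of the angle, that is, pi times the
  expected count. Waiting until the main term is within 1 of its limit accounts for the extra 1 in
  \<open>bulkD_bound\<close>.\<close>

theorem bulk_limit:
  assumes C: "1 \<le> C" and K: "0 \<le> K" and g: "\<forall>\<^sub>F n in sequentially. good C K n (\<omega> n)"
    and x: "- 2 < x" "x < 2" and y: "y \<longlonglongrightarrow> x" and L: "2 < L"
  shows "\<forall>\<^sub>F n in sequentially. \<bar>real (card {j \<in> {1..n}. \<omega> n j \<in> ball (y n) (L / real n)}) - 2 * semicircle x * L\<bar>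
      \<le> bulkD C * (ln L)\<^sup>2"
proof -
  note fl = frame_limits[OF C K g]
  define \<nu> a m where "\<nu> n = frameA C K * (edge_scale n)\<^sup>2" and "a n = scal n (\<omega> n)" and "m n = cent n (\<omega> n)" for n
  define B where "B = lagrange_config.CB C"
  have a1: "a \<longlonglongrightarrow> 1" and m0: "m \<longlonglongrightarrow> 0" and \<nu>0: "\<nu> \<longlonglongrightarrow> 0"
    using fl by (simp_all add: a_def[abs_def] m_def[abs_def] \<nu>_def[abs_def])
  have L0: "(\<lambda>n. L / real n) \<longlonglongrightarrow> 0" by real_asymp
  define \<theta> where "\<theta> = arccos (x / 2)"
  have xb: "- 1 < x / 2" "x / 2 < 1" using x by auto
  have \<theta>: "0 < \<theta>" "\<theta> < pi" "cos \<theta> = x / 2" using arccos_lt_bounded[OF xb] xb by (auto simp: \<theta>_def)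
  have S0: "0 < sin \<theta>" by (rule sin_gt_zero[OF \<theta>(1,2)])
  have conv: "(\<lambda>n. (y n + e * (L / real n) - m n) / (2 * a n)) \<longlonglongrightarrow> x / 2" for e
  proof -
    have "(\<lambda>n. (y n + e * (L / real n) - m n) / (2 * a n)) \<longlonglongrightarrow> (x + e * 0 - 0) / (2 * 1)"
      by (intro tendsto_intros y a1 m0 L0) simp
    then show ?thesis by simp
  qed
  \<comment> \<open>\<open>T 0\<close>, \<open>T 1\<close> and \<open>T (- 1)\<close> are the angles
    of the centre, the right end and the left end; \<open>arccos\<close> reverses the order.\<close>
  define T where "T e n = arccos ((y n + e * (L / real n) - m n) / (2 * a n))" for e n
  have T: "T e \<longlonglongrightarrow> \<theta>" for e
    unfolding T_def \<theta>_def by (rule isCont_tendsto_compose[OF isCont_arccos[OF xb] conv])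
  have a_ev: "\<forall>\<^sub>F n in sequentially. 1 / 2 < a n" using a1 by (rule order_tendstoD) simp
  have cosT: "\<forall>\<^sub>F n in sequentially. y n + e * (L / real n) - m n = 2 * a n * cos (T e n)" for e
    using order_tendstoD(1)[OF conv[of e] xb(1)] order_tendstoD(2)[OF conv[of e] xb(2)] a_ev
    by eventually_elim (simp add: T_def)
  define t where "t = T 0"
  have sint: "(\<lambda>n. sin (t n)) \<longlonglongrightarrow> sin \<theta>" unfolding t_def by (intro tendsto_intros T)
  have tb: "\<forall>\<^sub>F n in sequentially. 0 < t n" "\<forall>\<^sub>F n in sequentially. t n < pi"
    using order_tendstoD[OF T[of 0]] \<theta> by (auto simp: t_def)
  have close: "\<forall>\<^sub>F n in sequentially. \<bar>T e n - t n\<bar> < sin (t n) / 40" for e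
  proof -
    have "(\<lambda>n. sin (t n) / 40 - \<bar>T e n - t n\<bar>) \<longlonglongrightarrow> sin \<theta> / 40 - \<bar>\<theta> - \<theta>\<bar>"
      unfolding t_def by (intro tendsto_intros T) auto
    then have "\<forall>\<^sub>F n in sequentially. 0 < sin (t n) / 40 - \<bar>T e n - t n\<bar>" by (rule order_tendstoD) (use S0 in simp)
    then show ?thesis by eventually_elim simp
  qed
  have half: "\<forall>\<^sub>F n in sequentially. sin \<theta> / 2 < sin (t n)" using sint by (rule order_tendstoD) (use S0 in simp)
  have c8: "\<forall>\<^sub>F n in sequentially. 8000 \<le> real n * (sin \<theta> / 2) ^ 3"
    using S0 by real_asymp
  have lg: "\<forall>\<^sub>F n in sequentially. B * (1 + ln (1 + 6 * real n))\<^sup>2 < real n * (sin \<theta> / 2) ^ 3 / 20"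
  proof -
    have "(\<lambda>n. (1 + ln (1 + 6 * real n))\<^sup>2 / real n) \<longlonglongrightarrow> 0" by real_asymp
    then have "(\<lambda>n. B * ((1 + ln (1 + 6 * real n))\<^sup>2 / real n)) \<longlonglongrightarrow> B * 0" by (rule tendsto_mult_left)
    then have "\<forall>\<^sub>F n in sequentially. B * ((1 + ln (1 + 6 * real n))\<^sup>2 / real n) < (sin \<theta> / 2) ^ 3 / 20"
      by (rule order_tendstoD) (use S0 in simp)
    then show ?thesis using eventually_gt_at_top[of 0] by eventually_elim (simp add: field_simps)
  qed
  have nuS: "\<forall>\<^sub>F n in sequentially. \<nu> n \<le> (sin (t n))\<^sup>2 / 4"
  proof -
    have "(\<lambda>n. (sin (t n))\<^sup>2 / 4 - \<nu> n) \<longlonglongrightarrow> (sin \<theta>)\<^sup>2 / 4 - 0" by (intro tendsto_intros sint \<nu>0) simp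
    then have "\<forall>\<^sub>F n in sequentially. 0 < (sin (t n))\<^sup>2 / 4 - \<nu> n" by (rule order_tendstoD) (use S0 in simp)
    then show ?thesis by eventually_elim simp
  qed
  define Bd where "Bd = B * (1 + ln (1 + (1 + 64 * B)\<^sup>2 + 12 * L))\<^sup>2 + 2 * pi"
  define P where "P n \<xi> \<longleftrightarrow> T 1 n \<le> \<xi> \<and> \<xi> \<le> T (- 1) n \<and>
     \<bar>pi * real (card {j \<in> {1..n}. \<omega> n j \<in> ball (y n) (L / real n)})
        - L / a n * (1 - (a n)\<^sup>2 * cos (2 * \<xi>) - a n * m n * cos \<xi>) / sin \<xi>\<bar> \<le> Bd" for n \<xi>
  have "\<forall>\<^sub>F n in sequentially. \<exists>\<xi>. P n \<xi>"
    using fl(2) a_ev cosT[of 0] cosT[of 1] cosT[of "- 1"] tb close[of 1] close[of "- 1"] half c8 lg nuS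
  proof eventually_elim
    case (elim n)
    have g': "good C K n (\<omega> n)" "8 \<le> n" "2 \<le> n" "frameA C K * (edge_scale n)\<^sup>2 \<le> 1 / 10" using elim by auto
    note fp = frame_pinned[OF g'(1,2) C K g'(4), folded a_def m_def \<nu>_def]
    have S3: "(sin \<theta> / 2) ^ 3 \<le> sin (t n) ^ 3" using elim S0 by (intro power_mono) auto
    have S3n: "real n * (sin \<theta> / 2) ^ 3 \<le> real n * sin (t n) ^ 3" using S3 by (intro mult_left_mono) auto
    have big: "8000 \<le> real n * sin (t n) ^ 3" "B * (1 + ln (1 + 6 * real n))\<^sup>2 < real n * sin (t n) ^ 3 / 20"
      using S3n elim by linarith+
    show ?case
      unfolding P_def a_def m_def Bd_def B_def
    proof (rule bulk_at[OF g'(1,3), where t = "t n" and \<nu> = "\<nu> n"], goal_cases)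
      case 1 then show ?case using L by simp
    next case 2 then show ?case using fp(1) by (simp add: a_def m_def)
    next case 12 then show ?case using fp(2) elim by (simp add: a_def m_def)
    qed (use elim big in \<open>auto simp: a_def m_def B_def t_def\<close>)
  qed
  then obtain N where "\<forall>n\<ge>N. \<exists>\<xi>. P n \<xi>" unfolding eventually_sequentially by blast
  then have "\<exists>\<xi>. \<forall>n\<ge>N. P n (\<xi> n)" by metis
  then obtain \<xi> where "\<forall>n\<ge>N. P n (\<xi> n)" by blast
  then have \<xi>: "T 1 n \<le> \<xi> n" "\<xi> n \<le> T (- 1) n"
     "\<bar>pi * real (card {j \<in> {1..n}. \<omega> n j \<in> ball (y n) (L / real n)})
        - L / a n * (1 - (a n)\<^sup>2 * cos (2 * \<xi> n) - a n * m n * cos (\<xi> n)) / sin (\<xi> n)\<bar> \<le> Bd" if "N \<le> n" for n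
    using that unfolding P_def by blast+
  have "\<forall>\<^sub>F n in sequentially. T 1 n \<le> \<xi> n" "\<forall>\<^sub>F n in sequentially. \<xi> n \<le> T (- 1) n"
    using \<xi>(1,2) unfolding eventually_sequentially by blast+
  then have x1: "\<xi> \<longlonglongrightarrow> \<theta>" by (rule tendsto_sandwich[OF _ _ T[of 1] T[of "- 1"]])
  define V where "V n = L / a n * (1 - (a n)\<^sup>2 * cos (2 * \<xi> n) - a n * m n * cos (\<xi> n)) / sin (\<xi> n)" for n
  have "V \<longlonglongrightarrow> L / 1 * (1 - 1\<^sup>2 * cos (2 * \<theta>) - 1 * 0 * cos \<theta>) / sin \<theta>"
    unfolding V_def using S0 by (intro tendsto_intros a1 m0 x1) auto
  moreover have "L / 1 * (1 - 1\<^sup>2 * cos (2 * \<theta>) - 1 * 0 * cos \<theta>) / sin \<theta> = pi * (2 * semicircle x * L)"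
  proof -
    have "x = 2 * cos \<theta>" using \<theta>(3) by simp
    then have "4 - x\<^sup>2 = (2 * sin \<theta>)\<^sup>2" by (simp add: sin_squared_eq power_mult_distrib)
    then have "max 0 (4 - x\<^sup>2) = (2 * sin \<theta>)\<^sup>2" by (simp only: max_absorb2[OF zero_le_power2])
    then have "sqrt (max 0 (4 - x\<^sup>2)) = \<bar>2 * sin \<theta>\<bar>" by (simp only: real_sqrt_abs)
    then have "sqrt (max 0 (4 - x\<^sup>2)) = 2 * sin \<theta>" using S0 by simp
    then have "pi * (2 * semicircle x * L) = 2 * L * sin \<theta>" by (simp add: semicircle_def)
    moreover have "L / 1 * (1 - 1\<^sup>2 * cos (2 * \<theta>) - 1 * 0 * cos \<theta>) / sin \<theta> = 2 * L * sin \<theta>"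
      using S0 by (simp add: cos_double_sin power2_eq_square)
    ultimately show ?thesis by (simp only:)
  qed
  ultimately have V: "V \<longlonglongrightarrow> pi * (2 * semicircle x * L)" by simp
  have V1: "\<forall>\<^sub>F n in sequentially. dist (V n) (pi * (2 * semicircle x * L)) < 1"
    using V by (rule tendstoD) simp
  have CB: "\<forall>\<^sub>F n in sequentially. 0 \<le> B"
    using fl(2)
  proof eventually_elim
    case (elim n)
    then show ?case using lagrange_config.CB_nonneg[OF frame_pinned(1)[of C K n "\<omega> n"]] C K by (simp add: B_def)
  qed
  then have B0: "0 \<le> B" using eventually_happens[OF CB] by simp
  show ?thesis
    using V1 eventually_ge_at_top[of N]
  proof eventually_elim
    case (elim n)
    define R where "R = real (card {j \<in> {1..n}. \<omega> n j \<in> ball (y n) (L / real n)})"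
    define W where "W = 2 * semicircle x * L"
    have "\<bar>pi * R - V n\<bar> \<le> Bd" using \<xi>(3)[OF elim(2)] by (simp add: R_def V_def)
    moreover have "\<bar>V n - pi * W\<bar> < 1" using elim(1) by (simp add: dist_real_def W_def)
    ultimately have "\<bar>pi * R - pi * W\<bar> \<le> Bd + 1" by linarith
    then have *: "pi * \<bar>R - W\<bar> \<le> Bd + 1" by (simp only: right_diff_distrib[symmetric] abs_mult) simp
    have "\<bar>R - W\<bar> = 1 * \<bar>R - W\<bar>" by simp
    also have "\<dots> \<le> pi * \<bar>R - W\<bar>" using pi_ge_two by (intro mult_right_mono) auto
    also note *
    also have "Bd + 1 \<le> bulkD C * (ln L)\<^sup>2"
      using bulkD_bound[OF L] B0 unfolding Bd_def B_def by simp
    finally show ?case unfolding R_def[symmetric] W_def[symmetric] .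
  qed
qed

section \<open>Limits at the edge\<close>

lemma trig_taylor:
  fixes y :: real
  assumes "0 \<le> y"
  shows "1 - y\<^sup>2 / 2 \<le> cos y" "y - y ^ 3 / 6 \<le> sin y" "cos y \<le> 1 - y\<^sup>2 / 2 + y ^ 4 / 24"
    "sin y \<le> y - y ^ 3 / 6 + y ^ 5 / 120"
proof -
  have 1: "0 \<le> cos x - 1 + x\<^sup>2 / 2" if "0 \<le> x" for x :: real
    by (rule increasing_from_zero[of x "\<lambda>x. cos x - 1 + x\<^sup>2 / 2" "\<lambda>x. x - sin x"])
       (use that in \<open>auto intro!: derivative_eq_intros simp: sin_x_le_x\<close>)
  have 2: "0 \<le> sin x - x + x ^ 3 / 6" if "0 \<le> x" for x :: real
    by (rule increasing_from_zero[of x "\<lambda>x. sin x - x + x ^ 3 / 6" "\<lambda>x. cos x - 1 + x\<^sup>2 / 2", OF that _ _ 1])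
       (auto intro!: derivative_eq_intros)
  have 3: "0 \<le> 1 - x\<^sup>2 / 2 + x ^ 4 / 24 - cos x" if "0 \<le> x" for x :: real
    by (rule increasing_from_zero[of x "\<lambda>x. 1 - x\<^sup>2 / 2 + x ^ 4 / 24 - cos x" "\<lambda>x. sin x - x + x ^ 3 / 6", OF that _ _ 2])
       (auto intro!: derivative_eq_intros)
  have 4: "0 \<le> x - x ^ 3 / 6 + x ^ 5 / 120 - sin x" if "0 \<le> x" for x :: real
    by (rule increasing_from_zero[of x "\<lambda>x. x - x ^ 3 / 6 + x ^ 5 / 120 - sin x" "\<lambda>x. 1 - x\<^sup>2 / 2 + x ^ 4 / 24 - cos x", OF that _ _ 3])
       (auto intro!: derivative_eq_intros)
  show "1 - y\<^sup>2 / 2 \<le> cos y" "y - y ^ 3 / 6 \<le> sin y" "cos y \<le> 1 - y\<^sup>2 / 2 + y ^ 4 / 24"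
      "sin y \<le> y - y ^ 3 / 6 + y ^ 5 / 120"
    using 1[OF assms] 2[OF assms] 3[OF assms] 4[OF assms] by linarith+
qed

lemma arccos_near_one:
  fixes u :: real
  assumes u: "0 < u" "u \<le> 1 / 2"
  defines "\<theta> \<equiv> arccos (1 - u / 2)"
  shows "0 < \<theta>" "\<theta> < pi" "2 * cos \<theta> = 2 - u" "\<theta> \<le> 1" "u \<le> \<theta>\<^sup>2" "\<theta>\<^sup>2 \<le> 2 * u" "\<theta>\<^sup>2 \<le> u + u\<^sup>2"
proof -
  have b: "- 1 < 1 - u / 2" "1 - u / 2 < 1" using u by auto
  show t: "0 < \<theta>" "\<theta> < pi" using arccos_lt_bounded[OF b] by (auto simp: \<theta>_def)
  show c: "2 * cos \<theta> = 2 - u" using b by (simp add: \<theta>_def)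
  show t1: "\<theta> \<le> 1"
  proof (rule ccontr)
    assume "\<not> ?thesis"
    then have "cos \<theta> \<le> cos 1" using t by (intro cos_monotone_0_pi_le) auto
    moreover have "cos 1 \<le> 13 / (24 :: real)" using trig_taylor(3)[of 1] by simp
    ultimately show False using c u by linarith
  qed
  show "u \<le> \<theta>\<^sup>2" using trig_taylor(1)[of \<theta>] t c by linarith
  have "\<theta>\<^sup>2 \<le> 1" using t t1 by (intro power_le_one) auto
  then have "\<theta>\<^sup>2 * \<theta>\<^sup>2 \<le> \<theta>\<^sup>2 * 1" by (intro mult_left_mono) auto
  then have 4: "\<theta> ^ 4 \<le> \<theta>\<^sup>2" by (simp add: power2_eq_square power4_eq_xxxx)
  have le: "\<theta>\<^sup>2 \<le> u + \<theta> ^ 4 / 12" using trig_taylor(3)[of \<theta>] t c by linarith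
  then show "\<theta>\<^sup>2 \<le> 2 * u" using 4 u by linarith
  then have "\<theta>\<^sup>2 * \<theta>\<^sup>2 \<le> (2 * u) * (2 * u)" by (intro mult_mono) (use u in auto)
  then have "\<theta> ^ 4 \<le> 4 * u\<^sup>2" by (simp add: power2_eq_square power4_eq_xxxx)
  then show "\<theta>\<^sup>2 \<le> u + u\<^sup>2" using le zero_le_power2[of u] by linarith
qed

text \<open>In edge units: the window reaches \<open>mu ^ 2 * delta ^ 2\<close> below 2, with
  \<open>mu\<close> later the cube root of L, and phi is the corresponding angle over delta. An
  uncertainty of \<open>A * delta ^ 2\<close> in centre and scale shifts the square of phi by
  \<open>5 * A\<close> at most. The condition on \<open>mu ^ 5 * delta ^ 2\<close> makes the
  curvature of \<open>arccos\<close> negligible.\<close>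

lemma edge_angle:
  fixes A a m u \<mu> \<delta> :: real
  assumes A: "10 \<le> A" and \<mu>: "100 * A \<le> \<mu>" and \<delta>: "0 < \<delta>" "\<mu> ^ 5 * \<delta>\<^sup>2 \<le> 1"
    and a: "\<bar>a - 1\<bar> \<le> A * \<delta>\<^sup>2" and m: "\<bar>m\<bar> \<le> A * \<delta>\<^sup>2" and u: "a * u = 2 * a - 2 + \<mu>\<^sup>2 * \<delta>\<^sup>2 + m"
  defines "\<phi> \<equiv> arccos (1 - u / 2) / \<delta>"
  shows "0 < u" "u \<le> 1 / 2" "\<bar>\<phi>\<^sup>2 - \<mu>\<^sup>2\<bar> \<le> 5 * A" "24 / 25 * \<mu> \<le> \<phi>" "\<phi> \<le> 26 / 25 * \<mu>" "\<phi> * \<delta> \<le> 1 / 100"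
proof -
  define \<epsilon> where "\<epsilon> = \<delta>\<^sup>2"
  have \<epsilon>: "0 < \<epsilon>" using \<delta> by (simp add: \<epsilon>_def)
  have l: "1000 \<le> \<mu>" using A \<mu> by simp
  have l2: "1000 * \<mu> \<le> \<mu>\<^sup>2" using mult_right_mono[OF l, of \<mu>] l by (simp add: power2_eq_square)
  have Al: "100 * A \<le> \<mu>\<^sup>2 / 1000" using \<mu> l2 by simp
  have l4e: "\<mu>\<^sup>2 * (\<mu>\<^sup>2 * \<epsilon>) \<le> 1 / 1000"
  proof -
    have "1000 * (\<mu>\<^sup>2 * (\<mu>\<^sup>2 * \<epsilon>)) \<le> \<mu> * (\<mu>\<^sup>2 * (\<mu>\<^sup>2 * \<epsilon>))" using l \<epsilon> by (intro mult_right_mono) auto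
    also have "\<dots> = \<mu> ^ 5 * \<delta>\<^sup>2" by (simp add: \<epsilon>_def power2_eq_square eval_nat_numeral)
    finally show ?thesis using \<delta> by simp
  qed
  define E where "E = \<mu>\<^sup>2 * \<epsilon>"
  have E0: "0 < E" using l \<epsilon> by (simp add: E_def)
  have E: "\<mu>\<^sup>2 * E \<le> 1 / 1000" using l4e by (simp add: E_def)
  have l6: "1000000 \<le> \<mu>\<^sup>2" using l2 l by linarith
  have "1000000 * E \<le> \<mu>\<^sup>2 * E" using l6 E0 by (intro mult_right_mono) auto
  then have E9: "E \<le> 1 / 1000000000" using E by linarith
  have Ae: "A * \<epsilon> \<le> E / 100000"
    using mult_right_mono[OF Al, of \<epsilon>] \<epsilon> by (simp add: E_def)
  have a1: "\<bar>a - 1\<bar> \<le> A * \<epsilon>" and m1: "\<bar>m\<bar> \<le> A * \<epsilon>" using a m by (simp_all add: \<epsilon>_def)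
  have au: "\<bar>a * u - E\<bar> \<le> 3 * (A * \<epsilon>)" using u a1 m1 unfolding E_def \<epsilon>_def[symmetric] by linarith
  have ah: "99 / 100 \<le> a" using a1 Ae E9 by linarith
  have "0 < a * u" using au Ae E0 by linarith
  then show u0: "0 < u" using ah by (simp add: zero_less_mult_iff)
  have "99 / 100 * u \<le> a * u" using ah u0 by (intro mult_right_mono) auto
  then have u2: "u \<le> 2 * E" using au Ae E0 by linarith
  then show uh: "u \<le> 1 / 2" using E9 by linarith
  have "\<bar>a - 1\<bar> * u \<le> (A * \<epsilon>) * 1" using a1 u0 uh by (intro mult_mono) auto
  moreover have "a * u - u = (a - 1) * u" by (simp add: algebra_simps)
  ultimately have "\<bar>a * u - u\<bar> \<le> A * \<epsilon>" using u0 by (simp add: abs_mult)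
  then have uE: "\<bar>u - E\<bar> \<le> 4 * (A * \<epsilon>)" using au by linarith
  note t = arccos_near_one[OF u0 uh]
  have \<phi>\<delta>: "arccos (1 - u / 2) = \<phi> * \<delta>" using \<delta> by (simp add: \<phi>_def)
  have \<phi>0: "0 < \<phi>" using t(1) \<delta> by (simp add: \<phi>_def)
  have "u * u \<le> (2 * E) * (2 * E)" using u2 u0 by (intro mult_mono) auto
  also have "\<dots> = 4 * (\<mu>\<^sup>2 * E) * \<epsilon>" by (simp add: E_def)
  also have "\<dots> \<le> 1 * \<epsilon>" using E \<epsilon> by (intro mult_right_mono) auto
  also have "\<dots> \<le> A * \<epsilon>" using A \<epsilon> by (intro mult_right_mono) auto
  finally have "u\<^sup>2 \<le> A * \<epsilon>" by (simp add: power2_eq_square)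
  then have "\<bar>(\<phi> * \<delta>)\<^sup>2 - E\<bar> \<le> 5 * (A * \<epsilon>)" using t(5,7) uE unfolding \<phi>\<delta> by linarith
  moreover have "(\<phi> * \<delta>)\<^sup>2 - E = (\<phi>\<^sup>2 - \<mu>\<^sup>2) * \<epsilon>" by (simp add: E_def \<epsilon>_def power_mult_distrib algebra_simps)
  ultimately have "\<bar>\<phi>\<^sup>2 - \<mu>\<^sup>2\<bar> * \<epsilon> \<le> 5 * A * \<epsilon>" using \<epsilon> by (simp add: abs_mult)
  then show main: "\<bar>\<phi>\<^sup>2 - \<mu>\<^sup>2\<bar> \<le> 5 * A" using \<epsilon> by simp
  have "(24 / 25 * \<mu>)\<^sup>2 \<le> \<phi>\<^sup>2" using main Al by (simp add: power_mult_distrib) (simp add: power2_eq_square)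
  then show "24 / 25 * \<mu> \<le> \<phi>" using power2_le_imp_le[OF _ less_imp_le[OF \<phi>0]] by blast
  have "\<phi>\<^sup>2 \<le> (26 / 25 * \<mu>)\<^sup>2" using main Al by (simp add: power_mult_distrib) (simp add: power2_eq_square)
  then show "\<phi> \<le> 26 / 25 * \<mu>" using power2_le_imp_le[of \<phi> "26 / 25 * \<mu>"] l by simp
  have "(\<phi> * \<delta>)\<^sup>2 \<le> (1 / 100)\<^sup>2"
    using t(6) u2 E9 unfolding \<phi>\<delta> by (simp add: power2_eq_square)
  then show "\<phi> * \<delta> \<le> 1 / 100" using power2_le_imp_le[of "\<phi> * \<delta>" "1 / 100"] by simp
qed

lemma frameA_ge:
  assumes "0 \<le> K"
  shows "10 \<le> frameA C K" "K \<le> frameA C K"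
proof -
  define P where "P = pinC C + K + 1"
  have P: "1 \<le> P" "K \<le> P" using assms by (auto simp: P_def pinC_def)
  have "1 * P \<le> P * P" using P by (intro mult_right_mono) auto
  then have "P \<le> P\<^sup>2" by (simp add: power2_eq_square)
  then show "10 \<le> frameA C K" "K \<le> frameA C K" using P unfolding frameA_def P_def[symmetric] by linarith+
qed

text \<open>\<open>edge_count\<close> with the rightmost point as base point. The main term is n
  times \<open>2 / 3\<close> of the cube of the angle, that is, \<open>2 / 3\<close> of phi cubed.
  The corrections are the Taylor remainder of order \<open>mu ^ 5 * delta ^ 2\<close>, the frame
  defect of order \<open>A * mu\<close>, and the replacement of phi by \<open>mu\<close>, again of
  order \<open>A * mu\<close>.\<close>

lemma edge_at:
  fixes \<mu> :: real
  assumes g: "good C K n x" and n: "8 \<le> n" and C: "1 \<le> C" and K: "0 \<le> K"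
    and small: "frameA C K * (edge_scale n)\<^sup>2 \<le> 1 / 10"
  defines "A \<equiv> frameA C K" and "\<delta> \<equiv> edge_scale n"
  assumes \<mu>: "100 * A \<le> \<mu>" and \<mu>\<delta>: "\<mu> ^ 5 * \<delta>\<^sup>2 \<le> 1"
  shows "\<bar>pi * real (card {j \<in> {1..n}. 2 - \<mu>\<^sup>2 * \<delta>\<^sup>2 < x j}) - 2 / 3 * \<mu> ^ 3\<bar>
    \<le> 20 * A * \<mu> + (2 * lagrange_config.KC C 1 + 5 * lagrange_config.KU C + 40) * (ln (\<mu> ^ 3))\<^sup>2 + pi"
proof -
  have n2: "2 \<le> n" using n by simp
  define m a where "m = cent n x" and "a = scal n x"
  note fb = frame_basic[OF g n2, folded m_def a_def]
  note fp = frame_pinned[OF g n C K small, folded m_def a_def A_def \<delta>_def]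
  interpret lagrange_config "{1..n}" "resc n x" n "a\<^sup>2" "a * m" "A * \<delta>\<^sup>2" C by (rule fp(1))
  have \<delta>: "0 < \<delta>" "real n * \<delta> ^ 3 = 1" "\<delta> \<le> 1 / 2" using edge_scale[of n] edge_scale_half[OF n] n by (auto simp: \<delta>_def)
  have A: "10 \<le> A"
    unfolding A_def by (rule frameA_ge(1)[OF K])
  have a0: "0 < a" by (rule fb(1))
  define u where "u = (2 * a - 2 + \<mu>\<^sup>2 * \<delta>\<^sup>2 + m) / a"
  have au: "a * u = 2 * a - 2 + \<mu>\<^sup>2 * \<delta>\<^sup>2 + m" using a0 by (simp add: u_def)
  define \<theta> \<phi> where "\<theta> = arccos (1 - u / 2)" and "\<phi> = \<theta> / \<delta>"
  note ea = edge_angle[OF A \<mu> \<delta>(1) \<mu>\<delta> fp(3,4) au, folded \<theta>_def, folded \<phi>_def]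
  note t = arccos_near_one[OF ea(1,2), folded \<theta>_def]
  have th: "\<theta> = \<phi> * \<delta>" using \<delta> by (simp add: \<phi>_def)
  have l: "1000 \<le> \<mu>" using A \<mu> by simp
  have \<phi>: "900 \<le> \<phi>" using ea(4) l by simp
  define L where "L = \<mu> ^ 3"
  have L3: "L = \<mu> * \<mu>\<^sup>2" by (simp add: L_def power2_eq_square power3_eq_cube)
  have l2: "1000 * \<mu> \<le> \<mu>\<^sup>2" using mult_right_mono[OF l, of \<mu>] l by (simp add: power2_eq_square)
  have lL: "\<mu>\<^sup>2 * 1000 \<le> L" using mult_right_mono[OF l, of "\<mu>\<^sup>2"] by (simp add: L3)
  have eL: "exp 1 \<le> L" using lL l2 l exp_le by linarith
  have lnL: "1 \<le> ln L" using eL by (subst ln_ge_iff) (use exp_gt_zero[of "1::real"] in linarith)+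
  obtain b where b: "b \<in> {1..n}" "resc n x b = 2" using hi by blast
  have zb: "zr b = cis 0" using circ_root_cos[of 0] b by simp
  have eb: "1 / eta b = A / \<delta>"
  proof -
    have "1 / eta b = real n * (A * \<delta>\<^sup>2)" by (simp add: eta_def zb)
    also have "\<dots> = A * (real n * \<delta> ^ 3) / \<delta>" using \<delta>(1) by (simp add: power2_eq_square power3_eq_cube)
    finally show ?thesis using \<delta>(2) by simp
  qed
  have nb: "norm (cis \<theta> - zr b) \<le> \<theta>" using cis_dist[of \<theta> 0] t(1) by (simp add: zb)
  have s: "9 / 10 * \<theta> \<le> sin \<theta>" "sin \<theta> \<le> \<theta>"
  proof -
    have "\<theta>\<^sup>2 * \<theta> \<le> (1 / 100)\<^sup>2 * \<theta>" using ea(6) t(1) by (intro mult_right_mono power_mono) (auto simp: th)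
    then have "\<theta> ^ 3 \<le> \<theta> / 10000" by (simp add: power2_eq_square power3_eq_cube)
    then show "9 / 10 * \<theta> \<le> sin \<theta>" using trig_taylor(2)[of \<theta>] t(1) by linarith
    show "sin \<theta> \<le> \<theta>" using t(1) by (simp add: sin_x_le_x)
  qed
  have s0: "0 < sin \<theta>" using s t(1) by linarith
  have n\<theta>: "real n * \<theta> ^ 3 = \<phi> ^ 3" unfolding th power_mult_distrib using \<delta>(2) by (simp add: ac_simps)
  have big: "1000 \<le> real n * sin \<theta> ^ 3" and nsin: "real n * sin \<theta> ^ 3 \<le> L\<^sup>2"
  proof -
    have "real n * (9 / 10 * \<theta>) ^ 3 \<le> real n * sin \<theta> ^ 3" using s t(1) by (intro mult_left_mono power_mono) auto
    moreover have "real n * (9 / 10 * \<theta>) ^ 3 = 729 / 1000 * (real n * \<theta> ^ 3)" by (simp add: power3_eq_cube)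
    ultimately have "729 / 1000 * \<phi> ^ 3 \<le> real n * sin \<theta> ^ 3" unfolding n\<theta> by simp
    moreover have "900 ^ 3 \<le> \<phi> ^ 3" using \<phi> by (intro power_mono) auto
    ultimately show "1000 \<le> real n * sin \<theta> ^ 3" by simp
    have "real n * sin \<theta> ^ 3 \<le> real n * \<theta> ^ 3" using s s0 by (intro mult_left_mono power_mono) auto
    also have "\<dots> \<le> (26 / 25 * \<mu>) ^ 3" unfolding n\<theta> using ea(5) \<phi> by (intro power_mono) auto
    also have "\<dots> \<le> 2 * L" using l by (simp add: L_def power3_eq_cube)
    also have "\<dots> \<le> L * L" using lL l2 l by (intro mult_right_mono) linarith+
    finally show "real n * sin \<theta> ^ 3 \<le> L\<^sup>2" by (simp add: power2_eq_square)
  qed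
  \<comment> \<open>Because \<open>100 * A <= mu\<close>, the distance to the edge in spacings of
    the extreme point is at most \<open>L\<close>, so the logarithms below are multiples of
    \<open>ln L\<close>.\<close>
  have AL: "1 + 7 * A * \<phi> \<le> L"
  proof -
    have "A * \<phi> \<le> (\<mu> / 100) * (26 / 25 * \<mu>)" using \<mu> ea(5) \<phi> A by (intro mult_mono) auto
    then have "A * \<phi> \<le> \<mu>\<^sup>2 * (26 / 2500)" by (simp add: power2_eq_square)
    then show ?thesis using lL l2 l by linarith
  qed
  have A\<phi>: "0 \<le> A * \<phi>" using A \<phi> by simp
  have eps: "\<delta>\<^sup>2 * A \<le> (sin \<theta>)\<^sup>2"
  proof -
    have "A \<le> \<phi>\<^sup>2 * (81 / 100)"
    proof -
      have "\<phi> * 900 \<le> \<phi> * \<phi>" using \<phi> by (intro mult_left_mono) auto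
      moreover have "A \<le> \<phi>" using \<mu> ea(4) A by linarith
      ultimately show ?thesis using \<phi> unfolding power2_eq_square by linarith
    qed
    then have "\<delta>\<^sup>2 * A \<le> \<delta>\<^sup>2 * (\<phi>\<^sup>2 * (81 / 100))" by (intro mult_left_mono) auto
    also have "\<dots> = (9 / 10 * \<theta>)\<^sup>2" by (simp add: th power_mult_distrib power2_eq_square)
    also have "\<dots> \<le> (sin \<theta>)\<^sup>2" using s t(1) by (intro power_mono) auto
    finally show ?thesis .
  qed
  have "\<bar>pi * real (NN b (2 * cos \<theta>)) - Phi \<theta>\<bar>
    \<le> KC 1 * (1 + ln (1 + norm (cis \<theta> - zr b) / eta b))
      + (KU + 8 * ln (1 + (norm (cis \<theta> - zr b) + 6 * sin \<theta>) / eta b)) * (1 + 2 * ln (real n * sin \<theta> ^ 3))"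
    using eps fp(2) s ea(6) by (intro edge_count[OF b(1) t(1,2) big]) (auto simp: th ac_simps)
  also have "\<dots> \<le> KC 1 * (2 * ln L) + (KU * ln L + 8 * ln L) * (5 * ln L)"
  proof -
    have "0 \<le> norm (cis \<theta> - zr b) / eta b" "0 \<le> (norm (cis \<theta> - zr b) + 6 * sin \<theta>) / eta b"
      using eta_pos[of b] s0 by auto
    moreover have "norm (cis \<theta> - zr b) * (1 / eta b) \<le> \<theta> * (A / \<delta>)"
      unfolding eb using nb A \<delta> by (intro mult_right_mono) auto
    then have "norm (cis \<theta> - zr b) / eta b \<le> A * \<phi>" using \<delta> by (simp add: \<phi>_def ac_simps)
    moreover have "(norm (cis \<theta> - zr b) + 6 * sin \<theta>) * (1 / eta b) \<le> (7 * \<theta>) * (A / \<delta>)"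
      unfolding eb using nb s A \<delta> by (intro mult_right_mono) auto
    then have "(norm (cis \<theta> - zr b) + 6 * sin \<theta>) / eta b \<le> 7 * A * \<phi>" using \<delta> by (simp add: \<phi>_def ac_simps)
    ultimately have "ln (1 + norm (cis \<theta> - zr b) / eta b) \<le> ln L" "ln (1 + (norm (cis \<theta> - zr b) + 6 * sin \<theta>) / eta b) \<le> ln L"
        "0 \<le> ln (1 + (norm (cis \<theta> - zr b) + 6 * sin \<theta>) / eta b)"
      using AL A\<phi> by (auto intro!: ln_mono ln_ge_zero)
    moreover have "ln (real n * sin \<theta> ^ 3) \<le> ln (L\<^sup>2)" using nsin big by (intro ln_mono) linarith+
    then have "ln (real n * sin \<theta> ^ 3) \<le> 2 * ln L" using eL exp_gt_zero[of "1 :: real"] by (simp add: ln_realpow)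
    moreover have "0 \<le> ln (real n * sin \<theta> ^ 3)" using big by simp
    moreover have "KU * 1 \<le> KU * ln L" using lnL KU_nonneg by (intro mult_left_mono) auto
    moreover have "KC 1 * (1 + T1) + (KU + 8 * T2) * (1 + 2 * T3) \<le> KC 1 * (2 * ln L) + (KU * ln L + 8 * ln L) * (5 * ln L)"
      if "T1 \<le> ln L" "T2 \<le> ln L" "0 \<le> T2" "T3 \<le> 2 * ln L" "0 \<le> T3" "KU * 1 \<le> KU * ln L" for T1 T2 T3
    proof -
      have "KC 1 * (1 + T1) \<le> KC 1 * (2 * ln L)" using that lnL KC_nonneg[of 1] by (intro mult_left_mono) auto
      moreover have "(KU + 8 * T2) * (1 + 2 * T3) \<le> (KU * ln L + 8 * ln L) * (5 * ln L)"
      proof (rule mult_mono)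
        show "KU + 8 * T2 \<le> KU * ln L + 8 * ln L" "1 + 2 * T3 \<le> 5 * ln L" using that lnL by linarith+
        show "0 \<le> KU * ln L + 8 * ln L" using lnL KU_nonneg by simp
        show "0 \<le> 1 + 2 * T3" using that by simp
      qed
      ultimately show ?thesis by linarith
    qed
    ultimately show ?thesis by blast
  qed
  also have "\<dots> \<le> (2 * KC 1 + 5 * KU + 40) * (ln L)\<^sup>2"
  proof -
    have "KC 1 * (2 * (ln L * 1)) \<le> KC 1 * (2 * (ln L * ln L))" using lnL KC_nonneg[of 1] by (intro mult_left_mono) auto
    then show ?thesis by (simp add: power2_eq_square algebra_simps)
  qed
  finally have ec: "\<bar>pi * real (NN b (2 * cos \<theta>)) - Phi \<theta>\<bar> \<le> (2 * KC 1 + 5 * KU + 40) * (ln L)\<^sup>2" .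
  have ph: "\<bar>Phi \<theta> - 2 / 3 * L\<bar> \<le> 20 * A * \<mu>"
  proof -
    define R where "R = (1 - a\<^sup>2) * sin (2 * \<theta>) / 2 - a * m * sin \<theta>"
    have dec: "Phi \<theta> = real n * (\<theta> - sin (2 * \<theta>) / 2) + real n * R"
    proof -
      have "\<theta> - a\<^sup>2 * sin (2 * \<theta>) / 2 - a * m * sin \<theta> = (\<theta> - sin (2 * \<theta>) / 2) + R"
      proof -
        have "R = sin (2 * \<theta>) / 2 - a\<^sup>2 * sin (2 * \<theta>) / 2 - a * m * sin \<theta>"
          by (simp add: R_def left_diff_distrib diff_divide_distrib)
        then show ?thesis by simp
      qed
      then show ?thesis unfolding Phi_def distrib_left[symmetric] by simp
    qed
    have "\<bar>R\<bar> \<le> A * \<delta>\<^sup>2 * \<theta>"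
    proof -
      have "\<bar>sin (2 * \<theta>)\<bar> \<le> 2 * \<theta>" using sin_lipschitz[of "2 * \<theta>" 0] t(1) by simp
      then have "\<bar>1 - a\<^sup>2\<bar> * \<bar>sin (2 * \<theta>)\<bar> \<le> \<bar>1 - a\<^sup>2\<bar> * (2 * \<theta>)" by (intro mult_left_mono) auto
      then have 1: "\<bar>(1 - a\<^sup>2) * sin (2 * \<theta>)\<bar> \<le> \<bar>1 - a\<^sup>2\<bar> * (2 * \<theta>)" by (simp only: abs_mult)
      have "\<bar>a * m\<bar> * \<bar>sin \<theta>\<bar> \<le> \<bar>a * m\<bar> * \<theta>" using s s0 by (intro mult_left_mono) auto
      then have 2: "\<bar>a * m * sin \<theta>\<bar> \<le> \<bar>a * m\<bar> * \<theta>" by (simp only: abs_mult)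
      have "\<bar>R\<bar> \<le> \<bar>1 - a\<^sup>2\<bar> * \<theta> + \<bar>a * m\<bar> * \<theta>" using 1 2 unfolding R_def by linarith
      also have "\<dots> = (\<bar>1 - a\<^sup>2\<bar> + \<bar>a * m\<bar>) * \<theta>" by (simp add: algebra_simps)
      also have "\<dots> \<le> A * \<delta>\<^sup>2 * \<theta>" using fp(2) t(1) abs_ge_zero[of "a * m"] by (intro mult_right_mono) linarith+
      finally show ?thesis .
    qed
    then have "real n * \<bar>R\<bar> \<le> real n * (A * \<delta>\<^sup>2 * \<theta>)" by (intro mult_left_mono) auto
    also have "\<dots> = A * \<phi> * (real n * \<delta> ^ 3)" by (simp add: th power2_eq_square power3_eq_cube)
    finally have R: "\<bar>real n * R\<bar> \<le> A * \<phi>" using \<delta>(2) by (simp add: abs_mult)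
    have "2 * \<theta> - (2 * \<theta>) ^ 3 / 6 \<le> sin (2 * \<theta>)" "sin (2 * \<theta>) \<le> 2 * \<theta> - (2 * \<theta>) ^ 3 / 6 + (2 * \<theta>) ^ 5 / 120"
      using trig_taylor(2,4)[of "2 * \<theta>"] t(1) by auto
    then have w: "\<theta> - sin (2 * \<theta>) / 2 \<le> 2 / 3 * \<theta> ^ 3" "2 / 3 * \<theta> ^ 3 - \<theta> ^ 5 \<le> \<theta> - sin (2 * \<theta>) / 2"
      using t(1) zero_le_power[of \<theta> 5] by (auto simp: power_mult_distrib)
    have "real n * (\<theta> - sin (2 * \<theta>) / 2) \<le> real n * (2 / 3 * \<theta> ^ 3)"
      "real n * (2 / 3 * \<theta> ^ 3 - \<theta> ^ 5) \<le> real n * (\<theta> - sin (2 * \<theta>) / 2)"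
      using mult_left_mono[OF w(1) of_nat_0_le_iff] mult_left_mono[OF w(2) of_nat_0_le_iff] by blast+
    moreover have "real n * (2 / 3 * \<theta> ^ 3) = 2 / 3 * \<phi> ^ 3" using n\<theta> by (simp add: ac_simps)
    moreover have "real n * (2 / 3 * \<theta> ^ 3 - \<theta> ^ 5) = 2 / 3 * \<phi> ^ 3 - \<phi> ^ 3 * \<theta>\<^sup>2"
    proof -
      have "\<theta> ^ 5 = \<theta> ^ 3 * \<theta>\<^sup>2" by (simp flip: power_add)
      then have "real n * (2 / 3 * \<theta> ^ 3 - \<theta> ^ 5) = 2 / 3 * (real n * \<theta> ^ 3) - (real n * \<theta> ^ 3) * \<theta>\<^sup>2" by (simp add: algebra_simps)
      then show ?thesis by (simp only: n\<theta>)
    qed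
    moreover have "\<phi> ^ 3 * \<theta>\<^sup>2 \<le> 2"
    proof -
      have "\<phi> ^ 3 * \<theta>\<^sup>2 = \<phi> ^ 5 * \<delta>\<^sup>2" by (simp add: th power_mult_distrib eval_nat_numeral)
      also have "\<dots> \<le> (26 / 25 * \<mu>) ^ 5 * \<delta>\<^sup>2" using ea(5) \<phi> by (intro mult_right_mono power_mono) auto
      also have "\<dots> = (26 / 25) ^ 5 * (\<mu> ^ 5 * \<delta>\<^sup>2)" by (simp only: power_mult_distrib mult.assoc)
      also have "\<dots> \<le> (26 / 25) ^ 5 * 1" using \<mu>\<delta> by (intro mult_left_mono) auto
      finally have "\<phi> ^ 3 * \<theta>\<^sup>2 \<le> (26 / 25) ^ 5 * 1" .
      moreover have "(26 / 25 :: real) ^ 5 \<le> 2" by (simp add: eval_nat_numeral)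
      ultimately show ?thesis by linarith
    qed
    ultimately have main: "\<bar>real n * (\<theta> - sin (2 * \<theta>) / 2) - 2 / 3 * \<phi> ^ 3\<bar> \<le> 2" by linarith
    have cub: "\<bar>\<phi> ^ 3 - \<mu> ^ 3\<bar> \<le> 11 * A * \<mu>"
    proof -
      have pos: "0 < \<phi> + \<mu>" using \<phi> l by simp
      have eq: "\<bar>\<phi> - \<mu>\<bar> * (\<phi> + \<mu>) = \<bar>\<phi>\<^sup>2 - \<mu>\<^sup>2\<bar>"
      proof -
        have "\<phi>\<^sup>2 - \<mu>\<^sup>2 = (\<phi> - \<mu>) * (\<phi> + \<mu>)" by (simp add: power2_eq_square algebra_simps)
        then show ?thesis using pos by (simp add: abs_mult)
      qed
      have "\<phi> ^ 3 - \<mu> ^ 3 = (\<phi> - \<mu>) * (\<phi>\<^sup>2 + \<phi> * \<mu> + \<mu>\<^sup>2)" by (simp add: power2_eq_square power3_eq_cube algebra_simps)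
      then have "\<bar>\<phi> ^ 3 - \<mu> ^ 3\<bar> = \<bar>\<phi> - \<mu>\<bar> * (\<phi>\<^sup>2 + \<phi> * \<mu> + \<mu>\<^sup>2)" using \<phi> l by (simp add: abs_mult)
      moreover have "\<phi>\<^sup>2 + \<phi> * \<mu> + \<mu>\<^sup>2 \<le> (\<phi> + \<mu>) * (\<phi> + \<mu>)"
        using \<phi> l by (simp add: power2_eq_square algebra_simps)
      then have "\<bar>\<phi> - \<mu>\<bar> * (\<phi>\<^sup>2 + \<phi> * \<mu> + \<mu>\<^sup>2) \<le> \<bar>\<phi> - \<mu>\<bar> * ((\<phi> + \<mu>) * (\<phi> + \<mu>))" by (intro mult_left_mono) auto
      ultimately have "\<bar>\<phi> ^ 3 - \<mu> ^ 3\<bar> \<le> \<bar>\<phi>\<^sup>2 - \<mu>\<^sup>2\<bar> * (\<phi> + \<mu>)"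
        unfolding eq[symmetric] by (simp only: mult.assoc)
      also have "\<dots> \<le> (5 * A) * (51 / 25 * \<mu>)" using ea(3,5) \<phi> l A by (intro mult_mono) auto
      also have "\<dots> \<le> 11 * A * \<mu>" using A l by simp
      finally show ?thesis .
    qed
    have "A * \<phi> \<le> A * (26 / 25 * \<mu>)" using ea(5) A by (intro mult_left_mono) auto
    moreover have "10 * 1000 \<le> A * \<mu>" using A l by (intro mult_mono) auto
    ultimately show ?thesis using main R cub unfolding dec L_def by linarith
  qed
  have cnt: "real (card {j \<in> {1..n}. 2 - \<mu>\<^sup>2 * \<delta>\<^sup>2 < x j}) = real (NT (2 * cos \<theta>))"
  proof -
    have "2 * cos \<theta> < resc n x j \<longleftrightarrow> 2 - \<mu>\<^sup>2 * \<delta>\<^sup>2 < x j" if "j \<in> {1..n}" for j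
    proof -
      have "2 * cos \<theta> < resc n x j \<longleftrightarrow> a * (2 * cos \<theta>) < a * resc n x j" using a0 by simp
      moreover have "a * (2 * cos \<theta>) = 2 * a - a * u" unfolding t(3) by (simp add: algebra_simps)
      ultimately show ?thesis using fb(7)[OF that] au by auto
    qed
    then show ?thesis unfolding NT_def by (metis (no_types, lifting))
  qed
  have "pi * real (NN b (2 * cos \<theta>)) \<le> pi * real (NT (2 * cos \<theta>))" "pi * real (NT (2 * cos \<theta>)) \<le> pi * (real (NN b (2 * cos \<theta>)) + 1)"
    using NT_NN[OF b(1)] by (intro mult_left_mono; simp)+
  then have "\<bar>pi * real (NT (2 * cos \<theta>)) - pi * real (NN b (2 * cos \<theta>))\<bar> \<le> pi" by (simp add: distrib_left abs_le_iff)
  then show ?thesis using ec ph unfolding cnt L_def by linarith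
qed

section \<open>Constants and limits at the edge\<close>

definition edgeE :: "real \<Rightarrow> real" where
  "edgeE C = \<bar>2 * lagrange_config.KC C 1 + 5 * lagrange_config.KU C + 40\<bar>"

text \<open>The error actually obtained: the uncertainty of the frame moves the edge by a bounded
  number of edge units, which changes the count by order L^(1/3).\<close>

definition edgeW :: "real \<Rightarrow> real \<Rightarrow> real \<Rightarrow> real" where
  "edgeW C A L = 20 * A * L powr (1 / 3) + edgeE C * (ln L)\<^sup>2 + pi"

text \<open>The last summand serves those \<open>L\<close> that are too small for
  \<open>edge_at\<close>.\<close>

definition edgeD :: "real \<Rightarrow> real \<Rightarrow> real" where
  "edgeD C K = (let A = frameA C K in
     40 * A + 13 * edgeE C + 8 + 2 * ((100 * A) ^ 3 + edgeW C A ((100 * A) ^ 3)))"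

text \<open>Since \<open>ln L\<close> is at least 1/2 its fifth root is bounded below, and
  \<open>ln x <= x - 1\<close> at \<open>x = L powr (2 / 5)\<close> bounds the squared logarithm by
  a power of L.\<close>

lemma edge_base:
  fixes L :: real
  assumes L: "2 < L"
  defines "b \<equiv> L powr (4 / 5) * ln L powr (1 / 5)"
  shows "1 / 2 \<le> b" "L powr (4 / 5) \<le> 2 * b" "L powr (1 / 3) \<le> 2 * b" "(ln L)\<^sup>2 \<le> 13 * b"
proof -
  have l: "1 / 2 \<le> ln L" by (rule ln_ge_half[OF L])
  have "1 / 2 = (1 / 2 :: real) powr 1" by simp
  also have "\<dots> \<le> (1 / 2) powr (1 / 5)" by (rule powr_mono') auto
  also have "\<dots> \<le> ln L powr (1 / 5)" using l by (intro powr_mono2) auto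
  finally have q: "1 / 2 \<le> ln L powr (1 / 5)" .
  have "L powr (4 / 5) * (1 / 2) \<le> b" unfolding b_def using q by (intro mult_left_mono) auto
  then show b: "L powr (4 / 5) \<le> 2 * b" by simp
  have "1 \<le> L powr (4 / 5)" using L by (intro ge_one_powr_ge_zero) auto
  then show "1 / 2 \<le> b" using b by simp
  have "L powr (1 / 3) \<le> L powr (4 / 5)" using L by (intro powr_mono) auto
  then show "L powr (1 / 3) \<le> 2 * b" using b by simp
  have "ln (L powr (2 / 5)) \<le> L powr (2 / 5) - 1" using L by (intro ln_le_minus_one) simp
  then have "ln L \<le> 5 / 2 * L powr (2 / 5)" using L by (simp add: ln_powr)
  then have "(ln L)\<^sup>2 \<le> (5 / 2 * L powr (2 / 5))\<^sup>2" using l by (intro power_mono) auto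
  also have "\<dots> = 25 / 4 * (L powr (2 / 5) * L powr (2 / 5))" by (simp add: power2_eq_square)
  also have "\<dots> = 25 / 4 * L powr (4 / 5)" by (simp flip: powr_add)
  also have "\<dots> \<le> 13 * b" using b \<open>1 / 2 \<le> b\<close> by linarith
  finally show "(ln L)\<^sup>2 \<le> 13 * b" .
qed

lemma edge_window:
  assumes "0 < L" "0 < n"
  shows "(L / real n) powr (2 / 3) = (L powr (1 / 3))\<^sup>2 * (edge_scale n)\<^sup>2"
proof -
  have "(L powr (1 / 3))\<^sup>2 = L powr (2 / 3)" using assms by (simp add: power2_eq_square flip: powr_add)
  moreover have "(edge_scale n)\<^sup>2 = real n powr (- (2 / 3))"
    using assms by (simp add: edge_scale_def power2_eq_square flip: powr_add)
  ultimately show ?thesis using assms by (simp add: powr_divide powr_minus_divide)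
qed

text \<open>By \<open>good\<close> no point exceeds 2 by more than K squared edge units. Once the
  window is larger than that, the ball around 2 contains the same points as a half-line, to which
  \<open>edge_at\<close> applies.\<close>

lemma edge_right_large:
  assumes C: "1 \<le> C" and K: "0 \<le> K" and g: "\<forall>\<^sub>F n in sequentially. good C K n (\<omega> n)"
    and L: "(100 * frameA C K) ^ 3 \<le> L"
  shows "\<forall>\<^sub>F n in sequentially. \<bar>real (card {j \<in> {1..n}. \<omega> n j \<in> ball 2 ((L / real n) powr (2 / 3))}) - 2 / (3 * pi) * L\<bar>
      \<le> edgeW C (frameA C K) L"
proof -
  define A l where "A = frameA C K" and "l = L powr (1 / 3)"
  have A: "10 \<le> A" "K \<le> A" using frameA_ge[OF K] by (auto simp: A_def)
  have "0 < (100 * A) ^ 3" using A by simp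
  then have L0: "0 < L" using L unfolding A_def[symmetric] by linarith
  have l3: "l ^ 3 = L" using L0 by (simp add: l_def powr_powr flip: powr_realpow)
  have lA: "100 * A \<le> l" using L power_le_imp_le_base[of "100 * A" 2 l] l3 by (simp add: A_def l_def eval_nat_numeral)
  have "(\<lambda>n. l ^ 5 * (edge_scale n)\<^sup>2) \<longlonglongrightarrow> l ^ 5 * 0\<^sup>2" by (intro tendsto_intros edge_scale_tendsto)
  then have "\<forall>\<^sub>F n in sequentially. l ^ 5 * (edge_scale n)\<^sup>2 < 1" by (rule order_tendstoD) simp
  with frame_limits(2)[OF C K g] show ?thesis
  proof eventually_elim
    case (elim n)
    then have n: "8 \<le> n" and gn: "good C K n (\<omega> n)" by auto
    define r where "r = l\<^sup>2 * (edge_scale n)\<^sup>2"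
    have r: "(L / real n) powr (2 / 3) = r" using edge_window[OF L0, of n] n by (simp add: r_def l_def)
    have e0: "0 < (edge_scale n)\<^sup>2" using edge_scale(1)[of n] n by simp
    have "K < l\<^sup>2"
    proof -
      have "1 * l \<le> l * l" using lA A by (intro mult_right_mono) auto
      then show ?thesis using A lA unfolding power2_eq_square by linarith
    qed
    then have Kr: "K * (edge_scale n)\<^sup>2 < r" unfolding r_def using e0 by (rule mult_strict_right_mono)
    have "\<omega> n j \<in> ball 2 r \<longleftrightarrow> 2 - r < \<omega> n j" if "j \<in> {1..n}" for j
    proof -
      have "\<bar>\<omega> n j\<bar> \<le> 2 + K * (edge_scale n)\<^sup>2" using gn that unfolding good_def by blast
      then have "\<omega> n j < 2 + r" using Kr by linarith
      then show ?thesis by (auto simp: dist_real_def abs_less_iff)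
    qed
    then have "{j \<in> {1..n}. \<omega> n j \<in> ball 2 r} = {j \<in> {1..n}. 2 - r < \<omega> n j}" by blast
    then have "\<bar>pi * real (card {j \<in> {1..n}. \<omega> n j \<in> ball 2 r}) - 2 / 3 * l ^ 3\<bar>
      \<le> 20 * A * l + (2 * lagrange_config.KC C 1 + 5 * lagrange_config.KU C + 40) * (ln (l ^ 3))\<^sup>2 + pi"
      using edge_at[OF gn n C K _ lA[unfolded A_def]] elim unfolding A_def r_def by simp
    also have "\<dots> \<le> edgeW C A L"
      unfolding edgeW_def edgeE_def l3 l_def[symmetric] by (intro add_mono mult_right_mono order_refl abs_ge_self zero_le_power2)
    finally have *: "\<bar>pi * real (card {j \<in> {1..n}. \<omega> n j \<in> ball 2 r}) - 2 / 3 * L\<bar> \<le> edgeW C A L" unfolding l3 .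
    define N where "N = real (card {j \<in> {1..n}. \<omega> n j \<in> ball 2 r})"
    have "pi * N - 2 / 3 * L = pi * (N - 2 / (3 * pi) * L)" by (simp add: right_diff_distrib)
    then have "\<bar>pi * N - 2 / 3 * L\<bar> = pi * \<bar>N - 2 / (3 * pi) * L\<bar>" by (simp only: abs_mult) simp
    moreover have "1 * \<bar>N - 2 / (3 * pi) * L\<bar> \<le> pi * \<bar>N - 2 / (3 * pi) * L\<bar>" using pi_ge_two by (intro mult_right_mono) auto
    ultimately have "\<bar>N - 2 / (3 * pi) * L\<bar> \<le> edgeW C A L" using *[folded N_def] by simp
    then show ?case unfolding r N_def A_def .
  qed
qed

lemma edgeW_nonneg: "0 \<le> A \<Longrightarrow> 0 \<le> edgeW C A L"
  by (simp add: edgeW_def edgeE_def)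

lemma edgeD_pos: "0 \<le> K \<Longrightarrow> 0 < edgeD C K"
  using frameA_ge(1)[of K C] edgeW_nonneg[of "frameA C K" C]
  unfolding edgeD_def Let_def edgeE_def by (intro add_pos_nonneg add_nonneg_pos) auto

lemma edge_right:
  assumes C: "1 \<le> C" and K: "0 \<le> K" and g: "\<forall>\<^sub>F n in sequentially. good C K n (\<omega> n)" and L: "2 < L"
  shows "\<forall>\<^sub>F n in sequentially. \<bar>real (card {j \<in> {1..n}. \<omega> n j \<in> ball 2 ((L / real n) powr (2 / 3))}) - 2 / (3 * pi) * L\<bar>
      \<le> edgeD C K * L powr (4 / 5) * ln L powr (1 / 5)"
proof -
  define A L0 where "A = frameA C K" and "L0 = (100 * A) ^ 3"
  define b where "b = L powr (4 / 5) * ln L powr (1 / 5)"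
  note eb = edge_base[OF L, folded b_def]
  have A: "10 \<le> A" using frameA_ge[OF K] by (simp add: A_def)
  have E: "0 \<le> edgeE C" by (simp add: edgeE_def)
  have L0p: "0 < L0" using A by (simp add: L0_def)
  have W0: "0 \<le> edgeW C A L0" using A by (intro edgeW_nonneg) simp
  have D: "edgeD C K = 40 * A + 13 * edgeE C + 8 + 2 * (L0 + edgeW C A L0)"
    by (simp add: edgeD_def Let_def A_def L0_def)
  have "\<forall>\<^sub>F n in sequentially. \<bar>real (card {j \<in> {1..n}. \<omega> n j \<in> ball 2 ((L / real n) powr (2 / 3))}) - 2 / (3 * pi) * L\<bar> \<le> edgeD C K * b"
  proof (cases "L0 \<le> L")
    case True
    have "edgeW C A L \<le> edgeD C K * b"
    proof -
      have "20 * A * L powr (1 / 3) \<le> 20 * A * (2 * b)" using eb(3) A by (intro mult_left_mono) auto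
      moreover have "edgeE C * (ln L)\<^sup>2 \<le> edgeE C * (13 * b)" using eb(4) E by (intro mult_left_mono) auto
      moreover have "0 \<le> (2 * (L0 + edgeW C A L0)) * b" using L0p W0 eb(1) by (intro mult_nonneg_nonneg) auto
      moreover have "pi \<le> 8 * b" using eb(1) pi_less_4 by linarith
      moreover have "edgeD C K * b = 20 * A * (2 * b) + edgeE C * (13 * b) + 8 * b + (2 * (L0 + edgeW C A L0)) * b"
        unfolding D by (simp add: algebra_simps)
      ultimately show ?thesis unfolding edgeW_def by linarith
    qed
    moreover note edge_right_large[OF C K g, of L] True
    ultimately show ?thesis by (auto simp: A_def L0_def elim!: eventually_mono)
  next
    case False
    \<comment> \<open>For smaller \<open>L\<close> the ball is contained in the one for
      \<open>L0\<close>, whose count is already controlled; a bounded error is admissible because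
      \<open>b\<close> is at least 1/2.\<close>
    have "(100 * frameA C K) ^ 3 \<le> L0" by (simp add: L0_def A_def)
    from edge_right_large[OF C K g this, folded A_def] eventually_gt_at_top[of 0]
    show ?thesis
    proof (eventually_elim, goal_cases)
      case (1 n)
      define N N0 where "N = real (card {j \<in> {1..n}. \<omega> n j \<in> ball 2 ((L / real n) powr (2 / 3))})"
        and "N0 = real (card {j \<in> {1..n}. \<omega> n j \<in> ball 2 ((L0 / real n) powr (2 / 3))})"
      have "(L / real n) powr (2 / 3) \<le> (L0 / real n) powr (2 / 3)"
        using False L by (intro powr_mono2 divide_right_mono) auto
      then have "N \<le> N0" unfolding N_def N0_def
        by (intro of_nat_mono card_mono) auto
      moreover have "2 / (3 * pi) \<le> 1" using pi_ge_two by simp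
      then have "2 / (3 * pi) * L0 \<le> 1 * L0" "2 / (3 * pi) * L \<le> 1 * L"
        using L0p L by (intro mult_right_mono; simp)+
      moreover have "0 \<le> 2 / (3 * pi) * L" using L by simp
      moreover have "\<bar>N0 - 2 / (3 * pi) * L0\<bar> \<le> edgeW C A L0" using 1 by (simp add: N0_def)
      moreover have "0 \<le> N" by (simp add: N_def)
      ultimately have "\<bar>N - 2 / (3 * pi) * L\<bar> \<le> L0 + edgeW C A L0" using False W0 by linarith
      also have "\<dots> \<le> (2 * (L0 + edgeW C A L0)) * b"
      proof -
        have "(2 * (L0 + edgeW C A L0)) * (1 / 2) \<le> (2 * (L0 + edgeW C A L0)) * b"
          using eb(1) L0p W0 by (intro mult_left_mono) auto
        then show ?thesis by simp
      qed
      also have "\<dots> \<le> edgeD C K * b" unfolding D using A E eb(1) by (intro mult_right_mono) auto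
      finally show ?case by (simp add: N_def)
    qed
  qed
  then show ?thesis by (simp add: b_def mult.assoc)
qed

lemma edge_left:
  assumes C: "1 \<le> C" and K: "0 \<le> K" and g: "\<forall>\<^sub>F n in sequentially. good C K n (\<omega> n)" and L: "2 < L"
  shows "\<forall>\<^sub>F n in sequentially. \<bar>real (card {j \<in> {1..n}. \<omega> n j \<in> ball (- 2) ((L / real n) powr (2 / 3))}) - 2 / (3 * pi) * L\<bar>
      \<le> edgeD C K * L powr (4 / 5) * ln L powr (1 / 5)"
proof -
  have "\<forall>\<^sub>F n in sequentially. good C K n (\<lambda>i. - \<omega> n i)" by (rule eventually_mono[OF g good_reflect])
  note edge_right[OF C K this L]
  moreover have "- \<omega> n j \<in> ball 2 r \<longleftrightarrow> \<omega> n j \<in> ball (- 2) r" for n j and r :: real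
    by (auto simp: dist_real_def)
  ultimately show ?thesis by (simp only:)
qed

section \<open>The ensemble\<close>

abbreviation conf :: "nat \<Rightarrow> (nat \<Rightarrow> real) measure" where "conf n \<equiv> PiM {1..n} (\<lambda>_. lborel)"

interpretation lborel_product: product_sigma_finite "\<lambda>_ :: nat. lborel :: real measure"
  by standard

definition pairs :: "nat \<Rightarrow> (nat \<times> nat) set" where
  "pairs n = {(k, j). 1 \<le> k \<and> k < j \<and> j \<le> n}"

lemma finite_pairs: "finite (pairs n)"
  by (rule finite_subset[of _ "{1..n} \<times> {1..n}"]) (auto simp: pairs_def)

lemma weight_pairs:
  "weight \<beta> n x = (\<Prod>(k, l)\<in>pairs n. \<bar>x k - x l\<bar> powr \<beta>) * exp (- (real n * \<beta> / 4) * (\<Sum>i=1..n. (x i)\<^sup>2))"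
  by (simp add: weight_def pairs_def sum_distrib_left[symmetric] sum_divide_distrib[symmetric])

lemma weight_nonneg: "0 \<le> weight \<beta> n x"
  by (simp add: weight_pairs prod_nonneg split_beta)

lemma weight_measurable [measurable]: "weight \<beta> n \<in> borel_measurable (conf n)"
proof -
  have "(\<lambda>x. \<bar>x (fst e) - x (snd e)\<bar> powr \<beta>) \<in> borel_measurable (conf n)" if "e \<in> pairs n" for e
  proof -
    have [measurable]: "(\<lambda>x. x (fst e)) \<in> borel_measurable (conf n)" "(\<lambda>x. x (snd e)) \<in> borel_measurable (conf n)"
      using that measurable_component_singleton[of "fst e" "{1..n}" "\<lambda>_. lborel"]
        measurable_component_singleton[of "snd e" "{1..n}" "\<lambda>_. lborel"] by (auto simp: pairs_def)
    show ?thesis by measurable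
  qed
  then have [measurable]: "(\<lambda>x. \<Prod>e\<in>pairs n. \<bar>x (fst e) - x (snd e)\<bar> powr \<beta>) \<in> borel_measurable (conf n)"
    by (rule borel_measurable_prod)
  have [measurable]: "(\<lambda>x. \<Sum>i=1..n. (x i)\<^sup>2) \<in> borel_measurable (conf n)"
    by (intro borel_measurable_sum borel_measurable_power)
       (use measurable_component_singleton[of _ "{1..n}" "\<lambda>_. lborel"] in auto)
  show ?thesis unfolding weight_pairs[abs_def] split_beta by measurable
qed

lemma weight_ennreal_measurable [measurable]: "(\<lambda>x. ennreal (weight \<beta> n x)) \<in> borel_measurable (conf n)"
  by (rule measurable_compose[OF weight_measurable measurable_ennreal])

definition rest_weight :: "real \<Rightarrow> nat \<Rightarrow> (nat \<Rightarrow> real) \<Rightarrow> nat \<Rightarrow> real" where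
  "rest_weight \<beta> n x j = (\<Prod>(k, l)\<in>{e \<in> pairs n. fst e \<noteq> j \<and> snd e \<noteq> j}. \<bar>x k - x l\<bar> powr \<beta>)
     * exp (- (real n * \<beta> / 4) * (\<Sum>i\<in>{1..n} - {j}. (x i)\<^sup>2))"

lemma rest_weight_update: "rest_weight \<beta> n (x(j := t)) j = rest_weight \<beta> n x j"
  unfolding rest_weight_def by (intro arg_cong2[where f = "(*)"] arg_cong[where f = exp] prod.cong refl) auto

lemma rest_weight_nonneg: "0 \<le> rest_weight \<beta> n x j"
  by (simp add: rest_weight_def prod_nonneg split_beta)

lemma lagr_weight_update: "lagr_weight n (x(j := t)) j s = lagr_weight n x j s"
  unfolding lagr_weight_def by (intro arg_cong2[where f = "(*)"] prod.cong refl) auto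

lemma lagr_weight_nonneg: "0 \<le> lagr_weight n x j s"
  by (simp add: lagr_weight_def prod_nonneg)

lemma weight_split:
  assumes j: "j \<in> {1..n}"
  shows "weight \<beta> n x = lagr_weight n x j (x j) powr \<beta> * rest_weight \<beta> n x j"
proof -
  define A B where "A = {e \<in> pairs n. fst e = j \<or> snd e = j}" and "B = {e \<in> pairs n. fst e \<noteq> j \<and> snd e \<noteq> j}"
  define f where "f e = \<bar>x (fst e) - x (snd e)\<bar> powr \<beta>" for e
  have un: "pairs n = A \<union> B" "A \<inter> B = {}" by (auto simp: A_def B_def)
  have fin: "finite A" "finite B" using finite_pairs[of n] by (auto simp: A_def B_def)
  have "prod f (pairs n) = prod f A * prod f B" unfolding un(1) using fin un(2) by (intro prod.union_disjoint) auto
  moreover have "prod f A = (\<Prod>i\<in>{1..n} - {j}. \<bar>x j - x i\<bar> powr \<beta>)"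
    by (rule prod.reindex_bij_witness[where i = "\<lambda>i. (min i j, max i j)" and j = "\<lambda>e. if fst e = j then snd e else fst e"])
       (use j in \<open>auto simp: A_def pairs_def f_def abs_minus_commute min_def max_def\<close>)
  moreover have "\<dots> = (\<Prod>i\<in>{1..n} - {j}. \<bar>x j - x i\<bar>) powr \<beta>" by (rule prod_powr_distrib[symmetric])
  ultimately have P: "prod f (pairs n) = (\<Prod>i\<in>{1..n} - {j}. \<bar>x j - x i\<bar>) powr \<beta> * prod f B" by simp
  have S: "(\<Sum>i=1..n. (x i)\<^sup>2) = (x j)\<^sup>2 + (\<Sum>i\<in>{1..n} - {j}. (x i)\<^sup>2)" using j by (intro sum.remove) auto
  have E: "exp (- (real n * \<beta> / 4) * (x j)\<^sup>2) = exp (- real n * (x j)\<^sup>2 / 4) powr \<beta>" by (simp add: powr_def)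
  have "weight \<beta> n x = prod f (pairs n) * exp (- (real n * \<beta> / 4) * (\<Sum>i=1..n. (x i)\<^sup>2))"
    by (simp add: weight_pairs f_def[abs_def] split_beta')
  also have "\<dots> = ((\<Prod>i\<in>{1..n} - {j}. \<bar>x j - x i\<bar>) powr \<beta> * exp (- real n * (x j)\<^sup>2 / 4) powr \<beta>)
      * (prod f B * exp (- (real n * \<beta> / 4) * (\<Sum>i\<in>{1..n} - {j}. (x i)\<^sup>2)))"
    unfolding P S distrib_left exp_add E by (simp only: ac_simps)
  also have "\<dots> = lagr_weight n x j (x j) powr \<beta> * rest_weight \<beta> n x j"
    unfolding lagr_weight_def rest_weight_def B_def[symmetric] f_def[abs_def] split_beta' by (simp add: powr_mult prod_nonneg)
  finally show ?thesis .
qed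

text \<open>Use \<open>1 + u <= exp u\<close> for the modulus u of \<open>x\<close>, then complete
  the square; half of the Gaussian is kept for integrability.\<close>

lemma one_plus_powr_gaussian:
  fixes a b x :: real
  assumes "0 \<le> a" "0 < b"
  shows "(1 + \<bar>x\<bar>) powr a * exp (- b * x\<^sup>2) \<le> exp (a\<^sup>2 / (2 * b)) * exp (- (b / 2) * x\<^sup>2)"
proof -
  have "(1 + \<bar>x\<bar>) powr a \<le> exp \<bar>x\<bar> powr a" using assms exp_ge_add_one_self[of "\<bar>x\<bar>"] by (intro powr_mono2) auto
  also have "\<dots> = exp (a * \<bar>x\<bar>)" by (simp add: powr_def)
  also have "\<dots> \<le> exp (a\<^sup>2 / (2 * b) + b / 2 * x\<^sup>2)"
  proof -
    have "0 \<le> (a - b * \<bar>x\<bar>)\<^sup>2 / (2 * b)" using assms by simp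
    also have "\<dots> = a\<^sup>2 / (2 * b) + b / 2 * x\<^sup>2 - a * \<bar>x\<bar>"
    proof -
      have "(a - b * \<bar>x\<bar>)\<^sup>2 = a\<^sup>2 + b\<^sup>2 * x\<^sup>2 - 2 * a * b * \<bar>x\<bar>" by (simp add: power2_diff power_mult_distrib)
      then show ?thesis using assms by (simp add: field_simps power2_eq_square)
    qed
    finally show ?thesis by simp
  qed
  finally have "(1 + \<bar>x\<bar>) powr a * exp (- b * x\<^sup>2) \<le> exp (a\<^sup>2 / (2 * b) + b / 2 * x\<^sup>2) * exp (- b * x\<^sup>2)"
    by (intro mult_right_mono) auto
  also have "\<dots> = exp (a\<^sup>2 / (2 * b)) * exp (- (b / 2) * x\<^sup>2)" by (simp add: exp_add[symmetric] algebra_simps)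
  finally show ?thesis .
qed

lemma integrable_gaussian:
  fixes b :: real
  assumes "0 < b"
  shows "integrable lborel (\<lambda>x. exp (- b * x\<^sup>2))"
proof -
  define s where "s = sqrt (1 / (2 * b))"
  have s: "0 < s" "s\<^sup>2 = 1 / (2 * b)" using assms by (simp_all add: s_def)
  have "integrable lborel (\<lambda>x. sqrt (2 * pi * s\<^sup>2) * normal_density 0 s x)"
    by (intro integrable_mult_right integrable_normal_density) (use s assms in auto)
  moreover have "sqrt (2 * pi * s\<^sup>2) * normal_density 0 s x = exp (- b * x\<^sup>2)" for x
  proof -
    have "- (x - 0)\<^sup>2 / (2 * s\<^sup>2) = - b * x\<^sup>2" unfolding s(2) using assms by (simp add: field_simps)
    moreover have "sqrt (2 * pi * s\<^sup>2) \<noteq> 0" using s(1) by (metis s(1) mult_eq_0_iff less_irrefl pi_gt_zero power_not_zero real_sqrt_eq_zero_cancel_iff zero_neq_numeral)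
    ultimately show ?thesis unfolding normal_density_def by simp
  qed
  ultimately show ?thesis by simp
qed

text \<open>Every difference of two coordinates is bounded by the product of all
  \<open>1 + u\<close> over the moduli u of the coordinates. This makes the majorant a product of
  functions of one variable.\<close>

lemma weight_integrable:
  assumes "0 < \<beta>" "1 \<le> n"
  shows "integrable (conf n) (weight \<beta> n)"
proof -
  define b a where "b = real n * \<beta> / 4" and "a = \<beta> * real (card (pairs n))"
  have b: "0 < b" "0 \<le> a" using assms by (auto simp: b_def a_def)
  define h where "h y = exp (a\<^sup>2 / (2 * b)) * exp (- (b / 2) * y\<^sup>2)" for y :: real
  have "integrable (conf n) (\<lambda>x. \<Prod>i\<in>{1..n}. h (x i))"
    unfolding h_def using b by (intro lborel_product.product_integrable_prod integrable_mult_right integrable_gaussian) auto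
  then show ?thesis
  proof (rule Bochner_Integration.integrable_bound)
    show "AE x in conf n. norm (weight \<beta> n x) \<le> norm (\<Prod>i\<in>{1..n}. h (x i))"
    proof (rule AE_I2)
      fix x :: "nat \<Rightarrow> real"
      define G where "G = (\<Prod>i\<in>{1..n}. (1 + \<bar>x i\<bar>))"
      have "\<bar>x k - x l\<bar> \<le> G" if "(k, l) \<in> pairs n" for k l
      proof -
        have kl: "k \<in> {1..n}" "l \<in> {1..n}" "k \<noteq> l" using that by (auto simp: pairs_def)
        have "\<bar>x k - x l\<bar> \<le> (1 + \<bar>x k\<bar>) * (1 + \<bar>x l\<bar>)"
        proof -
          have "0 \<le> \<bar>x k\<bar> * \<bar>x l\<bar>" by simp
          moreover have "(1 + \<bar>x k\<bar>) * (1 + \<bar>x l\<bar>) = 1 + \<bar>x k\<bar> + \<bar>x l\<bar> + \<bar>x k\<bar> * \<bar>x l\<bar>" by (simp add: algebra_simps)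
          ultimately show ?thesis by linarith
        qed
        also have "\<dots> = (\<Prod>i\<in>{k, l}. (1 + \<bar>x i\<bar>))" using kl by simp
        also have "\<dots> \<le> G" unfolding G_def using kl by (intro prod_mono2) auto
        finally show ?thesis .
      qed
      then have "(\<Prod>e\<in>pairs n. \<bar>x (fst e) - x (snd e)\<bar> powr \<beta>) \<le> (\<Prod>e\<in>pairs n. G powr \<beta>)"
        using assms by (intro prod_mono conjI powr_mono2) auto
      also have "\<dots> = G powr a"
      proof -
        have "0 < G" unfolding G_def by (intro prod_pos) (auto simp: add_pos_nonneg)
        then show ?thesis by (simp add: a_def powr_powr[symmetric] powr_realpow)
      qed
      also have "\<dots> = (\<Prod>i\<in>{1..n}. (1 + \<bar>x i\<bar>) powr a)" unfolding G_def by (rule prod_powr_distrib)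
      finally have 1: "(\<Prod>e\<in>pairs n. \<bar>x (fst e) - x (snd e)\<bar> powr \<beta>) \<le> (\<Prod>i\<in>{1..n}. (1 + \<bar>x i\<bar>) powr a)" .
      have "exp (- (real n * \<beta> / 4) * (\<Sum>i=1..n. (x i)\<^sup>2)) = (\<Prod>i\<in>{1..n}. exp (- b * (x i)\<^sup>2))"
        by (simp add: exp_sum[symmetric] sum_distrib_left b_def)
      then have "weight \<beta> n x \<le> (\<Prod>i\<in>{1..n}. (1 + \<bar>x i\<bar>) powr a) * (\<Prod>i\<in>{1..n}. exp (- b * (x i)\<^sup>2))"
        using 1 unfolding weight_pairs split_beta by (simp add: mult_right_mono prod_nonneg)
      also have "\<dots> = (\<Prod>i\<in>{1..n}. (1 + \<bar>x i\<bar>) powr a * exp (- b * (x i)\<^sup>2))" by (simp add: prod.distrib)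
      also have "\<dots> \<le> (\<Prod>i\<in>{1..n}. h (x i))"
        unfolding h_def using one_plus_powr_gaussian[OF b(2,1)] by (intro prod_mono) auto
      finally show "norm (weight \<beta> n x) \<le> norm (\<Prod>i\<in>{1..n}. h (x i))" using weight_nonneg[of \<beta> n x] by simp
    qed
  qed measurable
qed

lemma partition_const_pos:
  assumes "0 < \<beta>" "1 \<le> n"
  shows "0 < partition_const \<beta> n"
proof -
  have "0 \<le> partition_const \<beta> n" unfolding partition_const_def by (intro integral_nonneg_AE) (simp add: weight_nonneg)
  moreover have "partition_const \<beta> n \<noteq> 0"
  proof
    assume "partition_const \<beta> n = 0"
    then have "AE x in conf n. weight \<beta> n x = 0"
      unfolding partition_const_def
      by (subst (asm) integral_nonneg_eq_0_iff_AE) (use weight_integrable[OF assms] weight_nonneg in auto)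
    \<comment> \<open>On this box of positive measure the coordinates lie in disjoint intervals, so
      the density does not vanish there.\<close>
    moreover define Q where "Q = (\<Pi>\<^sub>E i\<in>{1..n}. {real i .. real i + 1 / 2})"
    have "x \<notin> Q" if "weight \<beta> n x = 0" for x
    proof
      assume Q: "x \<in> Q"
      have "0 < \<bar>x k - x l\<bar>" if "(k, l) \<in> pairs n" for k l
      proof -
        have "real k + 1 \<le> real l" "x k \<le> real k + 1 / 2" "real l \<le> x l"
          using that Q by (auto simp: pairs_def Q_def PiE_iff)
        then show ?thesis by linarith
      qed
      then have "0 < weight \<beta> n x" unfolding weight_pairs by (intro mult_pos_pos prod_pos) auto
      then show False using that by simp
    qed
    ultimately have "AE x in conf n. x \<notin> Q" by auto
    moreover have "Q \<in> sets (conf n)" unfolding Q_def by (intro sets_PiM_I_finite) auto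
    ultimately have "emeasure (conf n) Q = 0" by (simp add: AE_iff_measurable[OF _ refl] AE_iff_null_sets null_setsD1)
    moreover have "emeasure (conf n) Q = (\<Prod>i\<in>{1..n}. emeasure lborel {real i .. real i + 1 / 2})"
      unfolding Q_def by (intro lborel_product.emeasure_PiM) auto
    ultimately show False by simp
  qed
  ultimately show ?thesis by simp
qed

lemma nn_integral_weight:
  assumes "0 < \<beta>" "1 \<le> n"
  shows "(\<integral>\<^sup>+ x. ennreal (weight \<beta> n x) \<partial>conf n) = ennreal (partition_const \<beta> n)"
  unfolding partition_const_def by (intro nn_integral_eq_integral weight_integrable assms) (simp add: weight_nonneg)

lemma beta_density_measurable: "(\<lambda>x. ennreal (1 / partition_const \<beta> n * weight \<beta> n x)) \<in> borel_measurable (conf n)"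
  by (intro measurable_compose[OF _ measurable_ennreal] borel_measurable_times weight_measurable) simp

lemma nn_integral_beta_ensemble:
  assumes "0 < \<beta>" "1 \<le> n" and [measurable]: "f \<in> borel_measurable (conf n)"
  shows "(\<integral>\<^sup>+ x. f x \<partial>beta_ensemble \<beta> n)
    = ennreal (1 / partition_const \<beta> n) * (\<integral>\<^sup>+ x. ennreal (weight \<beta> n x) * f x \<partial>conf n)"
proof -
  have Z: "0 < partition_const \<beta> n" by (rule partition_const_pos[OF assms(1,2)])
  have "(\<integral>\<^sup>+ x. f x \<partial>beta_ensemble \<beta> n) = (\<integral>\<^sup>+ x. ennreal (1 / partition_const \<beta> n * weight \<beta> n x) * f x \<partial>conf n)"
    unfolding beta_ensemble_def
    by (rule nn_integral_density[OF beta_density_measurable assms(3)])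
  also have "\<dots> = (\<integral>\<^sup>+ x. ennreal (1 / partition_const \<beta> n) * (ennreal (weight \<beta> n x) * f x) \<partial>conf n)"
  proof (rule nn_integral_cong)
    fix x
    have "ennreal (1 / partition_const \<beta> n * weight \<beta> n x) = ennreal (1 / partition_const \<beta> n) * ennreal (weight \<beta> n x)"
      using Z by (intro ennreal_mult weight_nonneg) simp
    then show "ennreal (1 / partition_const \<beta> n * weight \<beta> n x) * f x = ennreal (1 / partition_const \<beta> n) * (ennreal (weight \<beta> n x) * f x)"
      by (simp only: mult.assoc)
  qed
  also have "\<dots> = ennreal (1 / partition_const \<beta> n) * (\<integral>\<^sup>+ x. ennreal (weight \<beta> n x) * f x \<partial>conf n)"
    by (intro nn_integral_cmult borel_measurable_times_ennreal weight_ennreal_measurable assms(3))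
  finally show ?thesis .
qed

lemma sets_beta_ensemble [measurable_cong]: "sets (beta_ensemble \<beta> n) = sets (conf n)"
  by (simp add: beta_ensemble_def)

lemma space_beta_ensemble: "space (beta_ensemble \<beta> n) = space (conf n)"
  by (simp add: beta_ensemble_def)

lemma prob_space_beta_ensemble:
  assumes "0 < \<beta>" "1 \<le> n"
  shows "prob_space (beta_ensemble \<beta> n)"
proof (rule prob_spaceI)
  have Z: "0 < partition_const \<beta> n" by (rule partition_const_pos[OF assms])
  have "emeasure (beta_ensemble \<beta> n) (space (beta_ensemble \<beta> n)) = (\<integral>\<^sup>+ x. 1 \<partial>beta_ensemble \<beta> n)" by simp
  also have "\<dots> = ennreal (1 / partition_const \<beta> n) * ennreal (partition_const \<beta> n)"
    by (subst nn_integral_beta_ensemble[OF assms]) (simp_all only: mult_1_right nn_integral_weight[OF assms] borel_measurable_const)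
  also have "\<dots> = 1" using Z by (simp add: ennreal_mult[symmetric])
  finally show "emeasure (beta_ensemble \<beta> n) (space (beta_ensemble \<beta> n)) = 1" .
qed

lemma beta_ensemble_AE_pos: "AE x in beta_ensemble \<beta> n. 0 < weight \<beta> n x"
proof -
  have "AE x in conf n. 0 < ennreal (1 / partition_const \<beta> n * weight \<beta> n x) \<longrightarrow> 0 < weight \<beta> n x"
    using weight_nonneg[of \<beta> n] by (intro AE_I2) (auto simp: less_le)
  then show ?thesis unfolding beta_ensemble_def AE_density[OF beta_density_measurable] .
qed

section \<open>Resampling one point\<close>

definition resampled :: "real \<Rightarrow> nat \<Rightarrow> nat \<Rightarrow> (nat \<Rightarrow> real) \<Rightarrow> ennreal" where
  "resampled \<beta> n j x = (\<integral>\<^sup>+ t. ennreal (weight \<beta> n (x(j := t))) \<partial>lborel)"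

lemma resampled_measurable [measurable]:
  assumes j: "j \<in> {1..n}"
  shows "resampled \<beta> n j \<in> borel_measurable (conf n)"
proof -
  have "(\<lambda>p. (fst p)(j := snd p)) \<in> measurable (conf n \<Otimes>\<^sub>M lborel) (conf n)"
    by (rule measurable_fun_upd[where J = "{1..n}"]) (use j in auto)
  then have "(\<lambda>p. weight \<beta> n ((fst p)(j := snd p))) \<in> borel_measurable (conf n \<Otimes>\<^sub>M lborel)"
    by (rule measurable_compose[OF _ weight_measurable])
  then show ?thesis unfolding resampled_def[abs_def]
    by (intro lborel.borel_measurable_nn_integral) (simp add: split_beta')
qed

lemma nn_integral_cauchy: "(\<integral>\<^sup>+ y. ennreal (1 / (1 + y\<^sup>2)) \<partial>lborel) = ennreal pi"
proof -
  have e: "einterval (-\<infinity>) \<infinity> = (UNIV :: real set)" by (auto simp: einterval_def)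
  have i: "integrable lborel (\<lambda>y :: real. 1 / (1 + y\<^sup>2))"
    using integrable_inverse_1_plus_square by (simp add: set_integrable_def e inverse_eq_divide)
  have "(LINT y|lborel. 1 / (1 + y\<^sup>2)) = pi"
    using LBINT_inverse_1_plus_square
    by (simp add: interval_lebesgue_integral_def set_lebesgue_integral_def e inverse_eq_divide)
  then show ?thesis using nn_integral_eq_integral[OF i] by (simp add: add_nonneg_nonneg)
qed

text \<open>\<open>resampled\<close> does not depend on the coordinate \<open>j\<close>, so this
  coordinate can be integrated first. The Cauchy factor gives it the finite total mass pi; Lebesgue
  measure would give infinity.\<close>

lemma nn_integral_resampled:
  assumes j: "j \<in> {1..n}"
  shows "(\<integral>\<^sup>+ x. resampled \<beta> n j x * ennreal (1 / (1 + (x j)\<^sup>2)) \<partial>conf n)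
    = ennreal pi * (\<integral>\<^sup>+ x. ennreal (weight \<beta> n x) \<partial>conf n)"
proof -
  define I where "I = {1..n} - {j}"
  have I: "finite I" "j \<notin> I" "{1..n} = insert j I" using j by (auto simp: I_def)
  have cj [measurable]: "(\<lambda>x. x j) \<in> borel_measurable (conf n)"
    using measurable_component_singleton[OF j, of "\<lambda>_. lborel"] by simp
  note [measurable] = resampled_measurable[OF j]
  have r: "resampled \<beta> n j (x(j := y)) = resampled \<beta> n j x" for x y by (simp add: resampled_def)
  have "(\<integral>\<^sup>+ x. resampled \<beta> n j x * ennreal (1 / (1 + (x j)\<^sup>2)) \<partial>conf n)
    = (\<integral>\<^sup>+ x. (\<integral>\<^sup>+ y. resampled \<beta> n j (x(j := y)) * ennreal (1 / (1 + ((x(j := y)) j)\<^sup>2)) \<partial>lborel) \<partial>PiM I (\<lambda>_. lborel))"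
    unfolding I(3) by (rule lborel_product.product_nn_integral_insert[OF I(1,2)]) (unfold I(3)[symmetric], measurable)
  also have "\<dots> = (\<integral>\<^sup>+ x. resampled \<beta> n j x * ennreal pi \<partial>PiM I (\<lambda>_. lborel))"
  proof (rule nn_integral_cong)
    fix x
    have "(\<integral>\<^sup>+ y. resampled \<beta> n j (x(j := y)) * ennreal (1 / (1 + ((x(j := y)) j)\<^sup>2)) \<partial>lborel)
       = (\<integral>\<^sup>+ y. resampled \<beta> n j x * ennreal (1 / (1 + y\<^sup>2)) \<partial>lborel)" by (simp add: r)
    also have "\<dots> = resampled \<beta> n j x * ennreal pi"
      by (subst nn_integral_cmult) (simp_all add: nn_integral_cauchy)
    finally show "(\<integral>\<^sup>+ y. resampled \<beta> n j (x(j := y)) * ennreal (1 / (1 + ((x(j := y)) j)\<^sup>2)) \<partial>lborel)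
       = resampled \<beta> n j x * ennreal pi" .
  qed
  also have "\<dots> = (\<integral>\<^sup>+ x. (\<integral>\<^sup>+ y. ennreal pi * ennreal (weight \<beta> n (x(j := y))) \<partial>lborel) \<partial>PiM I (\<lambda>_. lborel))"
  proof (rule nn_integral_cong)
    fix x assume x: "x \<in> space (PiM I (\<lambda>_. lborel :: real measure))"
    have "(\<lambda>y. x(j := y)) \<in> measurable lborel (conf n)"
      using measurable_component_update[OF x I(2)] unfolding I(3) by simp
    then have [measurable]: "(\<lambda>y. weight \<beta> n (x(j := y))) \<in> borel_measurable lborel"
      by (rule measurable_compose[OF _ weight_measurable])
    show "resampled \<beta> n j x * ennreal pi = (\<integral>\<^sup>+ y. ennreal pi * ennreal (weight \<beta> n (x(j := y))) \<partial>lborel)"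
      unfolding resampled_def by (subst nn_integral_cmult) (auto simp: mult.commute)
  qed
  also have "\<dots> = (\<integral>\<^sup>+ x. ennreal pi * ennreal (weight \<beta> n x) \<partial>conf n)"
    unfolding I(3) by (rule lborel_product.product_nn_integral_insert[OF I(1,2), symmetric]) (unfold I(3)[symmetric], measurable)
  also have "\<dots> = ennreal pi * (\<integral>\<^sup>+ x. ennreal (weight \<beta> n x) \<partial>conf n)"
    by (intro nn_integral_cmult weight_ennreal_measurable)
  finally show ?thesis .
qed

text \<open>The power 3 leaves a summable \<open>1 / n ^ 2\<close> after the union over the n
  points.\<close>

definition atypical :: "real \<Rightarrow> nat \<Rightarrow> nat \<Rightarrow> (nat \<Rightarrow> real) set" where
  "atypical \<beta> n j = {x \<in> space (conf n). ennreal (real n ^ 3 * (1 + (x j)\<^sup>2) * weight \<beta> n x) < resampled \<beta> n j x}"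

lemma atypical_sets:
  assumes j: "j \<in> {1..n}"
  shows "atypical \<beta> n j \<in> sets (conf n)"
proof -
  have [measurable]: "(\<lambda>x. x j) \<in> borel_measurable (conf n)"
    using measurable_component_singleton[OF j, of "\<lambda>_. lborel"] by simp
  note [measurable] = resampled_measurable[OF j]
  show ?thesis unfolding atypical_def by measurable
qed

lemma emeasure_atypical:
  assumes \<beta>: "0 < \<beta>" and j: "j \<in> {1..n}"
  shows "emeasure (beta_ensemble \<beta> n) (atypical \<beta> n j) \<le> ennreal (pi / real n ^ 3)"
proof -
  have n: "1 \<le> n" using j by simp
  note Z = partition_const_pos[OF \<beta> n]
  note [measurable] = atypical_sets[OF j, of \<beta>] resampled_measurable[OF j]
  have [measurable]: "(\<lambda>x. x j) \<in> borel_measurable (conf n)"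
    using measurable_component_singleton[OF j, of "\<lambda>_. lborel"] by simp
  define c where "c = 1 / real n ^ 3"
  have c: "0 < c" using n by (simp add: c_def)
  have le: "ennreal (weight \<beta> n x) * indicator (atypical \<beta> n j) x
      \<le> ennreal c * (resampled \<beta> n j x * ennreal (1 / (1 + (x j)\<^sup>2)))" for x
  proof (cases "x \<in> atypical \<beta> n j")
    case True
    define d where "d = 1 / (1 + (x j)\<^sup>2)"
    have d: "0 < d" by (simp add: d_def add_pos_nonneg)
    define q where "q = real n ^ 3 * (1 + (x j)\<^sup>2) * weight \<beta> n x"
    have q: "0 \<le> q" by (simp add: q_def weight_nonneg)
    have "weight \<beta> n x = c * (q * d)"
    proof -
      have "(1 + (x j)\<^sup>2) * d = 1" using add_pos_nonneg[OF zero_less_one zero_le_power2, of "x j"] by (simp add: d_def)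
      moreover have "c * real n ^ 3 = 1" using n by (simp add: c_def)
      moreover have "c * (q * d) = (c * real n ^ 3) * ((1 + (x j)\<^sup>2) * d) * weight \<beta> n x"
        by (simp only: q_def ac_simps)
      ultimately show ?thesis by simp
    qed
    then have "ennreal (weight \<beta> n x) = ennreal c * (ennreal q * ennreal d)"
      using c d q by (simp flip: ennreal_mult)
    also have "\<dots> \<le> ennreal c * (resampled \<beta> n j x * ennreal d)"
      using True by (intro mult_left_mono mult_right_mono) (auto simp: atypical_def q_def)
    finally show ?thesis using True by (simp add: d_def)
  qed simp
  have "emeasure (beta_ensemble \<beta> n) (atypical \<beta> n j) = (\<integral>\<^sup>+ x. indicator (atypical \<beta> n j) x \<partial>beta_ensemble \<beta> n)" by simp
  also have "\<dots> = ennreal (1 / partition_const \<beta> n) * (\<integral>\<^sup>+ x. ennreal (weight \<beta> n x) * indicator (atypical \<beta> n j) x \<partial>conf n)"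
    by (rule nn_integral_beta_ensemble[OF \<beta> n borel_measurable_indicator[OF atypical_sets[OF j]]])
  also have "\<dots> \<le> ennreal (1 / partition_const \<beta> n) * (\<integral>\<^sup>+ x. ennreal c * (resampled \<beta> n j x * ennreal (1 / (1 + (x j)\<^sup>2))) \<partial>conf n)"
    by (intro mult_left_mono nn_integral_mono le) simp
  also have "\<dots> = ennreal (1 / partition_const \<beta> n) * (ennreal c * (ennreal pi * ennreal (partition_const \<beta> n)))"
    by (subst nn_integral_cmult) (measurable, simp only: nn_integral_resampled[OF j] nn_integral_weight[OF \<beta> n])
  also have "\<dots> = ennreal (1 / partition_const \<beta> n * (c * (pi * partition_const \<beta> n)))"
    using c Z by (simp flip: ennreal_mult)
  also have "\<dots> = ennreal (pi / real n ^ 3)" using Z by (simp add: c_def)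
  finally show ?thesis .
qed

section \<open>A Bernstein inequality and the price of a supremum\<close>

lemma cos_gap:
  fixes s e :: real
  assumes "0 \<le> s" "s + e \<le> pi" "0 < e" "e \<le> 1"
  shows "e\<^sup>2 / 4 \<le> cos s - cos (s + e)"
proof -
  \<comment> \<open>The difference is \<open>2 * sin (s + a) * sin a\<close>, and
    \<open>s + a\<close> keeps the distance \<open>a\<close> from 0 and from pi. The quadratic gap
    is what happens at the ends of the interval.\<close>
  define a where "a = e / 2"
  have a: "0 < a" "a \<le> 1 / 2" using assms by (auto simp: a_def)
  have "a * a * a \<le> a * 1 * 1" using a by (intro mult_mono) auto
  then have "a ^ 3 \<le> a" by (simp add: power3_eq_cube)
  then have sa: "3 / 4 * a \<le> sin a" using trig_taylor(2)[of a] a by linarith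
  have "sin a \<le> sin (s + a)"
  proof (cases "s + a \<le> pi / 2")
    case True
    then show ?thesis using assms a by (intro sin_monotone_2pi_le) auto
  next
    case False
    have "sin a \<le> sin (pi - (s + a))" using assms a False by (intro sin_monotone_2pi_le) (auto simp: a_def)
    then show ?thesis by simp
  qed
  then have "(3 / 4 * a) * (3 / 4 * a) \<le> sin (s + a) * sin a" using sa a by (intro mult_mono) auto
  moreover have "cos s - cos (s + e) = 2 * sin (s + a) * sin a"
  proof -
    have "(s + (s + e)) / 2 = s + a" "(s + e - s) / 2 = a" by (simp_all add: a_def)
    then show ?thesis unfolding cos_diff_cos by (simp only:)
  qed
  moreover have "e\<^sup>2 / 4 = a * a" by (simp add: a_def power2_eq_square)
  moreover have "0 \<le> a * a" by simp
  ultimately show ?thesis by linarith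
qed

text \<open>The square of \<open>n * e\<close> for the arc length \<open>e\<close> used in
  \<open>near_maximum\<close>; the square is due to \<open>cos_gap\<close>.\<close>

definition arc_const :: real where "arc_const = 1 / (16 * exp 128)"

lemma arc_const: "0 < arc_const" "arc_const \<le> 1"
  using exp_ge_add_one_self[of "128 :: real"] by (auto simp: arc_const_def)

text \<open>In the frame \<open>t = 2 (z + 1 / z)\<close> the weight \<open>exp (- n t\<^sup>2 / 4)\<close> cancels the exterior growth of the
  polynomial to first order in the distance to the unit circle, so a Bernstein inequality holds on the circle.\<close>

lemma near_maximum:
  assumes n: "1 \<le> n" and j: "j \<in> {1..n}"
  obtains S u v where "\<And>t. \<bar>t\<bar> \<le> 4 \<Longrightarrow> lagr_weight n x j t \<le> S" "arc_const / (real n)\<^sup>2 \<le> v - u"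
    "\<And>t. u \<le> t \<Longrightarrow> t \<le> v \<Longrightarrow> S / 2 \<le> lagr_weight n x j t" "0 \<le> S" "u \<le> v"
proof -
  define F where "F = lagr_weight n x j"
  define J c where "J = {1..n} - {j}" and "c i = x i / 2" for i
  \<comment> \<open>The points are halved, so that \<open>t = 4 * Re z\<close> runs over [-4, 4] and
    the Gaussian factor becomes the weight with \<open>p = 4\<close>. As \<open>1 - p\<close> is
    negative, \<open>wpoly_growth\<close> applies with \<open>nu = 0\<close>.\<close>
  define f where "f = wpoly c n 4 0 J"
  define e0 where "e0 = exp (2 * real n) / 2 ^ card J"
  have e0: "0 < e0" by (simp add: e0_def)
  have J: "finite J" "card J \<le> n" using j by (auto simp: J_def)
  have n0: "0 < real n" using n by simp
  have circ: "norm (f z) = F (4 * Re z) * e0" if "norm z = 1" for z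
  proof -
    have "(\<Prod>i\<in>J. \<bar>4 * Re z - x i\<bar>) = (\<Prod>i\<in>J. 2 * \<bar>2 * Re z - c i\<bar>)"
      by (intro prod.cong refl) (simp add: c_def abs_if)
    also have "\<dots> = 2 ^ card J * (\<Prod>i\<in>J. \<bar>2 * Re z - c i\<bar>)" by (simp add: prod.distrib)
    finally have "F (4 * Re z) = 2 ^ card J * rweight c n 4 0 J (2 * Re z)"
      unfolding F_def lagr_weight_def J_def[symmetric] rweight_def by (simp add: power_mult_distrib)
    then show ?thesis unfolding f_def norm_wpoly_unit[OF that] by (simp add: e0_def)
  qed
  have "continuous_on {- 4..4} F" unfolding F_def lagr_weight_def by (intro continuous_intros) auto
  then obtain t0 where t0: "t0 \<in> {- 4..4}" "\<And>t. t \<in> {- 4..4} \<Longrightarrow> F t \<le> F t0"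
    using continuous_attains_sup[of "{- 4..4 :: real}" F] by auto
  define S where "S = F t0"
  have S: "F t \<le> S" if "\<bar>t\<bar> \<le> 4" for t using t0(2)[of t] that by (auto simp: S_def abs_le_iff)
  have S0: "0 \<le> S" by (simp add: S_def F_def lagr_weight_nonneg)
  define \<theta> where "\<theta> = arccos (t0 / 4)"
  have tb: "- 1 \<le> t0 / 4" "t0 / 4 \<le> 1" using t0(1) by auto
  have \<theta>: "0 \<le> \<theta>" "\<theta> \<le> pi" "4 * cos \<theta> = t0"
    using arccos_lbound[OF tb] arccos_ubound[OF tb] cos_arccos[OF tb] by (auto simp: \<theta>_def)
  define m where "m = S * e0"
  have m0: "0 \<le> m" using S0 e0 by (simp add: m_def)
  have on_circle: "norm (f z) \<le> m" if "norm z = 1" for z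
  proof -
    have "F (4 * Re z) \<le> S" using abs_Re_le_cmod[of z] that by (intro S) simp
    then show ?thesis unfolding circ[OF that] m_def using e0 by (intro mult_right_mono) auto
  qed
  have near: "norm (f z) \<le> m * exp 64" if "norm z \<le> 1 + 1 / real n" for z
  proof (cases "norm z \<le> 1")
    case True
    have "norm (f z) \<le> m * 1"
      using wpoly_max_disc[of c n 4 0 J m z] on_circle True by (simp add: f_def)
    also have "\<dots> \<le> m * exp 64" using m0 by (intro mult_left_mono) auto
    finally show ?thesis .
  next
    case False
    have n1: "1 / real n \<le> 1" using n by simp
    have z2: "norm z \<le> 2" using that n1 by linarith
    have "norm (f z) \<le> m * exp (16 * real n * (norm z - 1) * (0 + (Im z)\<^sup>2))"
      unfolding f_def using on_circle False z2 by (intro wpoly_growth[OF J]) (auto simp: f_def)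
    also have "\<dots> \<le> m * exp 64"
    proof -
      have "real n * (norm z - 1) \<le> real n * (1 / real n)" using that n0 by (intro mult_left_mono) auto
      then have 1: "real n * (norm z - 1) \<le> 1" using n0 by simp
      have "\<bar>Im z\<bar> \<le> 2" using abs_Im_le_cmod[of z] z2 by linarith
      then have "(Im z)\<^sup>2 \<le> 4" using power_mono[of "\<bar>Im z\<bar>" 2 2] by simp
      then have "(real n * (norm z - 1)) * (Im z)\<^sup>2 \<le> 1 * 4" using 1 False by (intro mult_mono) auto
      then show ?thesis using m0 by (intro mult_left_mono) (auto simp: mult.assoc)
    qed
    finally show ?thesis .
  qed
  \<comment> \<open>Cauchy's bound on a disc of radius \<open>1 / n\<close> then allows a change of
    at most half the maximum: \<open>2 * exp 64 * n * e = 1 / 2\<close>.\<close>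
  define e where "e = 1 / (4 * exp 64 * real n)"
  have ex: "65 \<le> exp (64 :: real)" using exp_ge_add_one_self[of "64 :: real"] by simp
  have e: "0 < e" "e \<le> 1 / real n / 2" "e \<le> 1"
  proof -
    show "0 < e" using n0 by (simp add: e_def)
    have "1 / (4 * exp 64 * real n) \<le> 1 / (2 * real n)" using ex n0 by (intro divide_left_mono mult_right_mono) auto
    then show "e \<le> 1 / real n / 2" by (simp add: e_def)
    also have "\<dots> \<le> 1" using n by (simp add: pos_divide_le_eq)
    finally show "e \<le> 1" .
  qed
  have half: "S / 2 \<le> F (4 * cos s)" if s: "\<bar>s - \<theta>\<bar> \<le> e" for s
  proof -
    have dist: "norm (cis s - cis \<theta>) \<le> \<bar>s - \<theta>\<bar>" by (rule cis_dist)
    have "norm (f (cis s) - f (cis \<theta>)) \<le> 2 * (m * exp 64) / (1 / real n) * norm (cis s - cis \<theta>)"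
    proof (rule holomorphic_near)
      show "f holomorphic_on cball (cis \<theta>) (1 / real n)"
        unfolding f_def wpoly_def[abs_def] quad_def by (intro holomorphic_intros) auto
      show "norm (f z) \<le> m * exp 64" if "z \<in> cball (cis \<theta>) (1 / real n)" for z
      proof (rule near)
        have "norm (z - cis \<theta>) \<le> 1 / real n" using that by (simp add: dist_norm norm_minus_commute)
        then show "norm z \<le> 1 + 1 / real n" using norm_triangle_sub[of z "cis \<theta>"] by simp
      qed
    qed (use n0 dist s e in auto)
    also have "\<dots> \<le> 2 * (m * exp 64) / (1 / real n) * e"
      using dist s m0 n0 by (intro mult_left_mono) auto
    also have "\<dots> = m / 2" using n0 by (simp add: e_def)
    finally have "norm (f (cis s) - f (cis \<theta>)) \<le> m / 2" .
    moreover have "norm (f (cis \<theta>)) = m" using circ[of "cis \<theta>"] \<theta>(3) by (simp add: m_def S_def)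
    ultimately have "m / 2 \<le> norm (f (cis s))" using norm_triangle_ineq2[of "f (cis \<theta>)" "f (cis s)"] by (simp add: norm_minus_commute)
    also have "\<dots> = F (4 * cos s) * e0" using circ[of "cis s"] by simp
    finally have "(S / 2) * e0 \<le> F (4 * cos s) * e0" by (simp add: m_def)
    then show ?thesis using e0 by simp
  qed
  \<comment> \<open>The arc is laid on the side of the maximum that faces \<open>pi / 2\<close>, so
    that it stays in the range of \<open>arccos\<close>.\<close>
  obtain s where s: "0 \<le> s" "s + e \<le> pi" "\<theta> - e \<le> s" "s \<le> \<theta>"
  proof (cases "\<theta> \<le> pi / 2")
    case True
    then show ?thesis using \<theta> e pi_gt3 by (intro that[of \<theta>]) auto
  next
    case False
    then show ?thesis using \<theta> e pi_gt3 by (intro that[of "\<theta> - e"]) auto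
  qed
  show ?thesis
  proof (rule that[of S "4 * cos s" "4 * cos (s + e)"])
    show "lagr_weight n x j t \<le> S" if "\<bar>t\<bar> \<le> 4" for t using S[OF that] by (simp add: F_def)
    show "0 \<le> S" by (rule S0)
    have "e\<^sup>2 \<le> 4 * (cos s - cos (s + e))" using cos_gap[OF s(1,2) e(1,3)] by simp
    moreover have "e\<^sup>2 = arc_const / (real n)\<^sup>2"
    proof -
      have "exp 64 * exp 64 = exp (128 :: real)" by (simp flip: exp_add)
      then show ?thesis by (simp add: e_def arc_const_def power2_eq_square)
    qed
    ultimately show "arc_const / (real n)\<^sup>2 \<le> 4 * cos s - 4 * cos (s + e)" by simp
    then show "4 * cos (s + e) \<le> 4 * cos s" using arc_const n0 by (smt (verit) divide_nonneg_nonneg zero_le_power2)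
    fix t assume t: "4 * cos (s + e) \<le> t" "t \<le> 4 * cos s"
    have tb: "- 1 \<le> t / 4" "t / 4 \<le> 1" using t cos_ge_minus_one[of "s + e"] cos_le_one[of s] by linarith+
    have a: "0 \<le> arccos (t / 4)" "arccos (t / 4) \<le> pi" "t = 4 * cos (arccos (t / 4))"
      using arccos_lbound[OF tb] arccos_ubound[OF tb] cos_arccos[OF tb] by auto
    have "s \<le> arccos (t / 4)"
      using t(2) a s e cos_mono_le_eq[of "arccos (t / 4)" s] by auto
    moreover have "arccos (t / 4) \<le> s + e"
      using t(1) a s e cos_mono_le_eq[of "s + e" "arccos (t / 4)"] by auto
    ultimately have "\<bar>arccos (t / 4) - \<theta>\<bar> \<le> e" using s by linarith
    from half[OF this] show "S / 2 \<le> lagr_weight n x j t" using a(3) by (simp add: F_def)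
  qed
qed

text \<open>The resampling integral is at least its part over the interval of length
  \<open>arc_const / n ^ 2\<close> on which the weight exceeds half its supremum. With the
  \<open>n ^ 3\<close> of the hypothesis this gives \<open>n ^ 5\<close>, of which the root of order
  beta is taken.\<close>

lemma max_from_resampling:
  assumes \<beta>: "0 < \<beta>" and j: "j \<in> {1..n}" and W: "0 < weight \<beta> n x"
    and rs: "resampled \<beta> n j x \<le> ennreal (real n ^ 3 * (1 + (x j)\<^sup>2) * weight \<beta> n x)"
    and t: "\<bar>t\<bar> \<le> 4"
  shows "lagr_weight n x j t \<le> 2 * (real n ^ 5 * (1 + (x j)\<^sup>2) / arc_const) powr (1 / \<beta>) * lagr_weight n x j (x j)"
proof -
  have n: "1 \<le> n" using j by simp
  have n0: "0 < real n" using n by simp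
  define F where "F = lagr_weight n x j"
  define R where "R = rest_weight \<beta> n x j"
  obtain S v u where S: "\<And>t. \<bar>t\<bar> \<le> 4 \<Longrightarrow> F t \<le> S" "arc_const / (real n)\<^sup>2 \<le> v - u"
    "\<And>t. u \<le> t \<Longrightarrow> t \<le> v \<Longrightarrow> S / 2 \<le> F t" "0 \<le> S" "u \<le> v"
  proof (rule near_maximum[OF n j, of x, folded F_def])
    fix S u v
    assume *: "\<And>t. \<bar>t\<bar> \<le> 4 \<Longrightarrow> F t \<le> S" "arc_const / (real n)\<^sup>2 \<le> v - u"
      "\<And>t. u \<le> t \<Longrightarrow> t \<le> v \<Longrightarrow> S / 2 \<le> F t" "0 \<le> S" "u \<le> v"
    show thesis by (rule that[OF *])
  qed
  have W_eq: "weight \<beta> n x = F (x j) powr \<beta> * R" using weight_split[OF j] by (simp add: F_def R_def)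
  have Fj: "0 < F (x j)" and R: "0 < R"
  proof -
    have "F (x j) \<noteq> 0" "R \<noteq> 0" using W unfolding W_eq by auto
    then show "0 < F (x j)" "0 < R"
      using lagr_weight_nonneg[of n x j "x j"] rest_weight_nonneg[of \<beta> n x j] by (simp_all add: F_def R_def)
  qed
  define a where "a = (S / 2) powr \<beta> * R"
  have a0: "0 \<le> a" using R by (simp add: a_def)
  have up: "weight \<beta> n (x(j := t)) = F t powr \<beta> * R" for t
    using weight_split[OF j, of \<beta> "x(j := t)"] by (simp add: F_def R_def lagr_weight_update rest_weight_update)
  have "ennreal (a * (v - u)) = (\<integral>\<^sup>+ t. ennreal a * indicator {u..v} t \<partial>lborel)"
    using a0 S(5) by (simp add: nn_integral_cmult_indicator ennreal_mult)
  also have "\<dots> \<le> resampled \<beta> n j x"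
    unfolding resampled_def up
  proof (rule nn_integral_mono)
    fix t
    show "ennreal a * indicator {u..v} t \<le> ennreal (F t powr \<beta> * R)"
    proof (cases "t \<in> {u..v}")
      case True
      then have "(S / 2) powr \<beta> \<le> F t powr \<beta>" using S \<beta> by (intro powr_mono2) auto
      then show ?thesis using True R by (auto simp: a_def intro!: ennreal_leI mult_right_mono)
    qed simp
  qed
  also note rs
  finally have "a * (v - u) \<le> real n ^ 3 * (1 + (x j)\<^sup>2) * weight \<beta> n x"
    using W by (subst (asm) ennreal_le_iff) auto
  moreover have "a * (arc_const / (real n)\<^sup>2) \<le> a * (v - u)" using S(2) a0 by (rule mult_left_mono)
  ultimately have "((S / 2) powr \<beta> * (arc_const / (real n)\<^sup>2)) * R \<le> (real n ^ 3 * (1 + (x j)\<^sup>2) * F (x j) powr \<beta>) * R"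
    unfolding W_eq a_def by (simp add: ac_simps)
  then have "(S / 2) powr \<beta> * (arc_const / (real n)\<^sup>2) \<le> real n ^ 3 * (1 + (x j)\<^sup>2) * F (x j) powr \<beta>"
    by (rule mult_right_le_imp_le[OF _ R])
  then have scaled: "((S / 2) powr \<beta> * (arc_const / (real n)\<^sup>2)) * ((real n)\<^sup>2 / arc_const)
      \<le> (real n ^ 3 * (1 + (x j)\<^sup>2) * F (x j) powr \<beta>) * ((real n)\<^sup>2 / arc_const)"
    using arc_const by (intro mult_right_mono) auto
  have le: "(S / 2) powr \<beta> \<le> (real n ^ 5 * (1 + (x j)\<^sup>2) / arc_const) * F (x j) powr \<beta>"
  proof -
    have "real n ^ 5 = real n ^ 3 * (real n)\<^sup>2" by (simp flip: power_add)
    then have "(real n ^ 3 * (1 + (x j)\<^sup>2) * F (x j) powr \<beta>) * ((real n)\<^sup>2 / arc_const)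
        = (real n ^ 5 * (1 + (x j)\<^sup>2) / arc_const) * F (x j) powr \<beta>" by simp
    moreover have "((S / 2) powr \<beta> * (arc_const / (real n)\<^sup>2)) * ((real n)\<^sup>2 / arc_const) = (S / 2) powr \<beta>"
      using arc_const n0 by simp
    ultimately show ?thesis using scaled by (simp only:)
  qed
  define q where "q = real n ^ 5 * (1 + (x j)\<^sup>2) / arc_const"
  have q: "0 < q" using n0 arc_const by (simp add: q_def add_pos_nonneg)
  have "((S / 2) powr \<beta>) powr (1 / \<beta>) \<le> (q * F (x j) powr \<beta>) powr (1 / \<beta>)"
    using le \<beta> by (intro powr_mono2) (auto simp: q_def)
  then have "S / 2 \<le> q powr (1 / \<beta>) * F (x j)"
    using \<beta> S(4) Fj q by (simp add: powr_powr powr_mult)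
  then show ?thesis using S(1)[OF t] by (simp add: F_def q_def)
qed

section \<open>From typical to good configurations\<close>

definition resC :: "real \<Rightarrow> real" where
  "resC c0 = 2 * exp (5 / c0) * (1 / arc_const) powr (1 / c0)"

lemma resC_ge: "0 < c0 \<Longrightarrow> 2 \<le> resC c0"
proof -
  assume c: "0 < c0"
  have "1 * 1 \<le> exp (5 / c0) * (1 / arc_const) powr (1 / c0)"
    using c arc_const by (intro mult_mono ge_one_powr_ge_zero) auto
  then show ?thesis by (simp add: resC_def)
qed

text \<open>Here the growth of beta is spent: \<open>n powr (5 / beta)\<close> is at most
  \<open>exp (5 / c0)\<close>. For \<open>3 <= n\<close> also \<open>c0 <= beta\<close>, which
  bounds the other two roots.\<close>

lemma max_from_resampling_log:
  assumes c: "0 < c0" and n: "3 \<le> n" and b: "c0 * ln (real n) \<le> \<beta>" and j: "j \<in> {1..n}" and W: "0 < weight \<beta> n x"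
    and rs: "resampled \<beta> n j x \<le> ennreal (real n ^ 3 * (1 + (x j)\<^sup>2) * weight \<beta> n x)"
    and t: "\<bar>t\<bar> \<le> 4"
  shows "lagr_weight n x j t \<le> resC c0 * (1 + (x j)\<^sup>2) powr (1 / c0) * lagr_weight n x j (x j)"
proof -
  have "exp 1 \<le> real n" using exp_le n by linarith
  then have l: "1 \<le> ln (real n)" using n by (simp add: ln_ge_iff)
  have "c0 * 1 \<le> c0 * ln (real n)" using l c by (intro mult_left_mono) auto
  then have bc: "c0 \<le> \<beta>" "0 < \<beta>" using b c by linarith+
  have inv: "1 / \<beta> \<le> 1 / c0" using bc c by (simp add: frac_le)
  have X: "1 \<le> 1 + (x j)\<^sup>2" by simp
  have "(real n ^ 5 * (1 + (x j)\<^sup>2) / arc_const) powr (1 / \<beta>)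
      = (real n ^ 5) powr (1 / \<beta>) * (1 + (x j)\<^sup>2) powr (1 / \<beta>) * (1 / arc_const) powr (1 / \<beta>)"
    by (simp add: powr_mult[symmetric])
  also have "\<dots> \<le> exp (5 / c0) * (1 + (x j)\<^sup>2) powr (1 / c0) * (1 / arc_const) powr (1 / c0)"
  proof (intro mult_mono)
    have "(real n ^ 5) powr (1 / \<beta>) = exp (5 * ln (real n) / \<beta>)" using n by (simp add: powr_def ln_realpow)
    also have "\<dots> \<le> exp (5 / c0)"
    proof -
      have "ln (real n) / \<beta> \<le> 1 / c0" using b c bc by (simp add: field_simps)
      then show ?thesis by simp
    qed
    finally show "(real n ^ 5) powr (1 / \<beta>) \<le> exp (5 / c0)" .
    show "(1 + (x j)\<^sup>2) powr (1 / \<beta>) \<le> (1 + (x j)\<^sup>2) powr (1 / c0)" by (rule powr_mono[OF inv X])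
    show "(1 / arc_const) powr (1 / \<beta>) \<le> (1 / arc_const) powr (1 / c0)"
      using arc_const by (intro powr_mono[OF inv]) simp
  qed auto
  finally have "(2 * (real n ^ 5 * (1 + (x j)\<^sup>2) / arc_const) powr (1 / \<beta>)) * lagr_weight n x j (x j)
      \<le> (2 * (exp (5 / c0) * (1 + (x j)\<^sup>2) powr (1 / c0) * (1 / arc_const) powr (1 / c0))) * lagr_weight n x j (x j)"
    using lagr_weight_nonneg[of n x j "x j"] by (intro mult_right_mono mult_left_mono) auto
  also have "\<dots> = resC c0 * (1 + (x j)\<^sup>2) powr (1 / c0) * lagr_weight n x j (x j)" by (simp add: resC_def)
  finally show ?thesis using max_from_resampling[OF bc(2) j W rs t] by linarith
qed

text \<open>Outside [-2, 2] write \<open>x j = z + 1 / z\<close> with a real \<open>z\<close> in the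
  disc. In the frame \<open>p = 1\<close> the maximum principle bounds the weighted polynomial at
  \<open>z\<close> by the supremum over [-2, 2]; the surplus exponent is the amount by which the
  Gaussian factor at \<open>x j\<close> is smaller than the harmonic continuation.\<close>

lemma exterior_growth:
  assumes n: "1 \<le> n" and j: "j \<in> {1..n}" and u: "0 \<le> u" and xj: "\<bar>x j\<bar> = 2 * cosh u"
    and M: "\<And>t. \<bar>t\<bar> \<le> 2 \<Longrightarrow> lagr_weight n x j t \<le> M"
  shows "lagr_weight n x j (x j) * exp (real n / 2 * sinh (2 * u) - (real n - 1) * u) \<le> M"
proof -
  define J where "J = {1..n} - {j}"
  have cJ: "card J = n - 1" using j by (simp add: J_def)
  define w where "w = exp (- u)"
  have w: "0 < w" "w \<le> 1" using u by (auto simp: w_def)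
  define z where "z = (if x j \<ge> 0 then w else - w)"
  have z: "\<bar>z\<bar> = w" "z\<^sup>2 = w\<^sup>2" "z \<noteq> 0" using w by (auto simp: z_def)
  have ww: "2 * cosh u = w + 1 / w" by (simp add: w_def cosh_def exp_minus field_simps)
  have xz: "x j = z + 1 / z"
  proof (cases "x j \<ge> 0")
    case True then show ?thesis using xj ww by (simp add: z_def)
  next
    case False
    then have "x j = - (w + 1 / w)" using xj ww by simp
    then show ?thesis using False by (simp add: z_def)
  qed
  have q: "norm (quad (x i) (of_real z)) = w * \<bar>x j - x i\<bar>" for i
  proof -
    have "quad (x i) (of_real z) = of_real (z * (x j - x i))"
      unfolding xz using z(3) by (simp add: quad_def field_simps power2_eq_square)
    then have "norm (quad (x i) (of_real z)) = \<bar>z * (x j - x i)\<bar>" by (metis norm_of_real)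
    then show ?thesis by (simp add: abs_mult z(1))
  qed
  have "(\<Prod>i\<in>J. norm (quad (x i) (of_real z))) = w ^ (n - 1) * (\<Prod>i\<in>J. \<bar>x j - x i\<bar>)"
    unfolding q by (simp add: prod.distrib cJ)
  moreover have "w ^ (n - 1) = exp (- (real n - 1) * u)"
  proof -
    have "w ^ (n - 1) = exp (real (n - 1) * - u)" unfolding w_def by (rule exp_of_nat_mult[symmetric])
    then show ?thesis using n by (simp add: of_nat_diff algebra_simps)
  qed
  moreover have "Re ((of_real z)\<^sup>2 :: complex) = w\<^sup>2" using z(2) by (simp flip: of_real_power)
  ultimately have "norm (wpoly x n 1 0 J (of_real z))
      = (\<Prod>i\<in>J. \<bar>x j - x i\<bar>) * exp (- (real n - 1) * u + - real n * (w\<^sup>2 / 2))"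
    unfolding norm_wpoly exp_add by (simp add: ac_simps)
  also have "- (real n - 1) * u + - real n * (w\<^sup>2 / 2)
      = - real n * (x j)\<^sup>2 / 4 + (real n / 2 * sinh (2 * u) - (real n - 1) * u) + real n / 2"
  proof -
    have 1: "sinh (2 * u) = (1 / w\<^sup>2 - w\<^sup>2) / 2"
      by (simp add: w_def sinh_def exp_minus power2_eq_square exp_add[symmetric] field_simps)
    have "(x j)\<^sup>2 = (w + 1 / w)\<^sup>2" using xj ww by (metis power2_abs)
    also have "\<dots> = w\<^sup>2 + 2 + 1 / w\<^sup>2" using w by (simp add: power2_eq_square field_simps)
    finally have 2: "(x j)\<^sup>2 = w\<^sup>2 + 2 + 1 / w\<^sup>2" .
    define B where "B = 1 / w\<^sup>2"
    show ?thesis unfolding 1 2 B_def[symmetric] by (simp add: algebra_simps add_divide_distrib diff_divide_distrib)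
  qed
  finally have eq: "norm (wpoly x n 1 0 J (of_real z))
      = lagr_weight n x j (x j) * exp (real n / 2 * sinh (2 * u) - (real n - 1) * u) * exp (real n / 2)"
    unfolding exp_add lagr_weight_def J_def by (simp only: ac_simps)
  have "norm (wpoly x n 1 0 J (of_real z)) \<le> M * exp (real n / 2)"
  proof (rule wpoly_max_disc)
    show "norm (of_real z :: complex) \<le> 1" using z(1) w by simp
    fix v :: complex assume v: "norm v = 1"
    have "rweight x n 1 0 J (2 * Re v) = lagr_weight n x j (2 * Re v)"
      by (simp add: rweight_def lagr_weight_def J_def)
    also have "\<dots> \<le> M" using abs_Re_le_cmod[of v] v by (intro M) simp
    finally show "norm (wpoly x n 1 0 J v) \<le> M * exp (real n / 2)"
      unfolding norm_wpoly_unit[OF v] by simp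
  qed
  then show ?thesis unfolding eq by simp
qed

text \<open>Bounds \<open>v^2\<close> when
  \<open>2 / 3 * v ^ 3 <= (ln (resC c0) + 6 / c0) * v\<close>, where \<open>v\<close> measures the
  excursion of a point beyond the edge in edge units.\<close>

definition confV :: "real \<Rightarrow> real" where
  "confV c0 = 1 + 3 / 2 * (ln (resC c0) + 6 / c0)"

text \<open>The 65 is \<open>1 + 8^2\<close>: once the points are confined, none exceeds 8 in
  modulus.\<close>

definition confC :: "real \<Rightarrow> real" where "confC c0 = resC c0 * 65 powr (1 / c0)"

text \<open>The bound from resampling still carries a factor that grows with \<open>x j\<close>. For
  a point \<open>2 * cosh u\<close> outside, this factor is at most
  \<open>exp ((4 + 2 * u) / c0)\<close>, while \<open>exterior_growth\<close> gains an exponent of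
  order \<open>n * u ^ 3\<close>. Hence \<open>u\<close> is of order n^(-1/3), the excursion
  \<open>2 * cosh u - 2\<close> is of order n^(-2/3), and the factor becomes a constant.\<close>

lemma good_of_typical:
  assumes c: "0 < c0" and n: "3 \<le> n" and b: "c0 * ln (real n) \<le> \<beta>" and W: "0 < weight \<beta> n x"
    and rs: "\<And>j. j \<in> {1..n} \<Longrightarrow> resampled \<beta> n j x \<le> ennreal (real n ^ 3 * (1 + (x j)\<^sup>2) * weight \<beta> n x)"
    and small: "confV c0 * (edge_scale n)\<^sup>2 \<le> 1"
  shows "good (confC c0) (6 * confV c0) n x"
proof -
  have n1: "1 \<le> n" and n0: "0 < real n" using n by auto
  define \<delta> where "\<delta> = edge_scale n"
  have \<delta>: "0 < \<delta>" "real n * \<delta> ^ 3 = 1" using edge_scale[of n] n by (auto simp: \<delta>_def)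
  have \<delta>1: "\<delta> \<le> 1"
  proof (rule ccontr)
    assume "\<not> ?thesis"
    then have "1 < \<delta> ^ 3" by (intro one_less_power) auto
    then have "1 * 1 < real n * \<delta> ^ 3" using n1 by (intro mult_le_less_imp_less) auto
    then show False using \<delta> by simp
  qed
  have Q: "2 \<le> resC c0" by (rule resC_ge[OF c])
  have lQ: "0 \<le> ln (resC c0)" using Q by simp
  have V1: "1 \<le> confV c0" using lQ c by (simp add: confV_def)
  have key: "0 < lagr_weight n x j (x j) \<and> (\<forall>t. \<bar>t\<bar> \<le> 4 \<longrightarrow> lagr_weight n x j t \<le> confC c0 * lagr_weight n x j (x j))
      \<and> \<bar>x j\<bar> \<le> 2 + 6 * confV c0 * (edge_scale n)\<^sup>2" if j: "j \<in> {1..n}" for j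
  proof -
    define F where "F = lagr_weight n x j"
    note mx = max_from_resampling_log[OF c n b j W rs[OF j], folded F_def]
    have F0: "0 < F (x j)"
      using W weight_split[OF j, of \<beta> x] lagr_weight_nonneg[of n x j "x j"] by (auto simp: F_def less_le)
    have xb: "\<bar>x j\<bar> \<le> 2 + 6 * confV c0 * \<delta>\<^sup>2"
    proof (cases "\<bar>x j\<bar> \<le> 2")
      case True
      then show ?thesis using V1 zero_le_power2[of \<delta>] by (smt (verit) mult_nonneg_nonneg)
    next
      case False
      define u where "u = arcosh (\<bar>x j\<bar> / 2)"
      have u: "0 \<le> u" "\<bar>x j\<bar> = 2 * cosh u" using False by (auto simp: u_def)
      define X where "X = (1 + (x j)\<^sup>2) powr (1 / c0)"
      have "F (x j) * exp (real n / 2 * sinh (2 * u) - (real n - 1) * u) \<le> resC c0 * X * F (x j)"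
        unfolding F_def X_def by (rule exterior_growth[of n j u x, OF n1 j u]) (use mx in \<open>simp add: F_def\<close>)
      then have "exp (real n / 2 * sinh (2 * u) - (real n - 1) * u) \<le> resC c0 * X" using F0 by (simp add: mult.commute)
      also have "\<dots> \<le> resC c0 * exp ((4 + 2 * u) / c0)"
      proof -
        have "(x j)\<^sup>2 = (2 * cosh u)\<^sup>2" using u(2) by (metis power2_abs)
        moreover have "cosh u \<le> exp u" using u(1) by (simp add: cosh_def)
        then have "(2 * cosh u)\<^sup>2 \<le> (2 * exp u)\<^sup>2" by (intro power_mono) auto
        moreover have "(2 * exp u)\<^sup>2 = 4 * exp (2 * u)" by (simp add: power_mult_distrib exp_double)
        moreover have "1 \<le> exp (2 * u)" using u(1) by simp
        moreover have "5 \<le> exp (4 :: real)" using exp_ge_add_one_self[of "4 :: real"] by simp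
        then have "5 * exp (2 * u) \<le> exp 4 * exp (2 * u)" by (intro mult_right_mono) auto
        ultimately have "1 + (x j)\<^sup>2 \<le> exp (4 + 2 * u)" unfolding exp_add by linarith
        then have "X \<le> exp (4 + 2 * u) powr (1 / c0)" unfolding X_def using c by (intro powr_mono2) auto
        also have "\<dots> = exp ((4 + 2 * u) / c0)" by (simp add: powr_def)
        finally show ?thesis using Q by (intro mult_left_mono) auto
      qed
      also have "\<dots> = exp (ln (resC c0) + (4 + 2 * u) / c0)" using Q by (simp add: exp_add)
      finally have "real n / 2 * sinh (2 * u) - (real n - 1) * u \<le> ln (resC c0) + (4 + 2 * u) / c0" by simp
      moreover have "real n / 2 * (2 * u + (2 * u) ^ 3 / 6) \<le> real n / 2 * sinh (2 * u)"
        using sinh_ge_cubic[of "2 * u"] u(1) by (intro mult_left_mono) auto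
      moreover have "real n / 2 * (2 * u + (2 * u) ^ 3 / 6) = real n * u + 2 / 3 * (real n * u ^ 3)"
        by (simp add: power3_eq_cube algebra_simps)
      moreover have "(real n - 1) * u = real n * u - u" by (simp add: algebra_simps)
      ultimately have main: "2 / 3 * (real n * u ^ 3) \<le> ln (resC c0) + (4 + 2 * u) / c0"
        using u(1) by linarith
      define v where "v = u / \<delta>"
      have uv: "u = v * \<delta>" and v0: "0 \<le> v" using \<delta> u(1) by (auto simp: v_def)
      have nu: "real n * u ^ 3 = v ^ 3" unfolding uv power_mult_distrib using \<delta>(2) by (simp add: ac_simps)
      have v2: "v\<^sup>2 \<le> confV c0"
      proof (cases "v \<le> 1")
        case True
        then have "v\<^sup>2 \<le> 1" using v0 by (intro power_le_one) auto
        then show ?thesis using V1 by linarith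
      next
        case v1: False
        have "u \<le> v * 1" unfolding uv using \<delta>1 v0 by (intro mult_left_mono) auto
        then have "(4 + 2 * u) / c0 \<le> (4 * v + 2 * v) / c0" using c v1 by (intro divide_right_mono) auto
        also have "\<dots> = (6 / c0) * v" by simp
        finally have "2 / 3 * v ^ 3 \<le> ln (resC c0) + (6 / c0) * v" using main unfolding nu by linarith
        moreover have "ln (resC c0) * 1 \<le> ln (resC c0) * v" using lQ v1 by (intro mult_left_mono) auto
        ultimately have "2 / 3 * v ^ 3 \<le> (ln (resC c0) + 6 / c0) * v" by (simp add: distrib_right)
        then have "(2 / 3 * v\<^sup>2) * v \<le> (ln (resC c0) + 6 / c0) * v" by (simp add: power2_eq_square power3_eq_cube)
        then have "2 / 3 * v\<^sup>2 \<le> ln (resC c0) + 6 / c0" by (rule mult_right_le_imp_le) (use v1 in linarith)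
        moreover have "v\<^sup>2 \<le> 1 + 3 / 2 * w" if "2 / 3 * v\<^sup>2 \<le> w" for w using that by linarith
        ultimately show ?thesis unfolding confV_def by blast
      qed
      have u2: "u\<^sup>2 \<le> confV c0 * \<delta>\<^sup>2"
        unfolding uv power_mult_distrib using v2 by (intro mult_right_mono) auto
      then have "u\<^sup>2 \<le> 1\<^sup>2" using small by (simp add: \<delta>_def)
      then have u1: "u \<le> 1" using power2_le_imp_le[of u 1] by simp
      have "\<bar>x j\<bar> \<le> 2 + 6 * u\<^sup>2" using cosh_le_square[OF u(1) u1] u(2) by simp
      then show ?thesis using u2 by linarith
    qed
    have "\<bar>x j\<bar> \<le> 8" using xb small by (simp add: \<delta>_def)
    then have "(x j)\<^sup>2 \<le> 8\<^sup>2" using power_mono[of "\<bar>x j\<bar>" 8 2] by simp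
    then have "(1 + (x j)\<^sup>2) powr (1 / c0) \<le> 65 powr (1 / c0)" using c by (intro powr_mono2) auto
    then have CC: "resC c0 * (1 + (x j)\<^sup>2) powr (1 / c0) * F (x j) \<le> confC c0 * F (x j)"
      unfolding confC_def using Q F0 by (intro mult_right_mono mult_left_mono) auto
    show ?thesis using F0 xb order_trans[OF mx CC] by (simp add: F_def \<delta>_def)
  qed
  then show ?thesis unfolding good_def by (simp add: mult.assoc)
qed

text \<open>Two exceptional sets are discarded: finitely many atypical configurations, by
  Borel--Cantelli, and the null set where some density vanishes. On the rest
  \<open>good_of_typical\<close> applies for all large n.\<close>

lemma joint_law_eventually_good:
  assumes c: "0 < c0" and pos: "\<And>n. 1 \<le> n \<Longrightarrow> 0 < \<beta> n"
    and b: "\<forall>\<^sub>F n in sequentially. c0 * ln (real n) \<le> \<beta> n"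
  shows "AE \<omega> in joint_law \<beta>. \<forall>\<^sub>F n in sequentially. good (confC c0) (6 * confV c0) n (\<omega> n)"
proof -
  define P where "P = joint_law \<beta>"
  define E where "E n = beta_ensemble (\<beta> n) n" for n
  have P_eq: "P = PiM {1..} E" by (simp add: P_def joint_law_def E_def[abs_def])
  have pr: "prob_space (E n)" if "n \<in> {1..}" for n
    unfolding E_def using that pos by (intro prob_space_beta_ensemble) auto
  interpret P: prob_space P unfolding P_eq by (rule prob_space_PiM[OF pr])
  define B where "B n = (\<Union>j\<in>{1..n}. atypical (\<beta> n) n j)" for n
  have B_sets: "B n \<in> sets (E n)" for n
    unfolding B_def E_def sets_beta_ensemble using atypical_sets by (intro sets.finite_UN) auto
  \<comment> \<open>The product has no component 0, so that index is given the empty event.\<close>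
  define A where "A n = (if n = 0 then {} else (\<lambda>\<omega>. \<omega> n) -` B n \<inter> space P)" for n
  have comp: "(\<lambda>\<omega>. \<omega> n) \<in> measurable P (E n)" if "1 \<le> n" for n
    unfolding P_eq using that by (intro measurable_component_singleton) simp
  have A_sets: "A n \<in> sets P" for n
    unfolding A_def using measurable_sets[OF comp B_sets] by auto
  have A_le: "emeasure P (A n) \<le> ennreal (pi / (real n)\<^sup>2)" for n
  proof (cases "n = 0")
    case False
    then have n: "1 \<le> n" by simp
    have "emeasure P (A n) = emeasure (distr P (E n) (\<lambda>\<omega>. \<omega> n)) (B n)"
      using False by (simp add: A_def emeasure_distr[OF comp[OF n] B_sets])
    also have "distr P (E n) (\<lambda>\<omega>. \<omega> n) = E n"
      unfolding P_eq by (rule distr_PiM_component[OF pr]) (use n in auto)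
    also have "emeasure (E n) (B n) \<le> (\<Sum>j\<in>{1..n}. emeasure (E n) (atypical (\<beta> n) n j))"
      unfolding B_def using atypical_sets by (intro emeasure_subadditive_finite) (auto simp: E_def sets_beta_ensemble)
    also have "\<dots> \<le> (\<Sum>j\<in>{1..n}. ennreal (pi / real n ^ 3))"
      unfolding E_def by (intro sum_mono emeasure_atypical pos n)
    also have "\<dots> = ennreal (\<Sum>j\<in>{1..n}. pi / real n ^ 3)" by (intro sum_ennreal) simp
    also have "(\<Sum>j\<in>{1..n}. pi / real n ^ 3) = pi / (real n)\<^sup>2"
      using n by (simp add: power2_eq_square power3_eq_cube)
    finally show ?thesis .
  qed (simp add: A_def)
  have "AE \<omega> in P. \<forall>\<^sub>F n in sequentially. \<omega> \<in> space P - A n"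
  proof (rule borel_cantelli_AE1[OF A_sets])
    show "emeasure P (A n) < \<infinity>" for n using A_le[of n] by (simp add: order_le_less_trans[OF _ ennreal_less_top] less_top[symmetric])
    show "summable (\<lambda>n. measure P (A n))"
    proof (rule summable_comparison_test')
      show "summable (\<lambda>n. pi * (1 / (real n)\<^sup>2))"
        by (intro summable_mult) (use inverse_power_summable[of 2] in \<open>simp add: inverse_eq_divide\<close>)
      show "norm (measure P (A n)) \<le> pi * (1 / (real n)\<^sup>2)" if "0 \<le> n" for n
        using A_le[of n] by (simp add: P.emeasure_eq_measure)
    qed
  qed
  moreover have "AE \<omega> in P. \<forall>n\<in>{1..}. 0 < weight (\<beta> n) n (\<omega> n)"
  proof (rule AE_ball_countable[THEN iffD2])
    show "\<forall>n\<in>{1..}. AE \<omega> in P. 0 < weight (\<beta> n) n (\<omega> n)"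
    proof
      fix n :: nat assume n: "n \<in> {1..}"
      show "AE \<omega> in P. 0 < weight (\<beta> n) n (\<omega> n)"
        unfolding P_eq by (rule AE_PiM_component[OF pr n]) (simp_all only: E_def beta_ensemble_AE_pos)
    qed
  qed simp
  ultimately have "AE \<omega> in P. \<forall>\<^sub>F n in sequentially. good (confC c0) (6 * confV c0) n (\<omega> n)"
  proof eventually_elim
    case (elim \<omega>)
    have "(\<lambda>n. confV c0 * (edge_scale n)\<^sup>2) \<longlonglongrightarrow> confV c0 * 0\<^sup>2"
      by (intro tendsto_intros edge_scale_tendsto)
    then have "\<forall>\<^sub>F n in sequentially. confV c0 * (edge_scale n)\<^sup>2 < 1" by (rule order_tendstoD) simp
    with elim(1) b eventually_ge_at_top[of 3] show ?case
    proof eventually_elim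
      case (elim n)
      note e = elim
      have n: "1 \<le> n" "n \<in> {1..}" "n \<noteq> 0" using e(3) by auto
      have "\<omega> n \<in> space (conf n)"
        using measurable_space[OF comp[OF n(1)], of \<omega>] e(1) by (simp add: E_def space_beta_ensemble)
      moreover have "\<omega> n \<notin> B n" using e(1) n by (auto simp: A_def)
      ultimately have "\<not> ennreal (real n ^ 3 * (1 + (\<omega> n j)\<^sup>2) * weight (\<beta> n) n (\<omega> n)) < resampled (\<beta> n) n j (\<omega> n)"
        if "j \<in> {1..n}" for j using that unfolding B_def atypical_def by blast
      moreover have "0 < weight (\<beta> n) n (\<omega> n)" using \<open>\<forall>n\<in>{1..}. 0 < weight (\<beta> n) n (\<omega> n)\<close> n by blast
      ultimately show ?case
        using e by (intro good_of_typical[OF c]) (auto simp: not_less)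
    qed
  qed
  then show ?thesis unfolding P_def .
qed

theorem corollary1p14:
  fixes c0 :: real
  assumes "c0 > 0"
  shows "\<exists>D>0. \<forall>L>2. \<forall>\<beta> :: nat \<Rightarrow> real.
    (\<forall>n\<ge>1. \<beta> n > 0) \<longrightarrow> (\<forall>\<^sub>F n in sequentially. \<beta> n \<ge> c0 * ln (real n)) \<longrightarrow>
    (AE \<omega> in joint_law \<beta>.
      (\<forall>x\<in>{-2<..<2}. \<forall>y :: nat \<Rightarrow> real. y \<longlonglongrightarrow> x \<longrightarrow>
         limsup (\<lambda>n. ereal \<bar>real (num_points \<omega> n (ball (y n) (L / real n)))
                           - 2 * semicircle x * L\<bar>)
           \<le> ereal (D * (ln L)\<^sup>2)) \<and>
      (\<forall>x\<in>{-2, 2}.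
         limsup (\<lambda>n. ereal \<bar>real (num_points \<omega> n (ball x ((L / real n) powr (2 / 3))))
                           - 2 / (3 * pi) * L\<bar>)
           \<le> ereal (D * L powr (4 / 5) * (ln L) powr (1 / 5))))"
proof -
  define C K where "C = confC c0" and "K = 6 * confV c0"
  have Q: "2 \<le> resC c0" by (rule resC_ge[OF assms])
  have "2 * 1 \<le> resC c0 * 65 powr (1 / c0)"
    using Q assms by (intro mult_mono ge_one_powr_ge_zero) auto
  then have C: "1 \<le> C" by (simp add: C_def confC_def)
  have "0 \<le> ln (resC c0)" using Q by simp
  then have K: "0 \<le> K" using assms by (simp add: K_def confV_def)
  define D where "D = bulkD C + edgeD C K"
  have D: "0 < bulkD C" "0 < edgeD C K" using bulkD_pos edgeD_pos[OF K] by auto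
  show ?thesis
  proof (intro exI[of _ D] conjI allI impI)
    show "0 < D" using D by (simp add: D_def)
    fix L :: real and \<beta> :: "nat \<Rightarrow> real"
    assume L: "2 < L" and pos: "\<forall>n\<ge>1. 0 < \<beta> n" and b: "\<forall>\<^sub>F n in sequentially. c0 * ln (real n) \<le> \<beta> n"
    \<comment> \<open>A single null set serves every \<open>x\<close> and every sequence
      \<open>y\<close>; what follows is deterministic.\<close>
    have "AE \<omega> in joint_law \<beta>. \<forall>\<^sub>F n in sequentially. good C K n (\<omega> n)"
      unfolding C_def K_def by (rule joint_law_eventually_good[OF assms _ b]) (use pos in auto)
    then show "AE \<omega> in joint_law \<beta>.
      (\<forall>x\<in>{-2<..<2}. \<forall>y :: nat \<Rightarrow> real. y \<longlonglongrightarrow> x \<longrightarrow>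
         limsup (\<lambda>n. ereal \<bar>real (num_points \<omega> n (ball (y n) (L / real n)))
                           - 2 * semicircle x * L\<bar>)
           \<le> ereal (D * (ln L)\<^sup>2)) \<and>
      (\<forall>x\<in>{-2, 2}.
         limsup (\<lambda>n. ereal \<bar>real (num_points \<omega> n (ball x ((L / real n) powr (2 / 3))))
                           - 2 / (3 * pi) * L\<bar>)
           \<le> ereal (D * L powr (4 / 5) * (ln L) powr (1 / 5)))"
    proof eventually_elim
      case (elim \<omega>)
      show ?case
      proof (intro conjI ballI allI impI)
        fix x :: real and y :: "nat \<Rightarrow> real" assume x: "x \<in> {-2<..<2}" and y: "y \<longlonglongrightarrow> x"
        have le: "bulkD C * (ln L)\<^sup>2 \<le> D * (ln L)\<^sup>2" using D by (intro mult_right_mono) (auto simp: D_def)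
        have "\<forall>\<^sub>F n in sequentially. \<bar>real (num_points \<omega> n (ball (y n) (L / real n))) - 2 * semicircle x * L\<bar> \<le> bulkD C * (ln L)\<^sup>2"
          unfolding num_points_def by (rule bulk_limit[OF C K elim _ _ y L]) (use x in auto)
        then show "limsup (\<lambda>n. ereal \<bar>real (num_points \<omega> n (ball (y n) (L / real n))) - 2 * semicircle x * L\<bar>) \<le> ereal (D * (ln L)\<^sup>2)"
          by (intro Limsup_bounded) (elim eventually_mono, use le in simp)
      next
        fix x :: real assume x: "x \<in> {-2, 2}"
        have le: "edgeD C K * L powr (4 / 5) * ln L powr (1 / 5) \<le> D * L powr (4 / 5) * ln L powr (1 / 5)"
          using D by (intro mult_right_mono) (auto simp: D_def)
        have "\<forall>\<^sub>F n in sequentially. \<bar>real (num_points \<omega> n (ball x ((L / real n) powr (2 / 3)))) - 2 / (3 * pi) * L\<bar>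
            \<le> edgeD C K * L powr (4 / 5) * ln L powr (1 / 5)"
          unfolding num_points_def using x edge_left[OF C K elim L] edge_right[OF C K elim L] by blast
        then show "limsup (\<lambda>n. ereal \<bar>real (num_points \<omega> n (ball x ((L / real n) powr (2 / 3)))) - 2 / (3 * pi) * L\<bar>)
            \<le> ereal (D * L powr (4 / 5) * ln L powr (1 / 5))"
          by (intro Limsup_bounded) (elim eventually_mono, use le in simp)
      qed
    qed
  qed
qed

end
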